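(* Let $\mathbf v_1,\mathbf v_2\in\mathbb R^2$ be linearly independent and let $d>0$. Let $\chi(r)$ be a smooth truncation function equal to $1$ for $r<r_1$ and equal to $0$ for $r>r_2$ (where $0<r_1<r_2$), and let $p$ be an integer with $p\ge 3$. Then, for all real triples $(k,\alpha,\beta)=(k,\boldsymbol\alpha)$ with $k\neq 0$, the sums $$G^{p,A}(\tilde{\mathbf x},z)=\frac1{4\pi}\sum_{m,n\in\mathbb Z,\ |m\mathbf v_1+n\mathbf v_2|\le A} e^{-i\boldsymbol\alpha\cdot(m\mathbf v_1+n\mathbf v_2)}\sum_{q=0}^p a_{pq}\frac{e^{ikr^q_{mn}}}{r^q_{mn}}$$ and $$\hat G^{p,A}(\tilde{\mathbf x},z)=\frac1{4\pi}\sum_{m,n\in\mathbb Z} e^{-i\boldsymbol\alpha\cdot(m\mathbf v_1+n\mathbf v_2)}\sum_{q=0}^p a_{pq}\frac{e^{ikr^q_{mn}}}{r^q_{mn}}\,\chi(\tilde r_{mn}/A),$$ where $(r^q_{mn})^2=|\tilde{\mathbf x}+m\mathbf v_1+n\mathbf v_2|^2+(z+qd)^2$ and $\tilde r_{mn}=|\tilde{\mathbf x}+m\mathbf v_1+n\mathbf v_2|$, converge as $A\to\infty$ to one and the same function $\tilde G^q_p(\mathbf x)$, $\mathbf x=(\tilde{\mathbf x},z)$, which is radiating, satisfies the partial differential equation $$\nabla^2\tilde G^q_p(\mathbf x)+k^2\tilde G^q_p(\mathbf x)=-\sum_{m,n\in\mathbb Z}\sum_{q=0}^p a_{pq}\,e^{i\boldsymbol\alpha\cdot(m\mathbf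 v_1+n\mathbf v_2)}\,\delta(\mathbf x-\mathbf x'_{mnq}),\qquad \mathbf x'_{mnq}=(m\mathbf v_1+n\mathbf v_2,\,-qd),$$ and satisfies the quasi-periodicity condition $$\tilde G^q_p(\mathbf x+(m\mathbf v_1+n\mathbf v_2,0))=\tilde G^q_p(\mathbf x)\,e^{i\boldsymbol\alpha\cdot(m\mathbf v_1+n\mathbf v_2)}\qquad (m,n\in\mathbb Z).$$ Further, for $\mathbf x$ fixed (not equal to any of the points $\mathbf x'_{mnq}$) there exists a constant $C_p=C_p(k,\alpha,\beta)$, independent of $A$, for which $$\left|G^{p,A}(\mathbf x)-\tilde G^q_p(\mathbf x)\right|<\frac{C_p}{A^{\lceil p/2\rceil-1}}\qquad\text{and}\qquad \left|\hat G^{p,A}(\mathbf x)-\tilde G^q_p(\mathbf x)\right|<\frac{C_p}{A^{\lceil p/2\rceil-1/2}}$$ for all sufficiently large values of $A$.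
   Context: Points of $\mathbb R^3$ are written $\mathbf x=(\tilde{\mathbf x},z)$ with $\tilde{\mathbf x}\in\mathbb R^2$, $z\in\mathbb R$; $\boldsymbol\alpha=(\alpha,\beta)\in\mathbb R^2$ is the Bloch wave-vector. The finite-difference coefficients are $a_{pq}=(-1)^q\binom{p}{q}$, $0\le q\le p$. $\lceil r\rceil$ is the smallest integer $\ge r$. The superscript $q$ in $\tilde G^q_p$ is only a label (for "quasi-periodic") and is not the summation index $q$. Let $\mathbf v_1^*,\mathbf v_2^*\in\mathbb R^2$ be the dual vectors, $\mathbf v_i^*\cdot\mathbf v_j=\delta_{ij}$, and for $j,\ell\in\mathbb Z$ put $\mathbf v^*_{j\ell}=2\pi j\,\mathbf v_1^*+2\pi\ell\,\mathbf v_2^*+\boldsymbol\alpha$ and $\gamma_{j\ell}=(k^2-\|\mathbf v^*_{j\ell}\|^2)^{1/2}$, with the branch of the square root for which $\sqrt1=1$ and the branch cut is the negative imaginary semiaxis (so $\gamma_{j\ell}\geq 0$ or $\gamma_{j\ell}\in i(0,\infty)$). A triple $(k,\alpha,\beta)$ is a Wood configuration if $\gamma_{j\ell}=0$ for some $(j,\ell)$; such triples are allowed in the theorem. "Radiating" means that the function has, for $k>0$, expansions $\sum_{j,\ell}B^+_{j\ell}e^{i\mathbf v^*_{j\ell}\cdot\tilde{\mathbf x}}e^{i\gamma_{j\ell}z}$ above all the singular points ($z>0$) and $\sum_{j,\ell}B^-_{j\ell}e^{i\mathbf v^*_{j\ell}\cdot\tilde{\mathbf x}}e^{-i\gamma_{j\ell}z}$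 below all of them ($z<-pd$), with constant coefficients $B^\pm_{j\ell}$; for $k<0$ the same with each real $\gamma_{j\ell}$ replaced by $-\gamma_{j\ell}$. Convergence is understood at points $\mathbf x$ other than the singular points $\mathbf x'_{mnq}$, and the partial differential equation is understood in the sense of distributions. *)

theory Defs
  imports "HOL-Analysis.Analysis"
begin

text \<open>Points of three-dimensional space are pairs \<open>(x, z)\<close> of type \<open>(real^2) \<times> real\<close>, which carries
  the Euclidean norm and, through \<^const>\<open>lborel\<close>, three-dimensional Lebesgue measure.\<close>

section \<open>Smooth functions, test functions, the Laplacian\<close>

primrec C_k :: "nat \<Rightarrow> ('a::real_normed_vector \<Rightarrow> 'b::real_normed_vector) \<Rightarrow> bool" where
  "C_k 0 f \<longleftrightarrow> continuous_on UNIV f"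
| "C_k (Suc n) f \<longleftrightarrow>
     (\<forall>x. f differentiable (at x)) \<and> (\<forall>v. C_k n (\<lambda>x. frechet_derivative f (at x) v))"

definition smooth :: "('a::real_normed_vector \<Rightarrow> 'b::real_normed_vector) \<Rightarrow> bool" where
  "smooth f \<longleftrightarrow> (\<forall>n. C_k n f)"

definition test_function :: "('a::euclidean_space \<Rightarrow> complex) \<Rightarrow> bool" where
  "test_function \<phi> \<longleftrightarrow> smooth \<phi> \<and> compact (closure {x. \<phi> x \<noteq> 0})"

definition laplacian :: "('a::euclidean_space \<Rightarrow> complex) \<Rightarrow> 'a \<Rightarrow> complex" where
  "laplacian f x =
     (\<Sum>b\<in>Basis. frechet_derivative (\<lambda>y. frechet_derivative f (at y) b) (at x) b)"

definition locally_integrable :: "('a::euclidean_space \<Rightarrow> complex) \<Rightarrow> bool" where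
  "locally_integrable f \<longleftrightarrow> (\<forall>K. compact K \<longrightarrow> set_integrable lborel K f)"

text \<open>\<open>\<nabla>\<^sup>2 G + k\<^sup>2 G = T\<close> in the sense of distributions, where the distribution \<open>T\<close> is given by its
  values on test functions.\<close>

definition helmholtz_distr ::
    "real \<Rightarrow> ('a::euclidean_space \<Rightarrow> complex) \<Rightarrow> (('a \<Rightarrow> complex) \<Rightarrow> complex) \<Rightarrow> bool" where
  "helmholtz_distr k G T \<longleftrightarrow> locally_integrable G \<and>
     (\<forall>\<phi>. test_function \<phi> \<longrightarrow>
        (LINT x|lborel. G x * (laplacian \<phi> x + (of_real k)\<^sup>2 * \<phi> x)) = T \<phi>)"

section \<open>The lattice sums\<close>

definition lat :: "real^2 \<Rightarrow> real^2 \<Rightarrow> int \<Rightarrow> int \<Rightarrow> real^2" where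
  "lat v1 v2 m n = of_int m *\<^sub>R v1 + of_int n *\<^sub>R v2"

definition fd_coeff :: "nat \<Rightarrow> nat \<Rightarrow> complex" where
  "fd_coeff p q = (-1) ^ q * of_nat (p choose q)"

definition rdist :: "real^2 \<Rightarrow> real^2 \<Rightarrow> real \<Rightarrow> int \<Rightarrow> int \<Rightarrow> nat \<Rightarrow> (real^2) \<times> real \<Rightarrow> real" where
  "rdist v1 v2 d m n q = (\<lambda>(x, z). sqrt ((norm (x + lat v1 v2 m n))\<^sup>2 + (z + real q * d)\<^sup>2))"

definition rdist_h :: "real^2 \<Rightarrow> real^2 \<Rightarrow> int \<Rightarrow> int \<Rightarrow> (real^2) \<times> real \<Rightarrow> real" where
  "rdist_h v1 v2 m n = (\<lambda>(x, z). norm (x + lat v1 v2 m n))"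

definition lattice_term ::
    "real^2 \<Rightarrow> real^2 \<Rightarrow> real \<Rightarrow> nat \<Rightarrow> real \<Rightarrow> real^2 \<Rightarrow> int \<Rightarrow> int \<Rightarrow> (real^2) \<times> real \<Rightarrow> complex" where
  "lattice_term v1 v2 d p k \<alpha> m n x =
     cis (- (\<alpha> \<bullet> lat v1 v2 m n)) *
     (\<Sum>q=0..p. fd_coeff p q * (cis (k * rdist v1 v2 d m n q x) / of_real (rdist v1 v2 d m n q x)))"

definition G_trunc ::
    "real^2 \<Rightarrow> real^2 \<Rightarrow> real \<Rightarrow> nat \<Rightarrow> real \<Rightarrow> real^2 \<Rightarrow> real \<Rightarrow> (real^2) \<times> real \<Rightarrow> complex" where
  "G_trunc v1 v2 d p k \<alpha> A x =
     1 / (4 * of_real pi) *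
     (\<Sum>(m, n) \<in> {(m, n). norm (lat v1 v2 m n) \<le> A}. lattice_term v1 v2 d p k \<alpha> m n x)"

definition G_smooth_trunc ::
    "(real \<Rightarrow> real) \<Rightarrow> real^2 \<Rightarrow> real^2 \<Rightarrow> real \<Rightarrow> nat \<Rightarrow> real \<Rightarrow> real^2 \<Rightarrow> real \<Rightarrow>
     (real^2) \<times> real \<Rightarrow> complex" where
  "G_smooth_trunc chi v1 v2 d p k \<alpha> A x =
     1 / (4 * of_real pi) *
     (\<Sum>\<^sub>\<infinity>(m, n) \<in> UNIV. lattice_term v1 v2 d p k \<alpha> m n x * of_real (chi (rdist_h v1 v2 m n x / A)))"

definition source_pt :: "real^2 \<Rightarrow> real^2 \<Rightarrow> real \<Rightarrow> int \<Rightarrow> int \<Rightarrow> nat \<Rightarrow> (real^2) \<times> real" where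
  "source_pt v1 v2 d m n q = (lat v1 v2 m n, - (real q * d))"

definition sources :: "real^2 \<Rightarrow> real^2 \<Rightarrow> real \<Rightarrow> nat \<Rightarrow> ((real^2) \<times> real) set" where
  "sources v1 v2 d p = {source_pt v1 v2 d m n q |m n q. q \<le> p}"

text \<open>The distribution \<open>\<Sum>\<^sub>m\<^sub>,\<^sub>n \<Sum>\<^sub>q a\<^sub>p\<^sub>q e\<^sup>i\<^sup>\<alpha>\<^sup>\<cdot>\<^sup>v \<delta>(x - x'\<^sub>m\<^sub>n\<^sub>q)\<close>, with \<open>v = m v\<^sub>1 + n v\<^sub>2\<close>, on test functions.
  A compact support meets only finitely many source points, so the sum is finitely supported.\<close>

definition source_distr ::
    "real^2 \<Rightarrow> real^2 \<Rightarrow> real \<Rightarrow> nat \<Rightarrow> real^2 \<Rightarrow> ((real^2) \<times> real \<Rightarrow> complex) \<Rightarrow> complex" where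
  "source_distr v1 v2 d p \<alpha> \<phi> =
     (\<Sum>\<^sub>\<infinity>(m, n) \<in> UNIV. \<Sum>q=0..p.
        fd_coeff p q * cis (\<alpha> \<bullet> lat v1 v2 m n) * \<phi> (source_pt v1 v2 d m n q))"

section \<open>Radiating functions\<close>

text \<open>The square root with \<open>\<surd>1 = 1\<close> and branch cut along the negative imaginary semiaxis, obtained by
  rotating the principal branch \<^const>\<open>csqrt\<close>.\<close>

definition sqrt_cut :: "complex \<Rightarrow> complex" where
  "sqrt_cut w = cis (pi / 4) * csqrt (- \<i> * w)"

lemma sqrt_cut_power2: "(sqrt_cut w)\<^sup>2 = w"
proof -
  have "(cis (pi / 4))\<^sup>2 = \<i>"
    by (simp add: power2_eq_square cis_mult)
  then show ?thesis
    by (simp add: sqrt_cut_def power_mult_distrib flip: mult.assoc)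
qed

lemma sqrt_cut_of_real:
  "sqrt_cut (of_real t) = (if t \<ge> 0 then of_real (sqrt t) else \<i> * of_real (sqrt (- t)))"
proof -
  have s: "sqrt (u / 2) = sqrt u * sqrt 2 / 2" for u :: real
    by (simp add: real_sqrt_divide field_simps)
  have s': "sqrt (- (u / 2)) = sqrt (- u) * sqrt 2 / 2" for u :: real
    using s[of "- u"] by simp
  show ?thesis
    by (cases t "0::real" rule: linorder_cases)
      (auto simp: sqrt_cut_def complex_eq_iff cos_45 sin_45 s s' field_simps norm_mult)
qed

definition vstar :: "real^2 \<Rightarrow> real^2 \<Rightarrow> real^2 \<Rightarrow> int \<Rightarrow> int \<Rightarrow> real^2" where
  "vstar w1 w2 \<alpha> j l = (2 * pi * of_int j) *\<^sub>R w1 + (2 * pi * of_int l) *\<^sub>R w2 + \<alpha>"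

definition gam :: "real^2 \<Rightarrow> real^2 \<Rightarrow> real \<Rightarrow> real^2 \<Rightarrow> int \<Rightarrow> int \<Rightarrow> complex" where
  "gam w1 w2 k \<alpha> j l = sqrt_cut (of_real (k\<^sup>2 - (norm (vstar w1 w2 \<alpha> j l))\<^sup>2))"

text \<open>The exponents of the outgoing modes: \<open>\<gamma>\<^sub>j\<^sub>l\<close> for \<open>k > 0\<close>, with the real ones negated for \<open>k < 0\<close>.\<close>

definition gam_out :: "real^2 \<Rightarrow> real^2 \<Rightarrow> real \<Rightarrow> real^2 \<Rightarrow> int \<Rightarrow> int \<Rightarrow> complex" where
  "gam_out w1 w2 k \<alpha> j l =
     (if k < 0 \<and> gam w1 w2 k \<alpha> j l \<in> \<real> then - gam w1 w2 k \<alpha> j l else gam w1 w2 k \<alpha> j l)"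

text \<open>The arguments \<open>w1\<close>, \<open>w2\<close> are the dual vectors, and all singularities lie in \<open>-h \<le> z \<le> 0\<close>.\<close>

definition radiating ::
    "real^2 \<Rightarrow> real^2 \<Rightarrow> real \<Rightarrow> real \<Rightarrow> real^2 \<Rightarrow> ((real^2) \<times> real \<Rightarrow> complex) \<Rightarrow> bool" where
  "radiating w1 w2 h k \<alpha> G \<longleftrightarrow>
     (\<exists>B :: int \<Rightarrow> int \<Rightarrow> complex. \<forall>x z. z > 0 \<longrightarrow>
        ((\<lambda>(j, l). B j l * cis (vstar w1 w2 \<alpha> j l \<bullet> x) *
            exp (\<i> * gam_out w1 w2 k \<alpha> j l * of_real z)) has_sum G (x, z)) UNIV) \<and>
     (\<exists>B :: int \<Rightarrow> int \<Rightarrow> complex. \<forall>x z. z < - h \<longrightarrow>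
        ((\<lambda>(j, l). B j l * cis (vstar w1 w2 \<alpha> j l \<bullet> x) *
            exp (- \<i> * gam_out w1 w2 k \<alpha> j l * of_real z)) has_sum G (x, z)) UNIV)"

end

theory Submission
  imports Defs "HOL-Probability.Probability" "HOL-Complex_Analysis.Complex_Analysis" "HOL-Real_Asymp.Real_Asymp"
begin

text \<open>Write \<open>\<rho>\<close> for the horizontal distance of \<open>x\<close> to a lattice point and \<open>s = \<lceil>p/2\<rceil>\<close>. As a function of
  \<open>\<rho>\<^sup>2\<close> and \<open>t = (z + q d)\<^sup>2\<close> the spherical wave has a Taylor expansion in \<open>t\<close> whose \<open>i\<close>-th
  coefficient decays like \<open>\<rho>\<close> to the power \<open>- i - 1\<close>. A \<open>p\<close>-th finite difference annihilates the
  polynomials in \<open>q\<close> of degree below \<open>p\<close>, hence all terms with \<open>2 i < p\<close>, so one lattice term of the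
  sum has size \<open>\<rho>\<close> to the power \<open>- s - 1\<close>, and to leading order it is a constant multiple of
  \<open>exp (i k \<rho>)\<close> times that power (\<open>fds_bound\<close>, \<open>fds_asymp\<close>). For \<open>p \<ge> 3\<close> the double series therefore
  converges absolutely, and its sum, without any summation convention, is \<open>Gfun\<close>. Quasi-periodicity
  is a reindexing, and the rate for the sharp truncation is the trivial bound for the tail.

The smooth truncation leaves the tail weighted with \<open>1 - \<chi>(\<rho>/A)\<close>. It gains a further factor
  \<open>1/sqrt A\<close> from cancellation. The plane is cut into two sectors, each a union of lattice lines
  \<open>n \<mapsto> m a + n b\<close> with \<open>\<bar>n\<bar> \<le> \<bar>m\<bar>\<close>, which are transverse to the radial direction. Along such a line the
  second difference of the phase \<open>k \<rho> - \<alpha> \<bullet> (m a + n b)\<close> comes from \<open>k \<rho>\<close> alone and is of order \<open>1/\<bar>m\<bar>\<close>,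
  so van der Corput's second derivative test bounds its exponential sum by \<open>sqrt \<bar>m\<bar>\<close>
  (\<open>lattice_line_sum\<close>); the smoothness of the weight lets Abel summation insert the amplitude. The
  linear phase of \<open>\<alpha>\<close> drops out of the second difference, so Wood configurations need no special
  treatment.

The differential equation holds term by term, \<open>exp (i k r) / r\<close> being a fundamental solution of the
  Helmholtz equation up to the factor \<open>- 4 \<pi>\<close>. This is proved by replacing \<open>r\<close> with
  \<open>sqrt (r\<^sup>2 + \<epsilon>\<^sup>2)\<close>, for which integration by parts is elementary, and letting \<open>\<epsilon>\<close> tend to zero
  (\<open>fundamental_solution\<close>); absolute convergence, uniform on balls away from finitely many terms,
  permits exchanging sum and integral.

For the radiation condition, \<open>z > 0\<close> is fixed and Poisson summation is applied in the horizontal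
  variables. The Fourier transform of \<open>exp (i k r) / r\<close> at height \<open>z\<close> is given by Weyl's identity: for
  \<open>k = i \<mu>\<close> it follows from writing the function as a superposition of Gaussians, for \<open>Im k > 0\<close> by
  analytic continuation. For real \<open>k\<close> the transform of one spherical wave no longer converges
  absolutely, but that of its finite difference does, so one may let \<open>k + i/n\<close> tend to \<open>k\<close>; the limit has
  the form of a constant times \<open>exp (- z \<tau>)\<close> with \<open>- \<tau> = i \<gamma>\<close> for the outgoing \<open>\<gamma>\<close>, also when
  \<open>\<gamma> = 0\<close> (\<open>FT_fds_mode\<close>). These transforms are summable over the dual lattice, which makes the
  expansion above the sources absolutely convergent; the expansion below them follows from the
  symmetry of the sum under \<open>z \<mapsto> - p d - z\<close>.\<close>

section \<open>Tails of lattice sums\<close>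

lemma sum_inverse_squares_le:
  assumes "a \<ge> 1"
  shows "(\<Sum>n\<in>{a..b::nat}. 1 / (real n)\<^sup>2) \<le> 2 / real a"
proof (cases "a \<le> b")
  case True
  \<comment> \<open>Since \<open>1/n\<^sup>2 \<le> 1/(n\<^sup>2 - 1/4) = 1/(n - 1/2) - 1/(n + 1/2)\<close>, the sum is dominated by a telescoping one.\<close>
  have "(\<Sum>n\<in>{a..b::nat}. 1 / (real n)\<^sup>2) \<le> 1 / (real a - 1/2) - 1 / (real b + 1/2)"
    using True
  proof (induction b rule: dec_induct)
    case base
    have "1 / (real a - 1/2) - 1 / (real a + 1/2) = 1 / ((real a)\<^sup>2 - 1/4)"
      using assms by (simp add: field_simps power2_eq_square)
    moreover have "1 / (real a)\<^sup>2 \<le> 1 / ((real a)\<^sup>2 - 1/4)"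
    proof -
      have "1 \<le> (real a)\<^sup>2" using assms by (intro one_le_power) auto
      then show ?thesis by (intro divide_left_mono mult_pos_pos) linarith+
    qed
    ultimately show ?case by simp
  next
    case (step b)
    have "(\<Sum>n\<in>{a..Suc b}. 1 / (real n)\<^sup>2) = (\<Sum>n\<in>{a..b}. 1 / (real n)\<^sup>2) + 1 / (real (Suc b))\<^sup>2"
      using step by simp
    moreover have "1 / (real b + 1/2) - 1 / (real (Suc b) + 1/2) = 1 / ((real (Suc b))\<^sup>2 - 1/4)"
      by (simp add: field_simps power2_eq_square)
    moreover have "1 / (real (Suc b))\<^sup>2 \<le> 1 / ((real (Suc b))\<^sup>2 - 1/4)"
    proof -
      have "1 \<le> (real (Suc b))\<^sup>2" by (intro one_le_power) auto
      then show ?thesis by (intro divide_left_mono mult_pos_pos) linarith+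
    qed
    ultimately show ?case using step by linarith
  qed
  also have "\<dots> \<le> 1 / (real a - 1/2)" by simp
  also have "\<dots> \<le> 2 / real a" using assms by (simp add: field_simps)
  finally show ?thesis .
qed simp

lemma int_tail_finite:
  assumes F: "finite F" "\<And>m. m \<in> F \<Longrightarrow> L \<le> \<bar>real_of_int m\<bar>" and L: "L \<ge> 1"
  shows "(\<Sum>m\<in>F. 1 / (real_of_int m)\<^sup>2) \<le> 4 / L"
proof -
  define a where "a = nat \<lceil>L\<rceil>"
  define b where "b = nat (Max (insert 0 (abs ` F)))"
  have a: "a \<ge> 1" "real a \<ge> L" using L unfolding a_def by linarith+
  have ab: "nat \<bar>m\<bar> \<in> {a..b}" if "m \<in> F" for m
  proof -
    have "\<lceil>L\<rceil> \<le> \<bar>m\<bar>" using F(2)[OF that] by (simp add: ceiling_le_iff)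
    moreover have "\<bar>m\<bar> \<le> Max (insert 0 (abs ` F))" using F(1) that by (intro Max_ge) auto
    ultimately show ?thesis unfolding a_def b_def atLeastAtMost_iff by (intro conjI nat_mono)
  qed
  have "F \<subseteq> int ` {a..b} \<union> (\<lambda>n. - int n) ` {a..b}"
  proof
    fix m assume m: "m \<in> F"
    show "m \<in> int ` {a..b} \<union> (\<lambda>n. - int n) ` {a..b}"
    proof (cases "m \<ge> 0")
      case True
      then have "m = int (nat \<bar>m\<bar>)" by simp
      then show ?thesis using ab[OF m] by blast
    next
      case False
      then have "m = - int (nat \<bar>m\<bar>)" by simp
      then show ?thesis using ab[OF m] by blast
    qed
  qed
  then have "(\<Sum>m\<in>F. 1 / (real_of_int m)\<^sup>2) \<le> (\<Sum>m\<in>int ` {a..b} \<union> (\<lambda>n. - int n) ` {a..b}. 1 / (real_of_int m)\<^sup>2)"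
    by (intro sum_mono2) auto
  also have "\<dots> \<le> (\<Sum>m\<in>int ` {a..b}. 1 / (real_of_int m)\<^sup>2) + (\<Sum>m\<in>(\<lambda>n. - int n) ` {a..b}. 1 / (real_of_int m)\<^sup>2)"
    by (subst sum_Un) (auto intro!: sum_nonneg)
  also have "\<dots> = 2 * (\<Sum>n\<in>{a..b}. 1 / (real n)\<^sup>2)"
    by (subst (1 2) sum.reindex) (auto simp: inj_on_def)
  also have "\<dots> \<le> 4 / real a" using sum_inverse_squares_le[OF a(1), of b] by simp
  also have "\<dots> \<le> 4 / L" using a L by (intro divide_left_mono) auto
  finally show ?thesis .
qed

lemma int_tail_powr_finite:
  assumes F: "finite F" "\<And>m. m \<in> F \<Longrightarrow> L \<le> \<bar>real_of_int m\<bar>" and L: "L \<ge> 1" and a: "a \<ge> 2"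
  shows "(\<Sum>m\<in>F. \<bar>real_of_int m\<bar> powr (- a)) \<le> 4 * L powr (1 - a)"
proof -
  have "(\<Sum>m\<in>F. \<bar>real_of_int m\<bar> powr (- a)) \<le> (\<Sum>m\<in>F. L powr (2 - a) * (1 / (real_of_int m)\<^sup>2))"
  proof (rule sum_mono)
    fix m assume "m \<in> F"
    then have m: "L \<le> \<bar>real_of_int m\<bar>" by (rule F)
    have "\<bar>real_of_int m\<bar> powr (- a) = \<bar>real_of_int m\<bar> powr (2 - a) * \<bar>real_of_int m\<bar> powr (- 2)"
      by (simp add: powr_add[symmetric])
    also have "\<bar>real_of_int m\<bar> powr (- 2) = 1 / (real_of_int m)\<^sup>2"
      using m L by (simp add: powr_minus powr_numeral divide_inverse)
    also have "\<bar>real_of_int m\<bar> powr (2 - a) \<le> L powr (2 - a)"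
      using m L a by (intro powr_mono2') auto
    finally show "\<bar>real_of_int m\<bar> powr (- a) \<le> L powr (2 - a) * (1 / (real_of_int m)\<^sup>2)"
      by (simp add: mult_right_mono divide_right_mono)
  qed
  also have "\<dots> = L powr (2 - a) * (\<Sum>m\<in>F. 1 / (real_of_int m)\<^sup>2)" by (simp add: sum_distrib_left)
  also have "\<dots> \<le> L powr (2 - a) * (4 / L)"
    using int_tail_finite[OF F L] by (intro mult_left_mono) auto
  also have "L powr (2 - a) * (4 / L) = 4 * L powr (1 - a)"
    using L by (simp add: powr_diff power2_eq_square)
  finally show ?thesis .
qed

text \<open>Exponents of at least 2 are what a finite difference of order at least 3 produces, and for them
  comparison with the squares suffices.\<close>

lemma int_tail_powr:
  assumes L: "L \<ge> 1" and a: "a \<ge> 2"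
  shows "(\<lambda>m::int. \<bar>real_of_int m\<bar> powr (- a)) summable_on {m. L \<le> \<bar>real_of_int m\<bar>}"
    and "infsum (\<lambda>m::int. \<bar>real_of_int m\<bar> powr (- a)) {m. L \<le> \<bar>real_of_int m\<bar>} \<le> 4 * L powr (1 - a)"
proof -
  show s: "(\<lambda>m::int. \<bar>real_of_int m\<bar> powr (- a)) summable_on {m. L \<le> \<bar>real_of_int m\<bar>}"
  proof (rule nonneg_bdd_above_summable_on)
    show "bdd_above (sum (\<lambda>m::int. \<bar>real_of_int m\<bar> powr (- a)) ` {F. F \<subseteq> {m. L \<le> \<bar>real_of_int m\<bar>} \<and> finite F})"
      using int_tail_powr_finite[OF _ _ L a] by (intro bdd_aboveI2[of _ _ "4 * L powr (1 - a)"]) blast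
  qed simp
  show "infsum (\<lambda>m::int. \<bar>real_of_int m\<bar> powr (- a)) {m. L \<le> \<bar>real_of_int m\<bar>} \<le> 4 * L powr (1 - a)"
    using int_tail_powr_finite[OF _ _ L a] by (intro infsum_le_finite_sums[OF s]) blast
qed

text \<open>The form in which cancellation enters: only the sums over whole lines are assumed small, not
  the individual terms. Summability is a hypothesis so that the double sum may be taken line by line.\<close>

lemma line_sum_bound:
  fixes t :: "int \<times> int \<Rightarrow> complex"
  assumes L: "L \<ge> 1" and a: "a \<ge> 2" and C: "C \<ge> 0"
    and sm: "t summable_on Sigma {m. L \<le> \<bar>real_of_int m\<bar>} I" and fin: "\<And>m. finite (I m)"
    and line: "\<And>m. L \<le> \<bar>real_of_int m\<bar> \<Longrightarrow> norm (\<Sum>n\<in>I m. t (m, n)) \<le> C * \<bar>real_of_int m\<bar> powr (- a)"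
  shows "norm (infsum t (Sigma {m. L \<le> \<bar>real_of_int m\<bar>} I)) \<le> 4 * C * L powr (1 - a)"
proof -
  let ?S = "{m::int. L \<le> \<bar>real_of_int m\<bar>}"
  have "infsum t (Sigma ?S I) = (\<Sum>\<^sub>\<infinity>m\<in>?S. \<Sum>n\<in>I m. t (m, n))"
    by (subst infsum_Sigma_banach[OF sm, symmetric]) (simp add: fin)
  also have "norm \<dots> \<le> (\<Sum>\<^sub>\<infinity>m\<in>?S. C * \<bar>real_of_int m\<bar> powr (- a))"
  proof (rule norm_infsum_le[OF has_sum_infsum has_sum_infsum])
    show "(\<lambda>m. \<Sum>n\<in>I m. t (m, n)) summable_on ?S"
      using summable_on_Sigma_banach[of "\<lambda>m n. t (m, n)" ?S I] sm fin by (simp add: case_prod_unfold)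
    show "(\<lambda>m. C * \<bar>real_of_int m\<bar> powr (- a)) summable_on ?S"
      by (rule summable_on_cmult_right[OF int_tail_powr(1)[OF L a]])
  qed (use line in auto)
  also have "\<dots> = C * (\<Sum>\<^sub>\<infinity>m\<in>?S. \<bar>real_of_int m\<bar> powr (- a))"
    by (rule infsum_cmult_right) (use int_tail_powr(1)[OF L a] in auto)
  also have "\<dots> \<le> C * (4 * L powr (1 - a))"
    by (intro mult_left_mono int_tail_powr(2) L a C)
  finally show ?thesis by (simp add: mult_ac)
qed

text \<open>A line of the sector at abscissa \<open>m\<close> has at most \<open>2 \<bar>m\<bar> + 1\<close> points, which costs one power of
  \<open>\<bar>m\<bar>\<close>.\<close>

lemma sector_abs_bound:
  fixes t :: "int \<times> int \<Rightarrow> complex"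
  assumes L: "L \<ge> 1" and a: "a \<ge> 2" and C: "C \<ge> 0"
    and I: "\<And>m. I m \<subseteq> {- \<bar>m\<bar>..\<bar>m\<bar>}"
    and bd: "\<And>m n. L \<le> \<bar>real_of_int m\<bar> \<Longrightarrow> n \<in> I m \<Longrightarrow> norm (t (m, n)) \<le> C * \<bar>real_of_int m\<bar> powr (- (a + 1))"
  shows "(\<lambda>x. norm (t x)) summable_on Sigma {m. L \<le> \<bar>real_of_int m\<bar>} I"
    and "infsum (\<lambda>x. norm (t x)) (Sigma {m. L \<le> \<bar>real_of_int m\<bar>} I) \<le> 12 * C * L powr (1 - a)"
proof -
  let ?S = "{m::int. L \<le> \<bar>real_of_int m\<bar>}"
  have fin: "finite (I m)" for m using I finite_subset by blast
  have line: "(\<Sum>n\<in>I m. norm (t (m, n))) \<le> 3 * C * \<bar>real_of_int m\<bar> powr (- a)" if m: "L \<le> \<bar>real_of_int m\<bar>" for m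
  proof -
    have "(\<Sum>n\<in>I m. norm (t (m, n))) \<le> real (card (I m)) * (C * \<bar>real_of_int m\<bar> powr (- (a + 1)))"
      by (rule sum_bounded_above) (rule bd[OF m])
    also have "real (card (I m)) \<le> 3 * \<bar>real_of_int m\<bar>"
    proof -
      have "card (I m) \<le> card {- \<bar>m\<bar>..\<bar>m\<bar>}" by (intro card_mono I) auto
      then have "real (card (I m)) \<le> 2 * \<bar>real_of_int m\<bar> + 1" by simp
      then show ?thesis using m L by linarith
    qed
    then have "real (card (I m)) * (C * \<bar>real_of_int m\<bar> powr (- (a + 1))) \<le> 3 * \<bar>real_of_int m\<bar> * (C * \<bar>real_of_int m\<bar> powr (- (a + 1)))"
      using C by (intro mult_right_mono) auto
    also have "\<dots> = 3 * C * (\<bar>real_of_int m\<bar> powr 1 * \<bar>real_of_int m\<bar> powr (- (a + 1)))"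
      using m L by simp
    also have "\<dots> = 3 * C * \<bar>real_of_int m\<bar> powr (- a)"
      by (subst powr_add[symmetric]) simp
    finally show ?thesis by simp
  qed
  have sm: "(\<lambda>m. \<Sum>n\<in>I m. norm (t (m, n))) summable_on ?S"
    by (rule summable_on_comparison_test[OF summable_on_cmult_right[OF int_tail_powr(1)[OF L a], of "3 * C"]])
       (use line in \<open>auto intro: sum_nonneg\<close>)
  show s: "(\<lambda>x. norm (t x)) summable_on Sigma ?S I"
    by (rule summable_on_SigmaI[OF _ sm]) (auto intro!: has_sum_finite fin)
  have "infsum (\<lambda>x. norm (t x)) (Sigma ?S I) = (\<Sum>\<^sub>\<infinity>m\<in>?S. \<Sum>n\<in>I m. norm (t (m, n)))"
    by (subst infsum_Sigma_banach[OF s, symmetric]) (simp add: fin)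
  also have "\<dots> \<le> (\<Sum>\<^sub>\<infinity>m\<in>?S. 3 * C * \<bar>real_of_int m\<bar> powr (- a))"
    by (rule infsum_mono[OF sm summable_on_cmult_right[OF int_tail_powr(1)[OF L a]]]) (use line in auto)
  also have "\<dots> = 3 * C * (\<Sum>\<^sub>\<infinity>m\<in>?S. \<bar>real_of_int m\<bar> powr (- a))"
    by (rule infsum_cmult_right) (use int_tail_powr(1)[OF L a] in auto)
  also have "\<dots> \<le> 3 * C * (4 * L powr (1 - a))"
    using C by (intro mult_left_mono int_tail_powr(2) L a) auto
  finally show "infsum (\<lambda>x. norm (t x)) (Sigma ?S I) \<le> 12 * C * L powr (1 - a)" by (simp add: mult_ac)
qed

definition maxn :: "int \<times> int \<Rightarrow> real" where
  "maxn = (\<lambda>(m, n). max \<bar>real_of_int m\<bar> \<bar>real_of_int n\<bar>)"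

text \<open>The lattice outside a square is split into the part where the first coordinate dominates and the
  mirror image of the part where the second one strictly dominates; the diagonals belong to the
  first sector only. On both parts a line of the sector runs transversally to the radial direction.\<close>

abbreviation sector1 :: "real \<Rightarrow> (int \<times> int) set" where
  "sector1 L \<equiv> Sigma {m. L \<le> \<bar>real_of_int m\<bar>} (\<lambda>m. {- \<bar>m\<bar>..\<bar>m\<bar>})"

abbreviation sector2 :: "real \<Rightarrow> (int \<times> int) set" where
  "sector2 L \<equiv> Sigma {m. L \<le> \<bar>real_of_int m\<bar>} (\<lambda>m. {- (\<bar>m\<bar> - 1)..\<bar>m\<bar> - 1})"

lemma maxn_ge_eq_sectors:
  "{x. L \<le> maxn x} = sector1 L \<union> prod.swap ` sector2 L" "sector1 L \<inter> prod.swap ` sector2 L = {}"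
proof -
  have "x \<in> prod.swap ` sector2 L \<longleftrightarrow> prod.swap x \<in> sector2 L" for x
    by (cases x) (auto simp: image_iff)
  then show "{x. L \<le> maxn x} = sector1 L \<union> prod.swap ` sector2 L" "sector1 L \<inter> prod.swap ` sector2 L = {}"
    by (auto simp: maxn_def max_def split: if_splits)
qed

lemma lattice_abs_bound:
  fixes t :: "int \<times> int \<Rightarrow> complex"
  assumes L: "L \<ge> 1" and a: "a \<ge> 2" and C: "C \<ge> 0"
    and bd: "\<And>x. L \<le> maxn x \<Longrightarrow> norm (t x) \<le> C * maxn x powr (- (a + 1))"
  shows "(\<lambda>x. norm (t x)) summable_on {x. L \<le> maxn x}"
    and "infsum (\<lambda>x. norm (t x)) {x. L \<le> maxn x} \<le> 24 * C * L powr (1 - a)"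
proof -
  have 1: "(\<lambda>x. norm (t x)) summable_on sector1 L"
          "infsum (\<lambda>x. norm (t x)) (sector1 L) \<le> 12 * C * L powr (1 - a)"
  proof (rule_tac [!] sector_abs_bound[OF L a C])
    fix m n assume "L \<le> \<bar>real_of_int m\<bar>" "n \<in> {- \<bar>m\<bar>..\<bar>m\<bar>}"
    moreover from this have "maxn (m, n) = \<bar>real_of_int m\<bar>" by (auto simp: maxn_def)
    ultimately show "norm (t (m, n)) \<le> C * \<bar>real_of_int m\<bar> powr (- (a + 1))" 
      using bd[of "(m, n)"] by simp
    then show "norm (t (m, n)) \<le> C * \<bar>real_of_int m\<bar> powr (- (a + 1))" .
  qed auto
  have 2: "(\<lambda>x. norm ((t \<circ> prod.swap) x)) summable_on sector2 L"
          "infsum (\<lambda>x. norm ((t \<circ> prod.swap) x)) (sector2 L) \<le> 12 * C * L powr (1 - a)"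
  proof (rule_tac [!] sector_abs_bound[OF L a C])
    fix m n assume "L \<le> \<bar>real_of_int m\<bar>" "n \<in> {- (\<bar>m\<bar> - 1)..\<bar>m\<bar> - 1}"
    moreover from this have "maxn (n, m) = \<bar>real_of_int m\<bar>" by (auto simp: maxn_def)
    ultimately show "norm ((t \<circ> prod.swap) (m, n)) \<le> C * \<bar>real_of_int m\<bar> powr (- (a + 1))" 
      using bd[of "(n, m)"] by simp
    then show "norm ((t \<circ> prod.swap) (m, n)) \<le> C * \<bar>real_of_int m\<bar> powr (- (a + 1))" .
  qed auto
  have inj: "inj_on prod.swap (sector2 L)" by (auto simp: inj_on_def)
  have 3: "(\<lambda>x. norm (t x)) summable_on prod.swap ` sector2 L"
    using 2(1) by (subst summable_on_reindex[OF inj]) (simp add: comp_def)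
  have 4: "infsum (\<lambda>x. norm (t x)) (prod.swap ` sector2 L) \<le> 12 * C * L powr (1 - a)"
    using 2(2) by (subst infsum_reindex[OF inj]) (simp add: comp_def)
  show "(\<lambda>x. norm (t x)) summable_on {x. L \<le> maxn x}"
    unfolding maxn_ge_eq_sectors(1) by (rule summable_on_Un_disjoint[OF 1(1) 3 maxn_ge_eq_sectors(2)])
  show "infsum (\<lambda>x. norm (t x)) {x. L \<le> maxn x} \<le> 24 * C * L powr (1 - a)"
    unfolding maxn_ge_eq_sectors(1) infsum_Un_disjoint[OF 1(1) 3 maxn_ge_eq_sectors(2)]
    using 1(2) 4 by linarith
qed

text \<open>The counterpart of \<open>lattice_abs_bound\<close> that uses bounds for line sums in place of bounds for
  single terms; this is where an exponential sum estimate improves the trivial tail bound.\<close>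

lemma lattice_line_bound:
  fixes t :: "int \<times> int \<Rightarrow> complex"
  assumes L: "L \<ge> 1" and a: "a \<ge> 2" and C: "C \<ge> 0"
    and sm: "t summable_on {x. L \<le> maxn x}"
    and l1: "\<And>m. L \<le> \<bar>real_of_int m\<bar> \<Longrightarrow> norm (\<Sum>n\<in>{- \<bar>m\<bar>..\<bar>m\<bar>}. t (m, n)) \<le> C * \<bar>real_of_int m\<bar> powr (- a)"
    and l2: "\<And>m. L \<le> \<bar>real_of_int m\<bar> \<Longrightarrow> norm (\<Sum>n\<in>{- (\<bar>m\<bar> - 1)..\<bar>m\<bar> - 1}. t (n, m)) \<le> C * \<bar>real_of_int m\<bar> powr (- a)"
  shows "norm (infsum t {x. L \<le> maxn x}) \<le> 8 * C * L powr (1 - a)"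
proof -
  have inj: "inj_on prod.swap (sector2 L)" by (auto simp: inj_on_def)
  have s1: "t summable_on sector1 L" and s2: "t summable_on prod.swap ` sector2 L"
    using sm unfolding maxn_ge_eq_sectors(1) by (auto intro: summable_on_subset_banach)
  have 1: "norm (infsum t (sector1 L)) \<le> 4 * C * L powr (1 - a)"
    by (rule line_sum_bound[OF L a C s1 _ l1]) auto
  have "norm (infsum (t \<circ> prod.swap) (sector2 L)) \<le> 4 * C * L powr (1 - a)"
  proof (rule line_sum_bound[OF L a C])
    show "(t \<circ> prod.swap) summable_on sector2 L" using s2 by (subst (asm) summable_on_reindex[OF inj])
  qed (use l2 in auto)
  then have 2: "norm (infsum t (prod.swap ` sector2 L)) \<le> 4 * C * L powr (1 - a)"
    by (subst infsum_reindex[OF inj])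
  show ?thesis
    unfolding maxn_ge_eq_sectors(1) infsum_Un_disjoint[OF s1 s2 maxn_ge_eq_sectors(2)]
    using 1 2 by (intro order_trans[OF norm_triangle_ineq]) linarith
qed

section \<open>Finite differences of the spherical wave\<close>

text \<open>The outgoing spherical wave, with complex wave number because the Weyl identity is proved by
  continuation from the upper half-plane.\<close>

definition sph :: "complex \<Rightarrow> real \<Rightarrow> complex" where
  "sph k r = exp (\<i> * k * of_real r) / of_real r"

text \<open>One lattice term without its Bloch phase, as a function of the horizontal distance and the
  height.\<close>

definition fds :: "nat \<Rightarrow> real \<Rightarrow> complex \<Rightarrow> real \<Rightarrow> real \<Rightarrow> complex" where
  "fds p d k \<rho> z = (\<Sum>q=0..p. fd_coeff p q * sph k (sqrt (\<rho>\<^sup>2 + (z + real q * d)\<^sup>2)))"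

lemma norm_exp_i_le_1: "Im k \<ge> 0 \<Longrightarrow> r \<ge> 0 \<Longrightarrow> norm (exp (\<i> * k * of_real r)) \<le> 1"
  by (simp add: norm_exp_eq_Re)

text \<open>Pascal's rule, read as: a difference of order \<open>p + 1\<close> is a difference of order \<open>p\<close> of the first
  differences.\<close>

lemma fd_coeff_sum_Suc:
  "(\<Sum>q=0..Suc p. fd_coeff (Suc p) q * g q) = (\<Sum>q=0..p. fd_coeff p q * (g q - g (Suc q)))"
proof -
  have pascal: "fd_coeff (Suc p) (Suc q) = fd_coeff p (Suc q) - fd_coeff p q" for q
    by (simp add: fd_coeff_def algebra_simps)
  have top: "fd_coeff p (Suc p) = 0"
    by (simp add: fd_coeff_def binomial_eq_0)
  have "(\<Sum>q=0..Suc p. fd_coeff (Suc p) q * g q)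
      = fd_coeff p 0 * g 0 + (\<Sum>q=0..p. fd_coeff p (Suc q) * g (Suc q)) - (\<Sum>q=0..p. fd_coeff p q * g (Suc q))"
    unfolding sum.atLeast0_atMost_Suc_shift comp_def pascal
    by (simp add: fd_coeff_def left_diff_distrib sum_subtractf)
  also have "fd_coeff p 0 * g 0 + (\<Sum>q=0..p. fd_coeff p (Suc q) * g (Suc q)) = (\<Sum>q=0..Suc p. fd_coeff p q * g q)"
    unfolding sum.atLeast0_atMost_Suc_shift comp_def ..
  also have "\<dots> = (\<Sum>q=0..p. fd_coeff p q * g q)"
    by (simp add: top)
  finally show ?thesis
    by (simp add: right_diff_distrib sum_subtractf)
qed

text \<open>Taking one difference lowers the degree of a polynomial in \<open>q\<close>.\<close>

lemma fd_power_eq_0: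
  fixes z d :: complex
  assumes "n < p"
  shows "(\<Sum>q=0..p. fd_coeff p q * (z + of_nat q * d) ^ n) = 0"
  using assms
proof (induction p arbitrary: n)
  case 0
  then show ?case by simp
next
  case (Suc p)
  have step: "(z + of_nat q * d) ^ n - (z + of_nat (Suc q) * d) ^ n
      = (\<Sum>i<n. - (of_nat (n choose i) * d ^ (n - i)) * (z + of_nat q * d) ^ i)" for q
  proof -
    have "(z + of_nat (Suc q) * d) ^ n = ((z + of_nat q * d) + d) ^ n"
      by (simp add: algebra_simps)
    also have "\<dots> = (\<Sum>i\<le>n. of_nat (n choose i) * (z + of_nat q * d) ^ i * d ^ (n - i))"
      by (rule binomial_ring)
    also have "\<dots> = (\<Sum>i<n. of_nat (n choose i) * (z + of_nat q * d) ^ i * d ^ (n - i)) + (z + of_nat q * d) ^ n"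
      unfolding lessThan_Suc_atMost[symmetric] by simp
    finally show ?thesis
      by (simp add: sum_negf mult_ac)
  qed
  have "(\<Sum>q=0..Suc p. fd_coeff (Suc p) q * (z + of_nat q * d) ^ n)
     = (\<Sum>q=0..p. \<Sum>i<n. - (of_nat (n choose i) * d ^ (n - i)) * (fd_coeff p q * (z + of_nat q * d) ^ i))"
    unfolding fd_coeff_sum_Suc step sum_distrib_left by (intro sum.cong refl) (simp add: mult_ac)
  also have "\<dots> = (\<Sum>i<n. - (of_nat (n choose i) * d ^ (n - i)) * (\<Sum>q=0..p. fd_coeff p q * (z + of_nat q * d) ^ i))"
    unfolding sum_distrib_left by (rule sum.swap)
  also have "\<dots> = 0"
    using Suc by (intro sum.neutral) auto
  finally show ?case .
qed

text \<open>Differentiating \<open>exp (i k R) / R\<close> repeatedly with respect to \<open>R\<^sup>2\<close> gives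
  \<open>exp (i k R)\<close> times \<open>R\<close> to the power \<open>- j - 1\<close> times a polynomial in \<open>1/R\<close>; the recursion below is what
  one such differentiation does to the polynomial.\<close>

primrec dsph_poly :: "complex \<Rightarrow> nat \<Rightarrow> complex poly" where
  "dsph_poly k 0 = 1"
| "dsph_poly k (Suc j) = smult (1/2) (smult (\<i> * k) (dsph_poly k j) - smult (of_nat (Suc j)) (pCons 0 (dsph_poly k j))
      - pCons 0 (pCons 0 (pderiv (dsph_poly k j))))"

text \<open>Uniformity in \<open>k\<close> is needed later, when a real wave number is approached through complex ones.\<close>

lemma coeff_dsph_poly_bounded: "\<exists>C. \<forall>k. norm k \<le> K \<longrightarrow> norm (coeff (dsph_poly k j) i) \<le> C"
proof (induction j arbitrary: i)
  case 0
  show ?case by (intro exI[of _ "norm (coeff (1 :: complex poly) i)"]) simp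
next
  case (Suc j)
  obtain C where C: "\<And>i k. norm k \<le> K \<Longrightarrow> norm (coeff (dsph_poly k j) i) \<le> C i"
    using Suc.IH by metis
  show ?case
  proof (intro exI allI impI)
    fix k :: complex assume k: "norm k \<le> K"
    have Cn: "C i \<ge> 0" for i using C[OF k, of i] norm_ge_zero order_trans by blast
    define m where "m = i - 1"
    have "norm (coeff (dsph_poly k (Suc j)) i) = 1/2 * norm (\<i> * k * coeff (dsph_poly k j) i
        - (of_nat (Suc j) * coeff (dsph_poly k j) m * (if i = 0 then 0 else 1))
        - (if i \<le> 1 then 0 else of_nat m * coeff (dsph_poly k j) m))"
      unfolding m_def by (cases i rule: nat.exhaust; cases "i - 1"; simp add: coeff_pderiv norm_mult)
    also have "\<dots> \<le> 1/2 * (norm (\<i> * k * coeff (dsph_poly k j) i)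
        + norm (of_nat (Suc j) * coeff (dsph_poly k j) m * (if i = 0 then 0 else 1))
        + norm ((if i \<le> 1 then 0 else of_nat m * coeff (dsph_poly k j) m)))"
      by (intro mult_left_mono order_trans[OF norm_triangle_ineq4] add_right_mono) auto
    also have "\<dots> \<le> 1/2 * (K * C i + real (Suc j) * C m + real m * C m)"
      using k C[OF k] Cn order_trans[OF norm_ge_zero k]
      by (intro mult_left_mono add_mono) (auto simp: norm_mult simp del: of_nat_Suc intro!: mult_mono)
    finally show "norm (coeff (dsph_poly k (Suc j)) i) \<le> 1/2 * (K * C i + real (Suc j) * C (i - 1) + real (i - 1) * C (i - 1))"
      by (simp only: m_def)
  qed
qed

lemma degree_dsph_poly: "degree (dsph_poly k j) \<le> j"
proof (induction j)
  case (Suc j)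
  have "coeff (dsph_poly k (Suc j)) i = 0" if "i > Suc j" for i
    using that Suc.IH
    by (cases i rule: nat.exhaust; cases "i - 1") (auto simp: coeff_pderiv coeff_eq_0)
  then show ?case by (intro degree_le) auto
qed simp

lemma poly_dsph_poly: "poly (dsph_poly k j) w = (\<Sum>i\<le>j. coeff (dsph_poly k j) i * w ^ i)"
  unfolding poly_altdef using degree_dsph_poly[of k j] by (intro sum.mono_neutral_left) (auto simp: coeff_eq_0)

lemma dsph_poly_bounded:
  "\<exists>C. \<forall>k w. norm k \<le> K \<longrightarrow> norm w \<le> 1 \<longrightarrow> norm (poly (dsph_poly k j) w) \<le> C \<and>
      norm (poly (dsph_poly k j) w - coeff (dsph_poly k j) 0) \<le> C * norm w"
proof -
  obtain C where C: "\<And>i k. norm k \<le> K \<Longrightarrow> norm (coeff (dsph_poly k j) i) \<le> C i"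
    using coeff_dsph_poly_bounded by metis
  show ?thesis
  proof (intro exI allI impI conjI)
    fix k w :: complex assume k: "norm k \<le> K" and w: "norm w \<le> 1"
    have Cn: "C i \<ge> 0" for i using C[OF k, of i] norm_ge_zero order_trans by blast
    show "norm (poly (dsph_poly k j) w) \<le> (\<Sum>i\<le>j. C i)"
      unfolding poly_dsph_poly using C[OF k] w Cn
      by (intro sum_norm_le) (auto simp: norm_mult norm_power intro!: mult_le_one power_le_one
            order_trans[OF mult_right_le_one_le])
    have "poly (dsph_poly k j) w - coeff (dsph_poly k j) 0 = (\<Sum>i\<in>{..j}-{0}. coeff (dsph_poly k j) i * w ^ i)"
      unfolding poly_dsph_poly by (subst sum.remove[of _ 0]) auto
    also have "norm \<dots> \<le> (\<Sum>i\<in>{..j}-{0}. C i * norm w)"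
    proof (intro sum_norm_le)
      fix i assume i: "i \<in> {..j}-{0}"
      have "norm w ^ i \<le> norm w ^ 1" using i w by (intro power_decreasing) auto
      then show "norm (coeff (dsph_poly k j) i * w ^ i) \<le> C i * norm w"
        using C[OF k] Cn by (auto simp: norm_mult norm_power intro!: mult_mono)
    qed
    also have "\<dots> \<le> (\<Sum>i\<le>j. C i * norm w)"
      using Cn by (intro sum_mono2) auto
    finally show "norm (poly (dsph_poly k j) w - coeff (dsph_poly k j) 0) \<le> (\<Sum>i\<le>j. C i) * norm w"
      by (simp add: sum_distrib_right)
  qed
qed

text \<open>The \<open>j\<close>-th derivative of the spherical wave with respect to the square of its argument.\<close>

definition dsph :: "complex \<Rightarrow> nat \<Rightarrow> complex \<Rightarrow> complex" where
  "dsph k j R = exp (\<i> * k * R) * inverse R ^ Suc j * poly (dsph_poly k j) (inverse R)"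

text \<open>Differentiation in \<open>R\<close> is \<open>2 R\<close> times differentiation in \<open>R\<^sup>2\<close>.\<close>

lemma dsph_deriv:
  assumes "R \<noteq> 0"
  shows "(dsph k j has_field_derivative 2 * R * dsph k (Suc j) R) (at R)"
proof -
  define w where "w = inverse R"
  let ?E = "exp (\<i> * k * R)"
  have Rw: "R * w ^ Suc (Suc j) = w ^ Suc j" using assms by (simp add: w_def)
  have "((\<lambda>R. inverse R) has_field_derivative - (w * w)) (at R)"
    using assms by (auto intro!: derivative_eq_intros simp: w_def)
  note inv = this
  have "((\<lambda>R. poly (dsph_poly k j) (inverse R)) has_field_derivative poly (pderiv (dsph_poly k j)) w * - (w * w)) (at R)"
    using DERIV_chain2[OF poly_DERIV inv] by (simp add: w_def)
  note pol = this
  have "((\<lambda>R. inverse R ^ Suc j) has_field_derivative of_nat (Suc j) * w ^ j * - (w * w)) (at R)"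
    using DERIV_power[OF inv, of "Suc j"] by (simp add: w_def mult_ac)
  note pw = this
  have ex: "((\<lambda>R. exp (\<i> * k * R)) has_field_derivative ?E * (\<i> * k)) (at R)"
    by (auto intro!: derivative_eq_intros)
  have "(dsph k j has_field_derivative
     (?E * (\<i> * k) * w ^ Suc j + of_nat (Suc j) * w ^ j * - (w * w) * ?E) * poly (dsph_poly k j) w
      + poly (pderiv (dsph_poly k j)) w * - (w * w) * (?E * w ^ Suc j)) (at R)"
    using DERIV_mult[OF DERIV_mult[OF ex pw] pol] unfolding dsph_def[abs_def] w_def[symmetric]
    by (simp only: w_def)
  moreover have "2 * R * dsph k (Suc j) R = ?E * (R * w ^ Suc (Suc j)) *
     (\<i> * k * poly (dsph_poly k j) w - of_nat (Suc j) * (w * poly (dsph_poly k j) w) - w * (w * poly (pderiv (dsph_poly k j)) w))"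
    unfolding dsph_def w_def[symmetric] by (simp add: algebra_simps)
  moreover have "\<dots> = (?E * (\<i> * k) * w ^ Suc j + of_nat (Suc j) * w ^ j * - (w * w) * ?E) * poly (dsph_poly k j) w
      + poly (pderiv (dsph_poly k j)) w * - (w * w) * (?E * w ^ Suc j)"
    unfolding Rw by (simp add: algebra_simps)
  ultimately show ?thesis
    by metis
qed

lemma dsph_csqrt_deriv:
  assumes "\<rho> > 0" "Re t \<ge> 0"
  shows "((\<lambda>t. dsph k j (csqrt (of_real (\<rho>\<^sup>2) + t))) has_field_derivative dsph k (Suc j) (csqrt (of_real (\<rho>\<^sup>2) + t))) (at t)"
proof -
  have pos: "Re (of_real (\<rho>\<^sup>2) + t) > 0" using assms by (simp add: add_pos_nonneg)
  then have nz: "csqrt (of_real (\<rho>\<^sup>2) + t) \<noteq> 0" by (metis csqrt_eq_0 zero_complex.sel(1) less_irrefl)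
  have np: "of_real (\<rho>\<^sup>2) + t \<notin> \<real>\<^sub>\<le>\<^sub>0" using pos by (auto simp: complex_nonpos_Reals_iff)
  have dcs: "((\<lambda>t. csqrt (of_real (\<rho>\<^sup>2) + t)) has_field_derivative inverse (2 * csqrt (of_real (\<rho>\<^sup>2) + t))) (at t)"
    using np by (auto intro!: derivative_eq_intros simp: field_simps)
  have "2 * R * F * inverse (2 * R) = F" if "R \<noteq> 0" for R F :: complex
    using that by (simp add: field_simps)
  then show ?thesis
    using DERIV_chain2[OF dsph_deriv[OF nz] dcs] nz by metis
qed

text \<open>Taylor's formula in \<open>t\<close>. Each differentiation in \<open>\<rho>\<^sup>2\<close> gains the one power of \<open>1/\<rho>\<close> that the chain
  rule supplies; the oscillating exponential itself does not become smaller.\<close>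

lemma sph_taylor:
  "\<exists>C\<ge>0. \<forall>k \<rho> t. norm k \<le> K \<longrightarrow> Im k \<ge> 0 \<longrightarrow> \<rho> \<ge> 1 \<longrightarrow> 0 \<le> t \<longrightarrow>
     norm (sph k (sqrt (\<rho>\<^sup>2 + t)) - (\<Sum>i\<le>n. dsph k i (of_real \<rho>) * of_real t ^ i / fact i))
       \<le> C * t ^ Suc n / \<rho> ^ (n + 2)"
proof -
  obtain C0 where C0: "\<And>k w. norm k \<le> K \<Longrightarrow> norm w \<le> 1 \<Longrightarrow> norm (poly (dsph_poly k (Suc n)) w) \<le> C0"
    using dsph_poly_bounded[of K "Suc n"] by metis
  define C where "C = max C0 0"
  have C: "norm (poly (dsph_poly k (Suc n)) w) \<le> C" if "norm k \<le> K" "norm w \<le> 1" for k w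
    using C0[OF that] by (simp add: C_def)
  have "C \<ge> 0" by (simp add: C_def)
  show ?thesis
  proof (intro exI[of _ C] conjI allI impI)
    show "C \<ge> 0" by fact
    fix k :: complex and \<rho> t :: real
    assume k: "norm k \<le> K" and ik: "Im k \<ge> 0" and \<rho>: "\<rho> \<ge> 1" and t: "0 \<le> t"
    define S where "S = {u :: complex. 0 \<le> Re u \<and> Im u = 0}"
    let ?f = "\<lambda>j t. dsph k j (csqrt (of_real (\<rho>\<^sup>2) + t))"
    have cs: "csqrt (of_real (\<rho>\<^sup>2) + u) = of_real (sqrt (\<rho>\<^sup>2 + Re u))" if "u \<in> S" for u
      using csqrt_of_real_nonneg[of "of_real (\<rho>\<^sup>2) + u"] that by (simp add: S_def)
    \<comment> \<open>The complex Taylor formula is applied on a half-line, the real numbers \<open>t \<ge> 0\<close> seen in the complex plane.\<close>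
    have "norm (?f 0 (of_real t) - (\<Sum>i\<le>n. ?f i 0 * (of_real t - 0) ^ i / fact i))
        \<le> (C / \<rho> ^ (n + 2)) * norm (of_real t - 0 :: complex) ^ Suc n / fact n"
    proof (rule field_Taylor[of S])
      show "convex S" unfolding S_def convex_def by (auto simp: scaleR_complex.simps)
      show "0 \<in> S" "of_real t \<in> S" using t by (auto simp: S_def)
      show "(?f i has_field_derivative ?f (Suc i) u) (at u within S)" if "u \<in> S" for i u
        using that \<rho> by (intro has_field_derivative_at_within[OF dsph_csqrt_deriv]) (auto simp: S_def)
      fix u assume u: "u \<in> S"
      define r where "r = sqrt (\<rho>\<^sup>2 + Re u)"
      have r: "r \<ge> \<rho>" using u \<rho> by (auto simp: r_def S_def intro!: real_le_rsqrt)
      have "norm (?f (Suc n) u) = norm (exp (\<i> * k * of_real r)) * inverse r ^ (n + 2)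
            * norm (poly (dsph_poly k (Suc n)) (inverse (of_real r)))"
        using r \<rho> unfolding cs[OF u] r_def[symmetric] dsph_def by (simp add: norm_mult norm_power norm_inverse)
      also have "\<dots> \<le> 1 * inverse \<rho> ^ (n + 2) * C"
      proof (intro mult_mono)
        show "norm (exp (\<i> * k * of_real r)) \<le> 1" using r \<rho> ik by (intro norm_exp_i_le_1) auto
        show "inverse r ^ (n + 2) \<le> inverse \<rho> ^ (n + 2)"
          using r \<rho> by (intro power_mono le_imp_inverse_le) auto
        have "inverse r \<le> 1" using r \<rho> by (intro inverse_le_1_iff[THEN iffD2]) auto
        then show "norm (poly (dsph_poly k (Suc n)) (inverse (of_real r))) \<le> C"
          using r \<rho> by (intro C k) (auto simp: norm_inverse)
      qed (use r \<rho> in auto)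
      finally show "norm (?f (Suc n) u) \<le> C / \<rho> ^ (n + 2)"
        by (simp add: field_simps power_inverse)
    qed
    moreover have "?f 0 (of_real t) = sph k (sqrt (\<rho>\<^sup>2 + t))"
      using cs[of "of_real t"] t by (simp add: S_def dsph_def sph_def field_simps)
    moreover have "?f i 0 = dsph k i (of_real \<rho>)" for i
      using cs[of 0] \<rho> by (simp add: S_def)
    moreover have "(C / \<rho> ^ (n + 2)) * norm (of_real t - 0 :: complex) ^ Suc n / fact n \<le> (C / \<rho> ^ (n + 2)) * t ^ Suc n / 1"
      using t \<rho> \<open>C \<ge> 0\<close> by (intro frac_le) (auto simp del: power_Suc)
    ultimately show "norm (sph k (sqrt (\<rho>\<^sup>2 + t)) - (\<Sum>i\<le>n. dsph k i (of_real \<rho>) * of_real t ^ i / fact i))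
       \<le> C * t ^ Suc n / \<rho> ^ (n + 2)"
      by (simp add: mult.commute)
  qed
qed

lemma fds_taylor:
  assumes "d > 0"
  shows "\<exists>C\<ge>0. \<forall>k \<rho> z. norm k \<le> K \<longrightarrow> Im k \<ge> 0 \<longrightarrow> \<rho> \<ge> 1 \<longrightarrow> \<bar>z\<bar> \<le> Z \<longrightarrow>
     norm (fds p d k \<rho> z - (\<Sum>i\<le>n. dsph k i (of_real \<rho>) / fact i *
         (\<Sum>q=0..p. fd_coeff p q * (of_real z + of_nat q * of_real d) ^ (2 * i)))) \<le> C / \<rho> ^ (n + 2)"
proof -
  obtain C where C: "C \<ge> 0" "\<And>k \<rho> t. norm k \<le> K \<Longrightarrow> Im k \<ge> 0 \<Longrightarrow> \<rho> \<ge> 1 \<Longrightarrow> 0 \<le> t \<Longrightarrow>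
     norm (sph k (sqrt (\<rho>\<^sup>2 + t)) - (\<Sum>i\<le>n. dsph k i (of_real \<rho>) * of_real t ^ i / fact i))
       \<le> C * t ^ Suc n / \<rho> ^ (n + 2)"
    using sph_taylor[of K n] by blast
  define T where "T = (Z + real p * d)\<^sup>2"
  define D where "D = (\<Sum>q=0..p. norm (fd_coeff p q) * (C * T ^ Suc n))"
  show ?thesis
  proof (intro exI[of _ D] conjI allI impI)
    show "D \<ge> 0" unfolding D_def T_def using C(1) by (intro sum_nonneg) auto
    fix k \<rho> z assume k: "norm k \<le> K" "Im k \<ge> 0" and \<rho>: "(\<rho>::real) \<ge> 1" and z: "\<bar>z::real\<bar> \<le> Z"
    let ?t = "\<lambda>q. (z + real q * d)\<^sup>2"
    have "fds p d k \<rho> z - (\<Sum>i\<le>n. dsph k i (of_real \<rho>) / fact i *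
         (\<Sum>q=0..p. fd_coeff p q * (of_real z + of_nat q * of_real d) ^ (2 * i)))
       = (\<Sum>q=0..p. fd_coeff p q * (sph k (sqrt (\<rho>\<^sup>2 + ?t q)) - (\<Sum>i\<le>n. dsph k i (of_real \<rho>) * of_real (?t q) ^ i / fact i)))"
      unfolding fds_def right_diff_distrib sum_subtractf sum_distrib_left
      by (subst sum.swap) (intro arg_cong2[of _ _ _ _ minus] sum.cong refl, simp add: power_mult)
    also have "norm \<dots> \<le> (\<Sum>q=0..p. norm (fd_coeff p q) * (C * T ^ Suc n / \<rho> ^ (n + 2)))"
    proof (intro sum_norm_le)
      fix q assume q: "q \<in> {0..p}"
      have "\<bar>z + real q * d\<bar> \<le> Z + real p * d"
        using z q assms by (intro order_trans[OF abs_triangle_ineq] add_mono) (auto simp: abs_mult intro!: mult_right_mono)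
      then have "?t q \<le> T" unfolding T_def by (simp add: abs_le_square_iff[symmetric])
      then have "C * ?t q ^ Suc n / \<rho> ^ (n + 2) \<le> C * T ^ Suc n / \<rho> ^ (n + 2)"
        using C(1) \<rho> by (intro divide_right_mono mult_left_mono power_mono) auto
      then show "norm (fd_coeff p q * (sph k (sqrt (\<rho>\<^sup>2 + ?t q)) - (\<Sum>i\<le>n. dsph k i (of_real \<rho>) * of_real (?t q) ^ i / fact i)))
          \<le> norm (fd_coeff p q) * (C * T ^ Suc n / \<rho> ^ (n + 2))"
        unfolding norm_mult
        by (intro mult_left_mono order_trans[OF C(2)[OF k \<rho>]]) auto
    qed
    finally show "norm (fds p d k \<rho> z - (\<Sum>i\<le>n. dsph k i (of_real \<rho>) / fact i *
         (\<Sum>q=0..p. fd_coeff p q * (of_real z + of_nat q * of_real d) ^ (2 * i)))) \<le> D / \<rho> ^ (n + 2)"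
      by (simp add: D_def sum_divide_distrib)
  qed
qed

text \<open>The Taylor terms of order \<open>i < \<lceil>p/2\<rceil>\<close> are polynomials of degree \<open>2 i < p\<close> in the difference index
  and cancel, so the remainder of order \<open>\<lceil>p/2\<rceil>\<close> bounds the whole difference. In natural numbers,
  \<open>\<lceil>p/2\<rceil>\<close> is \<open>(p + 1) div 2\<close>.\<close>

lemma fds_bound:
  assumes "d > 0" "p \<ge> 1"
  shows "\<exists>C\<ge>0. \<forall>k \<rho> z. norm k \<le> K \<longrightarrow> Im k \<ge> 0 \<longrightarrow> \<rho> \<ge> 1 \<longrightarrow> \<bar>z\<bar> \<le> Z \<longrightarrow>
     norm (fds p d k \<rho> z) \<le> C / \<rho> ^ ((p + 1) div 2 + 1)"
proof -
  \<comment> \<open>The largest order whose Taylor terms all have degree below \<open>p\<close>.\<close>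
  define n where "n = (p + 1) div 2 - 1"
  have n: "n + 2 = (p + 1) div 2 + 1" "\<And>i. i \<le> n \<Longrightarrow> 2 * i < p" using assms by (auto simp: n_def)
  show ?thesis
    using fds_taylor[OF assms(1), of K Z p n] n(2) unfolding n(1) by (simp add: fd_power_eq_0)
qed

text \<open>One more Taylor term survives and, up to a further power of \<open>1/\<rho>\<close>, is the lowest coefficient of its
  polynomial times a pure oscillation. This explicit phase is what the exponential sum estimate
  acts upon.\<close>

lemma fds_asymp:
  assumes "d > 0" "p \<ge> 1" "Im k \<ge> 0"
  shows "\<exists>c C. C \<ge> 0 \<and> (\<forall>\<rho>\<ge>1. norm (fds p d k \<rho> z - c * exp (\<i> * k * of_real \<rho>) / of_real \<rho> ^ ((p + 1) div 2 + 1))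
      \<le> C / \<rho> ^ ((p + 1) div 2 + 2))"
proof -
  define s where "s = (p + 1) div 2"
  define M where "M = (\<Sum>q=0..p. fd_coeff p q * (of_real z + of_nat q * of_real d) ^ (2 * s)) / fact s"
  have s: "\<And>i. i < s \<Longrightarrow> 2 * i < p" using assms by (auto simp: s_def)
  obtain C1 where C1: "C1 \<ge> 0" "\<And>\<rho>. \<rho> \<ge> 1 \<Longrightarrow> norm (fds p d k \<rho> z - (\<Sum>i\<le>s. dsph k i (of_real \<rho>) / fact i *
         (\<Sum>q=0..p. fd_coeff p q * (of_real z + of_nat q * of_real d) ^ (2 * i)))) \<le> C1 / \<rho> ^ (s + 2)"
    using fds_taylor[OF assms(1), of "norm k" "\<bar>z\<bar>" p s] assms by blast
  have main: "(\<Sum>i\<le>s. dsph k i (of_real \<rho>) / fact i *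
         (\<Sum>q=0..p. fd_coeff p q * (of_real z + of_nat q * of_real d) ^ (2 * i))) = dsph k s (of_real \<rho>) * M" for \<rho> :: real
    unfolding lessThan_Suc_atMost[symmetric] using s by (simp add: fd_power_eq_0 M_def)
  obtain C2 where C2: "\<And>w. norm w \<le> 1 \<Longrightarrow> norm (poly (dsph_poly k s) w - coeff (dsph_poly k s) 0) \<le> C2 * norm w"
    using dsph_poly_bounded[of "norm k" s] by auto
  have C2n: "C2 \<ge> 0" using order_trans[OF norm_ge_zero C2[of 1]] by simp
  have "norm (fds p d k \<rho> z - (coeff (dsph_poly k s) 0 * M) * exp (\<i> * k * of_real \<rho>) / of_real \<rho> ^ (s + 1))
      \<le> (C1 + C2 * norm M) / \<rho> ^ (s + 2)" if \<rho>: "\<rho> \<ge> 1" for \<rho>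
  proof -
    let ?w = "inverse (of_real \<rho>) :: complex"
    have "norm (dsph k s (of_real \<rho>) * M - (coeff (dsph_poly k s) 0 * M) * exp (\<i> * k * of_real \<rho>) / of_real \<rho> ^ (s + 1))
       = norm (exp (\<i> * k * of_real \<rho>)) * (inverse \<rho> ^ (s + 1) * (norm (poly (dsph_poly k s) ?w - coeff (dsph_poly k s) 0) * norm M))"
    proof -
      have "dsph k s (of_real \<rho>) * M - (coeff (dsph_poly k s) 0 * M) * exp (\<i> * k * of_real \<rho>) / of_real \<rho> ^ (s + 1)
        = exp (\<i> * k * of_real \<rho>) * (?w ^ (s + 1) * ((poly (dsph_poly k s) ?w - coeff (dsph_poly k s) 0) * M))"
        unfolding dsph_def by (simp add: divide_inverse power_inverse algebra_simps)
      then show ?thesis using \<rho> by (simp only: norm_mult norm_power norm_inverse norm_of_real)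
    qed
    also have "\<dots> \<le> 1 * (inverse \<rho> ^ (s + 1) * ((C2 * inverse \<rho>) * norm M))"
      using \<rho> C2[of ?w] C2n assms(3)
      by (intro mult_mono norm_exp_i_le_1) (auto simp: norm_inverse inverse_le_1_iff)
    also have "\<dots> = C2 * norm M / \<rho> ^ (s + 2)"
      by (simp add: divide_inverse power_inverse)
    finally show ?thesis
      using C1(2)[OF \<rho>] unfolding main
      by (intro order_trans[OF norm_triangle_sub[of _ "fds p d k \<rho> z - dsph k s (of_real \<rho>) * M"]])
         (simp add: add_divide_distrib)
  qed
  then show ?thesis using C1(1) C2n unfolding s_def[symmetric]
    by (intro exI[of _ "coeff (dsph_poly k s) 0 * M"] exI[of _ "C1 + C2 * norm M"]) auto
qed

section \<open>Exponential sums along lattice lines\<close>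

lemma mult_cos_le_sin:
  fixes y :: real
  assumes "0 \<le> y" "y \<le> pi"
  shows "y * cos y \<le> sin y"
proof -
  have "sin 0 - 0 * cos 0 \<le> sin y - y * cos y"
  proof (rule DERIV_nonneg_imp_nondecreasing[OF assms(1)])
    fix x assume x: "0 \<le> x" "x \<le> y"
    have "((\<lambda>y. sin y - y * cos y) has_real_derivative x * sin x) (at x)"
      by (auto intro!: derivative_eq_intros)
    moreover have "x * sin x \<ge> 0" using x assms by (intro mult_nonneg_nonneg sin_ge_zero) auto
    ultimately show "\<exists>z. ((\<lambda>y. sin y - y * cos y) has_real_derivative z) (at x) \<and> 0 \<le> z" by blast
  qed
  then show ?thesis by simp
qed

lemma cot_antimono:
  fixes a b :: real
  assumes "0 < a" "a \<le> b" "b < pi"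
  shows "cot b \<le> cot a"
proof -
  have s: "sin a > 0" "sin b > 0" using assms by (auto intro: sin_gt_zero)
  have "cot a - cot b = sin (b - a) / (sin a * sin b)"
    using s by (simp add: cot_def sin_diff field_simps)
  moreover have "sin (b - a) \<ge> 0" using assms by (intro sin_ge_zero) auto
  ultimately show ?thesis using s by (smt (verit) divide_nonneg_nonneg mult_nonneg_nonneg)
qed

text \<open>From \<open>y cos y \<le> sin y\<close> and the monotonicity of the cotangent.\<close>

lemma abs_cot_le:
  fixes x y :: real
  assumes "0 < y" "y \<le> x" "x \<le> pi - y"
  shows "\<bar>cot x\<bar> \<le> 1 / y"
proof -
  have "cot y \<le> 1 / y"
    using assms mult_cos_le_sin[of y] sin_gt_zero[of y] by (simp add: cot_def field_simps)
  moreover have "cot x \<le> cot y" using assms by (intro cot_antimono) auto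
  moreover have "cot (pi - y) \<le> cot x" using assms by (intro cot_antimono) auto
  moreover have "cot (pi - y) = - cot y" by (simp add: cot_def)
  ultimately show ?thesis by linarith
qed

lemma sum_by_parts_complex:
  fixes g c :: "nat \<Rightarrow> complex"
  shows "(\<Sum>n<Suc M. g n * (c (Suc n) - c n)) = g M * c (Suc M) - g 0 * c 0 - (\<Sum>n<M. c (Suc n) * (g (Suc n) - g n))"
  by (induction M) (auto simp: algebra_simps)

text \<open>The Kuzmin-Landau inequality. Each term is a difference of consecutive terms multiplied by
  \<open>g n = 1 / (cis \<theta> - 1)\<close>, where \<open>\<theta>\<close> is the increment of the phase. Summation by parts leaves the
  total variation of \<open>g\<close>, and monotone increments make that variation telescope.\<close>

lemma kuzmin_landau:
  fixes \<phi> :: "nat \<Rightarrow> real" and l :: int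
  assumes \<delta>: "\<delta> > 0"
    and rng: "\<And>n. n < N \<Longrightarrow> 2 * pi * l + \<delta> \<le> \<phi> (Suc n) - \<phi> n"
             "\<And>n. n < N \<Longrightarrow> \<phi> (Suc n) - \<phi> n \<le> 2 * pi * (l + 1) - \<delta>"
    and mono: "\<And>n. Suc n < N \<Longrightarrow> \<phi> (Suc n) - \<phi> n \<le> \<phi> (Suc (Suc n)) - \<phi> (Suc n)"
  shows "norm (\<Sum>n<N. cis (\<phi> n)) \<le> 8 / \<delta>"
proof (cases N)
  case 0
  then show ?thesis using \<delta> by simp
next
  case (Suc M)
  \<comment> \<open>Half the increment modulo \<open>2 \<pi>\<close>; then \<open>1 / (cis (2 h) - 1) = - 1/2 - i/2 cot h\<close>, so that only the cotangent varies.\<close>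
  define h where "h n = (\<phi> (Suc n) - \<phi> n - 2 * pi * l) / 2" for n
  define g where "g n = Complex (- 1/2) (- cot (h n) / 2)" for n
  have hr: "\<delta> / 2 \<le> h n" "h n \<le> pi - \<delta> / 2" if "n < N" for n
    using rng[OF that] by (auto simp: h_def field_simps)
  have dpi: "\<delta> \<le> pi" using hr[of 0] Suc by simp
  have gc: "g n * (cis (\<phi> (Suc n)) - cis (\<phi> n)) = cis (\<phi> n)" if "n < N" for n
  proof -
    have s: "sin (h n) > 0" using hr[OF that] \<delta> by (intro sin_gt_zero) auto
    have "\<phi> (Suc n) = \<phi> n + 2 * h n + 2 * pi * l" by (simp add: h_def field_simps)
    then have "cis (\<phi> (Suc n)) = cis (\<phi> n) * cis (2 * h n) * cis (2 * pi * l)"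
      by (simp only: cis_mult)
    also have "cis (2 * pi * l) = 1" by (rule cis_multiple_2pi[OF Ints_of_int])
    finally have *: "cis (\<phi> (Suc n)) - cis (\<phi> n) = cis (\<phi> n) * (cis (2 * h n) - 1)"
      by (simp only: right_diff_distrib mult_1_right)
    have re: "Re (cis (2 * h n) - 1) = - (2 * (sin (h n))\<^sup>2)" by (simp add: cos_double_sin)
    have im: "Im (cis (2 * h n) - 1) = 2 * sin (h n) * cos (h n)" by (simp add: sin_double)
    have "cot (h n) * sin (h n) = cos (h n)" using s by (simp add: cot_def)
    then have cs: "cot (h n) * (2 * sin (h n) * cos (h n)) = 2 * (cos (h n))\<^sup>2"
              "cot (h n) * (2 * (sin (h n))\<^sup>2) = 2 * sin (h n) * cos (h n)"
      by (simp_all add: power2_eq_square mult_ac)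
    have "Re (g n * (cis (2 * h n) - 1)) = (sin (h n))\<^sup>2 + cot (h n) * (2 * sin (h n) * cos (h n)) / 2"
      unfolding times_complex.sel re im by (simp add: g_def)
    also have "\<dots> = 1" unfolding cs by simp
    finally have "Re (g n * (cis (2 * h n) - 1)) = 1" .
    moreover have "Im (g n * (cis (2 * h n) - 1)) = cot (h n) * (2 * (sin (h n))\<^sup>2) / 2 - sin (h n) * cos (h n)"
      unfolding times_complex.sel re im by (simp add: g_def)
    then have "Im (g n * (cis (2 * h n) - 1)) = 0" unfolding cs by simp
    ultimately have "g n * (cis (2 * h n) - 1) = 1" by (simp only: complex_eq_iff one_complex.sel)
    then show ?thesis unfolding * by (simp only: mult.left_commute[of "g n"] mult_1_right)
  qed
  have cb: "\<bar>cot (h n)\<bar> \<le> 2 / \<delta>" if "n < N" for n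
    using abs_cot_le[of "\<delta> / 2" "h n"] hr[OF that] \<delta> by simp
  have gb: "norm (g n) \<le> 1/2 + 1 / \<delta>" if "n < N" for n
    using cb[OF that] by (intro order_trans[OF cmod_le]) (simp add: g_def)
  have gd: "norm (g (Suc n) - g n) = (cot (h n) - cot (h (Suc n))) / 2" if "n < M" for n
  proof -
    have "cot (h (Suc n)) \<le> cot (h n)"
      using hr[of n] hr[of "Suc n"] mono[of n] that Suc \<delta> by (intro cot_antimono) (auto simp: h_def)
    moreover have "g (Suc n) - g n = Complex 0 ((cot (h n) - cot (h (Suc n))) / 2)"
      by (simp add: g_def complex_eq_iff field_simps)
    ultimately show ?thesis by (simp add: complex_norm)
  qed
  have "(\<Sum>n<N. cis (\<phi> n)) = (\<Sum>n<Suc M. g n * (cis (\<phi> (Suc n)) - cis (\<phi> n)))"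
    using gc Suc by (intro sum.cong) auto
  also have "norm \<dots> \<le> norm (g M) + norm (g 0) + (\<Sum>n<M. norm (g (Suc n) - g n))"
    unfolding sum_by_parts_complex[of g "\<lambda>n. cis (\<phi> n)" M]
    by (intro order_trans[OF norm_triangle_ineq4] add_mono sum_norm_le) (auto simp: norm_mult)
  also have "(\<Sum>n<M. norm (g (Suc n) - g n)) = (cot (h 0) - cot (h M)) / 2"
  proof -
    have "(\<Sum>n<M. norm (g (Suc n) - g n)) = (\<Sum>n<M. (cot (h n) - cot (h (Suc n))) / 2)"
      by (intro sum.cong refl gd) simp
    then show ?thesis by (simp only: sum_divide_distrib[symmetric] sum_lessThan_telescope'[of "\<lambda>n. cot (h n)"])
  qed
  also have "norm (g M) + norm (g 0) + (cot (h 0) - cot (h M)) / 2 \<le> 1 + 4 / \<delta>"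
    using gb[of M] gb[of 0] cb[of M] cb[of 0] Suc by (simp add: field_simps abs_le_iff)
  also have "\<dots> \<le> 8 / \<delta>"
    using dpi \<delta> pi_less_4 by (simp add: field_simps)
  finally show ?thesis .
qed

lemma card_nat_set_le:
  fixes S :: "nat set"
  assumes "finite S" "K \<ge> 0" "\<And>i j. i \<in> S \<Longrightarrow> j \<in> S \<Longrightarrow> i \<le> j \<Longrightarrow> real (j - i) \<le> K"
  shows "real (card S) \<le> K + 1"
proof (cases "S = {}")
  case False
  have le: "Min S \<le> Max S" using assms(1) False by simp
  have "card S \<le> card {Min S..Max S}"
    using assms(1) by (intro card_mono) auto
  then have "card S \<le> Max S - Min S + 1" using le by simp
  then have "real (card S) \<le> real (Max S - Min S) + 1" by linarith
  also have "\<dots> \<le> K + 1" using assms False le by (intro add_right_mono assms(3)) auto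
  finally show ?thesis .
qed (use assms in auto)

text \<open>Turns the set of indices whose increment lies in an interval into an interval of indices.\<close>

lemma convex_nat_set_obtain:
  fixes S :: "nat set"
  assumes "finite S" "S \<noteq> {}" "\<And>i j n. i \<in> S \<Longrightarrow> j \<in> S \<Longrightarrow> i \<le> n \<Longrightarrow> n \<le> j \<Longrightarrow> n \<in> S"
  obtains a b where "a \<le> b" "S = {a..b}"
proof
  show "Min S \<le> Max S" using assms(1,2) by simp
  have "n \<in> S" if "Min S \<le> n" "n \<le> Max S" for n
    by (rule assms(3)[OF Min_in[OF assms(1,2)] Max_in[OF assms(1,2)] that])
  moreover have "Min S \<le> n \<and> n \<le> Max S" if "n \<in> S" for n
    using assms(1) that by simp
  ultimately show "S = {Min S..Max S}"
    unfolding set_eq_iff atLeastAtMost_iff by blast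
qed

text \<open>Van der Corput's second derivative test in discrete form. The increments of a convex phase
  increase by at least \<open>\<eta>\<close> per step; those within \<open>\<delta>\<close> of a multiple of \<open>2 \<pi>\<close> are few and are estimated
  trivially, while the stretches in between are handled by Kuzmin-Landau. The bounded range of the
  increments limits the number of multiples that are met.\<close>

lemma van_der_corput_second:
  fixes \<phi> :: "nat \<Rightarrow> real"
  assumes "R \<ge> 0" and lam: "0 < \<eta>" "\<eta> \<le> 1"
    and conv: "\<And>n. Suc n < N \<Longrightarrow> \<eta> \<le> (\<phi> (Suc (Suc n)) - \<phi> (Suc n)) - (\<phi> (Suc n) - \<phi> n)"
    and bd: "\<And>n. n < N \<Longrightarrow> \<bar>\<phi> (Suc n) - \<phi> n\<bar> \<le> R"
  shows "norm (\<Sum>n<N. cis (\<phi> n)) \<le> 12 * (R + 2) / sqrt \<eta>"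
proof (cases "N = 0")
  case True
  then show ?thesis using lam \<open>R \<ge> 0\<close> by simp
next
  case False
  define \<theta> where "\<theta> n = \<phi> (Suc n) - \<phi> n" for n
  \<comment> \<open>At most about \<open>\<delta>/\<eta>\<close> increments lie in an interval of length \<open>\<delta>\<close>, and Kuzmin-Landau costs \<open>8/\<delta>\<close>; this choice balances the two.\<close>
  define \<delta> where "\<delta> = sqrt \<eta>"
  note R = \<open>R \<ge> 0\<close>
  have \<delta>: "0 < \<delta>" "\<delta> \<le> 1" "\<delta> * \<delta> = \<eta>" using lam by (auto simp: \<delta>_def)
  have grow: "real (j - i) * \<eta> \<le> \<theta> j - \<theta> i" if "i \<le> j" "j < N" for i j
    using that
  proof (induction j rule: dec_induct)
    case (step n)
    then show ?case using conv[of n] by (auto simp: \<theta>_def Suc_diff_le algebra_simps)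
  qed simp
  then have mono: "\<theta> i \<le> \<theta> j" if "i \<le> j" "j < N" for i j
    using that lam by (smt (verit) mult_nonneg_nonneg of_nat_0_le_iff)
  have near: "real (card {n. n < N \<and> c \<le> \<theta> n \<and> \<theta> n \<le> c + \<delta>}) \<le> 2 / \<delta>" for c
  proof -
    have "real (card {n. n < N \<and> c \<le> \<theta> n \<and> \<theta> n \<le> c + \<delta>}) \<le> 1 / \<delta> + 1"
    proof (rule card_nat_set_le)
      fix i j assume "i \<in> {n. n < N \<and> c \<le> \<theta> n \<and> \<theta> n \<le> c + \<delta>}" "j \<in> {n. n < N \<and> c \<le> \<theta> n \<and> \<theta> n \<le> c + \<delta>}"
        and ij: "i \<le> j"
      then have "j < N" "\<theta> j - \<theta> i \<le> \<delta>" by auto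
      with grow[OF ij] have "real (j - i) * (\<delta> * \<delta>) \<le> \<delta>" unfolding \<delta>(3) by linarith
      then show "real (j - i) \<le> 1 / \<delta>" using \<delta>(1) by (simp add: field_simps)
    qed (use \<delta> in auto)
    also have "\<dots> \<le> 2 / \<delta>"
    proof -
      have "1 \<le> 1 / \<delta>" using \<delta>(1,2) by simp
      then show ?thesis by simp
    qed
    finally show ?thesis .
  qed
  have mid: "norm (\<Sum>n\<in>{n. n < N \<and> 2 * pi * l + \<delta> \<le> \<theta> n \<and> \<theta> n \<le> 2 * pi * (l + 1) - \<delta>}. cis (\<phi> n)) \<le> 8 / \<delta>"
    (is "norm (sum _ ?S) \<le> _") for l :: int
  proof (cases "?S = {}")
    case False
    obtain a b where "a \<le> b" and S: "?S = {a..b}"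
    proof (rule convex_nat_set_obtain[OF _ False])
      fix i j n assume "i \<in> ?S" "j \<in> ?S" "i \<le> n" "n \<le> j"
      with mono[of i n] mono[of n j] show "n \<in> ?S" by auto
    qed auto
    have inS: "n + a \<in> ?S" if "n < Suc b - a" for n
      unfolding S using that by auto
    have "(\<Sum>n\<in>?S. cis (\<phi> n)) = (\<Sum>n\<in>{a..b}. cis (\<phi> n))" by (simp only: S)
    also have "\<dots> = (\<Sum>n<Suc b - a. cis (\<phi> (n + a)))"
      by (rule sum.reindex_bij_witness[of _ "\<lambda>n. n + a" "\<lambda>n. n - a"]) (use \<open>a \<le> b\<close> in auto)
    also have "norm \<dots> \<le> 8 / \<delta>"
    proof (rule kuzmin_landau[OF \<delta>(1), where l = l])
      fix n assume n: "n < Suc b - a"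
      from inS[OF this] show "2 * pi * l + \<delta> \<le> \<phi> (Suc n + a) - \<phi> (n + a)" "\<phi> (Suc n + a) - \<phi> (n + a) \<le> 2 * pi * (l + 1) - \<delta>"
        by (auto simp: \<theta>_def)
    next
      fix n assume n: "Suc n < Suc b - a"
      have "Suc n + a < N" using inS[OF n] by auto
      then show "\<phi> (Suc n + a) - \<phi> (n + a) \<le> \<phi> (Suc (Suc n) + a) - \<phi> (Suc n + a)"
        using mono[of "n + a" "Suc n + a"] by (auto simp: \<theta>_def)
    qed
    finally show ?thesis .
  qed (use \<delta> in \<open>simp only: sum.empty\<close>, simp)
  \<comment> \<open>The indices are grouped by the period in which the increment lies; each group has two short ends near multiples of \<open>2 \<pi>\<close>.\<close>
  define L where "L n = \<lfloor>\<theta> n / (2 * pi)\<rfloor>" for n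
  have fiber: "norm (\<Sum>n\<in>{n\<in>{..<N}. L n = l}. cis (\<phi> n)) \<le> 12 / \<delta>" for l
  proof -
    let ?A = "{n. n < N \<and> 2 * pi * l \<le> \<theta> n \<and> \<theta> n < 2 * pi * l + \<delta>}"
    let ?B = "{n. n < N \<and> 2 * pi * (l + 1) - \<delta> < \<theta> n \<and> \<theta> n < 2 * pi * (l + 1)}"
    let ?S = "{n. n < N \<and> 2 * pi * l + \<delta> \<le> \<theta> n \<and> \<theta> n \<le> 2 * pi * (l + 1) - \<delta>}"
    have Ln: "L n = l \<longleftrightarrow> 2 * pi * l \<le> \<theta> n \<and> \<theta> n < 2 * pi * (l + 1)" for n
      unfolding L_def floor_eq_iff by (simp add: field_simps)
    have pi2: "2 * \<delta> < 2 * pi" using \<delta> pi_gt3 by simp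
    have "{n\<in>{..<N}. L n = l} = ?A \<union> (?S \<union> ?B)"
      unfolding Ln using \<delta> pi2 by (auto simp: algebra_simps)
    moreover have "?A \<inter> (?S \<union> ?B) = {}" "?S \<inter> ?B = {}" using pi2 by (auto simp: algebra_simps)
    ultimately have split: "(\<Sum>n\<in>{n\<in>{..<N}. L n = l}. cis (\<phi> n)) = (\<Sum>n\<in>?A. cis (\<phi> n)) + ((\<Sum>n\<in>?S. cis (\<phi> n)) + (\<Sum>n\<in>?B. cis (\<phi> n)))"
      by (simp add: sum.union_disjoint)
    have "norm (\<Sum>n\<in>{n\<in>{..<N}. L n = l}. cis (\<phi> n)) \<le> real (card ?A) + (8 / \<delta> + real (card ?B))"
      unfolding split
      by (intro order_trans[OF norm_triangle_ineq] add_mono mid)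
         (auto intro!: order_trans[OF sum_norm_le[of _ _ "\<lambda>_. 1"]])
    moreover have "real (card ?A) \<le> 2 / \<delta>"
    proof (rule order_trans[OF _ near[of "2 * pi * l"]], unfold of_nat_le_iff, rule card_mono)
      show "?A \<subseteq> {n. n < N \<and> 2 * pi * l \<le> \<theta> n \<and> \<theta> n \<le> 2 * pi * l + \<delta>}" by (intro Collect_mono) linarith
    qed simp
    moreover have "real (card ?B) \<le> 2 / \<delta>"
    proof (rule order_trans[OF _ near[of "2 * pi * (l + 1) - \<delta>"]], unfold of_nat_le_iff, rule card_mono)
      show "?B \<subseteq> {n. n < N \<and> 2 * pi * (l + 1) - \<delta> \<le> \<theta> n \<and> \<theta> n \<le> 2 * pi * (l + 1) - \<delta> + \<delta>}"
        by (intro Collect_mono) linarith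
    qed simp
    ultimately show ?thesis by linarith
  qed
  define I where "I = {\<lfloor>- R / (2 * pi)\<rfloor>..\<lfloor>R / (2 * pi)\<rfloor>}"
  have LI: "L ` {..<N} \<subseteq> I"
  proof (intro image_subsetI)
    fix n assume "n \<in> {..<N}"
    then have "- R \<le> \<theta> n" "\<theta> n \<le> R" using bd[of n] by (auto simp: \<theta>_def abs_le_iff)
    then show "L n \<in> I" unfolding L_def I_def atLeastAtMost_iff
      by (intro conjI floor_mono divide_right_mono) auto
  qed
  have "(\<Sum>n<N. cis (\<phi> n)) = (\<Sum>l\<in>I. \<Sum>n\<in>{n\<in>{..<N}. L n = l}. cis (\<phi> n))"
    using LI by (subst sum.group) (auto simp: I_def)
  also have "norm \<dots> \<le> (\<Sum>l\<in>I. 12 / \<delta>)"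
    by (intro sum_norm_le fiber)
  also have "\<dots> = real (card I) * (12 / \<delta>)" by simp
  also have "\<dots> \<le> (R + 2) * (12 / \<delta>)"
  proof (intro mult_right_mono)
    have "\<lfloor>R / (2 * pi)\<rfloor> - \<lfloor>- R / (2 * pi)\<rfloor> + 1 \<le> R / (2 * pi) + R / (2 * pi) + 2"
      using floor_correct[of "R / (2 * pi)"] floor_correct[of "- R / (2 * pi)"] by simp linarith
    also have "\<dots> = R * (1 / pi) + 2" by (simp add: field_simps)
    also have "\<dots> \<le> R * 1 + 2" using R pi_gt3 by (intro add_right_mono mult_left_mono) auto
    finally have "\<lfloor>R / (2 * pi)\<rfloor> - \<lfloor>- R / (2 * pi)\<rfloor> + 1 \<le> R + 2" by simp
    then show "real (card I) \<le> R + 2" using R unfolding I_def by simp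
  qed (use \<delta> in simp)
  finally show ?thesis by (simp add: \<delta>_def mult.commute)
qed

text \<open>Abel summation, with one Lipschitz constant for the weights instead of their variation.\<close>

lemma abel_bound:
  fixes a :: "nat \<Rightarrow> real" and c :: "nat \<Rightarrow> complex"
  assumes B: "\<And>M. M \<le> N \<Longrightarrow> norm (\<Sum>n<M. c n) \<le> B"
    and a: "\<And>n. n < N \<Longrightarrow> \<bar>a n\<bar> \<le> \<alpha>" and da: "\<And>n. Suc n < N \<Longrightarrow> \<bar>a (Suc n) - a n\<bar> \<le> \<beta>"
    and nn: "\<alpha> \<ge> 0" "\<beta> \<ge> 0"
  shows "norm (\<Sum>n<N. of_real (a n) * c n) \<le> B * (\<alpha> + real N * \<beta>)"
proof (cases N)
  case 0
  then show ?thesis using B[of 0] nn by simp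
next
  case (Suc M)
  have Bn: "B \<ge> 0" using B[of 0] by simp
  have "(\<Sum>n<Suc M. of_real (a n) * c n) = of_real (a M) * (\<Sum>n<Suc M. c n) - (\<Sum>n<M. of_real (a (Suc n) - a n) * (\<Sum>i<Suc n. c i))"
    by (induction M) (auto simp: algebra_simps)
  also have "norm \<dots> \<le> \<alpha> * B + (\<Sum>n<M. \<beta> * B)"
    unfolding Suc using a da nn Suc Bn
    by (intro order_trans[OF norm_triangle_ineq4] add_mono sum_norm_le)
       (auto simp only: norm_mult norm_of_real intro!: mult_mono B, auto)
  also have "\<dots> \<le> B * (\<alpha> + real N * \<beta>)" using Suc Bn nn by (simp add: algebra_simps)
  finally show ?thesis using Suc by simp
qed

text \<open>With \<open>P = \<parallel>u + b\<parallel>\<close>, \<open>Q = \<parallel>u - b\<parallel>\<close> the parallelogram law gives \<open>P\<^sup>2 + Q\<^sup>2\<close>, and \<open>P Q\<close> exceeds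
  \<open>\<parallel>u\<parallel>\<^sup>2 - \<parallel>b\<parallel>\<^sup>2\<close> by at least a multiple of the Gram determinant of \<open>u\<close> and \<open>b\<close>; a lower bound for \<open>P + Q - 2 \<parallel>u\<parallel>\<close>
  follows by rationalising. This is quantitative strict convexity of the norm transversally to \<open>u\<close>.\<close>

lemma norm_second_difference:
  fixes u b :: "'a::real_inner"
  assumes "u \<noteq> 0"
  shows "4 * ((norm u)\<^sup>2 * (norm b)\<^sup>2 - (u \<bullet> b)\<^sup>2) / ((norm u)\<^sup>2 * (4 * norm u + 2 * norm b))
     \<le> norm (u + b) + norm (u - b) - 2 * norm u"
proof -
  define X Y P Q D where "X = norm u" and "Y = norm b" and "P = norm (u + b)" and "Q = norm (u - b)"
    and "D = X\<^sup>2 * Y\<^sup>2 - (u \<bullet> b)\<^sup>2"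
  have X: "X > 0" and nn: "Y \<ge> 0" "P \<ge> 0" "Q \<ge> 0" using assms by (auto simp: X_def Y_def P_def Q_def)
  have P2: "P\<^sup>2 = X\<^sup>2 + Y\<^sup>2 + 2 * (u \<bullet> b)" and Q2: "Q\<^sup>2 = X\<^sup>2 + Y\<^sup>2 - 2 * (u \<bullet> b)"
    unfolding P_def Q_def X_def Y_def by (simp_all add: power2_norm_eq_inner inner_simps inner_commute)
  have PQ2: "(P * Q)\<^sup>2 = (X\<^sup>2 - Y\<^sup>2)\<^sup>2 + 4 * D"
    unfolding power_mult_distrib P2 Q2 D_def by (simp add: power2_eq_square algebra_simps)
  have D: "D \<ge> 0" unfolding D_def X_def Y_def
    using Cauchy_Schwarz_ineq[of u b] by (simp add: power2_norm_eq_inner)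
  have PQ_le: "P * Q \<le> X\<^sup>2 + Y\<^sup>2"
  proof -
    have "2 * (P * Q) \<le> P\<^sup>2 + Q\<^sup>2" using zero_le_power2[of "P - Q"] by (simp add: power2_eq_square algebra_simps)
    then show ?thesis using P2 Q2 by simp
  qed
  have PQ_ge: "X\<^sup>2 - Y\<^sup>2 \<le> P * Q"
    using PQ2 D nn by (intro power2_le_imp_le[of "X\<^sup>2 - Y\<^sup>2" "P * Q"]) auto
  have "4 * D = (P * Q - (X\<^sup>2 - Y\<^sup>2)) * (P * Q + (X\<^sup>2 - Y\<^sup>2))"
    using PQ2 by (simp add: power2_eq_square algebra_simps)
  also have "\<dots> \<le> (P * Q - (X\<^sup>2 - Y\<^sup>2)) * (2 * X\<^sup>2)"
    using PQ_le PQ_ge by (intro mult_left_mono) auto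
  finally have 1: "2 * D / X\<^sup>2 \<le> P * Q - (X\<^sup>2 - Y\<^sup>2)"
    using X by (simp add: field_simps)
  have S: "P + Q \<le> 2 * X + 2 * Y"
    using norm_triangle_ineq[of u b] norm_triangle_ineq4[of u b] by (simp add: P_def Q_def X_def Y_def)
  have "(P + Q - 2 * X) * (P + Q + 2 * X) = 2 * (P * Q - (X\<^sup>2 - Y\<^sup>2))"
    using P2 Q2 by (simp add: power2_eq_square algebra_simps)
  then have 2: "4 * D / X\<^sup>2 \<le> (P + Q - 2 * X) * (P + Q + 2 * X)" using 1 by simp
  have pos: "P + Q + 2 * X > 0" using nn X by simp
  have "0 \<le> (P + Q - 2 * X) * (P + Q + 2 * X)" using 2 D X by (smt (verit) divide_nonneg_nonneg zero_le_power2)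
  then have "P + Q - 2 * X \<ge> 0" using pos by (simp add: zero_le_mult_iff)
  then have "(P + Q - 2 * X) * (P + Q + 2 * X) \<le> (P + Q - 2 * X) * (4 * X + 2 * Y)"
    using S by (intro mult_left_mono) auto
  with 2 have "4 * D / X\<^sup>2 \<le> (P + Q - 2 * X) * (4 * X + 2 * Y)" by simp
  then have "4 * D / X\<^sup>2 / (4 * X + 2 * Y) \<le> P + Q - 2 * X"
    using X nn by (simp add: pos_divide_le_eq mult_ac)
  then show ?thesis unfolding X_def Y_def P_def Q_def D_def by (simp only: divide_divide_eq_left)
qed

definition det2 :: "real^2 \<Rightarrow> real^2 \<Rightarrow> real" where
  "det2 a b = a$1 * b$2 - a$2 * b$1"

text \<open>Lagrange's identity.\<close>

lemma det2_power2: "(norm a)\<^sup>2 * (norm b)\<^sup>2 - (a \<bullet> b)\<^sup>2 = (det2 a b)\<^sup>2"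
  unfolding power2_norm_eq_inner
  by (simp add: det2_def inner_vec_def UNIV_2 power2_eq_square algebra_simps)

text \<open>On the line with index \<open>m\<close> inside the sector, the points have norm of order \<open>\<bar>m\<bar>\<close> and stay at a
  distance of order \<open>\<bar>m\<bar>\<close> from the direction \<open>b\<close>, so the norm has second differences of order \<open>1/\<bar>m\<bar>\<close>.
  The phase may contain an arbitrary affine part \<open>\<mu> + \<nu> n\<close>, which second differences do not see; the
  constant depends on \<open>\<nu>\<close> but not on \<open>\<mu>\<close>, which later varies with \<open>m\<close>.\<close>

lemma lattice_line_sum:
  fixes a b x :: "real^2" and k \<nu> :: real
  assumes det: "det2 a b \<noteq> 0" and k: "k \<noteq> 0"
  shows "\<exists>C M0. C \<ge> 0 \<and> M0 \<ge> 1 \<and> (\<forall>m lo N \<mu>. \<bar>real_of_int m\<bar> \<ge> M0 \<longrightarrow> (\<forall>i<N. \<bar>lo + int i\<bar> \<le> \<bar>m::int\<bar>) \<longrightarrow>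
     norm (\<Sum>i<N. cis (k * norm (x + of_int m *\<^sub>R a + of_int (lo + int i) *\<^sub>R b) + (\<mu> + \<nu> * of_int (lo + int i))))
        \<le> C * sqrt \<bar>of_int m\<bar>)"
proof -
  define C1 where "C1 = norm x + norm a + norm b"
  have b0: "b \<noteq> 0" using det by (auto simp: det2_def)
  have C1: "C1 > 0" using b0 by (simp add: C1_def add_nonneg_pos)
  \<comment> \<open>The determinant of a point of the line with \<open>b\<close> is \<open>det2 x b + m * det2 a b\<close>; beyond \<open>M0\<close> the second term is at least twice the first.\<close>
  define M0 where "M0 = 1 + 2 * \<bar>det2 x b\<bar> / \<bar>det2 a b\<bar>"
  have M0: "M0 \<ge> 1" using det by (simp add: M0_def)
  define c where "c = min 1 (\<bar>k\<bar> * (det2 a b)\<^sup>2 / (C1\<^sup>2 * (4 * C1 + 2 * norm b)))"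
  have c: "c > 0" "c \<le> 1" unfolding c_def using k det C1 b0 by (auto intro!: divide_pos_pos mult_pos_pos add_pos_pos)
  define R where "R = \<bar>k\<bar> * norm b + \<bar>\<nu>\<bar>"
  define C where "C = 12 * (R + 2) / sqrt c"
  show ?thesis
  proof (rule exI[of _ C], rule exI[of _ M0], intro conjI allI impI)
    show "C \<ge> 0" using c by (simp add: C_def R_def)
    show "M0 \<ge> 1" by fact
    fix m lo :: int and N :: nat and \<mu> :: real
    assume m: "\<bar>real_of_int m\<bar> \<ge> M0" and rng: "\<forall>i<N. \<bar>lo + int i\<bar> \<le> \<bar>m\<bar>"
    define u where "u i = x + of_int m *\<^sub>R a + of_int (lo + int i) *\<^sub>R b" for i
    define \<phi> where "\<phi> i = k * norm (u i) + (\<mu> + \<nu> * of_int (lo + int i))" for i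
    define mm where "mm = \<bar>real_of_int m\<bar>"
    have mm: "mm \<ge> M0" "mm \<ge> 1" using m M0 by (auto simp: mm_def)
    have uS: "u (Suc i) = u i + b" for i by (simp add: u_def algebra_simps)
    have bd: "\<bar>\<phi> (Suc i) - \<phi> i\<bar> \<le> R" for i
    proof -
      have "\<phi> (Suc i) - \<phi> i = k * (norm (u i + b) - norm (u i)) + \<nu>" by (simp add: \<phi>_def uS algebra_simps)
      also have "\<bar>\<dots>\<bar> \<le> \<bar>k\<bar> * \<bar>norm (u i + b) - norm (u i)\<bar> + \<bar>\<nu>\<bar>"
        by (intro order_trans[OF abs_triangle_ineq]) (simp add: abs_mult)
      also have "\<dots> \<le> R" unfolding R_def
        by (intro add_right_mono mult_left_mono) (use norm_triangle_ineq3[of "u i + b" "u i"] in auto)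
      finally show ?thesis .
    qed
    have sd: "c / mm \<le> \<bar>k\<bar> * (norm (u (Suc (Suc i))) - norm (u (Suc i)) - (norm (u (Suc i)) - norm (u i)))" if "Suc i < N" for i
    proof -
      define v where "v = u (Suc i)"
      have v1: "u (Suc (Suc i)) = v + b" "u i = v - b" by (simp_all add: v_def uS)
      have dv: "det2 v b = det2 x b + of_int m * det2 a b"
        by (simp add: v_def u_def det2_def algebra_simps)
      have "mm * \<bar>det2 a b\<bar> / 2 \<le> \<bar>det2 v b\<bar>"
      proof -
        have "2 * \<bar>det2 x b\<bar> / \<bar>det2 a b\<bar> \<le> mm" using mm by (simp add: M0_def)
        then have "2 * \<bar>det2 x b\<bar> \<le> mm * \<bar>det2 a b\<bar>" using det by (simp add: field_simps)
        moreover have "\<bar>of_int m * det2 a b\<bar> = mm * \<bar>det2 a b\<bar>" by (simp add: mm_def abs_mult)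
        ultimately show ?thesis unfolding dv by linarith
      qed
      then have "(mm * \<bar>det2 a b\<bar> / 2)\<^sup>2 \<le> \<bar>det2 v b\<bar>\<^sup>2" using mm by (intro power_mono) auto
      then have dv2: "mm\<^sup>2 * (det2 a b)\<^sup>2 \<le> 4 * (det2 v b)\<^sup>2"
        by (simp add: power_mult_distrib power_divide field_simps)
      have "(det2 v b)\<^sup>2 > 0" using dv2 mm det by (smt (verit) mult_pos_pos zero_less_power2)
      then have v0: "v \<noteq> 0" by (auto simp: det2_def)
      have nv: "norm v \<le> C1 * mm"
      proof -
        have "\<bar>real_of_int (lo + int (Suc i))\<bar> \<le> mm" using rng that unfolding mm_def by (metis of_int_abs of_int_le_iff)
        then have "norm v \<le> norm x + mm * norm a + mm * norm b"
          unfolding v_def u_def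
          by (intro order_trans[OF norm_triangle_ineq] add_mono) (auto simp: mm_def intro!: mult_right_mono simp del: of_nat_Suc of_int_add)
        also have "\<dots> \<le> mm * norm x + mm * norm a + mm * norm b" using mm by (auto simp: mult_le_cancel_right1)
        finally show ?thesis by (simp add: C1_def algebra_simps)
      qed
      have "c / mm \<le> \<bar>k\<bar> * (det2 a b)\<^sup>2 / (C1\<^sup>2 * (4 * C1 + 2 * norm b)) / mm"
        using mm by (intro divide_right_mono) (auto simp: c_def)
      also have "\<dots> = \<bar>k\<bar> * (mm\<^sup>2 * (det2 a b)\<^sup>2 / ((C1 * mm)\<^sup>2 * (4 * (C1 * mm) + 2 * (norm b * mm))))"
      proof -
        have "4 * (C1 * mm) + 2 * (norm b * mm) = (4 * C1 + 2 * norm b) * mm" by (simp add: algebra_simps)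
        then show ?thesis using mm by (simp add: power_mult_distrib)
      qed
      also have "\<dots> \<le> \<bar>k\<bar> * (4 * (det2 v b)\<^sup>2 / ((norm v)\<^sup>2 * (4 * norm v + 2 * norm b)))"
      proof (intro mult_left_mono frac_le)
        show "(norm v)\<^sup>2 * (4 * norm v + 2 * norm b) \<le> (C1 * mm)\<^sup>2 * (4 * (C1 * mm) + 2 * (norm b * mm))"
          using nv mm C1 by (intro mult_mono add_mono power_mono) (auto simp: mult_le_cancel_left1)
        show "0 < (norm v)\<^sup>2 * (4 * norm v + 2 * norm b)"
          using v0 by (intro mult_pos_pos add_pos_nonneg) auto
      qed (use dv2 in auto)
      also have "\<dots> \<le> \<bar>k\<bar> * (norm (v + b) + norm (v - b) - 2 * norm v)"
        using norm_second_difference[OF v0, of b] unfolding det2_power2 by (intro mult_left_mono) auto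
      finally show ?thesis unfolding v1 v_def[symmetric] by (simp add: algebra_simps)
    qed
    have R: "R \<ge> 0" by (simp add: R_def)
    have cm: "0 < c / mm" "c / mm \<le> 1" using c mm by (auto simp: field_simps)
    have "norm (\<Sum>i<N. cis (\<phi> i)) \<le> 12 * (R + 2) / sqrt (c / mm)"
    proof (cases "k > 0")
      case True
      show ?thesis
      proof (rule van_der_corput_second[OF R cm])
        fix i show "\<bar>\<phi> (Suc i) - \<phi> i\<bar> \<le> R" by (rule bd)
      next
        fix i assume "Suc i < N"
        from sd[OF this] show "c / mm \<le> \<phi> (Suc (Suc i)) - \<phi> (Suc i) - (\<phi> (Suc i) - \<phi> i)"
          using True by (simp add: \<phi>_def algebra_simps)
      qed
    next
      case False
      \<comment> \<open>For negative \<open>k\<close> the phase is concave, and its negative is treated instead.\<close>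
      have "norm (\<Sum>i<N. cis (- \<phi> i)) \<le> 12 * (R + 2) / sqrt (c / mm)"
      proof (rule van_der_corput_second[OF R cm])
        fix i assume "Suc i < N"
        from sd[OF this] show "c / mm \<le> - \<phi> (Suc (Suc i)) - - \<phi> (Suc i) - (- \<phi> (Suc i) - - \<phi> i)"
          using False by (simp add: \<phi>_def algebra_simps)
      next
        fix i show "\<bar>- \<phi> (Suc i) - - \<phi> i\<bar> \<le> R" using bd[of i] by linarith
      qed
      also have "(\<Sum>i<N. cis (- \<phi> i)) = cnj (\<Sum>i<N. cis (\<phi> i))" by (simp add: cis_cnj)
      finally show ?thesis by (simp only: complex_mod_cnj)
    qed
    also have "\<dots> = C * sqrt mm" by (simp add: C_def real_sqrt_divide)
    finally show "norm (\<Sum>i<N. cis (k * norm (x + of_int m *\<^sub>R a + of_int (lo + int i) *\<^sub>R b) + (\<mu> + \<nu> * of_int (lo + int i))))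
        \<le> C * sqrt \<bar>of_int m\<bar>"
      unfolding \<phi>_def u_def mm_def .
  qed
qed

section \<open>Absolute convergence and the sharp cut-off\<close>

text \<open>The pairing relations contain the linear independence of \<open>v1\<close>, \<open>v2\<close> in quantitative form
  (\<open>det2_dual\<close>, \<open>maxn_le_lat\<close>).\<close>

locale dual_lattice =
  fixes v1 v2 w1 w2 :: "real^2"
  assumes w1v1: "w1 \<bullet> v1 = 1" and w1v2: "w1 \<bullet> v2 = 0" and w2v1: "w2 \<bullet> v1 = 0" and w2v2: "w2 \<bullet> v2 = 1"
begin

text \<open>\<open>V\<close> and \<open>W\<close> compare the Euclidean norm of a lattice point with the maximum of its coordinates, in
  the two directions (\<open>lat_le_maxn\<close>, \<open>maxn_le_lat\<close>).\<close>

definition V where "V = norm v1 + norm v2"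
definition W where "W = norm w1 + norm w2"

lemma V_pos: "V > 0" and W_pos: "W > 0"
proof -
  have "v1 \<noteq> 0" "w1 \<noteq> 0" using w1v1 by auto
  then show "V > 0" "W > 0" by (auto simp: V_def W_def add_pos_nonneg)
qed

lemma inner_lat: "w1 \<bullet> lat v1 v2 m n = of_int m" "w2 \<bullet> lat v1 v2 m n = of_int n"
  by (simp_all add: lat_def inner_simps w1v1 w1v2 w2v1 w2v2)

lemma maxn_le_lat: "maxn (m, n) \<le> W * norm (lat v1 v2 m n)"
proof -
  have "\<bar>real_of_int m\<bar> \<le> norm w1 * norm (lat v1 v2 m n)" "\<bar>real_of_int n\<bar> \<le> norm w2 * norm (lat v1 v2 m n)"
    using Cauchy_Schwarz_ineq2[of w1 "lat v1 v2 m n"] Cauchy_Schwarz_ineq2[of w2 "lat v1 v2 m n"]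
    by (simp_all add: inner_lat)
  moreover have "norm w1 * norm (lat v1 v2 m n) \<le> W * norm (lat v1 v2 m n)"
     "norm w2 * norm (lat v1 v2 m n) \<le> W * norm (lat v1 v2 m n)"
    by (auto simp: W_def intro!: mult_right_mono)
  ultimately show ?thesis by (simp add: maxn_def)
qed

lemma lat_le_maxn: "norm (lat v1 v2 m n) \<le> V * maxn (m, n)"
proof -
  have "norm (lat v1 v2 m n) \<le> \<bar>real_of_int m\<bar> * norm v1 + \<bar>real_of_int n\<bar> * norm v2"
    unfolding lat_def by (intro order_trans[OF norm_triangle_ineq]) simp
  also have "\<dots> \<le> maxn (m, n) * norm v1 + maxn (m, n) * norm v2"
    by (intro add_mono mult_right_mono) (auto simp: maxn_def)
  finally show ?thesis by (simp add: V_def algebra_simps)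
qed

lemma det2_dual: "det2 w1 w2 * det2 v1 v2 = 1"
proof -
  have "det2 w1 w2 * det2 v1 v2 = (w1 \<bullet> v1) * (w2 \<bullet> v2) - (w1 \<bullet> v2) * (w2 \<bullet> v1)"
    by (simp add: det2_def inner_vec_def UNIV_2 algebra_simps)
  also have "\<dots> = 1" by (simp add: w1v1 w1v2 w2v1 w2v2)
  finally show ?thesis .
qed

lemma det2_nz: "det2 v1 v2 \<noteq> 0"
  using det2_dual by auto

lemma shifted_lat_ge:
  assumes "norm x \<le> X" "maxn (m, n) \<ge> W * (2 * X + 2)"
  shows "maxn (m, n) / (2 * W) \<le> norm (x + lat v1 v2 m n)" "1 \<le> norm (x + lat v1 v2 m n)"
proof -
  have X: "X \<ge> 0" using assms(1) norm_ge_zero order_trans by blast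
  have "norm (lat v1 v2 m n) - norm x \<le> norm (x + lat v1 v2 m n)"
    by (metis add.commute norm_diff_ineq)
  moreover have "maxn (m, n) / W \<le> norm (lat v1 v2 m n)"
    using maxn_le_lat[of m n] W_pos by (simp add: field_simps)
  moreover have "2 * X + 2 \<le> maxn (m, n) / W" using assms(2) W_pos by (simp add: field_simps)
  moreover have "maxn (m, n) / (2 * W) = (maxn (m, n) / W) / 2" by simp
  ultimately show "maxn (m, n) / (2 * W) \<le> norm (x + lat v1 v2 m n)" "1 \<le> norm (x + lat v1 v2 m n)"
    using assms(1) X by linarith+
qed

lemma inverse_power_le:
  assumes "M \<ge> 1" "M / (2 * W) \<le> \<rho>"
  shows "1 / \<rho> ^ n \<le> (2 * W) ^ n * M powr (- real n)"
proof -
  have "0 < M / (2 * W)" using assms W_pos by simp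
  then have "1 / \<rho> ^ n \<le> 1 / (M / (2 * W)) ^ n"
    using assms(2) by (intro divide_left_mono power_mono mult_pos_pos zero_less_power) auto
  also have "\<dots> = (2 * W) ^ n * M powr (- real n)"
  proof -
    have "M powr (- real n) = 1 / M ^ n" using assms(1) by (simp add: powr_minus_divide powr_realpow)
    then show ?thesis by (simp add: power_divide)
  qed
  finally show ?thesis .
qed

lemma lattice_term_eq:
  "lattice_term v1 v2 d p k \<alpha> m n (x, z) = cis (- (\<alpha> \<bullet> lat v1 v2 m n)) * fds p d (of_real k) (norm (x + lat v1 v2 m n)) z"
  by (simp add: lattice_term_def fds_def sph_def rdist_def cis_conv_exp mult.assoc)

lemma finite_maxn_less: "finite {x. maxn x < M}"
proof -
  have "{x. maxn x < M} \<subseteq> {- \<lceil>\<bar>M\<bar>\<rceil>..\<lceil>\<bar>M\<bar>\<rceil>} \<times> {- \<lceil>\<bar>M\<bar>\<rceil>..\<lceil>\<bar>M\<bar>\<rceil>}"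
  proof
    fix u assume "u \<in> {x. maxn x < M}"
    then obtain m n where u: "u = (m, n)" "\<bar>real_of_int m\<bar> < M" "\<bar>real_of_int n\<bar> < M" by (cases u) (auto simp: maxn_def)
    then have "\<bar>m\<bar> \<le> \<lceil>\<bar>M\<bar>\<rceil>" "\<bar>n\<bar> \<le> \<lceil>\<bar>M\<bar>\<rceil>" by linarith+
    then show "u \<in> {- \<lceil>\<bar>M\<bar>\<rceil>..\<lceil>\<bar>M\<bar>\<rceil>} \<times> {- \<lceil>\<bar>M\<bar>\<rceil>..\<lceil>\<bar>M\<bar>\<rceil>}" unfolding u(1) mem_Times_iff fst_conv snd_conv atLeastAtMost_iff by linarith
  qed
  then show ?thesis by (rule finite_subset) simp
qed

text \<open>Locally uniform in the evaluation point, so that it also serves to integrate the series over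
  balls.\<close>

lemma lattice_term_bound:
  assumes "d > 0" "p \<ge> 1"
  shows "\<exists>C M0. C \<ge> 0 \<and> M0 \<ge> 1 \<and> (\<forall>x z m n. norm x \<le> X \<longrightarrow> \<bar>z\<bar> \<le> Z \<longrightarrow> M0 \<le> maxn (m, n) \<longrightarrow>
     norm (lattice_term v1 v2 d p k \<alpha> m n (x, z)) \<le> C * maxn (m, n) powr (- (real ((p + 1) div 2) + 1)))"
proof -
  let ?s = "(p + 1) div 2"
  obtain C where C: "C \<ge> 0" "\<And>\<rho> z. \<rho> \<ge> 1 \<Longrightarrow> \<bar>z\<bar> \<le> Z \<Longrightarrow> norm (fds p d (of_real k) \<rho> z) \<le> C / \<rho> ^ (?s + 1)"
    using fds_bound[OF assms, of "\<bar>k\<bar>" Z] by auto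
  show ?thesis
  proof (rule exI[of _ "C * (2 * W) ^ (?s + 1)"], rule exI[of _ "max 1 (W * (2 * X + 2))"], intro conjI allI impI)
    show "C * (2 * W) ^ (?s + 1) \<ge> 0" using C W_pos by simp
    fix x :: "real^2" and z m n assume x: "norm x \<le> X" and z: "\<bar>z\<bar> \<le> Z" and M: "max 1 (W * (2 * X + 2)) \<le> maxn (m, n)"
    let ?\<rho> = "norm (x + lat v1 v2 m n)"
    have \<rho>: "maxn (m, n) / (2 * W) \<le> ?\<rho>" "1 \<le> ?\<rho>" using shifted_lat_ge[OF x] M by auto
    have "norm (lattice_term v1 v2 d p k \<alpha> m n (x, z)) \<le> C * (1 / ?\<rho> ^ (?s + 1))"
      unfolding lattice_term_eq using C(2)[OF \<rho>(2) z] by (simp add: norm_mult)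
    also have "\<dots> \<le> C * ((2 * W) ^ (?s + 1) * maxn (m, n) powr (- real (?s + 1)))"
      using M \<rho> C(1) by (intro mult_left_mono inverse_power_le) auto
    finally show "norm (lattice_term v1 v2 d p k \<alpha> m n (x, z)) \<le> C * (2 * W) ^ (?s + 1) * maxn (m, n) powr (- (real ?s + 1))"
      by (simp add: mult_ac add.commute)
  qed auto
qed

lemma abs_summable_from_tail:
  fixes t :: "int \<times> int \<Rightarrow> complex"
  assumes "(\<lambda>x. norm (t x)) summable_on {x. L \<le> maxn x}"
  shows "(\<lambda>x. norm (t x)) summable_on UNIV"
proof -
  have "(\<lambda>x. norm (t x)) summable_on ({x. maxn x < L} \<union> {x. L \<le> maxn x})"
    by (rule summable_on_Un_disjoint[OF _ assms]) (auto intro!: summable_on_finite finite_maxn_less)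
  also have "({x. maxn x < L} \<union> {x. L \<le> maxn x}) = UNIV" by auto
  finally show ?thesis .
qed

lemma lattice_term_summable:
  assumes "d > 0" "p \<ge> 3"
  shows "(\<lambda>u. norm (case u of (m, n) \<Rightarrow> lattice_term v1 v2 d p k \<alpha> m n x)) summable_on UNIV"
proof -
  obtain y z where x: "x = (y, z)" by (cases x)
  obtain C M0 where C: "C \<ge> 0" "M0 \<ge> 1" "\<And>m n. M0 \<le> maxn (m, n) \<Longrightarrow>
     norm (lattice_term v1 v2 d p k \<alpha> m n (y, z)) \<le> C * maxn (m, n) powr (- (real ((p + 1) div 2) + 1))"
    using lattice_term_bound[OF assms(1), of p "norm y" "\<bar>z\<bar>" k \<alpha>] assms(2) by auto
  have "(\<lambda>u. norm ((\<lambda>(m, n). lattice_term v1 v2 d p k \<alpha> m n x) u)) summable_on {x. M0 \<le> maxn x}"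
    by (rule lattice_abs_bound(1)[OF C(2) _ C(1), of "real ((p + 1) div 2)"]) (use assms C(3) in \<open>auto simp: x\<close>)
  then show ?thesis by (rule abs_summable_from_tail)
qed

text \<open>The limit function, as an unconditional sum. At a source the singular wave takes the value 0
  of division by zero; the sources form a null set, so this does not influence the distribution.\<close>

definition Gfun where
  "Gfun d p k \<alpha> x = 1 / (4 * of_real pi) * (\<Sum>\<^sub>\<infinity>(m, n)\<in>UNIV. lattice_term v1 v2 d p k \<alpha> m n x)"

text \<open>For any part of the tail, since the complement of a Euclidean disc is not one of the sets
  \<open>L \<le> maxn x\<close>.\<close>

lemma lattice_tail_le:
  fixes t :: "int \<times> int \<Rightarrow> complex"
  assumes L: "L \<ge> 1" and a: "a \<ge> 2" and C: "C \<ge> 0"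
    and bd: "\<And>x. L \<le> maxn x \<Longrightarrow> norm (t x) \<le> C * maxn x powr (- (a + 1))"
    and S: "S \<subseteq> {x. L \<le> maxn x}"
  shows "norm (infsum t S) \<le> 24 * C * L powr (1 - a)"
proof -
  note s = lattice_abs_bound(1)[OF L a C bd, simplified]
  have sS: "(\<lambda>x. norm (t x)) summable_on S" using summable_on_subset_banach[OF s] S by blast
  have "norm (infsum t S) \<le> infsum (\<lambda>x. norm (t x)) S" by (rule norm_infsum_bound[OF sS])
  also have "\<dots> \<le> infsum (\<lambda>x. norm (t x)) {x. L \<le> maxn x}"
    using S by (intro infsum_mono2[OF sS s]) auto
  also have "\<dots> \<le> 24 * C * L powr (1 - a)" by (rule lattice_abs_bound(2)[OF L a C bd])
  finally show ?thesis .
qed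

text \<open>The omitted lattice points lie outside a disc of radius \<open>A\<close>, hence outside a square of size \<open>A/V\<close>,
  and absolute summation of the tail already gives the rate.\<close>

lemma G_trunc_rate:
  assumes "d > 0" "p \<ge> 3"
  shows "\<exists>C. \<forall>\<^sub>F A in at_top. norm (G_trunc v1 v2 d p k \<alpha> A x - Gfun d p k \<alpha> x) \<le> C * A powr (1 - real ((p + 1) div 2))"
proof -
  obtain y z where x: "x = (y, z)" by (cases x)
  define s where "s = real ((p + 1) div 2)"
  have s2: "s \<ge> 2" using assms(2) by (auto simp: s_def)
  obtain C M0 where C: "C \<ge> 0" "M0 \<ge> 1" "\<And>m n. M0 \<le> maxn (m, n) \<Longrightarrow>
     norm (lattice_term v1 v2 d p k \<alpha> m n (y, z)) \<le> C * maxn (m, n) powr (- (s + 1))"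
    using lattice_term_bound[OF assms(1), of p "norm y" "\<bar>z\<bar>" k \<alpha>] assms(2) unfolding s_def by auto
  let ?t = "\<lambda>(m, n). lattice_term v1 v2 d p k \<alpha> m n x"
  have sm: "?t summable_on UNIV" using abs_summable_summable[OF lattice_term_summable[OF assms]] .
  show ?thesis
  proof (rule exI[of _ "24 * C * V powr (s - 1)"], rule eventually_mono[OF eventually_ge_at_top[of "M0 * V"]])
    fix A assume A: "A \<ge> M0 * V"
    define F where "F = {(m, n). norm (lat v1 v2 m n) \<le> A}"
    have L: "A / V \<ge> M0" using A V_pos by (simp add: field_simps)
    have Apos: "A > 0" using A V_pos C(2) by (meson less_le_trans mult_pos_pos zero_less_one order_less_le_trans)
    have fin: "finite F"
    proof (rule finite_subset[OF _ finite_maxn_less[of "W * A + 1"]])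
      show "F \<subseteq> {x. maxn x < W * A + 1}"
      proof
        fix u assume "u \<in> F"
        then obtain m n where u: "u = (m, n)" "norm (lat v1 v2 m n) \<le> A" by (auto simp: F_def)
        then have "W * norm (lat v1 v2 m n) \<le> W * A" using W_pos by (intro mult_left_mono) auto
        then show "u \<in> {x. maxn x < W * A + 1}" using maxn_le_lat[of m n] u by simp
      qed
    qed
    have "infsum ?t UNIV = infsum ?t (F \<union> - F)" by simp
    also have "\<dots> = sum ?t F + infsum ?t (- F)"
      by (subst infsum_Un_disjoint) (use fin sm summable_on_subset_banach in auto)
    finally have "G_trunc v1 v2 d p k \<alpha> A x - Gfun d p k \<alpha> x = - (1 / (4 * of_real pi) * infsum ?t (- F))"
      by (simp add: G_trunc_def Gfun_def F_def algebra_simps)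
    then have "norm (G_trunc v1 v2 d p k \<alpha> A x - Gfun d p k \<alpha> x) = 1 / (4 * pi) * norm (infsum ?t (- F))"
      by (simp add: norm_mult norm_divide)
    also have "\<dots> \<le> 1 * norm (infsum ?t (- F))"
      using pi_gt3 by (intro mult_right_mono) (auto simp: field_simps)
    also have "norm (infsum ?t (- F)) \<le> 24 * C * (A / V) powr (1 - s)"
    proof (rule lattice_tail_le[OF _ s2 C(1)])
      show "A / V \<ge> 1" using L C(2) by linarith
      show "norm (?t u) \<le> C * maxn u powr (- (s + 1))" if "A / V \<le> maxn u" for u
        using that L C(3) by (cases u) (auto simp: x)
      show "- F \<subseteq> {x. A / V \<le> maxn x}"
      proof
        fix u assume "u \<in> - F"
        then obtain m n where u: "u = (m, n)" "norm (lat v1 v2 m n) > A" by (cases u) (auto simp: F_def)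
        then show "u \<in> {x. A / V \<le> maxn x}" using lat_le_maxn[of m n] V_pos by (simp add: field_simps)
      qed
    qed
    also have "24 * C * (A / V) powr (1 - s) = 24 * C * V powr (s - 1) * A powr (1 - s)"
      using Apos V_pos by (simp add: powr_divide powr_diff)
    finally show "norm (G_trunc v1 v2 d p k \<alpha> A x - Gfun d p k \<alpha> x) \<le> 24 * C * V powr (s - 1) * A powr (1 - real ((p + 1) div 2))"
      by (simp add: s_def)
  qed
qed

end

text \<open>The derivative is continuous and vanishes outside \<open>[r1, r2]\<close>.\<close>

section \<open>The smooth cut-off\<close>

lemma cutoff_lipschitz:
  fixes chi :: "real \<Rightarrow> real"
  assumes sm: "smooth chi" and one: "\<And>r. r < r1 \<Longrightarrow> chi r = 1" and zero: "\<And>r. r > r2 \<Longrightarrow> chi r = 0"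
  shows "\<exists>L\<ge>0. \<forall>x y. \<bar>chi x - chi y\<bar> \<le> L * \<bar>x - y\<bar>"
proof -
  have C1: "C_k (Suc 0) chi" using sm by (auto simp: smooth_def)
  define D where "D x = frechet_derivative chi (at x) 1" for x
  have diff: "chi differentiable (at x)" for x using C1 by auto
  have cont: "continuous_on UNIV D" using C1 by (auto simp: D_def[abs_def])
  have der: "(chi has_real_derivative D x) (at x)" for x
  proof -
    have "(chi has_derivative frechet_derivative chi (at x)) (at x)" using diff frechet_derivative_works by blast
    moreover have "frechet_derivative chi (at x) = (\<lambda>h. h * D x)"
    proof
      fix h :: real
      have "linear (frechet_derivative chi (at x))" using diff linear_frechet_derivative by blast
      from linear_cmul[OF this, of h 1] show "frechet_derivative chi (at x) h = h * D x" by (simp add: D_def)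
    qed
    ultimately show ?thesis by (simp add: has_field_derivative_def mult.commute[of _ "D x"])
  qed
  have D0: "D x = 0" if "x < r1" for x
  proof -
    have "((\<lambda>_. 1) has_real_derivative D x) (at x)"
      by (rule has_field_derivative_transform_within_open[OF der[of x], of "{..<r1}"]) (use that one in auto)
    then show ?thesis using DERIV_const DERIV_unique by blast
  qed
  have D1: "D x = 0" if "x > r2" for x
  proof -
    have "((\<lambda>_. 0) has_real_derivative D x) (at x)"
      by (rule has_field_derivative_transform_within_open[OF der[of x], of "{r2<..}"]) (use that zero in auto)
    then show ?thesis using DERIV_const DERIV_unique by blast
  qed
  have "compact (D ` {r1..r2})" by (intro compact_continuous_image continuous_on_subset[OF cont]) auto
  then obtain B where B: "\<And>x. x \<in> {r1..r2} \<Longrightarrow> \<bar>D x\<bar> \<le> B" 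
    using compact_imp_bounded bounded_iff by (metis image_eqI real_norm_def)
  have B': "\<bar>D x\<bar> \<le> max B 0" for x
    using B[of x] D0[of x] D1[of x] by (cases "x < r1"; cases "x > r2"; auto)
  have "\<bar>chi x - chi y\<bar> \<le> max B 0 * \<bar>x - y\<bar>" for x y
    using field_differentiable_bound[of UNIV chi D "max B 0" x y] der B' by simp
  then show ?thesis by (intro exI[of _ "max B 0"]) auto
qed

text \<open>The point is that the bound has no explicit \<open>A\<close>: the cut-off contributes a slope of order \<open>1/A\<close> only
  where its argument is at most \<open>r2\<close>, and there \<open>1/A\<close> is at most \<open>r2/\<mu>\<close>.\<close>

lemma amplitude_diff:
  fixes chi :: "real \<Rightarrow> real"
  assumes lip: "\<And>x y. \<bar>chi x - chi y\<bar> \<le> L * \<bar>x - y\<bar>" and bd: "\<And>x. \<bar>chi x\<bar> \<le> X" and zero: "\<And>r. r > r2 \<Longrightarrow> chi r = 0"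
    and L: "L \<ge> 0" and \<mu>: "\<mu> > 0" and A: "A > 0" and \<rho>: "\<mu> \<le> \<rho>" "\<mu> \<le> \<rho>'" and r2: "r2 > 0"
  shows "\<bar>(1 - chi (\<rho> / A)) / \<rho> ^ n - (1 - chi (\<rho>' / A)) / \<rho>' ^ n\<bar> \<le> (real n * (1 + X) + L * r2) * \<bar>\<rho> - \<rho>'\<bar> / \<mu> ^ Suc n"
proof -
  have pos: "\<rho> > 0" "\<rho>' > 0" using \<rho> \<mu> by auto
  have X: "X \<ge> 0" using bd[of 0] by linarith
  have 1: "\<bar>chi (\<rho> / A) - chi (\<rho>' / A)\<bar> \<le> L * r2 * \<bar>\<rho> - \<rho>'\<bar> / \<mu>"
  proof (cases "\<mu> > r2 * A")
    case True
    then have "\<rho> / A > r2" "\<rho>' / A > r2" using \<rho> A by (auto simp: field_simps)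
    then show ?thesis using zero L r2 \<mu> by simp
  next
    case False
    then have "1 / A \<le> r2 / \<mu>" using A \<mu> by (simp add: field_simps)
    have "\<bar>chi (\<rho> / A) - chi (\<rho>' / A)\<bar> \<le> L * \<bar>\<rho> / A - \<rho>' / A\<bar>" by (rule lip)
    also have "\<bar>\<rho> / A - \<rho>' / A\<bar> = \<bar>\<rho> - \<rho>'\<bar> * (1 / A)" using A by (simp add: diff_divide_distrib[symmetric] abs_divide)
    also have "L * (\<bar>\<rho> - \<rho>'\<bar> * (1 / A)) \<le> L * (\<bar>\<rho> - \<rho>'\<bar> * (r2 / \<mu>))"
      using \<open>1 / A \<le> r2 / \<mu>\<close> L by (intro mult_left_mono) auto
    finally show ?thesis by (simp add: mult_ac)
  qed
  have 2: "\<bar>1 / \<rho> ^ n - 1 / \<rho>' ^ n\<bar> \<le> real n * \<bar>\<rho> - \<rho>'\<bar> / \<mu> ^ Suc n"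
  proof -
    have "norm ((\<mu> / \<rho>) ^ n - (\<mu> / \<rho>') ^ n) \<le> real n * norm (\<mu> / \<rho> - \<mu> / \<rho>')"
      using \<rho> \<mu> pos by (intro norm_power_diff) auto
    also have "norm (\<mu> / \<rho> - \<mu> / \<rho>') = \<mu> * \<bar>\<rho> - \<rho>'\<bar> / (\<rho> * \<rho>')"
    proof -
      have "\<mu> / \<rho> - \<mu> / \<rho>' = \<mu> * (\<rho>' - \<rho>) / (\<rho> * \<rho>')" using pos by (simp add: field_simps)
      then show ?thesis using pos \<mu> by (simp add: abs_mult abs_minus_commute)
    qed
    also have "\<dots> \<le> \<mu> * \<bar>\<rho> - \<rho>'\<bar> / (\<mu> * \<mu>)"
      using \<rho> \<mu> pos by (intro divide_left_mono mult_mono mult_nonneg_nonneg mult_pos_pos) auto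
    also have "\<dots> = \<bar>\<rho> - \<rho>'\<bar> / \<mu>" using \<mu> by simp
    finally have *: "\<bar>(\<mu> / \<rho>) ^ n - (\<mu> / \<rho>') ^ n\<bar> \<le> real n * (\<bar>\<rho> - \<rho>'\<bar> / \<mu>)" by (simp add: mult_left_mono)
    have "(\<mu> / \<rho>) ^ n - (\<mu> / \<rho>') ^ n = \<mu> ^ n * (1 / \<rho> ^ n - 1 / \<rho>' ^ n)" by (simp add: power_divide algebra_simps)
    then have "\<mu> ^ n * \<bar>1 / \<rho> ^ n - 1 / \<rho>' ^ n\<bar> \<le> real n * (\<bar>\<rho> - \<rho>'\<bar> / \<mu>)"
      using * \<mu> by (simp add: abs_mult)
    then have "\<bar>1 / \<rho> ^ n - 1 / \<rho>' ^ n\<bar> \<le> real n * (\<bar>\<rho> - \<rho>'\<bar> / \<mu>) / \<mu> ^ n"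
      using \<mu> by (simp add: pos_le_divide_eq mult.commute)
    then show ?thesis by simp
  qed
  have "(1 - chi (\<rho> / A)) / \<rho> ^ n - (1 - chi (\<rho>' / A)) / \<rho>' ^ n
      = (1 - chi (\<rho> / A)) * (1 / \<rho> ^ n - 1 / \<rho>' ^ n) + (chi (\<rho>' / A) - chi (\<rho> / A)) * (1 / \<rho>' ^ n)"
    by (simp add: algebra_simps diff_divide_distrib)
  also have "\<bar>\<dots>\<bar> \<le> \<bar>1 - chi (\<rho> / A)\<bar> * \<bar>1 / \<rho> ^ n - 1 / \<rho>' ^ n\<bar> + \<bar>chi (\<rho> / A) - chi (\<rho>' / A)\<bar> * \<bar>1 / \<rho>' ^ n\<bar>"
    by (intro order_trans[OF abs_triangle_ineq]) (simp add: abs_mult abs_minus_commute)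
  also have "\<dots> \<le> (1 + X) * (real n * \<bar>\<rho> - \<rho>'\<bar> / \<mu> ^ Suc n) + (L * r2 * \<bar>\<rho> - \<rho>'\<bar> / \<mu>) * (1 / \<mu> ^ n)"
  proof (intro add_mono mult_mono 1 2)
    show "\<bar>1 - chi (\<rho> / A)\<bar> \<le> 1 + X" using bd[of "\<rho> / A"] by linarith
    show "\<bar>1 / \<rho>' ^ n\<bar> \<le> 1 / \<mu> ^ n"
      using \<rho> \<mu> pos by (auto simp: abs_divide intro!: divide_left_mono power_mono mult_pos_pos)
  qed (use X L r2 \<mu> in auto)
  also have "\<dots> = (real n * (1 + X) + L * r2) * \<bar>\<rho> - \<rho>'\<bar> / \<mu> ^ Suc n"
    using \<mu> by (simp add: field_simps)
  finally show ?thesis .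
qed

lemma sum_int_interval:
  fixes f :: "int \<Rightarrow> complex"
  shows "(\<Sum>n\<in>{lo..hi}. f n) = (\<Sum>i<nat (hi - lo + 1). f (lo + int i))"
  by (rule sum.reindex_bij_witness[of _ "\<lambda>i. lo + int i" "\<lambda>n. nat (n - lo)"]) auto

text \<open>The exponential sum \<open>lattice_line_sum\<close> with the amplitude \<open>(1 - \<chi>(\<rho>/A)) / \<rho>\<close> to the power \<open>s\<close> inserted by
  Abel summation: on the line with index \<open>m\<close> the amplitude is of order \<open>\<bar>m\<bar>\<close> to the power \<open>- s\<close>, and its
  variation over the at most \<open>3 \<bar>m\<bar>\<close> points is of the same order, uniformly in \<open>A\<close>.\<close>

lemma cutoff_line_sum:
  fixes chi :: "real \<Rightarrow> real" and a b x \<alpha> :: "real^2"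
  assumes lip: "\<And>x y. \<bar>chi x - chi y\<bar> \<le> L * \<bar>x - y\<bar>" and bd: "\<And>x. \<bar>chi x\<bar> \<le> X" and zero: "\<And>r. r > r2 \<Longrightarrow> chi r = 0"
    and L: "L \<ge> 0" and r2: "r2 > 0" and k: "k \<noteq> 0" and det: "det2 a b \<noteq> 0" and c: "c > 0"
    and low: "\<And>m n. M1 \<le> \<bar>real_of_int m\<bar> \<Longrightarrow> \<bar>n\<bar> \<le> \<bar>m\<bar> \<Longrightarrow> c * \<bar>real_of_int m\<bar> \<le> norm (x + (of_int m *\<^sub>R a + of_int n *\<^sub>R b))"
  shows "\<exists>C M0. C \<ge> 0 \<and> M0 \<ge> 1 \<and> (\<forall>A m lo hi. A > 0 \<longrightarrow> M0 \<le> \<bar>real_of_int m\<bar> \<longrightarrow> - \<bar>m\<bar> \<le> lo \<longrightarrow> hi \<le> \<bar>m\<bar> \<longrightarrow>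
     norm (\<Sum>n\<in>{lo..hi}. of_real ((1 - chi (norm (x + (of_int m *\<^sub>R a + of_int n *\<^sub>R b)) / A)) / norm (x + (of_int m *\<^sub>R a + of_int n *\<^sub>R b)) ^ s) *
         cis (k * norm (x + (of_int m *\<^sub>R a + of_int n *\<^sub>R b)) - \<alpha> \<bullet> (of_int m *\<^sub>R a + of_int n *\<^sub>R b)))
       \<le> C * \<bar>real_of_int m\<bar> powr (1/2 - real s))"
proof -
  obtain C1 M0 where C1: "C1 \<ge> 0" "M0 \<ge> 1" "\<And>m lo N \<mu>. \<bar>real_of_int m\<bar> \<ge> M0 \<Longrightarrow> (\<And>i. i < N \<Longrightarrow> \<bar>lo + int i\<bar> \<le> \<bar>m\<bar>) \<Longrightarrow>
     norm (\<Sum>i<N. cis (k * norm (x + of_int m *\<^sub>R a + of_int (lo + int i) *\<^sub>R b) + (\<mu> + - (\<alpha> \<bullet> b) * of_int (lo + int i))))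
        \<le> C1 * sqrt \<bar>of_int m\<bar>"
    using lattice_line_sum[OF det k, of x "- (\<alpha> \<bullet> b)"] by blast
  have X: "X \<ge> 0" using bd[of 0] by linarith
  define E where "E = (real s * (1 + X) + L * r2) * norm b"
  have E: "E \<ge> 0" using X L r2 by (simp add: E_def)
  define C where "C = C1 * ((1 + X) / c ^ s + 3 * E / c ^ Suc s)"
  show ?thesis
  proof (rule exI[of _ C], rule exI[of _ "max M0 M1"], intro conjI allI impI)
    show "C \<ge> 0" using C1 X E c by (simp add: C_def)
    fix A :: real and m lo hi :: int
    assume A: "A > 0" and m: "max M0 M1 \<le> \<bar>real_of_int m\<bar>" and lo: "- \<bar>m\<bar> \<le> lo" and hi: "hi \<le> \<bar>m\<bar>"
    define mm where "mm = \<bar>real_of_int m\<bar>"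
    have mm: "mm \<ge> 1" using m C1(2) by (simp add: mm_def)
    define N where "N = nat (hi - lo + 1)"
    define \<rho> where "\<rho> i = norm (x + (of_int m *\<^sub>R a + of_int (lo + int i) *\<^sub>R b))" for i
    define am where "am i = (1 - chi (\<rho> i / A)) / \<rho> i ^ s" for i
    define ph where "ph i = cis (k * \<rho> i - \<alpha> \<bullet> (of_int m *\<^sub>R a + of_int (lo + int i) *\<^sub>R b))" for i
    have rng: "\<bar>lo + int i\<bar> \<le> \<bar>m\<bar>" if "i < N" for i using that lo hi unfolding N_def by linarith
    have low': "c * mm \<le> \<rho> i" if "i < N" for i
      unfolding \<rho>_def mm_def using m rng[OF that] by (intro low) auto
    have N: "real N \<le> 3 * mm"
    proof -
      have "real N \<le> 2 * mm + 1" unfolding N_def mm_def using lo hi by linarith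
      then show ?thesis using mm by linarith
    qed
    have cm: "c * mm > 0" using c mm by simp
    have "norm (\<Sum>i<N. of_real (am i) * ph i) \<le> (C1 * sqrt mm) * ((1 + X) / (c * mm) ^ s + real N * (E / (c * mm) ^ Suc s))"
    proof (rule abel_bound)
      fix M assume "M \<le> N"
      have ph_eq: "ph i = cis (k * norm (x + of_int m *\<^sub>R a + of_int (lo + int i) *\<^sub>R b) + (- (of_int m * (\<alpha> \<bullet> a)) + - (\<alpha> \<bullet> b) * of_int (lo + int i)))" for i
        unfolding ph_def \<rho>_def by (rule arg_cong[of _ _ cis]) (simp add: inner_simps algebra_simps)
      show "norm (\<Sum>i<M. ph i) \<le> C1 * sqrt mm"
        unfolding ph_eq mm_def using m \<open>M \<le> N\<close> by (intro C1(3) rng) auto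
    next
      fix i assume i: "i < N"
      show "\<bar>am i\<bar> \<le> (1 + X) / (c * mm) ^ s"
        unfolding am_def abs_divide using low'[OF i] cm bd[of "\<rho> i / A"] X
        by (intro frac_le) (auto intro!: power_mono simp: power_abs abs_le_iff)
    next
      fix i assume i: "Suc i < N"
      have "\<bar>am (Suc i) - am i\<bar> \<le> (real s * (1 + X) + L * r2) * \<bar>\<rho> (Suc i) - \<rho> i\<bar> / (c * mm) ^ Suc s"
        unfolding am_def using low'[of i] low'[of "Suc i"] i by (intro amplitude_diff[OF lip bd zero L cm A _ _ r2]) auto
      also have "\<dots> \<le> E / (c * mm) ^ Suc s"
      proof -
        have "\<bar>\<rho> (Suc i) - \<rho> i\<bar> \<le> norm ((x + (of_int m *\<^sub>R a + of_int (lo + int (Suc i)) *\<^sub>R b)) - (x + (of_int m *\<^sub>R a + of_int (lo + int i) *\<^sub>R b)))"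
          unfolding \<rho>_def by (rule norm_triangle_ineq3)
        also have "\<dots> = norm b" by (simp add: algebra_simps)
        finally show ?thesis unfolding E_def using X L r2 cm
          by (intro divide_right_mono mult_left_mono) auto
      qed
      finally show "\<bar>am (Suc i) - am i\<bar> \<le> E / (c * mm) ^ Suc s" .
    qed (use X cm E in auto)
    also have "\<dots> \<le> (C1 * sqrt mm) * ((1 + X) / (c * mm) ^ s + (3 * mm) * (E / (c * mm) ^ Suc s))"
      using N C1(1) mm cm E by (intro mult_left_mono add_left_mono mult_right_mono) auto
    also have "\<dots> = C * (sqrt mm / mm ^ s)"
      using mm c by (simp add: C_def power_mult_distrib field_simps)
    also have "sqrt mm / mm ^ s = mm powr (1/2 - real s)"
      using mm by (simp add: powr_diff powr_half_sqrt powr_realpow)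
    finally show "norm (\<Sum>n\<in>{lo..hi}. of_real ((1 - chi (norm (x + (of_int m *\<^sub>R a + of_int n *\<^sub>R b)) / A)) / norm (x + (of_int m *\<^sub>R a + of_int n *\<^sub>R b)) ^ s) *
         cis (k * norm (x + (of_int m *\<^sub>R a + of_int n *\<^sub>R b)) - \<alpha> \<bullet> (of_int m *\<^sub>R a + of_int n *\<^sub>R b)))
       \<le> C * \<bar>real_of_int m\<bar> powr (1/2 - real s)"
      unfolding sum_int_interval am_def ph_def \<rho>_def N_def mm_def .
  qed (use C1(2) in auto)
qed

context dual_lattice
begin

text \<open>The error is the series weighted with \<open>1 - \<chi>(\<rho>/A)\<close>, which lives outside a square of size comparable
  to \<open>A\<close>. Its leading part is summed along lines with square root cancellation; the remaining part
  decays by one more power and is summed absolutely.\<close>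

lemma G_smooth_trunc_rate:
  fixes chi :: "real \<Rightarrow> real"
  assumes d: "d > 0" and p: "p \<ge> 3" and r: "0 < r1" "r1 < r2"
    and sm: "smooth chi" and one: "\<And>r. r < r1 \<Longrightarrow> chi r = 1" and zero: "\<And>r. r > r2 \<Longrightarrow> chi r = 0"
    and k: "k \<noteq> 0"
  shows "\<exists>C. \<forall>\<^sub>F A in at_top. norm (G_smooth_trunc chi v1 v2 d p k \<alpha> A x - Gfun d p k \<alpha> x) \<le> C * A powr (1/2 - real ((p + 1) div 2))"
proof -
  obtain y z where x: "x = (y, z)" by (cases x)
  define sN where "sN = (p + 1) div 2"
  define s where "s = real sN"
  have s2: "s \<ge> 2" using p by (auto simp: s_def sN_def)
  have r2: "r2 > 0" using r by simp
  obtain L where L: "L \<ge> 0" "\<And>x y. \<bar>chi x - chi y\<bar> \<le> L * \<bar>x - y\<bar>"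
    using cutoff_lipschitz[OF sm one zero] by blast
  define Xb where "Xb = 1 + L * (r2 + 1)"
  have Xb: "\<bar>chi u\<bar> \<le> Xb" for u
  proof (cases "u < r1 \<or> u > r2")
    case True
    then show ?thesis using one[of u] zero[of u] L(1) r2 by (auto simp: Xb_def)
  next
    case False
    \<comment> \<open>A bound for the cut-off follows from its Lipschitz constant, starting at the zero \<open>r2 + 1\<close>.\<close>
    have "\<bar>chi u\<bar> = \<bar>chi u - chi (r2 + 1)\<bar>" using zero[of "r2 + 1"] by simp
    also have "\<dots> \<le> L * \<bar>u - (r2 + 1)\<bar>" by (rule L(2))
    also have "\<dots> \<le> L * (r2 + 1)" using False r L(1) by (intro mult_left_mono) auto
    finally show ?thesis by (simp add: Xb_def)
  qed
  have Xb0: "Xb \<ge> 0" using Xb[of 0] by linarith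
  have X1: "\<bar>1 - chi u\<bar> \<le> 1 + Xb" for u using Xb[of u] by linarith
  define \<rho> where "\<rho> u = norm (y + lat v1 v2 (fst u) (snd u))" for u
  obtain c C1 where C1: "C1 \<ge> 0" "\<And>\<rho>. \<rho> \<ge> 1 \<Longrightarrow> norm (fds p d (of_real k) \<rho> z - c * exp (\<i> * of_real k * of_real \<rho>) / of_real \<rho> ^ (sN + 1))
      \<le> C1 / \<rho> ^ (sN + 2)"
    using fds_asymp[OF d, of p "of_real k" z] p unfolding sN_def by auto
  define M1 where "M1 = W * (2 * norm y + 2)"
  have W2: "1 / (2 * W) > 0" using W_pos by simp
  have low1: "1 / (2 * W) * \<bar>real_of_int m\<bar> \<le> norm (y + (of_int m *\<^sub>R v1 + of_int n *\<^sub>R v2))"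
    if "M1 \<le> \<bar>real_of_int m\<bar>" "\<bar>n\<bar> \<le> \<bar>m\<bar>" for m n
  proof -
    have "maxn (m, n) = \<bar>real_of_int m\<bar>" using that by (auto simp: maxn_def)
    then show ?thesis using shifted_lat_ge(1)[OF order_refl, of y m n] that by (simp add: M1_def lat_def)
  qed
  have low2: "1 / (2 * W) * \<bar>real_of_int m\<bar> \<le> norm (y + (of_int m *\<^sub>R v2 + of_int n *\<^sub>R v1))"
    if "M1 \<le> \<bar>real_of_int m\<bar>" "\<bar>n\<bar> \<le> \<bar>m\<bar>" for m n
  proof -
    have "maxn (n, m) = \<bar>real_of_int m\<bar>" using that by (auto simp: maxn_def)
    then show ?thesis using shifted_lat_ge(1)[OF order_refl, of y n m] that by (simp add: M1_def lat_def add_ac)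
  qed
  have det': "det2 v2 v1 \<noteq> 0" using det2_nz by (auto simp: det2_def algebra_simps)
  \<comment> \<open>The leading part of the weighted term, with the constant \<open>c\<close> and the phase of \<open>fds_asymp\<close>.\<close>
  define h where "h A u = complex_of_real ((1 - chi (\<rho> u / A)) / \<rho> u ^ (sN + 1)) * cis (k * \<rho> u - \<alpha> \<bullet> lat v1 v2 (fst u) (snd u))" for A u
  obtain Ca Ma where Ca: "Ca \<ge> 0" "Ma \<ge> 1" "\<And>A m lo hi. A > 0 \<Longrightarrow> Ma \<le> \<bar>real_of_int m\<bar> \<Longrightarrow> - \<bar>m\<bar> \<le> lo \<Longrightarrow> hi \<le> \<bar>m\<bar> \<Longrightarrow>
      norm (\<Sum>n\<in>{lo..hi}. h A (m, n)) \<le> Ca * \<bar>real_of_int m\<bar> powr (1/2 - real (sN + 1))"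
    using cutoff_line_sum[OF L(2) Xb zero L(1) r2 k det2_nz W2 low1, where s = "sN + 1" and \<alpha> = \<alpha>]
    unfolding h_def \<rho>_def lat_def fst_conv snd_conv by blast
  obtain Cb Mb where Cb: "Cb \<ge> 0" "Mb \<ge> 1" "\<And>A m lo hi. A > 0 \<Longrightarrow> Mb \<le> \<bar>real_of_int m\<bar> \<Longrightarrow> - \<bar>m\<bar> \<le> lo \<Longrightarrow> hi \<le> \<bar>m\<bar> \<Longrightarrow>
      norm (\<Sum>n\<in>{lo..hi}. h A (n, m)) \<le> Cb * \<bar>real_of_int m\<bar> powr (1/2 - real (sN + 1))"
    using cutoff_line_sum[OF L(2) Xb zero L(1) r2 k det' W2 low2, where s = "sN + 1" and \<alpha> = \<alpha>]
    unfolding h_def \<rho>_def lat_def fst_conv snd_conv add.commute[of "of_int _ *\<^sub>R v2" "of_int _ *\<^sub>R v1"] by blast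
  define Mm where "Mm = max (max Ma Mb) M1"
  have Mm: "Mm \<ge> 1" "Mm \<ge> Ma" "Mm \<ge> Mb" "Mm \<ge> M1" using Ca(2) by (auto simp: Mm_def)
  define t where "t A u = (case u of (m, n) \<Rightarrow> lattice_term v1 v2 d p k \<alpha> m n x) * of_real (1 - chi (\<rho> u / A))" for A u
  have rho: "maxn u / (2 * W) \<le> \<rho> u" "1 \<le> \<rho> u" if "Mm \<le> maxn u" for u
    using shifted_lat_ge[OF order_refl, of y "fst u" "snd u"] that Mm by (auto simp: \<rho>_def M1_def)
  have hb: "norm (c * h A u) \<le> norm c * (1 + Xb) * (2 * W) ^ (sN + 1) * maxn u powr (- (s + 1))" if "Mm \<le> maxn u" for A u
  proof -
    have "norm (c * h A u) = norm c * (\<bar>1 - chi (\<rho> u / A)\<bar> * (1 / \<rho> u ^ (sN + 1)))"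
      using rho[OF that] by (simp add: h_def norm_mult norm_divide norm_power del: of_real_diff of_real_power)
    also have "\<dots> \<le> norm c * ((1 + Xb) * ((2 * W) ^ (sN + 1) * maxn u powr (- real (sN + 1))))"
      using rho[OF that] Mm that Xb0 by (intro mult_left_mono mult_mono X1 inverse_power_le) auto
    finally show ?thesis by (simp add: s_def mult_ac add.commute)
  qed
  define K2 where "K2 = C1 * (1 + Xb) * (2 * W) ^ (sN + 2)"
  have t2b: "norm (t A u - c * h A u) \<le> K2 * maxn u powr (- (s + 1 + 1))" if "Mm \<le> maxn u" for A u
  proof -
    obtain m n where u: "u = (m, n)" by (cases u)
    have "t A u - c * h A u = cis (- (\<alpha> \<bullet> lat v1 v2 m n)) * of_real (1 - chi (\<rho> u / A)) *
       (fds p d (of_real k) (\<rho> u) z - c * exp (\<i> * of_real k * of_real (\<rho> u)) / of_real (\<rho> u) ^ (sN + 1))"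
    proof -
      have "cis (k * \<rho> u - \<alpha> \<bullet> lat v1 v2 m n) = cis (- (\<alpha> \<bullet> lat v1 v2 m n)) * exp (\<i> * of_real k * of_real (\<rho> u))"
        by (simp add: cis_conv_exp exp_add[symmetric] algebra_simps)
      then show ?thesis
        unfolding t_def h_def x u by (simp add: lattice_term_eq \<rho>_def right_diff_distrib divide_inverse mult_ac)
    qed
    then have "norm (t A u - c * h A u) = \<bar>1 - chi (\<rho> u / A)\<bar> *
       norm (fds p d (of_real k) (\<rho> u) z - c * exp (\<i> * of_real k * of_real (\<rho> u)) / of_real (\<rho> u) ^ (sN + 1))"
      by (simp only: norm_mult norm_cis norm_of_real mult_1_left)
    also have "\<dots> \<le> (1 + Xb) * (C1 * (1 / \<rho> u ^ (sN + 2)))"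
      using C1(2)[OF rho(2)[OF that]] Xb0 by (intro mult_mono X1) auto
    also have "\<dots> \<le> (1 + Xb) * (C1 * ((2 * W) ^ (sN + 2) * maxn u powr (- real (sN + 2))))"
      using rho[OF that] Mm that Xb0 C1(1) by (intro mult_left_mono inverse_power_le) auto
    finally show ?thesis by (simp add: K2_def s_def mult_ac add.commute)
  qed
  have K2: "K2 \<ge> 0" using C1(1) Xb0 W_pos by (simp add: K2_def)
  define K1 where "K1 = norm c * max Ca Cb"
  have K1: "K1 \<ge> 0" using Ca(1) by (simp add: K1_def)
  define F where "F = 8 * K1 + 24 * K2"
  \<comment> \<open>If the coordinates are below \<open>A Q\<close> and \<open>\<parallel>y\<parallel> \<le> A r1 / 2\<close>, then \<open>\<rho> < A r1\<close> and the weight \<open>1 - \<chi>(\<rho>/A)\<close> vanishes.\<close>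
  define Q where "Q = r1 / (2 * V)"
  have Q: "Q > 0" using r V_pos by (simp add: Q_def)
  define A0 where "A0 = max (Mm / Q) (max 1 (2 * norm y / r1))"
  have lt_sum: "(\<lambda>u. norm (case u of (m, n) \<Rightarrow> lattice_term v1 v2 d p k \<alpha> m n x)) summable_on UNIV"
    by (rule lattice_term_summable[OF d p])
  have bsum: "(\<lambda>u. (case u of (m, n) \<Rightarrow> lattice_term v1 v2 d p k \<alpha> m n x) * of_real (g u)) summable_on UNIV"
    if g: "\<And>u. \<bar>g u\<bar> \<le> B" for g B
  proof (rule abs_summable_summable, rule summable_on_comparison_test[OF summable_on_cmult_right[OF lt_sum, of B]])
    fix u show "norm ((case u of (m, n) \<Rightarrow> lattice_term v1 v2 d p k \<alpha> m n x) * of_real (g u)) \<le> B * norm (case u of (m, n) \<Rightarrow> lattice_term v1 v2 d p k \<alpha> m n x)"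
      using g[of u] by (simp add: norm_mult mult.commute mult_right_mono)
  qed simp
  show ?thesis
  proof (rule exI[of _ "F * Q powr (1/2 - s)"], rule eventually_mono[OF eventually_ge_at_top[of A0]])
    fix A assume A: "A \<ge> A0"
    have A1: "A \<ge> 1" "A \<ge> Mm / Q" "A \<ge> 2 * norm y / r1" using A by (auto simp: A0_def)
    have LA: "A * Q \<ge> Mm" using A1(2) Q by (simp add: field_simps)
    have yr: "norm y \<le> A * r1 / 2" using A1(3) r by (simp add: field_simps)
    have t_sum: "t A summable_on UNIV" unfolding t_def[abs_def] by (rule bsum[of _ "1 + Xb"]) (rule X1)
    have t0: "t A u = 0" if "\<not> A * Q \<le> maxn u" for u
    proof -
      have "\<rho> u \<le> norm y + V * maxn u" unfolding \<rho>_def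
        using lat_le_maxn[of "fst u" "snd u"] by (intro order_trans[OF norm_triangle_ineq]) simp
      also have "V * maxn u < V * (A * Q)" using that V_pos by (intro mult_strict_left_mono) auto
      also have "V * (A * Q) = A * r1 / 2" using V_pos by (simp add: Q_def)
      finally have "\<rho> u < A * r1" using yr by simp
      then have "\<rho> u / A < r1" using A1(1) by (simp add: field_simps)
      then show ?thesis by (simp add: t_def one)
    qed
    let ?S = "{u. A * Q \<le> maxn u}"
    have "infsum t' UNIV = infsum t' ?S" if "\<And>u. u \<notin> ?S \<Longrightarrow> t' u = 0" for t' :: "int \<times> int \<Rightarrow> complex"
      by (rule infsum_cong_neutral) (use that in auto)
    from this[of "t A"] t0 have tS: "infsum (t A) UNIV = infsum (t A) ?S" by blast
    have AQ1: "A * Q \<ge> 1" using LA Mm by linarith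
    have t1_sum: "(\<lambda>u. c * h A u) summable_on ?S"
    proof (rule abs_summable_summable, rule lattice_abs_bound(1)[OF AQ1 s2])
      show "0 \<le> norm c * (1 + Xb) * (2 * W) ^ (sN + 1)" using Xb0 W_pos by simp
      show "norm (c * h A u) \<le> norm c * (1 + Xb) * (2 * W) ^ (sN + 1) * maxn u powr (- (s + 1))" if "A * Q \<le> maxn u" for u
        using that LA by (intro hb) linarith
    qed
    have n1: "norm (infsum (\<lambda>u. c * h A u) ?S) \<le> 8 * K1 * (A * Q) powr (1 - (s + 1/2))"
    proof (rule lattice_line_bound[OF AQ1 _ K1 t1_sum])
      show "2 \<le> s + 1 / 2" using s2 by simp
      have e: "1 / 2 - real (sN + 1) = - (s + 1 / 2)" by (simp add: s_def)
      fix m assume m: "A * Q \<le> \<bar>real_of_int m\<bar>"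
      have "norm (\<Sum>n\<in>{- \<bar>m\<bar>..\<bar>m\<bar>}. c * h A (m, n)) = norm c * norm (\<Sum>n\<in>{- \<bar>m\<bar>..\<bar>m\<bar>}. h A (m, n))"
        by (simp add: sum_distrib_left[symmetric] norm_mult)
      also have "\<dots> \<le> norm c * (Ca * \<bar>real_of_int m\<bar> powr (1/2 - real (sN + 1)))"
        using A1 m LA Mm by (intro mult_left_mono Ca(3)) auto
      also have "\<dots> \<le> norm c * (max Ca Cb * \<bar>real_of_int m\<bar> powr (1/2 - real (sN + 1)))"
        by (intro mult_left_mono mult_right_mono) auto
      finally show "norm (\<Sum>n\<in>{- \<bar>m\<bar>..\<bar>m\<bar>}. c * h A (m, n)) \<le> K1 * \<bar>real_of_int m\<bar> powr - (s + 1 / 2)"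
        unfolding e K1_def by (simp only: mult.assoc)
      have "norm (\<Sum>n\<in>{- (\<bar>m\<bar> - 1)..\<bar>m\<bar> - 1}. c * h A (n, m)) = norm c * norm (\<Sum>n\<in>{- (\<bar>m\<bar> - 1)..\<bar>m\<bar> - 1}. h A (n, m))"
        by (simp add: sum_distrib_left[symmetric] norm_mult)
      also have "\<dots> \<le> norm c * (Cb * \<bar>real_of_int m\<bar> powr (1/2 - real (sN + 1)))"
        using A1 m LA Mm by (intro mult_left_mono Cb(3)) auto
      also have "\<dots> \<le> norm c * (max Ca Cb * \<bar>real_of_int m\<bar> powr (1/2 - real (sN + 1)))"
        by (intro mult_left_mono mult_right_mono) auto
      finally show "norm (\<Sum>n\<in>{- (\<bar>m\<bar> - 1)..\<bar>m\<bar> - 1}. c * h A (n, m)) \<le> K1 * \<bar>real_of_int m\<bar> powr - (s + 1 / 2)"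
        unfolding e K1_def by (simp only: mult.assoc)
    qed
    have n2: "norm (infsum (\<lambda>u. t A u - c * h A u) ?S) \<le> 24 * K2 * (A * Q) powr (1 - (s + 1))"
    proof (rule lattice_tail_le[OF AQ1 _ K2])
      show "norm (t A u - c * h A u) \<le> K2 * maxn u powr (- (s + 1 + 1))" if "A * Q \<le> maxn u" for u
        using that LA by (intro t2b) linarith
    qed (use s2 in auto)
    have t2_sum: "(\<lambda>u. t A u - c * h A u) summable_on ?S"
    proof (rule abs_summable_summable, rule lattice_abs_bound(1)[OF AQ1 _ K2, of "s + 1"])
      show "norm (t A u - c * h A u) \<le> K2 * maxn u powr (- (s + 1 + 1))" if "A * Q \<le> maxn u" for u
        using that LA by (intro t2b) linarith
    qed (use s2 in auto)
    have "infsum (t A) ?S = infsum (\<lambda>u. c * h A u) ?S + infsum (\<lambda>u. t A u - c * h A u) ?S"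
      by (subst infsum_add[symmetric]) (auto intro!: t1_sum t2_sum)
    then have "norm (infsum (t A) UNIV) \<le> 8 * K1 * (A * Q) powr (1 - (s + 1/2)) + 24 * K2 * (A * Q) powr (1 - (s + 1))"
      by (simp only: tS) (rule order_trans[OF norm_triangle_ineq add_mono[OF n1 n2]])
    also have "\<dots> \<le> 8 * K1 * (A * Q) powr (1/2 - s) + 24 * K2 * (A * Q) powr (1/2 - s)"
      using AQ1 K1 K2 by (intro add_mono mult_left_mono powr_mono) auto
    also have "\<dots> = F * Q powr (1/2 - s) * A powr (1/2 - s)"
      using A1 Q by (simp add: F_def powr_mult algebra_simps)
    finally have main: "norm (infsum (t A) UNIV) \<le> F * Q powr (1/2 - s) * A powr (1/2 - s)" .
    let ?lt = "\<lambda>u. (case u of (m, n) \<Rightarrow> lattice_term v1 v2 d p k \<alpha> m n x)"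
    have "infsum ?lt UNIV = infsum (\<lambda>u. ?lt u * of_real (chi (\<rho> u / A)) + t A u) UNIV"
      by (rule infsum_cong) (simp add: t_def algebra_simps)
    also have "\<dots> = infsum (\<lambda>u. ?lt u * of_real (chi (\<rho> u / A))) UNIV + infsum (t A) UNIV"
      by (rule infsum_add[OF bsum[OF Xb] t_sum])
    also have "infsum (\<lambda>u. ?lt u * of_real (chi (\<rho> u / A))) UNIV
        = (\<Sum>\<^sub>\<infinity>(m, n)\<in>UNIV. lattice_term v1 v2 d p k \<alpha> m n x * of_real (chi (rdist_h v1 v2 m n x / A)))"
      by (rule infsum_cong) (auto simp: x rdist_h_def \<rho>_def)
    finally have "G_smooth_trunc chi v1 v2 d p k \<alpha> A x - Gfun d p k \<alpha> x = - (1 / (4 * of_real pi) * infsum (t A) UNIV)"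
      by (simp add: G_smooth_trunc_def Gfun_def algebra_simps)
    then have "norm (G_smooth_trunc chi v1 v2 d p k \<alpha> A x - Gfun d p k \<alpha> x) = 1 / (4 * pi) * norm (infsum (t A) UNIV)"
      by (simp add: norm_mult norm_divide)
    also have "\<dots> \<le> 1 * norm (infsum (t A) UNIV)"
      using pi_gt3 by (intro mult_right_mono) (auto simp: field_simps)
    finally show "norm (G_smooth_trunc chi v1 v2 d p k \<alpha> A x - Gfun d p k \<alpha> x) \<le> F * Q powr (1/2 - s) * A powr (1/2 - real ((p + 1) div 2))"
      using main by (simp add: s_def sN_def)
  qed
qed

text \<open>A lattice translation of the argument shifts the summation index and multiplies the Bloch phases by
  a constant.\<close>

lemma Gfun_quasi_periodic:
  "Gfun d p k \<alpha> (x + (lat v1 v2 m n, 0)) = Gfun d p k \<alpha> x * cis (\<alpha> \<bullet> lat v1 v2 m n)"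
proof -
  obtain y z where x: "x = (y, z)" by (cases x)
  have add: "lat v1 v2 (m + i) (n + j) = lat v1 v2 m n + lat v1 v2 i j" for i j
    by (simp add: lat_def algebra_simps)
  have step: "lattice_term v1 v2 d p k \<alpha> i j (x + (lat v1 v2 m n, 0))
      = cis (\<alpha> \<bullet> lat v1 v2 m n) * lattice_term v1 v2 d p k \<alpha> (m + i) (n + j) x" for i j
    by (simp add: x lattice_term_eq add inner_simps cis_mult mult.assoc[symmetric] add.assoc)
  have bij: "bij_betw (\<lambda>(i, j). (m + i, n + j)) UNIV UNIV"
    by (rule bij_betw_byWitness[of _ "\<lambda>(i, j). (i - m, j - n)"]) auto
  have "(\<Sum>\<^sub>\<infinity>(i, j)\<in>UNIV. lattice_term v1 v2 d p k \<alpha> i j (x + (lat v1 v2 m n, 0)))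
     = (\<Sum>\<^sub>\<infinity>u\<in>UNIV. cis (\<alpha> \<bullet> lat v1 v2 m n) * (case u of (i, j) \<Rightarrow> lattice_term v1 v2 d p k \<alpha> (m + i) (n + j) x))"
    by (rule infsum_cong) (auto simp: step)
  also have "\<dots> = cis (\<alpha> \<bullet> lat v1 v2 m n) * (\<Sum>\<^sub>\<infinity>u\<in>UNIV. (case u of (i, j) \<Rightarrow> lattice_term v1 v2 d p k \<alpha> (m + i) (n + j) x))"
    by (rule infsum_cmult_right') 
  also have "(\<Sum>\<^sub>\<infinity>u\<in>UNIV. (case u of (i, j) \<Rightarrow> lattice_term v1 v2 d p k \<alpha> (m + i) (n + j) x))
      = (\<Sum>\<^sub>\<infinity>(i, j)\<in>UNIV. lattice_term v1 v2 d p k \<alpha> i j x)"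
    using infsum_reindex_bij_betw[OF bij, of "\<lambda>(i, j). lattice_term v1 v2 d p k \<alpha> i j x"] by (simp add: case_prod_unfold)
  finally show ?thesis by (simp add: Gfun_def)
qed

end

section \<open>Radial integrals and the fundamental solution\<close>

lemma lborel_integral_shift:
  fixes f :: "'a::euclidean_space \<Rightarrow> 'b::{banach, second_countable_topology}"
  assumes [measurable]: "f \<in> borel_measurable borel"
  shows "(LINT x|lborel. f (c + x)) = (LINT x|lborel. f x)"
  by (subst lborel_distr_plus[of c, symmetric]) (subst integral_distr; simp)

lemma lborel_integrable_shift:
  fixes f :: "'a::euclidean_space \<Rightarrow> 'b::{banach, second_countable_topology}"
  assumes "integrable lborel f"
  shows "integrable lborel (\<lambda>x. f (c + x))"
proof -
  have [measurable]: "f \<in> borel_measurable borel" using assms by auto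
  have "integrable (distr lborel borel ((+) c)) f" using assms by (simp add: lborel_distr_plus)
  then show ?thesis by (subst (asm) integrable_distr_eq) auto
qed

text \<open>Integration by parts without Fubini: the integral of a difference quotient vanishes by translation
  invariance, and the quotients converge boundedly on a fixed ball.\<close>

lemma integral_directional_derivative:
  fixes w w' :: "'a::euclidean_space \<Rightarrow> complex" and b :: 'a
  assumes der: "\<And>x. ((\<lambda>t. w (x + t *\<^sub>R b)) has_vector_derivative w' x) (at 0)"
    and cw: "continuous_on UNIV w" and cw': "continuous_on UNIV w'"
    and supp: "\<And>x. norm x > R \<Longrightarrow> w x = 0"
  shows "(LINT x|lborel. w' x) = 0"
proof -
  have w'0: "w' x = 0" if x: "norm x > R" for x
  proof -
    have "((\<lambda>t. 0) has_vector_derivative w' x) (at 0)"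
    proof (rule has_vector_derivative_transform_within_open[OF der[of x], of "{t. norm (x + t *\<^sub>R b) > R}"])
      show "open {t. norm (x + t *\<^sub>R b) > R}" by (intro open_Collect_less continuous_intros)
    qed (use x supp in auto)
    then show ?thesis using has_vector_derivative_const vector_derivative_unique_at by blast
  qed
  have "compact (w' ` cball 0 R)" by (intro compact_continuous_image continuous_on_subset[OF cw']) auto
  then obtain B0 where B0: "\<And>x. x \<in> cball 0 R \<Longrightarrow> norm (w' x) \<le> B0"
    using compact_imp_bounded bounded_iff by (metis image_eqI)
  define B where "B = max B0 0"
  have B: "norm (w' x) \<le> B" for x
    using B0[of x] w'0[of x] by (cases "norm x > R") (auto simp: B_def)
  have der_t: "((\<lambda>t. w (x + t *\<^sub>R b)) has_vector_derivative w' (x + t *\<^sub>R b)) (at t)" for x t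
  proof -
    have "((\<lambda>s. s - t) has_vector_derivative 1) (at t)"
      by (auto intro!: derivative_eq_intros)
    moreover have "((\<lambda>s. w (x + t *\<^sub>R b + s *\<^sub>R b)) has_vector_derivative w' (x + t *\<^sub>R b)) (at (t - t))"
      using der[of "x + t *\<^sub>R b"] by simp
    ultimately have "((\<lambda>s. w (x + t *\<^sub>R b + s *\<^sub>R b)) \<circ> (\<lambda>s. s - t) has_vector_derivative 1 *\<^sub>R w' (x + t *\<^sub>R b)) (at t)"
      by (rule vector_diff_chain_at)
    then show ?thesis by (simp add: comp_def algebra_simps)
  qed
  have lip: "norm (w (x + h *\<^sub>R b) - w x) \<le> B * h" if "h \<ge> 0" for x h
  proof -
    have "norm (w (x + h *\<^sub>R b) - w (x + 0 *\<^sub>R b)) \<le> B * norm (h - 0)"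
    proof (rule differentiable_bound[of UNIV "\<lambda>t. w (x + t *\<^sub>R b)" "\<lambda>t s. s *\<^sub>R w' (x + t *\<^sub>R b)"])
      show "onorm (\<lambda>s. s *\<^sub>R w' (x + t *\<^sub>R b)) \<le> B" for t
        using B[of "x + t *\<^sub>R b"] by (intro onorm_le) (auto simp: mult.commute[of B] intro!: mult_left_mono)
    qed (use der_t in \<open>auto simp: has_vector_derivative_def\<close>)
    then show ?thesis using that by simp
  qed
  define q where "q n x = of_nat (Suc n) * (w (x + inverse (real (Suc n)) *\<^sub>R b) - w x)" for n x
  have mw[measurable]: "w \<in> borel_measurable borel" using cw by (rule borel_measurable_continuous_onI)
  have mw'[measurable]: "w' \<in> borel_measurable borel" using cw' by (rule borel_measurable_continuous_onI)
  have iw: "integrable lborel w"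
  proof -
    have "integrable lborel (\<lambda>x. indicator (cball 0 R) x *\<^sub>R w x)"
      by (rule borel_integrable_compact) (auto intro: continuous_on_subset[OF cw])
    moreover have "(\<lambda>x. indicator (cball 0 R) x *\<^sub>R w x) = w"
      using supp by (auto simp: fun_eq_iff indicator_def)
    ultimately show ?thesis by simp
  qed
  have iws: "integrable lborel (\<lambda>x. w (x + c))" for c
    using lborel_integrable_shift[OF iw, of c] by (simp add: add.commute)
  have int_q: "(LINT x|lborel. q n x) = 0" for n
  proof -
    have "(LINT x|lborel. w (x + c)) = (LINT x|lborel. w x)" for c
      using lborel_integral_shift[OF mw, of c] by (simp add: add.commute)
    then show ?thesis unfolding q_def using iw iws by simp
  qed
  have qb: "norm (q n x) \<le> B * indicator (cball 0 (R + norm b)) x" for n x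
  proof (cases "x \<in> cball 0 (R + norm b)")
    case True
    have "norm (q n x) \<le> real (Suc n) * (B * inverse (real (Suc n)))"
      unfolding q_def norm_mult norm_of_nat by (intro mult_left_mono lip) auto
    also have "\<dots> = B" by (simp del: of_nat_Suc)
    finally have "norm (q n x) \<le> B" .
    then show ?thesis using True by simp
  next
    case False
    have "norm (inverse (real (Suc n)) *\<^sub>R b) \<le> norm b"
      using mult_right_mono[of "inverse (real (Suc n))" 1 "norm b"] by (simp add: inverse_le_1_iff)
    then have "norm (x + inverse (real (Suc n)) *\<^sub>R b) > R"
      using False norm_diff_ineq[of x "inverse (real (Suc n)) *\<^sub>R b"] by auto
    moreover have "norm x > R"
    proof -
      have "R + norm b < norm x" using False by simp
      then show ?thesis using norm_ge_zero[of b] by linarith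
    qed
    ultimately show ?thesis using False supp by (simp add: q_def)
  qed
  have lim: "(\<lambda>n. q n x) \<longlonglongrightarrow> w' x" for x
  proof -
    have "((\<lambda>h. norm (w (x + h *\<^sub>R b) - w x - h *\<^sub>R w' x) / norm h) \<longlongrightarrow> 0) (at 0)"
      using der[of x] unfolding has_vector_derivative_def has_derivative_at by simp
    moreover have "filterlim (\<lambda>n. inverse (real (Suc n))) (at 0) sequentially"
      using LIMSEQ_inverse_real_of_nat by (auto simp: filterlim_at)
    ultimately have "(\<lambda>n. norm (w (x + inverse (real (Suc n)) *\<^sub>R b) - w x - inverse (real (Suc n)) *\<^sub>R w' x) / norm (inverse (real (Suc n)))) \<longlonglongrightarrow> 0"
      by (rule filterlim_compose)
    moreover have "norm (w (x + inverse (real (Suc n)) *\<^sub>R b) - w x - inverse (real (Suc n)) *\<^sub>R w' x) / norm (inverse (real (Suc n)))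
        = norm (q n x - w' x)" for n
    proof -
      have "q n x - w' x = of_nat (Suc n) * (w (x + inverse (real (Suc n)) *\<^sub>R b) - w x - inverse (real (Suc n)) *\<^sub>R w' x)"
        unfolding q_def scaleR_conv_of_real right_diff_distrib
        by (simp del: of_nat_Suc add: mult.assoc[symmetric])
      then show ?thesis by (simp add: norm_mult divide_inverse mult.commute del: of_nat_Suc)
    qed
    ultimately show ?thesis by (simp add: tendsto_norm_zero_iff LIM_zero_iff)
  qed
  have "(\<lambda>n. LINT x|lborel. q n x) \<longlonglongrightarrow> (LINT x|lborel. w' x)"
  proof (rule integral_dominated_convergence[where w = "\<lambda>x. B * indicator (cball 0 (R + norm b)) x"])
    show "integrable lborel (\<lambda>x. B * indicator (cball (0::'a) (R + norm b)) x)"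
      using emeasure_lborel_cball_finite[of "0::'a" "R + norm b"] by (intro integrable_mult_right integrable_real_indicator) auto
    show "q n \<in> borel_measurable lborel" for n unfolding q_def by measurable
  qed (use lim qb in auto)
  then show ?thesis by (simp add: int_q LIMSEQ_const_iff)
qed

text \<open>Integration of radial functions in polar coordinates, read off from the volume \<open>4/3 \<pi> r\<^sup>3\<close> of balls.\<close>

lemma distr_norm_3:
  assumes "DIM('a::euclidean_space) = 3"
  shows "distr lborel borel (norm :: 'a \<Rightarrow> real) = density lborel (\<lambda>r. ennreal (4 * pi * r\<^sup>2 * indicator {0..} r))"
proof (rule measure_eqI_generator_eq[where E = "range (\<lambda>a::real. {..a})" and \<Omega> = UNIV and A = "\<lambda>i. {..real i}"])
  show "Int_stable (range (\<lambda>a::real. {..a}))"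
    by (auto simp: Int_stable_def)
  show "sets (distr lborel borel (norm :: 'a \<Rightarrow> real)) = sigma_sets UNIV (range (\<lambda>a::real. {..a}))"
    unfolding sets_distr borel_eq_atMost by simp
  show "sets (density lborel (\<lambda>r. ennreal (4 * pi * r\<^sup>2 * indicator {0..} r))) = sigma_sets UNIV (range (\<lambda>a::real. {..a}))"
    unfolding sets_density sets_lborel borel_eq_atMost by simp
  show "(\<Union>i. {..real i}) = UNIV" by (auto intro: real_arch_simple)
  have eq: "emeasure (distr lborel borel (norm :: 'a \<Rightarrow> real)) {..a} = emeasure (density lborel (\<lambda>r. ennreal (4 * pi * r\<^sup>2 * indicator {0..} r))) {..a}"
    and fin: "emeasure (distr lborel borel (norm :: 'a \<Rightarrow> real)) {..a} < \<infinity>" for a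
  proof -
    have 1: "emeasure (distr lborel borel (norm :: 'a \<Rightarrow> real)) {..a} = emeasure lborel (cball (0::'a) a)"
      by (subst emeasure_distr) (auto simp: cball_def dist_norm vimage_def)
    show "emeasure (distr lborel borel (norm :: 'a \<Rightarrow> real)) {..a} < \<infinity>"
      unfolding 1 by (rule emeasure_lborel_cball_finite)
    have 2: "emeasure (density lborel (\<lambda>r. ennreal (4 * pi * r\<^sup>2 * indicator {0..} r))) {..a}
        = (\<integral>\<^sup>+r\<in>{0..a}. ennreal (4 * pi * r\<^sup>2) \<partial>lborel)"
      by (subst emeasure_density) (auto intro!: nn_integral_cong simp: indicator_def)
    show "emeasure (distr lborel borel (norm :: 'a \<Rightarrow> real)) {..a} = emeasure (density lborel (\<lambda>r. ennreal (4 * pi * r\<^sup>2 * indicator {0..} r))) {..a}"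
    proof (cases "a \<ge> 0")
      case True
      have "(\<integral>\<^sup>+r\<in>{0..a}. ennreal (4 * pi * r\<^sup>2) \<partial>lborel) = ennreal (4 / 3 * pi * a ^ 3 - 4 / 3 * pi * 0 ^ 3)"
        by (rule nn_integral_FTC_Icc[where F = "\<lambda>r. 4 / 3 * pi * r ^ 3"]) (use True in \<open>auto intro!: derivative_eq_intros\<close>)
      then show ?thesis unfolding 1 2 using True assms unit_ball_vol_3 by (simp add: emeasure_cball)
    next
      case False
      then show ?thesis unfolding 1 2 by simp
    qed
  qed
  show "emeasure (distr lborel borel (norm :: 'a \<Rightarrow> real)) X = emeasure (density lborel (\<lambda>r. ennreal (4 * pi * r\<^sup>2 * indicator {0..} r))) X"
    if "X \<in> range (\<lambda>a::real. {..a})" for X using that eq by auto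
  show "emeasure (distr lborel borel (norm :: 'a \<Rightarrow> real)) {..real i} \<noteq> \<infinity>" for i using fin[of "real i"] by simp
qed auto

lemma nn_integral_norm_3:
  assumes "DIM('a::euclidean_space) = 3" and [measurable]: "f \<in> borel_measurable borel"
  shows "(\<integral>\<^sup>+x. ennreal (f (norm (x::'a))) \<partial>lborel) = (\<integral>\<^sup>+r\<in>{0..}. ennreal (4 * pi * r\<^sup>2 * f r) \<partial>lborel)"
proof -
  have "(\<integral>\<^sup>+x. ennreal (f (norm (x::'a))) \<partial>lborel) = (\<integral>\<^sup>+r. ennreal (f r) \<partial>distr lborel borel (norm :: 'a \<Rightarrow> real))"
    by (subst nn_integral_distr) auto
  also have "\<dots> = (\<integral>\<^sup>+r\<in>{0..}. ennreal (4 * pi * r\<^sup>2 * f r) \<partial>lborel)"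
    unfolding distr_norm_3[OF assms(1)]
    by (subst nn_integral_density) (auto intro!: nn_integral_cong simp: indicator_def ennreal_mult')
  finally show ?thesis .
qed

lemma integrable_inverse_norm_power:
  fixes c :: "'a::euclidean_space"
  assumes "DIM('a) = 3" "j \<le> 2"
  shows "integrable lborel (\<lambda>x::'a. indicator (cball c R) x / norm (x - c) ^ j)"
proof -
  have i0: "integrable lborel (\<lambda>x::'a. indicator {..R} (norm x) / norm x ^ j)"
  proof (rule integrableI_nonneg)
    have "(\<integral>\<^sup>+x. ennreal (indicator {..R} (norm (x::'a)) / norm x ^ j) \<partial>lborel)
       = (\<integral>\<^sup>+r\<in>{0..}. ennreal (4 * pi * r\<^sup>2 * (indicator {..R} r / r ^ j)) \<partial>lborel)"
      by (rule nn_integral_norm_3[OF assms(1)]) measurable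
    also have "\<dots> \<le> (\<integral>\<^sup>+r\<in>{0..R}. ennreal (4 * pi * R ^ (2 - j)) \<partial>lborel)"
    proof (rule nn_integral_mono)
      fix r :: real
      have "r\<^sup>2 / r ^ j \<le> R ^ (2 - j)" if "0 \<le> r" "r \<le> R"
      proof (cases "r = 0")
        case False
        then have "r\<^sup>2 / r ^ j = r ^ (2 - j)" using assms(2) by (simp add: power_diff)
        then show ?thesis using that by (simp add: power_mono)
      qed (use that in simp)
      then show "ennreal (4 * pi * r\<^sup>2 * (indicator {..R} r / r ^ j)) * indicator {0..} r \<le> ennreal (4 * pi * R ^ (2 - j)) * indicator {0..R} r"
        using mult_left_mono[of "r\<^sup>2 / r ^ j" "R ^ (2 - j)" "4 * pi"] by (auto simp: indicator_def mult.assoc intro!: ennreal_leI)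
    qed
    also have "\<dots> < \<infinity>" by (simp add: nn_integral_cmult_indicator ennreal_mult_less_top emeasure_lborel_Icc_eq)
    finally show "(\<integral>\<^sup>+x. ennreal (indicator {..R} (norm (x::'a)) / norm x ^ j) \<partial>lborel) < \<infinity>" .
  qed auto
  have "integrable lborel (\<lambda>x::'a. indicator {..R} (norm (- c + x)) / norm (- c + x) ^ j)"
    using lborel_integrable_shift[OF i0, of "- c"] .
  then show ?thesis by (simp add: indicator_def dist_norm norm_minus_commute)
qed

text \<open>This kernel is the Laplacian of \<open>- 1 / sqrt (1 + \<parallel>x\<parallel>\<^sup>2)\<close>. After the rescaling by \<open>\<epsilon>\<close> it is the
  approximate identity that produces the point mass. The radial integral has the antiderivative
  \<open>(r / sqrt (1 + r\<^sup>2))\<^sup>3\<close>.\<close>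

lemma integral_kernel_3:
  assumes "DIM('a::euclidean_space) = 3"
  shows "integrable lborel (\<lambda>x::'a. 3 / sqrt (1 + (norm x)\<^sup>2) ^ 5)"
    and "(LINT x|lborel. 3 / sqrt (1 + (norm (x::'a))\<^sup>2) ^ 5) = 4 * pi"
proof -
  have nn: "(\<integral>\<^sup>+x. ennreal (3 / sqrt (1 + (norm (x::'a))\<^sup>2) ^ 5) \<partial>lborel) = ennreal (4 * pi)"
  proof -
    have "(\<integral>\<^sup>+x. ennreal (3 / sqrt (1 + (norm (x::'a))\<^sup>2) ^ 5) \<partial>lborel)
      = (\<integral>\<^sup>+r\<in>{0..}. ennreal (4 * pi * r\<^sup>2 * (3 / sqrt (1 + r\<^sup>2) ^ 5)) \<partial>lborel)"
      by (rule nn_integral_norm_3[OF assms]) measurable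
    also have "\<dots> = ennreal (4 * pi - 4 * pi * (0 / sqrt (1 + 0\<^sup>2)) ^ 3)"
    proof (rule nn_integral_FTC_atLeast)
      fix r :: real assume "0 \<le> r"
      have s: "sqrt (1 + r\<^sup>2) > 0" "(sqrt (1 + r\<^sup>2))\<^sup>2 = 1 + r\<^sup>2" by (auto simp: add_pos_nonneg)
      show "((\<lambda>r. 4 * pi * (r / sqrt (1 + r\<^sup>2)) ^ 3) has_real_derivative 4 * pi * r\<^sup>2 * (3 / sqrt (1 + r\<^sup>2) ^ 5)) (at r)"
      proof -
        have ds: "((\<lambda>r. sqrt (1 + r\<^sup>2)) has_real_derivative r / sqrt (1 + r\<^sup>2)) (at r)"
        proof -
          have p: "1 + r\<^sup>2 > 0" by (simp add: add_pos_nonneg)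
          show ?thesis using p by (auto intro!: derivative_eq_intros simp: field_simps)
        qed
        have "((\<lambda>r. r / sqrt (1 + r\<^sup>2)) has_real_derivative 1 / sqrt (1 + r\<^sup>2) ^ 3) (at r)"
        proof -
          have d0: "((\<lambda>r. r / sqrt (1 + r\<^sup>2)) has_real_derivative (1 * sqrt (1 + r\<^sup>2) - r * (r / sqrt (1 + r\<^sup>2))) / (sqrt (1 + r\<^sup>2) * sqrt (1 + r\<^sup>2))) (at r)"
            using s by (intro DERIV_divide DERIV_ident ds) auto
          have alg: "(1 * S - r * (r / S)) / (S * S) = 1 / S ^ 3" if "S > 0" "S\<^sup>2 = 1 + r\<^sup>2" for S :: real
          proof -
            have "1 * S - r * (r / S) = (S\<^sup>2 - r\<^sup>2) / S"
              using that(1) by (simp add: diff_divide_distrib power2_eq_square)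
            also have "\<dots> = 1 / S" unfolding that(2) by simp
            finally show ?thesis by (simp add: power3_eq_cube mult.assoc)
          qed
          show ?thesis using d0 unfolding alg[OF s] .
        qed
        from DERIV_cmult[OF DERIV_power[OF this, of 3], of "4 * pi"]
        show ?thesis
          by (rule DERIV_cong) (use s(1) in \<open>simp add: field_simps eval_nat_numeral\<close>)
      qed
      show "0 \<le> 4 * pi * r\<^sup>2 * (3 / sqrt (1 + r\<^sup>2) ^ 5)" by simp
    next
      have "((\<lambda>r::real. 4 * pi * (r / sqrt (1 + r\<^sup>2)) ^ 3) \<longlongrightarrow> 4 * pi * 1 ^ 3) at_top"
      proof (intro tendsto_mult tendsto_const tendsto_power)
        show "((\<lambda>r::real. r / sqrt (1 + r\<^sup>2)) \<longlongrightarrow> 1) at_top" by real_asymp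
      qed
      then show "((\<lambda>r::real. 4 * pi * (r / sqrt (1 + r\<^sup>2)) ^ 3) \<longlongrightarrow> 4 * pi) at_top" by simp
    qed measurable
    finally show ?thesis by simp
  qed
  have "has_bochner_integral lborel (\<lambda>x::'a. 3 / sqrt (1 + (norm x)\<^sup>2) ^ 5) (4 * pi)"
    by (rule has_bochner_integral_nn_integral[OF _ _ _ nn]) auto
  then show "integrable lborel (\<lambda>x::'a. 3 / sqrt (1 + (norm x)\<^sup>2) ^ 5)"
    "(LINT x|lborel. 3 / sqrt (1 + (norm (x::'a))\<^sup>2) ^ 5) = 4 * pi"
    by (auto simp: has_bochner_integral_iff)
qed

text \<open>Directional derivatives as vector derivatives at 0 are the form that
  \<open>integral_directional_derivative\<close> accepts.\<close>

lemma dirderiv_of_differentiable: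
  fixes f :: "'a::real_normed_vector \<Rightarrow> 'b::real_normed_vector"
  assumes "f differentiable (at x)"
  shows "((\<lambda>t. f (x + t *\<^sub>R b)) has_vector_derivative frechet_derivative f (at x) b) (at 0)"
proof -
  have D: "(f has_derivative frechet_derivative f (at x)) (at (x + 0 *\<^sub>R b))"
    using assms frechet_derivative_works by auto
  have "((\<lambda>t. x + t *\<^sub>R b) has_derivative (\<lambda>t. t *\<^sub>R b)) (at 0)"
    by (auto intro!: derivative_eq_intros)
  from has_derivative_compose[OF this D]
  have "((\<lambda>t. f (x + t *\<^sub>R b)) has_derivative (\<lambda>t. frechet_derivative f (at x) (t *\<^sub>R b))) (at 0)" by simp
  moreover have "frechet_derivative f (at x) (t *\<^sub>R b) = t *\<^sub>R frechet_derivative f (at x) b" for t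
    using linear_cmul[OF linear_frechet_derivative[OF assms]] .
  ultimately show ?thesis by (simp add: has_vector_derivative_def)
qed

abbreviation dird :: "('a::euclidean_space \<Rightarrow> complex) \<Rightarrow> 'a \<Rightarrow> 'a \<Rightarrow> complex" where
  "dird f b \<equiv> (\<lambda>x. frechet_derivative f (at x) b)"

lemma frechet_derivative_eq_0_outside:
  fixes f :: "'a::euclidean_space \<Rightarrow> complex"
  assumes "\<And>x. norm x > R \<Longrightarrow> f x = 0" "norm x > R"
  shows "frechet_derivative f (at x) b = 0"
proof -
  have "(f has_derivative (\<lambda>_. 0)) (at x)"
  proof (rule has_derivative_transform_within_open[of "\<lambda>_. 0"])
    show "open {x::'a. norm x > R}" by (intro open_Collect_less continuous_intros)
  qed (use assms in auto)
  then have "(\<lambda>_. 0) = frechet_derivative f (at x)" by (rule frechet_derivative_at)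
  then show ?thesis by metis
qed

lemma test_function_facts:
  fixes \<phi> :: "'a::euclidean_space \<Rightarrow> complex"
  assumes "test_function \<phi>"
  obtains R where "\<And>x. norm x > R \<Longrightarrow> \<phi> x = 0" "\<And>x b. norm x > R \<Longrightarrow> dird \<phi> b x = 0"
    "\<And>x. norm x > R \<Longrightarrow> laplacian \<phi> x = 0" 
    "continuous_on UNIV \<phi>" "\<And>b. continuous_on UNIV (dird \<phi> b)" "\<And>b. continuous_on UNIV (dird (dird \<phi> b) b)"
    "continuous_on UNIV (laplacian \<phi>)"
    "\<And>x b. ((\<lambda>t. \<phi> (x + t *\<^sub>R b)) has_vector_derivative dird \<phi> b x) (at 0)"
    "\<And>x b. ((\<lambda>t. dird \<phi> b (x + t *\<^sub>R b)) has_vector_derivative dird (dird \<phi> b) b x) (at 0)"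
proof -
  have "bounded (closure {x. \<phi> x \<noteq> 0})" using assms compact_imp_bounded by (auto simp: test_function_def)
  then obtain R where "\<And>x. x \<in> closure {x. \<phi> x \<noteq> 0} \<Longrightarrow> norm x \<le> R" unfolding bounded_iff by blast
  then have R: "\<phi> x = 0" if "norm x > R" for x using that closure_subset[of "{x. \<phi> x \<noteq> 0}"] by fastforce
  have "C_k (Suc (Suc 0)) \<phi>" using assms by (auto simp: test_function_def smooth_def)
  then have d1: "\<And>x. \<phi> differentiable (at x)" and d2: "\<And>b x. dird \<phi> b differentiable (at x)"
    and c2: "\<And>b b'. continuous_on UNIV (dird (dird \<phi> b) b')" by auto
  have c0: "continuous_on UNIV \<phi>" using d1 differentiable_imp_continuous_within continuous_on_eq_continuous_within by blast
  have c1: "continuous_on UNIV (dird \<phi> b)" for b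
    using d2 differentiable_imp_continuous_within continuous_on_eq_continuous_within by blast
  have R1: "dird \<phi> b x = 0" if "norm x > R" for x b
    by (rule frechet_derivative_eq_0_outside[OF R that])
  have R2: "laplacian \<phi> x = 0" if "norm x > R" for x
    unfolding laplacian_def by (intro sum.neutral ballI frechet_derivative_eq_0_outside[OF R1 that])
  have cL: "continuous_on UNIV (laplacian \<phi>)"
    unfolding laplacian_def[abs_def] by (intro continuous_on_sum c2)
  show ?thesis
    by (rule that[OF R R1 R2 c0 c1 c2 cL dirderiv_of_differentiable[OF d1] dirderiv_of_differentiable[OF d2]])
qed

text \<open>The distance to \<open>c\<close>, smoothed so that it never vanishes.\<close>

definition reg_dist :: "real \<Rightarrow> 'a::euclidean_space \<Rightarrow> 'a \<Rightarrow> real" where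
  "reg_dist \<epsilon> c x = sqrt ((norm (x - c))\<^sup>2 + \<epsilon>\<^sup>2)"

lemma reg_dist_pos: "\<epsilon> > 0 \<Longrightarrow> reg_dist \<epsilon> c x > 0"
  by (simp add: reg_dist_def add_nonneg_pos)

lemma reg_dist_ge: "reg_dist \<epsilon> c x \<ge> norm (x - c)" "\<epsilon> > 0 \<Longrightarrow> reg_dist \<epsilon> c x \<ge> \<epsilon>"
  by (auto simp: reg_dist_def intro!: real_le_rsqrt)

lemma continuous_reg_dist: "continuous_on UNIV (reg_dist \<epsilon> c)"
  unfolding reg_dist_def[abs_def] by (intro continuous_intros)

lemma reg_dist_deriv:
  assumes "\<epsilon> > 0"
  shows "((\<lambda>t. reg_dist \<epsilon> c (x + t *\<^sub>R b)) has_real_derivative ((x - c) \<bullet> b) / reg_dist \<epsilon> c x) (at 0)"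
proof -
  have e: "(norm (x + t *\<^sub>R b - c))\<^sup>2 = (norm (x - c))\<^sup>2 + 2 * t * ((x - c) \<bullet> b) + t\<^sup>2 * (norm b)\<^sup>2" for t
    unfolding power2_norm_eq_inner by (simp add: inner_simps inner_commute algebra_simps power2_eq_square)
  have p: "(norm (x - c))\<^sup>2 + \<epsilon>\<^sup>2 > 0" using assms by (simp add: add_nonneg_pos)
  show ?thesis unfolding reg_dist_def e using p
    by (auto intro!: derivative_eq_intros simp: field_simps)
qed

lemma radial_deriv:
  fixes h :: "complex \<Rightarrow> complex"
  assumes "\<epsilon> > 0" "(h has_field_derivative h') (at (of_real (reg_dist \<epsilon> c x)))"
  shows "((\<lambda>t. h (of_real (reg_dist \<epsilon> c (x + t *\<^sub>R b)))) has_vector_derivative of_real (((x - c) \<bullet> b) / reg_dist \<epsilon> c x) * h') (at 0)"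
proof -
  have "((\<lambda>t. complex_of_real (reg_dist \<epsilon> c (x + t *\<^sub>R b))) has_vector_derivative of_real (((x - c) \<bullet> b) / reg_dist \<epsilon> c x)) (at 0)"
    by (rule has_vector_derivative_of_real) (use reg_dist_deriv[OF assms(1)] in \<open>simp add: has_real_derivative_iff_has_vector_derivative\<close>)
  from field_vector_diff_chain_at[OF this, of h h'] assms(2) show ?thesis by (simp add: comp_def)
qed

text \<open>The spherical wave with complex argument, and the functions that result from applying
  \<open>(1/s) d/ds\<close> to it once and twice; composition with the smoothed distance turns these into partial
  derivatives.\<close>

definition cgreen where "cgreen k s = exp (\<i> * k * s) / (s :: complex)"
definition cgreen1 where "cgreen1 k s = exp (\<i> * k * s) * (\<i> * k / s\<^sup>2 - 1 / (s :: complex) ^ 3)"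
definition cgreen2 where "cgreen2 k s = exp (\<i> * k * s) * (- k\<^sup>2 / s ^ 3 - 3 * \<i> * k / s ^ 4 + 3 / (s :: complex) ^ 5)"

lemma cgreen_deriv: "s \<noteq> 0 \<Longrightarrow> (cgreen k has_field_derivative s * cgreen1 k s) (at s)"
  unfolding cgreen_def[abs_def] cgreen1_def
  by (auto intro!: derivative_eq_intros simp: field_simps eval_nat_numeral)

lemma cgreen1_deriv: "s \<noteq> 0 \<Longrightarrow> (cgreen1 k has_field_derivative s * cgreen2 k s) (at s)"
proof -
  assume s: "s \<noteq> 0"
  have "((\<lambda>s. exp (\<i> * k * s)) has_field_derivative \<i> * k * exp (\<i> * k * s)) (at s)"
    by (auto intro!: derivative_eq_intros)
  note e = this
  have "((\<lambda>s. \<i> * k / s\<^sup>2 - 1 / s ^ 3) has_field_derivative (- 2 * \<i> * k / s ^ 3 + 3 / s ^ 4)) (at s)"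
    using s by (auto intro!: derivative_eq_intros simp: field_simps eval_nat_numeral)
  note f = this
  have eq: "\<i> * k * E * (\<i> * k / s\<^sup>2 - 1 / s ^ 3) + (- 2 * \<i> * k / s ^ 3 + 3 / s ^ 4) * E
     = s * (E * (- k\<^sup>2 / s ^ 3 - 3 * \<i> * k / s ^ 4 + 3 / s ^ 5))" for E :: complex
    using s by (simp add: divide_simps eval_nat_numeral) (simp add: algebra_simps)
  show ?thesis
    using DERIV_mult[OF e f] unfolding cgreen1_def[abs_def] cgreen2_def eq .
qed

text \<open>The exact spherical wave satisfies the Helmholtz equation away from its centre; smoothing the
  distance leaves an error term with the factor \<open>\<epsilon>\<^sup>2\<close>.\<close>

lemma cgreen_helmholtz:
  fixes x c :: "'a::euclidean_space"
  assumes "\<epsilon> > 0" "DIM('a) = 3"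
  shows "(\<Sum>b\<in>Basis. cgreen2 k (of_real (reg_dist \<epsilon> c x)) * of_real (((x - c) \<bullet> b)\<^sup>2) + cgreen1 k (of_real (reg_dist \<epsilon> c x)) * of_real (b \<bullet> b))
     + k\<^sup>2 * cgreen k (of_real (reg_dist \<epsilon> c x)) = - of_real (\<epsilon>\<^sup>2) * cgreen2 k (of_real (reg_dist \<epsilon> c x))"
proof -
  define s where "s = complex_of_real (reg_dist \<epsilon> c x)"
  have s: "s \<noteq> 0" using reg_dist_pos[OF assms(1), of c x] by (simp add: s_def)
  have 1: "(\<Sum>b\<in>Basis. ((x - c) \<bullet> b)\<^sup>2) = (norm (x - c))\<^sup>2"
    unfolding power2_norm_eq_inner by (subst euclidean_inner) (simp add: power2_eq_square)
  have 2: "(\<Sum>b\<in>Basis. (b::'a) \<bullet> b) = 3"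
    using assms(2) by (simp add: inner_same_Basis)
  have 3: "complex_of_real ((norm (x - c))\<^sup>2) = s\<^sup>2 - of_real (\<epsilon>\<^sup>2)"
    by (simp add: s_def reg_dist_def flip: of_real_power)
  have eqA: "(\<Sum>b\<in>Basis. cgreen2 k s * of_real (((x - c) \<bullet> b)\<^sup>2) + cgreen1 k s * of_real (b \<bullet> b)) = cgreen2 k s * (s\<^sup>2 - of_real (\<epsilon>\<^sup>2)) + 3 * cgreen1 k s"
    unfolding sum.distrib sum_distrib_left[symmetric] of_real_sum[symmetric] 1 2 3
    by simp
  have eqB: "cgreen2 k s * s\<^sup>2 + 3 * cgreen1 k s + k\<^sup>2 * cgreen k s = 0"
    unfolding cgreen1_def cgreen2_def cgreen_def using s by (simp add: divide_simps eval_nat_numeral) (simp add: algebra_simps)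
  show ?thesis unfolding s_def[symmetric] eqA using eqB by algebra
qed

lemma continuous_reg_dist_compose:
  assumes "\<epsilon> > 0"
  shows "continuous_on UNIV (\<lambda>x. cgreen k (of_real (reg_dist \<epsilon> c x)))" "continuous_on UNIV (\<lambda>x. cgreen1 k (of_real (reg_dist \<epsilon> c x)))"
    "continuous_on UNIV (\<lambda>x. cgreen2 k (of_real (reg_dist \<epsilon> c x)))"
proof -
  have nz: "complex_of_real (reg_dist \<epsilon> c x) \<noteq> 0" for x using reg_dist_pos[OF assms, of c x] by simp
  show "continuous_on UNIV (\<lambda>x. cgreen k (of_real (reg_dist \<epsilon> c x)))" "continuous_on UNIV (\<lambda>x. cgreen1 k (of_real (reg_dist \<epsilon> c x)))"
    "continuous_on UNIV (\<lambda>x. cgreen2 k (of_real (reg_dist \<epsilon> c x)))"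
    unfolding cgreen_def cgreen1_def cgreen2_def using nz by (auto intro!: continuous_intros continuous_reg_dist)
qed

text \<open>Green's second identity: in each coordinate direction,
  \<open>U \<partial>\<partial>\<phi> - \<phi> \<partial>\<partial>U\<close> is the derivative of \<open>U \<partial>\<phi> - \<phi> \<partial>U\<close>, whose integral vanishes.\<close>

lemma regularized_green_identity:
  fixes \<phi> :: "'a::euclidean_space \<Rightarrow> complex" and c :: 'a
  assumes tf: "test_function \<phi>" and e: "\<epsilon> > 0" and dim: "DIM('a) = 3"
  shows "(LINT x|lborel. cgreen k (of_real (reg_dist \<epsilon> c x)) * (laplacian \<phi> x + k\<^sup>2 * \<phi> x))
       = (LINT x|lborel. - of_real (\<epsilon>\<^sup>2) * cgreen2 k (of_real (reg_dist \<epsilon> c x)) * \<phi> x)"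
proof -
  obtain R where R: "\<And>x. norm x > R \<Longrightarrow> \<phi> x = 0" "\<And>x b. norm x > R \<Longrightarrow> dird \<phi> b x = 0"
    "\<And>x. norm x > R \<Longrightarrow> laplacian \<phi> x = 0" 
    and cont: "continuous_on UNIV \<phi>" "\<And>b. continuous_on UNIV (dird \<phi> b)" "\<And>b. continuous_on UNIV (dird (dird \<phi> b) b)"
    "continuous_on UNIV (laplacian \<phi>)"
    and der: "\<And>x b. ((\<lambda>t. \<phi> (x + t *\<^sub>R b)) has_vector_derivative dird \<phi> b x) (at 0)"
    "\<And>x b. ((\<lambda>t. dird \<phi> b (x + t *\<^sub>R b)) has_vector_derivative dird (dird \<phi> b) b x) (at 0)"
    by (rule test_function_facts[OF tf]) (rule that; assumption)
  let ?s = "\<lambda>x. complex_of_real (reg_dist \<epsilon> c x)"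
  have nz: "?s x \<noteq> 0" for x using reg_dist_pos[OF e, of c x] by simp
  define U where "U x = cgreen k (?s x)" for x
  define U1 where "U1 b x = cgreen1 k (?s x) * of_real ((x - c) \<bullet> b)" for b x
  define U2 where "U2 b x = cgreen2 k (?s x) * of_real (((x - c) \<bullet> b)\<^sup>2) + cgreen1 k (?s x) * of_real (b \<bullet> b)" for b x
  note cU = continuous_reg_dist_compose[OF e]
  have dU: "((\<lambda>t. U (x + t *\<^sub>R b)) has_vector_derivative U1 b x) (at 0)" for x b
    using radial_deriv[OF e cgreen_deriv[OF nz[of x], of k], of b] nz[of x] by (simp add: U_def U1_def mult_ac)
  have dU1: "((\<lambda>t. U1 b (x + t *\<^sub>R b)) has_vector_derivative U2 b x) (at 0)" for x b
  proof -
    have 1: "((\<lambda>t. cgreen1 k (?s (x + t *\<^sub>R b))) has_vector_derivative cgreen2 k (?s x) * of_real ((x - c) \<bullet> b)) (at 0)"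
      using radial_deriv[OF e cgreen1_deriv[OF nz[of x], of k], of b] nz[of x] by (simp add: mult_ac)
    have "((\<lambda>t. (x + t *\<^sub>R b - c) \<bullet> b) has_real_derivative b \<bullet> b) (at 0)"
      by (auto intro!: derivative_eq_intros simp: inner_simps)
    then have 2: "((\<lambda>t. complex_of_real ((x + t *\<^sub>R b - c) \<bullet> b)) has_vector_derivative of_real (b \<bullet> b)) (at 0)"
      by (intro has_vector_derivative_of_real) (simp add: has_real_derivative_iff_has_vector_derivative)
    show ?thesis
      using has_vector_derivative_mult[OF 1 2] unfolding U1_def U2_def by (simp add: power2_eq_square algebra_simps)
  qed
  have zero: "(LINT x|lborel. U x * dird (dird \<phi> b) b x - \<phi> x * U2 b x) = 0" for b
  proof (rule integral_directional_derivative[where w = "\<lambda>x. U x * dird \<phi> b x - \<phi> x * U1 b x" and b = b and R = R])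
    show "((\<lambda>t. U (x + t *\<^sub>R b) * dird \<phi> b (x + t *\<^sub>R b) - \<phi> (x + t *\<^sub>R b) * U1 b (x + t *\<^sub>R b))
       has_vector_derivative U x * dird (dird \<phi> b) b x - \<phi> x * U2 b x) (at 0)" for x
      using has_vector_derivative_diff[OF has_vector_derivative_mult[OF dU[where x = x and b = b] der(2)[where x = x and b = b]]
          has_vector_derivative_mult[OF der(1)[where x = x and b = b] dU1[where x = x and b = b]]]
      by (simp add: algebra_simps)
    show "continuous_on UNIV (\<lambda>x. U x * dird \<phi> b x - \<phi> x * U1 b x)"
      unfolding U_def U1_def by (intro continuous_intros cont cU)
    show "continuous_on UNIV (\<lambda>x. U x * dird (dird \<phi> b) b x - \<phi> x * U2 b x)"
      unfolding U_def U2_def by (intro continuous_intros cont cU)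
  qed (use R in auto)
  have cint: "integrable lborel f" if "continuous_on UNIV f" "\<And>x. norm x > R \<Longrightarrow> f x = 0" for f :: "'a \<Rightarrow> complex"
  proof -
    have "integrable lborel (\<lambda>x. indicator (cball 0 R) x *\<^sub>R f x)"
      by (rule borel_integrable_compact) (auto intro: continuous_on_subset[OF that(1)])
    moreover have "(\<lambda>x. indicator (cball 0 R) x *\<^sub>R f x) = f"
      using that(2) by (auto simp: fun_eq_iff indicator_def)
    ultimately show ?thesis by simp
  qed
  have i1: "integrable lborel (\<lambda>x. U x * dird (dird \<phi> b) b x - \<phi> x * U2 b x)" for b
    by (rule cint) (auto simp: U_def U2_def R frechet_derivative_eq_0_outside[OF R(2)] intro!: continuous_intros cont cU)
  have i2: "integrable lborel (\<lambda>x. U x * (laplacian \<phi> x + k\<^sup>2 * \<phi> x))"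
    by (rule cint) (auto simp: U_def R intro!: continuous_intros cont cU)
  have i3: "integrable lborel (\<lambda>x. - of_real (\<epsilon>\<^sup>2) * cgreen2 k (?s x) * \<phi> x)"
    by (rule cint) (auto simp: R intro!: continuous_intros cont cU)
  have "U x * (laplacian \<phi> x + k\<^sup>2 * \<phi> x) - (- of_real (\<epsilon>\<^sup>2) * cgreen2 k (?s x) * \<phi> x) = (\<Sum>b\<in>Basis. U x * dird (dird \<phi> b) b x - \<phi> x * U2 b x)" for x
  proof -
    have e: "(\<Sum>b\<in>Basis. U2 b x) = - of_real (\<epsilon>\<^sup>2) * cgreen2 k (?s x) - k\<^sup>2 * U x"
      using cgreen_helmholtz[OF e dim, of k c x] unfolding U2_def U_def by (simp add: algebra_simps)
    show ?thesis
      unfolding sum_subtractf sum_distrib_left[symmetric] laplacian_def e by (simp add: algebra_simps)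
  qed
  then have "(LINT x|lborel. U x * (laplacian \<phi> x + k\<^sup>2 * \<phi> x)) - (LINT x|lborel. - of_real (\<epsilon>\<^sup>2) * cgreen2 k (?s x) * \<phi> x)
     = (\<Sum>b\<in>Basis. LINT x|lborel. U x * dird (dird \<phi> b) b x - \<phi> x * U2 b x)"
    by (subst Bochner_Integration.integral_diff[OF i2 i3, symmetric]) (simp add: Bochner_Integration.integral_sum[OF i1] del: Bochner_Integration.integral_diff)
  also have "\<dots> = 0" by (simp add: zero)
  finally show ?thesis by (simp only: U_def right_minus_eq)
qed

lemma lborel_integral_affine:
  fixes f :: "'a::euclidean_space \<Rightarrow> complex"
  assumes [measurable]: "f \<in> borel_measurable borel" and e: "\<epsilon> > 0"
  shows "(LINT x|lborel. f x) = (LINT y|lborel. of_real (\<epsilon> ^ DIM('a)) * f (c + \<epsilon> *\<^sub>R y))"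
proof -
  have "(LINT x|lborel. f x) = (LINT x|density (distr lborel borel (\<lambda>x. c + \<epsilon> *\<^sub>R x)) (\<lambda>_. \<bar>\<epsilon>\<bar> ^ DIM('a)). f x)"
    using e by (subst lborel_affine[of \<epsilon> c]) auto
  also have "\<dots> = (LINT x|distr lborel borel (\<lambda>x. c + \<epsilon> *\<^sub>R x). (\<epsilon> ^ DIM('a)) *\<^sub>R f x)"
    using e by (subst integral_density) auto
  also have "\<dots> = (LINT y|lborel. of_real (\<epsilon> ^ DIM('a)) * f (c + \<epsilon> *\<^sub>R y))"
    by (subst integral_distr) (auto simp: scaleR_conv_of_real)
  finally show ?thesis .
qed

text \<open>In \<open>regularized_green_identity\<close> the left side converges by dominated convergence. On the right the
  error term splits into a part \<open>P\<close> with poles of order at most 4, which the factor \<open>\<epsilon>\<^sup>2\<close> makes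
  negligible, and the part \<open>Q\<close> with the pole of order 5, which after rescaling by \<open>\<epsilon>\<close> is integrated
  against \<open>\<phi> (c + \<epsilon> y)\<close> with a fixed kernel of mass \<open>4 \<pi>\<close>.\<close>

theorem fundamental_solution:
  fixes \<phi> :: "'a::euclidean_space \<Rightarrow> complex" and c :: 'a
  assumes tf: "test_function \<phi>" and dim: "DIM('a) = 3" and ik: "Im k \<ge> 0"
  shows "integrable lborel (\<lambda>x. sph k (norm (x - c)) * (laplacian \<phi> x + k\<^sup>2 * \<phi> x))"
    and "(LINT x|lborel. sph k (norm (x - c)) * (laplacian \<phi> x + k\<^sup>2 * \<phi> x)) = - 4 * pi * \<phi> c"
proof -
  obtain R where R: "\<And>x. norm x > R \<Longrightarrow> \<phi> x = 0" "\<And>x. norm x > R \<Longrightarrow> laplacian \<phi> x = 0" 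
    and cont: "continuous_on UNIV \<phi>" "continuous_on UNIV (laplacian \<phi>)"
    by (rule test_function_facts[OF tf]) (rule that; assumption)
  define F where "F x = laplacian \<phi> x + k\<^sup>2 * \<phi> x" for x
  have cF: "continuous_on UNIV F" unfolding F_def[abs_def] by (intro continuous_intros cont)
  have RF: "F x = 0" if "norm x > R" for x using R that by (simp add: F_def)
  have bnd: "\<exists>B\<ge>0. \<forall>x. norm (f x) \<le> B" if cf: "continuous_on UNIV f" and f0: "\<And>x. norm x > R \<Longrightarrow> f x = 0" for f :: "'a \<Rightarrow> complex"
  proof -
    have "compact (f ` cball 0 R)" by (intro compact_continuous_image continuous_on_subset[OF cf]) auto
    then obtain B where "\<And>x. x \<in> cball 0 R \<Longrightarrow> norm (f x) \<le> B"
      using compact_imp_bounded bounded_iff by (metis image_eqI)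
    then have "norm (f x) \<le> max B 0" for x
      using f0[of x] by (cases "norm x > R") (auto simp: le_max_iff_disj)
    then show ?thesis by (intro exI[of _ "max B 0"]) auto
  qed
  obtain B1 where B1: "B1 \<ge> 0" "\<And>x. norm (F x) \<le> B1" using bnd[OF cF RF] by blast
  obtain B2 where B2: "B2 \<ge> 0" "\<And>x. norm (\<phi> x) \<le> B2" using bnd[OF cont(1) R(1)] by blast
  have [measurable]: "F \<in> borel_measurable borel" "\<phi> \<in> borel_measurable borel"
    using cF cont by (auto intro: borel_measurable_continuous_onI)
  define R' where "R' = R + norm c"
  have ind: "indicator (cball c R') x = (1::real)" if "norm x \<le> R" for x
    using that norm_triangle_ineq4[of c x] by (simp add: R'_def dist_norm)
  define \<epsilon> where "\<epsilon> n = inverse (real (Suc n))" for n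
  have e: "\<epsilon> n > 0" "\<epsilon> n \<le> 1" for n by (auto simp: \<epsilon>_def inverse_le_1_iff)
  have e0: "\<epsilon> \<longlonglongrightarrow> 0" unfolding \<epsilon>_def[abs_def] by (rule LIMSEQ_inverse_real_of_nat)
  let ?s = "\<lambda>n x. reg_dist (\<epsilon> n) c x"
  have sp: "?s n x > 0" for n x by (rule reg_dist_pos[OF e(1)])
  have s_lim: "(\<lambda>n. ?s n x) \<longlonglongrightarrow> norm (x - c)" for x
  proof -
    have "(\<lambda>n. sqrt ((norm (x - c))\<^sup>2 + (\<epsilon> n)\<^sup>2)) \<longlonglongrightarrow> sqrt ((norm (x - c))\<^sup>2 + 0\<^sup>2)"
      by (intro tendsto_intros e0)
    then show ?thesis by (simp add: reg_dist_def)
  qed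
  have cs_lim: "(\<lambda>n. complex_of_real (?s n x)) \<longlonglongrightarrow> of_real (norm (x - c))" for x
    by (intro tendsto_of_real s_lim)
  have nexp: "norm (exp (\<i> * k * of_real (?s n x))) \<le> 1" for n x
    using sp[of n x] ik by (intro norm_exp_i_le_1) auto
  have [measurable]: "(\<lambda>x. reg_dist \<epsilon>' c x) \<in> borel_measurable borel" for \<epsilon>'
    by (intro borel_measurable_continuous_onI continuous_reg_dist)
  have AEc: "AE x in lborel. x \<noteq> c" by (rule AE_lborel_singleton)
  have ex_lim: "(\<lambda>n. exp (\<i> * k * of_real (?s n x))) \<longlonglongrightarrow> exp (\<i> * k * of_real (norm (x - c)))" for x
    by (intro tendsto_intros cs_lim)
  have dom1: "integrable lborel (\<lambda>x. B1 * (indicator (cball c R') x / norm (x - c) ^ 1))"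
    by (rule integrable_mult_right[OF integrable_inverse_norm_power[OF dim]]) simp
  have L1: "integrable lborel (\<lambda>x. sph k (norm (x - c)) * F x)"
     "(\<lambda>n. LINT x|lborel. cgreen k (of_real (?s n x)) * F x) \<longlonglongrightarrow> (LINT x|lborel. sph k (norm (x - c)) * F x)"
  proof -
    have m1: "(\<lambda>x. sph k (norm (x - c)) * F x) \<in> borel_measurable lborel" unfolding sph_def by measurable
    have m2: "\<And>n. (\<lambda>x. cgreen k (of_real (?s n x)) * F x) \<in> borel_measurable lborel" unfolding cgreen_def by measurable
    have lim: "AE x in lborel. (\<lambda>n. cgreen k (of_real (?s n x)) * F x) \<longlonglongrightarrow> sph k (norm (x - c)) * F x"
      using AEc
    proof (rule AE_mp, intro AE_I2 impI)
      fix x assume "x \<noteq> c"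
      then show "(\<lambda>n. cgreen k (of_real (?s n x)) * F x) \<longlonglongrightarrow> sph k (norm (x - c)) * F x"
        unfolding cgreen_def sph_def by (intro tendsto_mult tendsto_divide tendsto_const ex_lim cs_lim) auto
    qed
    have bd: "\<And>n. AE x in lborel. norm (cgreen k (of_real (?s n x)) * F x) \<le> B1 * (indicator (cball c R') x / norm (x - c) ^ 1)"
      using AEc
    proof (rule AE_mp, intro AE_I2 impI)
      fix n x assume x: "x \<noteq> c"
      show "norm (cgreen k (of_real (?s n x)) * F x) \<le> B1 * (indicator (cball c R') x / norm (x - c) ^ 1)"
      proof (cases "norm x > R")
        case True
        then show ?thesis using RF B1(1) by simp
      next
        case False
        have "norm (cgreen k (of_real (?s n x))) \<le> 1 / norm (x - c)"
          unfolding cgreen_def norm_divide using x nexp[of n x] sp[of n x] reg_dist_ge(1)[of x c "\<epsilon> n"] by (intro frac_le) auto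
        then have "norm (cgreen k (of_real (?s n x))) * norm (F x) \<le> 1 / norm (x - c) * B1"
          by (intro mult_mono B1) auto
        then show ?thesis using ind[of x] False by (simp add: norm_mult)
      qed
    qed
    show "integrable lborel (\<lambda>x. sph k (norm (x - c)) * F x)"
      by (rule integrable_dominated_convergence[OF m1 m2 dom1 lim bd])
    show "(\<lambda>n. LINT x|lborel. cgreen k (of_real (?s n x)) * F x) \<longlonglongrightarrow> (LINT x|lborel. sph k (norm (x - c)) * F x)"
      by (rule integral_dominated_convergence[OF m1 m2 dom1 lim bd])
  qed
  \<comment> \<open>The factor \<open>\<epsilon>\<^sup>2\<close> is spent on two of the powers in the denominator, which leaves integrable singularities of order 1 and 2.\<close>
  define P where "P n x = of_real ((\<epsilon> n)\<^sup>2) * (exp (\<i> * k * of_real (?s n x)) * (k\<^sup>2 / of_real (?s n x) ^ 3 + 3 * \<i> * k / of_real (?s n x) ^ 4)) * \<phi> x" for n x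
  define Q where "Q n x = - 3 * of_real ((\<epsilon> n)\<^sup>2) * exp (\<i> * k * of_real (?s n x)) / of_real (?s n x) ^ 5 * \<phi> x" for n x
  have PQ: "- of_real ((\<epsilon> n)\<^sup>2) * cgreen2 k (of_real (?s n x)) * \<phi> x = P n x + Q n x" for n x
    unfolding P_def Q_def cgreen2_def by (simp add: algebra_simps diff_divide_distrib)
  have mP[measurable]: "P n \<in> borel_measurable borel" and mQ[measurable]: "Q n \<in> borel_measurable borel" for n
    unfolding P_def[abs_def] Q_def[abs_def] by measurable
  define K where "K = (norm k ^ 2 + 3 * norm k) * B2"
  have K: "K \<ge> 0" using B2(1) by (simp add: K_def)
  have domP: "integrable lborel (\<lambda>x. K * (indicator (cball c R') x / norm (x - c) ^ 1 + indicator (cball c R') x / norm (x - c) ^ 2))"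
    by (intro integrable_mult_right Bochner_Integration.integrable_add integrable_inverse_norm_power[OF dim]) auto
  have Plim: "AE x in lborel. (\<lambda>n. P n x) \<longlonglongrightarrow> 0"
    using AEc
  proof (rule AE_mp, intro AE_I2 impI)
    fix x assume x: "x \<noteq> c"
    have "(\<lambda>n. P n x) \<longlonglongrightarrow> of_real (0\<^sup>2) * (exp (\<i> * k * of_real (norm (x - c))) * (k\<^sup>2 / of_real (norm (x - c)) ^ 3 + 3 * \<i> * k / of_real (norm (x - c)) ^ 4)) * \<phi> x"
      unfolding P_def using x by (intro tendsto_intros e0 ex_lim cs_lim) auto
    then show "(\<lambda>n. P n x) \<longlonglongrightarrow> 0" by simp
  qed
  have Pbd: "AE x in lborel. norm (P n x) \<le> K * (indicator (cball c R') x / norm (x - c) ^ 1 + indicator (cball c R') x / norm (x - c) ^ 2)" for n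
    using AEc
  proof (rule AE_mp, intro AE_I2 impI)
    fix x assume x: "x \<noteq> c"
    show "norm (P n x) \<le> K * (indicator (cball c R') x / norm (x - c) ^ 1 + indicator (cball c R') x / norm (x - c) ^ 2)"
    proof (cases "norm x > R")
      case True
      then show ?thesis using R(1) K by (simp add: P_def)
    next
      case False
      define s where "s = ?s n x"
      define r where "r = norm (x - c)"
      have s: "s > 0" "s \<ge> r" "s \<ge> \<epsilon> n" and r: "r > 0"
        using sp[of n x] reg_dist_ge(1)[of x c "\<epsilon> n"] reg_dist_ge(2)[of "\<epsilon> n" c x] e x by (auto simp: s_def r_def)
      have es: "(\<epsilon> n)\<^sup>2 \<le> s\<^sup>2" using s e(1)[of n] by (intro power_mono) auto
      have "norm (P n x) = (\<epsilon> n)\<^sup>2 * (norm (exp (\<i> * k * of_real s)) * norm (k\<^sup>2 / of_real s ^ 3 + 3 * \<i> * k / of_real s ^ 4)) * norm (\<phi> x)"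
        by (simp add: P_def s_def norm_mult norm_power)
      also have "\<dots> \<le> s\<^sup>2 * (1 * (norm k ^ 2 / s ^ 3 + 3 * norm k / s ^ 4)) * B2"
      proof (intro mult_mono es B2(2))
        show "norm (exp (\<i> * k * of_real s)) \<le> 1" unfolding s_def by (rule nexp)
        show "norm (k\<^sup>2 / of_real s ^ 3 + 3 * \<i> * k / of_real s ^ 4) \<le> norm k ^ 2 / s ^ 3 + 3 * norm k / s ^ 4"
          using s by (intro order_trans[OF norm_triangle_ineq]) (simp add: norm_divide norm_mult norm_power)
      qed (use s B2 in auto)
      also have "\<dots> = (norm k ^ 2 * (1 / s) + 3 * norm k * (1 / s\<^sup>2)) * B2"
        using s(1) by (simp add: eval_nat_numeral field_simps)
      also have "\<dots> \<le> ((norm k ^ 2 + 3 * norm k) * (1 / r) + (norm k ^ 2 + 3 * norm k) * (1 / r\<^sup>2)) * B2"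
        using s r B2(1)
        by (intro mult_right_mono add_mono mult_mono divide_left_mono power_mono mult_pos_pos zero_less_power) auto
      finally show ?thesis using ind[of x] False by (simp add: K_def r_def algebra_simps)
    qed
  qed
  have LP: "(\<lambda>n. LINT x|lborel. P n x) \<longlonglongrightarrow> (LINT x|(lborel :: 'a measure). (0::complex))"
  proof (rule integral_dominated_convergence)
    show "AE x in lborel. (\<lambda>n. P n x) \<longlonglongrightarrow> 0" by (rule Plim)
    show "AE x in lborel. norm (P n x) \<le> K * (indicator (cball c R') x / norm (x - c) ^ 1 + indicator (cball c R') x / norm (x - c) ^ 2)" for n
      by (rule Pbd)
  qed (use domP in auto)
  have iP: "integrable lborel (P n)" for n
    by (rule Bochner_Integration.integrable_bound[OF domP]) (use Pbd[of n] in \<open>auto elim!: eventually_mono\<close>)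
  have iQ: "integrable lborel (Q n)" for n
  proof -
    have nz: "complex_of_real (?s n x) \<noteq> 0" for x using sp[of n x] by simp
    have "continuous_on UNIV (Q n)" unfolding Q_def[abs_def] using nz by (auto intro!: continuous_intros continuous_reg_dist cont)
    then have "integrable lborel (\<lambda>x. indicator (cball 0 R) x *\<^sub>R Q n x)"
      by (intro borel_integrable_compact) (auto intro: continuous_on_subset)
    moreover have "(\<lambda>x. indicator (cball 0 R) x *\<^sub>R Q n x) = Q n"
      using R(1) by (auto simp: fun_eq_iff indicator_def Q_def)
    ultimately show ?thesis by simp
  qed
  define T where "T y = sqrt (1 + (norm (y::'a))\<^sup>2)" for y
  have T: "T y \<ge> 1" for y by (simp add: T_def)
  have T_meas[measurable]: "T \<in> borel_measurable borel" unfolding T_def[abs_def] by measurable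
  \<comment> \<open>The integrand of \<open>Q\<close> after the substitution \<open>x = c + \<epsilon> y\<close>: the volume \<open>\<epsilon>\<^sup>3\<close> and the factor \<open>\<epsilon>\<^sup>2\<close> cancel the fifth power.\<close>
  define Q' where "Q' n y = exp (\<i> * k * of_real (\<epsilon> n * T y)) * of_real (- (3 / T y ^ 5)) * \<phi> (c + \<epsilon> n *\<^sub>R y)" for n y
  have QQ': "(LINT x|lborel. Q n x) = (LINT y|lborel. Q' n y)" for n
  proof -
    have "?s n (c + \<epsilon> n *\<^sub>R y) = \<epsilon> n * T y" for y
    proof -
      have "(norm (c + \<epsilon> n *\<^sub>R y - c))\<^sup>2 + (\<epsilon> n)\<^sup>2 = (\<epsilon> n)\<^sup>2 * (1 + (norm y)\<^sup>2)"
        using e(1)[of n] by (simp add: power_mult_distrib algebra_simps)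
      then show ?thesis using e(1)[of n] by (simp add: reg_dist_def T_def real_sqrt_mult)
    qed
    then have "of_real ((\<epsilon> n) ^ 3) * Q n (c + \<epsilon> n *\<^sub>R y) = Q' n y" for y
      using e(1)[of n] T[of y] unfolding Q_def Q'_def by (simp add: field_simps eval_nat_numeral)
    then show ?thesis using lborel_integral_affine[OF mQ e(1), of n n c] by (simp only: dim)
  qed
  have LQ: "(\<lambda>n. LINT y|lborel. Q' n y) \<longlonglongrightarrow> (LINT y|lborel. of_real (- (3 / T y ^ 5)) * \<phi> c)"
  proof (rule integral_dominated_convergence[where w = "\<lambda>y. B2 * (3 / T y ^ 5)"])
    show "integrable lborel (\<lambda>y. B2 * (3 / T y ^ 5))"
      unfolding T_def by (rule integrable_mult_right[OF integral_kernel_3(1)[OF dim]])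
    have "(\<lambda>n. Q' n y) \<longlonglongrightarrow> exp (\<i> * k * of_real (0 * T y)) * of_real (- (3 / T y ^ 5)) * \<phi> c" for y
    proof -
      have "(\<lambda>n. c + \<epsilon> n *\<^sub>R y) \<longlonglongrightarrow> c + 0 *\<^sub>R y" by (intro tendsto_intros e0)
      then have "(\<lambda>n. \<phi> (c + \<epsilon> n *\<^sub>R y)) \<longlonglongrightarrow> \<phi> c"
        using continuous_on_tendsto_compose[OF cont(1)] by auto
      then show ?thesis unfolding Q'_def by (intro tendsto_intros e0)
    qed
    then show "AE y in lborel. (\<lambda>n. Q' n y) \<longlonglongrightarrow> of_real (- (3 / T y ^ 5)) * \<phi> c" by simp
    show "AE y in lborel. norm (Q' n y) \<le> B2 * (3 / T y ^ 5)" for n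
    proof (rule AE_I2)
      fix y
      have "norm (exp (\<i> * k * of_real (\<epsilon> n * T y))) \<le> 1"
        using e(1)[of n] T[of y] ik by (intro norm_exp_i_le_1) auto
      then have "norm (exp (\<i> * k * of_real (\<epsilon> n * T y))) * \<bar>- (3 / T y ^ 5)\<bar> * norm (\<phi> (c + \<epsilon> n *\<^sub>R y)) \<le> 1 * (3 / T y ^ 5) * B2"
        using T[of y] by (intro mult_mono B2) auto
      then show "norm (Q' n y) \<le> B2 * (3 / T y ^ 5)" 
        unfolding Q'_def norm_mult norm_of_real by (simp only: mult_ac mult_1_left)
    qed
  qed (unfold Q'_def, measurable)
  also have "(LINT y|lborel. of_real (- (3 / T y ^ 5)) * \<phi> c) = (LINT y|lborel. complex_of_real (- (3 / T y ^ 5))) * \<phi> c"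
    by (rule integral_mult_left_zero)
  also have "(LINT y|lborel. complex_of_real (- (3 / T y ^ 5))) = of_real (- (4 * pi))"
    unfolding integral_complex_of_real using integral_kernel_3(2)[OF dim] by (simp add: T_def)
  finally have LQ: "(\<lambda>n. LINT x|lborel. Q n x) \<longlonglongrightarrow> of_real (- (4 * pi)) * \<phi> c" unfolding QQ' .
  have "(LINT x|lborel. cgreen k (of_real (?s n x)) * F x) = (LINT x|lborel. P n x) + (LINT x|lborel. Q n x)" for n
    using regularized_green_identity[OF tf e(1) dim, of k n c]
    unfolding F_def[symmetric] PQ Bochner_Integration.integral_add[OF iP iQ] .
  then have "(\<lambda>n. LINT x|lborel. cgreen k (of_real (?s n x)) * F x) \<longlonglongrightarrow> 0 + of_real (- (4 * pi)) * \<phi> c"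
    using tendsto_add[OF LP LQ] by simp
  from LIMSEQ_unique[OF L1(2) this] L1(1)
  show "integrable lborel (\<lambda>x. sph k (norm (x - c)) * (laplacian \<phi> x + k\<^sup>2 * \<phi> x))"
    "(LINT x|lborel. sph k (norm (x - c)) * (laplacian \<phi> x + k\<^sup>2 * \<phi> x)) = - 4 * pi * \<phi> c"
    unfolding F_def by simp_all
qed

section \<open>The Helmholtz equation for the lattice sum\<close>

text \<open>Exchange of sum and integral for an unordered double series, by enumerating the index set and using
  the theorem for sequences.\<close>

lemma infsum_integral_int2:
  fixes f :: "int \<times> int \<Rightarrow> 'a \<Rightarrow> complex"
  assumes int: "\<And>u. integrable M (f u)" and sm: "(\<lambda>u. LINT x|M. norm (f u x)) summable_on UNIV"
    and pt: "\<And>x. x \<in> space M \<Longrightarrow> (\<lambda>u. norm (f u x)) summable_on UNIV"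
  shows "integrable M (\<lambda>x. infsum (\<lambda>u. f u x) UNIV)"
    and "((\<lambda>u. LINT x|M. f u x) has_sum (LINT x|M. infsum (\<lambda>u. f u x) UNIV)) UNIV"
proof -
  define h :: "nat \<Rightarrow> int \<times> int" where "h = from_nat_into UNIV"
  have "infinite (UNIV :: (int \<times> int) set)" by (simp add: finite_prod)
  then have h: "bij_betw h UNIV UNIV" unfolding h_def by (intro bij_betw_from_nat_into) auto
  have pn: "summable (\<lambda>n. norm (f (h n) x))" if "x \<in> space M" for x
    using summable_on_reindex_bij_betw[OF h, of "\<lambda>u. norm (f u x)"] pt[OF that] summable_on_imp_summable by blast
  have eq: "(infsum (\<lambda>u. f u x) UNIV) = (\<Sum>n. f (h n) x)" if "x \<in> space M" for x
  proof -
    have "(\<Sum>\<^sub>\<infinity>n\<in>UNIV. f (h n) x) = (\<Sum>n. f (h n) x)"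
      by (rule infsumI[OF norm_summable_imp_has_sum[OF pn[OF that] summable_sums[OF summable_norm_cancel[OF pn[OF that]]]]])
    then show ?thesis using infsum_reindex_bij_betw[OF h, of "\<lambda>u. f u x"] by simp
  qed
  have sn: "summable (\<lambda>n. LINT x|M. norm (f (h n) x))"
    using summable_on_reindex_bij_betw[OF h, of "\<lambda>u. LINT x|M. norm (f u x)"] sm summable_on_imp_summable by blast
  have ae: "AE x in M. summable (\<lambda>n. norm (f (h n) x))" using pn by (intro AE_I2) auto
  have "integrable M (\<lambda>x. (suminf (\<lambda>n. f (h n) x)))" by (rule integrable_suminf[OF int ae sn])
  then show "integrable M (\<lambda>x. infsum (\<lambda>u. f u x) UNIV)"
    using Bochner_Integration.integrable_cong[OF refl, of M "\<lambda>x. infsum (\<lambda>u. f u x) UNIV" "\<lambda>x. \<Sum>n. f (h n) x"] eq by blast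
  have sums: "(\<lambda>n. LINT x|M. f (h n) x) sums (LINT x|M. (suminf (\<lambda>n. f (h n) x)))"
    by (rule sums_integral[OF int ae sn])
  have "(LINT x|M. (suminf (\<lambda>n. f (h n) x))) = (LINT x|M. infsum (\<lambda>u. f u x) UNIV)"
    by (rule Bochner_Integration.integral_cong) (auto simp: eq)
  with sums have sums': "(\<lambda>n. LINT x|M. f (h n) x) sums (LINT x|M. infsum (\<lambda>u. f u x) UNIV)" by simp
  have "summable (\<lambda>n. norm (LINT x|M. f (h n) x))"
    by (rule summable_comparison_test'[OF sn, of 0]) (simp add: integral_norm_bound)
  from norm_summable_imp_has_sum[OF this sums']
  have "((\<lambda>n. LINT x|M. f (h n) x) has_sum (LINT x|M. infsum (\<lambda>u. f u x) UNIV)) UNIV" .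
  then show "((\<lambda>u. LINT x|M. f u x) has_sum (LINT x|M. infsum (\<lambda>u. f u x) UNIV)) UNIV"
    using has_sum_reindex_bij_betw[OF h, of "\<lambda>u. LINT x|M. f u x"] by simp
qed

lemma sph_integrable_on_cball:
  fixes c :: "'a::euclidean_space"
  assumes dim: "DIM('a) = 3" and ik: "Im k \<ge> 0"
  shows "integrable lborel (\<lambda>x. indicator (cball 0 R) x *\<^sub>R sph k (norm (x - c)))"
proof (rule Bochner_Integration.integrable_bound[OF integrable_inverse_norm_power[OF dim, of 1 c "R + norm c"]])
  show "AE x in lborel. norm (indicator (cball 0 R) x *\<^sub>R sph k (norm (x - c)))
      \<le> norm (indicator (cball c (R + norm c)) x / norm (x - c) ^ 1)"
  proof (rule AE_I2)
    fix x :: 'a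
    have "norm (exp (\<i> * k * of_real (norm (x - c)))) \<le> 1" using ik by (intro norm_exp_i_le_1) auto
    then have "norm (sph k (norm (x - c))) \<le> 1 / norm (x - c)"
      unfolding sph_def norm_divide by (simp add: divide_right_mono)
    moreover have "indicator (cball c (R + norm c)) x = (1::real)" if "norm x \<le> R"
      using that norm_triangle_ineq4[of c x] by (simp add: dist_norm)
    ultimately show "norm (indicator (cball 0 R) x *\<^sub>R sph k (norm (x - c)))
      \<le> norm (indicator (cball c (R + norm c)) x / norm (x - c) ^ 1)"
      by (cases "norm x \<le> R") auto
  qed
  show "(\<lambda>x. indicator (cball 0 R) x *\<^sub>R sph k (norm (x - c))) \<in> borel_measurable lborel"
  proof (intro borel_measurable_scaleR borel_measurable_indicator)
    show "(\<lambda>x. sph k (norm (x - c))) \<in> borel_measurable lborel" unfolding sph_def by measurable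
  qed auto
qed simp

context dual_lattice
begin

text \<open>The summation index of the series is the negative of the lattice index of the source.\<close>

lemma rdist_eq_norm: "rdist v1 v2 d m n q x = norm (x - source_pt v1 v2 d (- m) (- n) q)"
proof -
  obtain y z where x: "x = (y, z)" by (cases x)
  have "lat v1 v2 (- m) (- n) = - lat v1 v2 m n" by (simp add: lat_def)
  then show ?thesis by (simp add: x rdist_def source_pt_def norm_prod_def)
qed

lemma lattice_term_eq_sph:
  "lattice_term v1 v2 d p k \<alpha> m n x = (\<Sum>q=0..p. cis (- (\<alpha> \<bullet> lat v1 v2 m n)) * fd_coeff p q * sph (of_real k) (norm (x - source_pt v1 v2 d (- m) (- n) q)))"
  by (simp add: lattice_term_def rdist_eq_norm[symmetric] sph_def cis_conv_exp sum_distrib_left mult.assoc)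

abbreviation lterm :: "real \<Rightarrow> nat \<Rightarrow> real \<Rightarrow> real^2 \<Rightarrow> int \<times> int \<Rightarrow> (real^2) \<times> real \<Rightarrow> complex" where
  "lterm d p k \<alpha> u x \<equiv> (case u of (m, n) \<Rightarrow> lattice_term v1 v2 d p k \<alpha> m n x)"

lemma lterm_integrable_on_cball:
  "integrable lborel (\<lambda>x. indicator (cball 0 R) x *\<^sub>R lterm d p k \<alpha> u x)"
proof -
  obtain m n where u: "u = (m, n)" by (cases u)
  have "integrable lborel (\<lambda>x::(real^2) \<times> real. \<Sum>q=0..p. cis (- (\<alpha> \<bullet> lat v1 v2 m n)) * fd_coeff p q * (indicator (cball 0 R) x *\<^sub>R sph (of_real k) (norm (x - source_pt v1 v2 d (- m) (- n) q))))"
    by (intro Bochner_Integration.integrable_sum integrable_mult_right sph_integrable_on_cball) auto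
  also have "(\<lambda>x. \<Sum>q=0..p. cis (- (\<alpha> \<bullet> lat v1 v2 m n)) * fd_coeff p q * (indicator (cball 0 R) x *\<^sub>R sph (of_real k) (norm (x - source_pt v1 v2 d (- m) (- n) q))))
      = (\<lambda>x. indicator (cball 0 R) x *\<^sub>R lterm d p k \<alpha> u x)"
    by (simp add: u lattice_term_eq_sph fun_eq_iff scaleR_sum_right)
  finally show ?thesis .
qed

text \<open>The hypothesis for integrating the series term by term over a ball: finitely many terms are singular
  but integrable, the others are bounded uniformly on the ball.\<close>

lemma lterm_norm_integrals_summable:
  assumes "d > 0" "p \<ge> 3"
  shows "(\<lambda>u. LINT x|lborel. norm (indicator (cball 0 R) x *\<^sub>R lterm d p k \<alpha> u x)) summable_on UNIV"
proof -
  define s where "s = real ((p + 1) div 2)"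
  have s2: "s \<ge> 2" using assms(2) by (auto simp: s_def)
  obtain C M0 where C: "C \<ge> 0" "M0 \<ge> 1" "\<And>x z m n. norm x \<le> R \<Longrightarrow> \<bar>z\<bar> \<le> R \<Longrightarrow> M0 \<le> maxn (m, n) \<Longrightarrow>
     norm (lattice_term v1 v2 d p k \<alpha> m n (x, z)) \<le> C * maxn (m, n) powr (- (s + 1))"
    using lattice_term_bound[OF assms(1), of p R R k \<alpha>] assms(2) unfolding s_def by auto
  let ?B = "cball (0 :: (real^2) \<times> real) R"
  define t where "t u = complex_of_real (LINT x|lborel. norm (indicator ?B x *\<^sub>R lterm d p k \<alpha> u x))" for u
  have tn: "norm (t u) = (LINT x|lborel. norm (indicator ?B x *\<^sub>R lterm d p k \<alpha> u x))" for u
    by (simp add: t_def)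
  have "norm (t u) \<le> (C * measure lborel ?B) * maxn u powr (- (s + 1))" if u: "M0 \<le> maxn u" for u
  proof -
    have fin: "emeasure lborel ?B < \<infinity>" by (rule emeasure_lborel_cball_finite)
    have "norm (t u) \<le> (LINT x|lborel. C * maxn u powr (- (s + 1)) * indicator ?B x)"
      unfolding tn
    proof (rule integral_mono)
      show "integrable lborel (\<lambda>x. norm (indicator ?B x *\<^sub>R lterm d p k \<alpha> u x))"
        by (rule integrable_norm[OF lterm_integrable_on_cball])
      show "integrable lborel (\<lambda>x. C * maxn u powr (- (s + 1)) * indicator ?B x)"
        using fin by (intro integrable_mult_right integrable_real_indicator) auto
      fix x :: "(real^2) \<times> real"
      obtain y z where x: "x = (y, z)" by (cases x)
      show "norm (indicator ?B x *\<^sub>R lterm d p k \<alpha> u x) \<le> C * maxn u powr (- (s + 1)) * indicator ?B x"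
      proof (cases "x \<in> ?B")
        case True
        then have "norm y \<le> R" "\<bar>z\<bar> \<le> R"
          using norm_fst_le[of y z] norm_snd_le[of z y] x by auto
        then show ?thesis using True C(3)[of y z "fst u" "snd u"] u by (cases u) (simp add: x)
      qed simp
    qed
    also have "\<dots> = (C * measure lborel ?B) * maxn u powr (- (s + 1))"
      using fin by simp
    finally show ?thesis .
  qed
  from lattice_abs_bound(1)[OF C(2) s2 _ this] C(1)
  have "(\<lambda>u. norm (t u)) summable_on {u. M0 \<le> maxn u}" by simp
  from abs_summable_from_tail[OF this] show ?thesis unfolding tn .
qed

lemma Gfun_set_integrable:
  assumes "d > 0" "p \<ge> 3"
  shows "integrable lborel (\<lambda>x. indicator (cball 0 R) x *\<^sub>R Gfun d p k \<alpha> x)"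
proof -
  have "integrable lborel (\<lambda>x. \<Sum>\<^sub>\<infinity>u\<in>UNIV. indicator (cball 0 R) x *\<^sub>R lterm d p k \<alpha> u x)"
  proof (rule infsum_integral_int2(1)[OF lterm_integrable_on_cball lterm_norm_integrals_summable[OF assms]])
    fix x
    show "(\<lambda>u. norm (indicator (cball 0 R) x *\<^sub>R lterm d p k \<alpha> u x)) summable_on UNIV"
      using summable_on_cmult_right[OF lattice_term_summable[OF assms], of "indicator (cball 0 R) x" k \<alpha> x] by simp
  qed
  from integrable_mult_right[OF this, of "1 / (4 * of_real pi)"]
  show ?thesis by (simp add: Gfun_def infsum_scaleR_right)
qed

text \<open>Tested against \<open>\<phi>\<close>, every spherical wave contributes \<open>- 4 \<pi>\<close> times the value of \<open>\<phi>\<close> at its source;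
  the prefactor \<open>1/(4 \<pi>)\<close> of the series and the substitution \<open>(m, n) \<mapsto> (- m, - n)\<close> do the rest.\<close>

theorem Gfun_helmholtz:
  assumes "d > 0" "p \<ge> 3"
  shows "helmholtz_distr k (Gfun d p k \<alpha>) (\<lambda>\<phi>. - source_distr v1 v2 d p \<alpha> \<phi>)"
  unfolding helmholtz_distr_def
proof (intro conjI allI impI)
  show "locally_integrable (Gfun d p k \<alpha>)"
    unfolding locally_integrable_def
  proof (intro allI impI)
    fix K :: "((real^2) \<times> real) set" assume K: "compact K"
    then obtain R where "\<And>x. x \<in> K \<Longrightarrow> norm x \<le> R"
      using compact_imp_bounded[OF K] unfolding bounded_iff by auto
    then have R: "K \<subseteq> cball 0 R" by auto
    have "set_integrable lborel (cball 0 R) (Gfun d p k \<alpha>)"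
      unfolding set_integrable_def by (rule Gfun_set_integrable[OF assms])
    then show "set_integrable lborel K (Gfun d p k \<alpha>)"
      using K R by (rule_tac set_integrable_subset) (auto simp: compact_imp_closed)
  qed
next
  fix \<phi> :: "(real^2) \<times> real \<Rightarrow> complex" assume tf: "test_function \<phi>"
  define F where "F x = laplacian \<phi> x + (of_real k)\<^sup>2 * \<phi> x" for x
  obtain R where R: "\<And>x. norm x > R \<Longrightarrow> \<phi> x = 0" "\<And>x. norm x > R \<Longrightarrow> laplacian \<phi> x = 0" 
    and cont: "continuous_on UNIV \<phi>" "continuous_on UNIV (laplacian \<phi>)"
    by (rule test_function_facts[OF tf]) (rule that; assumption)
  have cF: "continuous_on UNIV F" unfolding F_def[abs_def] by (intro continuous_intros cont)
  have RF: "F x = 0" if "norm x > R" for x using R that by (simp add: F_def)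
  have "compact (F ` cball 0 R)" by (intro compact_continuous_image continuous_on_subset[OF cF]) auto
  then obtain B0 where B0: "\<And>x. x \<in> cball 0 R \<Longrightarrow> norm (F x) \<le> B0"
    using compact_imp_bounded bounded_iff by (metis image_eqI)
  define B where "B = max B0 0"
  have B: "B \<ge> 0" "norm (F x) \<le> B * indicator (cball 0 R) x" for x
    using B0[of x] RF[of x] by (auto simp: B_def indicator_def)
  define g where "g u x = lterm d p k \<alpha> u x * F x" for u x
  define val where "val m n = (\<Sum>q=0..p. cis (- (\<alpha> \<bullet> lat v1 v2 m n)) * fd_coeff p q * (- 4 * pi * \<phi> (source_pt v1 v2 d (- m) (- n) q)))" for m n
  have dim: "DIM((real^2) \<times> real) = 3" by simp
  have gi: "integrable lborel (g (m, n))" and gv: "(LINT x|lborel. g (m, n) x) = val m n" for m n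
  proof -
    note fs = fundamental_solution[OF tf dim, of "of_real k", simplified, folded F_def]
    have g_eq: "g (m, n) = (\<lambda>x. \<Sum>q=0..p. cis (- (\<alpha> \<bullet> lat v1 v2 m n)) * fd_coeff p q * (sph (of_real k) (norm (x - source_pt v1 v2 d (- m) (- n) q)) * F x))"
      by (simp add: g_def lattice_term_eq_sph sum_distrib_right mult.assoc fun_eq_iff)
    show "integrable lborel (g (m, n))" unfolding g_eq
      by (intro Bochner_Integration.integrable_sum integrable_mult_right fs(1))
    show "(LINT x|lborel. g (m, n) x) = val m n" unfolding g_eq val_def
      by (subst Bochner_Integration.integral_sum) (auto intro!: sum.cong integrable_mult_right fs(1) simp: fs(2))
  qed
  have gi': "integrable lborel (g u)" for u using gi by (cases u) auto
  have gb: "norm (g u x) \<le> B * norm (indicator (cball 0 R) x *\<^sub>R lterm d p k \<alpha> u x)" for u x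
    using mult_left_mono[OF B(2)[of x], of "norm (lterm d p k \<alpha> u x)"] unfolding g_def norm_mult norm_scaleR by (simp add: mult_ac)
  have sm: "(\<lambda>u. LINT x|lborel. norm (g u x)) summable_on UNIV"
  proof (rule summable_on_comparison_test[OF summable_on_cmult_right[OF lterm_norm_integrals_summable[OF assms], of B R k \<alpha>]])
    fix u
    have "(LINT x|lborel. norm (g u x)) \<le> (LINT x|lborel. B * norm (indicator (cball 0 R) x *\<^sub>R lterm d p k \<alpha> u x))"
      by (intro integral_mono integrable_norm gi' integrable_mult_right lterm_integrable_on_cball gb)
    then show "(LINT x|lborel. norm (g u x)) \<le> B * (LINT x|lborel. norm (indicator (cball 0 R) x *\<^sub>R lterm d p k \<alpha> u x))"
      by (simp only: integral_mult_right_zero)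
  qed simp
  have pt: "(\<lambda>u. norm (g u x)) summable_on UNIV" for x
    using summable_on_cmult_left[OF lattice_term_summable[OF assms], of k \<alpha> x "norm (F x)"] by (simp add: g_def norm_mult)
  have hs: "((\<lambda>u. LINT x|lborel. g u x) has_sum (LINT x|lborel. infsum (\<lambda>u. g u x) UNIV)) UNIV"
    by (rule infsum_integral_int2(2)[OF gi' sm pt])
  have "(infsum (\<lambda>u. g u x) UNIV) = (\<Sum>\<^sub>\<infinity>u\<in>UNIV. lterm d p k \<alpha> u x) * F x" for x
    unfolding g_def by (rule infsum_cmult_left')
  then have "(LINT x|lborel. Gfun d p k \<alpha> x * F x) = (LINT x|lborel. 1 / (4 * of_real pi) * (infsum (\<lambda>u. g u x) UNIV))"
    by (simp add: Gfun_def)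
  also have "\<dots> = 1 / (4 * of_real pi) * (LINT x|lborel. infsum (\<lambda>u. g u x) UNIV)"
    by (rule integral_mult_right_zero)
  also have "(LINT x|lborel. infsum (\<lambda>u. g u x) UNIV) = (\<Sum>\<^sub>\<infinity>u\<in>UNIV. LINT x|lborel. g u x)"
    using infsumI[OF hs] by simp
  also have "\<dots> = (\<Sum>\<^sub>\<infinity>u\<in>UNIV. (\<lambda>(m, n). - 4 * of_real pi * (\<Sum>q=0..p. fd_coeff p q * cis (\<alpha> \<bullet> lat v1 v2 m n) * \<phi> (source_pt v1 v2 d m n q))) ((\<lambda>(m, n). (- m, - n)) u))"
  proof (rule infsum_cong)
    fix u :: "int \<times> int"
    obtain m n where u: "u = (m, n)" by (cases u)
    have "lat v1 v2 (- m) (- n) = - lat v1 v2 m n" by (simp add: lat_def)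
    then show "(LINT x|lborel. g u x) = (\<lambda>(m, n). - 4 * of_real pi * (\<Sum>q=0..p. fd_coeff p q * cis (\<alpha> \<bullet> lat v1 v2 m n) * \<phi> (source_pt v1 v2 d m n q))) ((\<lambda>(m, n). (- m, - n)) u)"
      unfolding u gv val_def by (simp add: sum_distrib_left mult_ac)
  qed
  also have "\<dots> = (\<Sum>\<^sub>\<infinity>(m, n)\<in>UNIV. - 4 * of_real pi * (\<Sum>q=0..p. fd_coeff p q * cis (\<alpha> \<bullet> lat v1 v2 m n) * \<phi> (source_pt v1 v2 d m n q)))"
    by (rule infsum_reindex_bij_betw) (rule bij_betw_byWitness[of _ "\<lambda>(m, n). (- m, - n)"], auto)
  also have "\<dots> = - 4 * of_real pi * source_distr v1 v2 d p \<alpha> \<phi>"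
    unfolding source_distr_def by (subst infsum_cmult_right'[symmetric]) (rule infsum_cong, auto)
  finally show "(LINT x|lborel. Gfun d p k \<alpha> x * (laplacian \<phi> x + (of_real k)\<^sup>2 * \<phi> x)) = - source_distr v1 v2 d p \<alpha> \<phi>"
    by (simp add: F_def)
qed

end

section \<open>Gaussian integrals\<close>

text \<open>A rescaling of the characteristic function of the standard normal distribution.\<close>

lemma gaussian_fourier:
  fixes c b :: real
  assumes c: "c > 0"
  shows "integrable lborel (\<lambda>x. of_real (exp (- c * x\<^sup>2)) * cis (- b * x))"
    and "(LINT x|lborel. of_real (exp (- c * x\<^sup>2)) * cis (- b * x)) = of_real (sqrt (pi / c) * exp (- b\<^sup>2 / (4 * c)))"
proof -
  interpret std: prob_space std_normal_distribution by (rule real_dist_normal_dist[THEN real_distribution.axioms(1)])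
  define \<tau> where "\<tau> = sqrt (2 * c)"
  have \<tau>: "\<tau> > 0" "\<tau>\<^sup>2 = 2 * c" using c by (auto simp: \<tau>_def)
  define t where "t = - b / \<tau>"
  let ?g = "\<lambda>x. complex_of_real (std_normal_density x) * iexp (t * x)"
  have ig: "integrable lborel ?g"
  proof (rule Bochner_Integration.integrable_bound[OF integrable_normal_density[of 1 0]])
    show "AE x in lborel. norm (?g x) \<le> norm (normal_density 0 1 x)"
      by (rule AE_I2) (simp add: norm_mult)
  qed (auto simp: normal_density_def)
  have gv: "(LINT x|lborel. ?g x) = of_real (exp (- t\<^sup>2 / 2))"
  proof -
    have "(LINT x|lborel. ?g x) = char std_normal_distribution t"
      unfolding char_def by (subst integral_density) (auto simp: scaleR_conv_of_real)
    then show ?thesis by (simp add: char_std_normal_distribution)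
  qed
  have pt: "?g (\<tau> * x) = of_real (1 / sqrt (2 * pi)) * (of_real (exp (- c * x\<^sup>2)) * cis (- b * x))" for x
  proof -
    have "(\<tau> * x)\<^sup>2 / 2 = c * x\<^sup>2" using \<tau>(2) by (simp add: power_mult_distrib)
    moreover have "t * (\<tau> * x) = - b * x" using \<tau>(1) by (simp add: t_def)
    ultimately show ?thesis by (simp add: std_normal_density_def cis_conv_exp)
  qed
  have "integrable lborel (\<lambda>x. ?g (0 + \<tau> * x))"
    using lborel_integrable_real_affine[OF ig, of \<tau> 0] \<tau> by simp
  then have i1: "integrable lborel (\<lambda>x. of_real (1 / sqrt (2 * pi)) * (of_real (exp (- c * x\<^sup>2)) * cis (- b * x)))"
    unfolding add_0 pt .
  show "integrable lborel (\<lambda>x. of_real (exp (- c * x\<^sup>2)) * cis (- b * x))"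
  proof -
    have "of_real (sqrt (2 * pi)) * (of_real (1 / sqrt (2 * pi)) * w) = w" for w :: complex by simp
    then show ?thesis using integrable_mult_right[OF i1, of "of_real (sqrt (2 * pi))"] by (simp only:)
  qed
  have "of_real (exp (- t\<^sup>2 / 2)) = \<bar>\<tau>\<bar> *\<^sub>R (LINT x|lborel. ?g (0 + \<tau> * x))"
    unfolding gv[symmetric] by (rule lborel_integral_real_affine) (use \<tau> in auto)
  also have "\<dots> = of_real \<tau> * (of_real (1 / sqrt (2 * pi)) * (LINT x|lborel. of_real (exp (- c * x\<^sup>2)) * cis (- b * x)))"
    unfolding add_0 pt integral_mult_right_zero using \<tau> by (simp add: scaleR_conv_of_real)
  finally have "(LINT x|lborel. of_real (exp (- c * x\<^sup>2)) * cis (- b * x)) = of_real (exp (- t\<^sup>2 / 2)) * of_real (sqrt (2 * pi) / \<tau>)"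
    using \<tau>(1) by (simp add: field_simps)
  also have "sqrt (2 * pi) / \<tau> = sqrt (pi / c)"
    unfolding \<tau>_def using c by (simp add: real_sqrt_divide[symmetric])
  also have "- t\<^sup>2 / 2 = - b\<^sup>2 / (4 * c)" using \<tau> by (simp add: t_def power_divide)
  finally show "(LINT x|lborel. of_real (exp (- c * x\<^sup>2)) * cis (- b * x)) = of_real (sqrt (pi / c) * exp (- b\<^sup>2 / (4 * c)))"
    by (simp add: mult.commute)
qed

text \<open>An error function, with its limits at both ends; \<open>gaussian_reciprocal_integrals\<close> expresses its
  antiderivatives through it.\<close>

lemma gaussian_antiderivative:
  obtains F :: "real \<Rightarrow> real" where "\<And>x. (F has_real_derivative exp (- x\<^sup>2)) (at x)"
    "(F \<longlongrightarrow> sqrt pi / 2) at_top" "(F \<longlongrightarrow> - (sqrt pi / 2)) at_bot"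
proof -
  define F where "F x = (LBINT y=ereal 0..ereal x. exp (- y\<^sup>2))" for x
  have cont: "continuous_on S (\<lambda>y::real. exp (- y\<^sup>2))" for S by (intro continuous_intros)
  have D: "(F has_real_derivative exp (- x\<^sup>2)) (at x)" for x
  proof -
    have "((\<lambda>u. LBINT y=ereal 0..ereal u. exp (- y\<^sup>2)) has_vector_derivative exp (- x\<^sup>2)) (at x within {- \<bar>x\<bar> - 1..\<bar>x\<bar> + 1})"
      by (rule interval_integral_FTC2) (auto intro: cont)
    moreover have "at x within {- \<bar>x\<bar> - 1..\<bar>x\<bar> + 1} = at x" by (rule at_within_Icc_at) auto
    ultimately show ?thesis unfolding F_def[abs_def] by (simp add: has_real_derivative_iff_has_vector_derivative)
  qed
  have F0: "F 0 = 0" by (simp add: F_def zero_ereal_def)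
  have odd: "F (- x) = - F x" for x
  proof -
    have "((\<lambda>x. F (- x) + F x) has_real_derivative 0) (at x)" for x
      using D[of "- x"] D[of x] by (auto intro!: derivative_eq_intros DERIV_chain2[of F])
    then have "F (- x) + F x = F (- 0) + F 0" by (intro DERIV_isconst_all) auto
    then show ?thesis by (simp add: F0)
  qed
  have eqF: "(LINT y|lborel. exp (- y\<^sup>2) * indicator {0..x} y) = F x" if "x \<ge> 0" for x
    using integral_FTC_Icc_real[OF that D] F0 by (simp add: continuous_intros)
  have g0: "integrable lborel (\<lambda>y::real. indicator {0..} y *\<^sub>R exp (- y\<^sup>2))" "(LINT y|lborel. indicator {0..} y *\<^sub>R exp (- y\<^sup>2)) = sqrt pi / 2"
    using gaussian_moment_0 by (auto simp: has_bochner_integral_iff)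
  have "((\<lambda>x::real. LINT y|lborel. (exp (- y\<^sup>2) * indicator {0..x} y :: real)) \<longlongrightarrow> (LINT (y::real)|lborel. indicator {0..} y *\<^sub>R exp (- y\<^sup>2))) at_top"
  proof (rule integral_dominated_convergence_at_top[OF _ _ g0(1)])
    have "((\<lambda>x. exp (- y\<^sup>2) * indicator {0..x} y :: real) \<longlongrightarrow> indicator {0..} y *\<^sub>R exp (- y\<^sup>2)) at_top" for y :: real
    proof -
      have "\<forall>\<^sub>F x in at_top. (exp (- y\<^sup>2) * indicator {0..x} y :: real) = indicator {0..} y *\<^sub>R exp (- y\<^sup>2)"
        using eventually_ge_at_top[of y] by eventually_elim (auto simp: indicator_def)
      then show ?thesis by (rule tendsto_eventually)
    qed
    then show "AE y::real in lborel. ((\<lambda>x. exp (- y\<^sup>2) * indicator {0..x} y :: real) \<longlongrightarrow> indicator {0..} y *\<^sub>R exp (- y\<^sup>2)) at_top"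
      by simp
    show "\<forall>\<^sub>F x in at_top. AE y::real in lborel. norm (exp (- y\<^sup>2) * indicator {0..x} y :: real) \<le> indicator {0..} y *\<^sub>R exp (- y\<^sup>2)"
      by (intro always_eventually allI AE_I2) (auto simp: indicator_def)
  qed auto
  note lim = this
  have "\<forall>\<^sub>F x in at_top. (LINT y|lborel. exp (- y\<^sup>2) * indicator {0..x} y) = F x"
    using eventually_ge_at_top[of 0] by eventually_elim (rule eqF)
  from Lim_transform_eventually[OF lim this] have top: "(F \<longlongrightarrow> sqrt pi / 2) at_top"
    unfolding g0(2) .
  have "((\<lambda>x. - F (- x)) \<longlongrightarrow> - (sqrt pi / 2)) at_bot"
    by (intro tendsto_minus filterlim_compose[OF top filterlim_uminus_at_top_at_bot])
  then have "(F \<longlongrightarrow> - (sqrt pi / 2)) at_bot" by (simp add: odd)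
  then show ?thesis using that D top by blast
qed

text \<open>The integrand is a Gaussian in \<open>a u \<plusminus> b/u\<close>: with the antiderivative \<open>F\<close> of the Gaussian, the functions
  \<open>F (a u + b/u)\<close> and \<open>F (a u - b/u)\<close>, suitably scaled, have derivatives \<open>f u (a \<mp> b/u\<^sup>2)\<close>, and their
  combinations are antiderivatives of \<open>f\<close> and of \<open>f/u\<^sup>2\<close>.\<close>

lemma gaussian_reciprocal_integrals:
  fixes a b :: real
  assumes a: "a > 0" and b: "b > 0" and f: "f = (\<lambda>u. exp (- (a\<^sup>2 * u\<^sup>2) - b\<^sup>2 / u\<^sup>2))"
  shows "set_integrable lborel {0<..} f" "(LINT u:{0<..}|lborel. f u) = sqrt pi / (2 * a) * exp (- 2 * a * b)"
    "set_integrable lborel {0<..} (\<lambda>u. f u / u\<^sup>2)" "(LINT u:{0<..}|lborel. f u / u\<^sup>2) = sqrt pi / (2 * b) * exp (- 2 * a * b)"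
proof -
  obtain F :: "real \<Rightarrow> real" where D: "\<And>x. (F has_real_derivative exp (- x\<^sup>2)) (at x)"
    and top: "(F \<longlongrightarrow> sqrt pi / 2) at_top" and bot: "(F \<longlongrightarrow> - (sqrt pi / 2)) at_bot"
    by (rule gaussian_antiderivative) (rule that; assumption)
  define P where "P u = exp (2 * a * b) * F (a * u + b / u)" for u
  define N where "N u = exp (- 2 * a * b) * F (a * u - b / u)" for u
  have dP: "(P has_real_derivative f u * (a - b / u\<^sup>2)) (at u)" and dN: "(N has_real_derivative f u * (a + b / u\<^sup>2)) (at u)"
    if u: "u > 0" for u
  proof -
    have 1: "((\<lambda>u. a * u + b / u) has_real_derivative (a - b / u\<^sup>2)) (at u)"
      and 2: "((\<lambda>u. a * u - b / u) has_real_derivative (a + b / u\<^sup>2)) (at u)"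
      using u by (auto intro!: derivative_eq_intros simp: power2_eq_square)
    have e1: "exp (2 * a * b) * exp (- (a * u + b / u)\<^sup>2) = f u"
      and e2: "exp (- 2 * a * b) * exp (- (a * u - b / u)\<^sup>2) = f u"
      using u unfolding f exp_add[symmetric] by (auto simp: field_simps power2_eq_square)
    show "(P has_real_derivative f u * (a - b / u\<^sup>2)) (at u)"
      using DERIV_cmult[OF DERIV_chain2[OF D 1], of "exp (2 * a * b)"] unfolding P_def[abs_def] mult.assoc[symmetric] e1 .
    show "(N has_real_derivative f u * (a + b / u\<^sup>2)) (at u)"
      using DERIV_cmult[OF DERIV_chain2[OF D 2], of "exp (- 2 * a * b)"] unfolding N_def[abs_def] mult.assoc[symmetric] e2 .
  qed
  have lim: "filterlim (\<lambda>u. a * u + b / u) at_top at_top" "filterlim (\<lambda>u. a * u - b / u) at_top at_top"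
    "filterlim (\<lambda>u. a * u + b / u) at_top (at_right 0)" "filterlim (\<lambda>u. a * u - b / u) at_bot (at_right 0)"
    using a b by real_asymp+
  define S where "S = sqrt pi / 2"
  have P_top: "(P \<longlongrightarrow> exp (2 * a * b) * S) at_top" and N_top: "(N \<longlongrightarrow> exp (- 2 * a * b) * S) at_top"
    and P_0: "(P \<longlongrightarrow> exp (2 * a * b) * S) (at_right 0)" and N_0: "(N \<longlongrightarrow> exp (- 2 * a * b) * (- S)) (at_right 0)"
    unfolding P_def[abs_def] N_def[abs_def] S_def
    by (intro tendsto_mult tendsto_const filterlim_compose[OF top] filterlim_compose[OF bot] lim)+
  have cf: "isCont f u" if "u > 0" for u unfolding f using that by (intro continuous_intros) auto
  have fnn: "f u > 0" for u unfolding f by simp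
  have ei: "einterval 0 \<infinity> = {0<..}" by (auto simp: einterval_def zero_ereal_def)
  have I: "set_integrable lborel {0<..} g \<and> (LINT u:{0<..}|lborel. g u) = B - A"
    if g: "\<And>u. u > 0 \<Longrightarrow> (H has_real_derivative g u) (at u)" "\<And>u. u > 0 \<Longrightarrow> isCont g u" "\<And>u. u > 0 \<Longrightarrow> g u \<ge> 0"
      "(H \<longlongrightarrow> A) (at_right 0)" "(H \<longlongrightarrow> B) at_top" for g H :: "real \<Rightarrow> real" and A B
  proof -
    have "set_integrable lborel (einterval 0 \<infinity>) g" "(LBINT u=0..\<infinity>. g u) = B - A"
      by (rule interval_integral_FTC_nonneg[where F = H]; use g in \<open>simp add: zero_ereal_def ereal_tendsto_simps\<close>)+
    then show ?thesis by (simp add: interval_lebesgue_integral_def ei)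
  qed
  have 1: "set_integrable lborel {0<..} f \<and> (LINT u:{0<..}|lborel. f u) =
     1 / (2 * a) * (exp (2 * a * b) * S + exp (- 2 * a * b) * S) - 1 / (2 * a) * (exp (2 * a * b) * S + exp (- 2 * a * b) * (- S))"
  proof (rule I[where H = "\<lambda>u. 1 / (2 * a) * (P u + N u)"])
    fix u :: real assume u: "u > 0"
    show "((\<lambda>u. 1 / (2 * a) * (P u + N u)) has_real_derivative f u) (at u)"
      using DERIV_cmult[OF DERIV_add[OF dP[OF u] dN[OF u]], of "1 / (2 * a)"] a by (simp add: field_simps)
  next
    show "((\<lambda>u. 1 / (2 * a) * (P u + N u)) \<longlongrightarrow> 1 / (2 * a) * (exp (2 * a * b) * S + exp (- 2 * a * b) * (- S))) (at_right 0)"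
      "((\<lambda>u. 1 / (2 * a) * (P u + N u)) \<longlongrightarrow> 1 / (2 * a) * (exp (2 * a * b) * S + exp (- 2 * a * b) * S)) at_top"
      by (intro tendsto_mult tendsto_add tendsto_const P_top N_top P_0 N_0)+
  qed (use cf fnn less_imp_le in auto)
  have 2: "set_integrable lborel {0<..} (\<lambda>u. f u / u\<^sup>2) \<and> (LINT u:{0<..}|lborel. f u / u\<^sup>2) =
     1 / (2 * b) * (exp (- 2 * a * b) * S - exp (2 * a * b) * S) - 1 / (2 * b) * (exp (- 2 * a * b) * (- S) - exp (2 * a * b) * S)"
  proof (rule I[where H = "\<lambda>u. 1 / (2 * b) * (N u - P u)"])
    fix u :: real assume u: "u > 0"
    show "((\<lambda>u. 1 / (2 * b) * (N u - P u)) has_real_derivative f u / u\<^sup>2) (at u)"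
      using DERIV_cmult[OF DERIV_diff[OF dN[OF u] dP[OF u]], of "1 / (2 * b)"] b by (simp add: field_simps)
    show "isCont (\<lambda>u. f u / u\<^sup>2) u" using cf[OF u] u by (intro continuous_intros) auto
    show "f u / u\<^sup>2 \<ge> 0" using fnn[of u] by simp
  next
    show "((\<lambda>u. 1 / (2 * b) * (N u - P u)) \<longlongrightarrow> 1 / (2 * b) * (exp (- 2 * a * b) * (- S) - exp (2 * a * b) * S)) (at_right 0)"
      "((\<lambda>u. 1 / (2 * b) * (N u - P u)) \<longlongrightarrow> 1 / (2 * b) * (exp (- 2 * a * b) * S - exp (2 * a * b) * S)) at_top"
      by (intro tendsto_mult tendsto_diff tendsto_const P_top N_top P_0 N_0)+
  qed
  show "set_integrable lborel {0<..} f" "set_integrable lborel {0<..} (\<lambda>u. f u / u\<^sup>2)" using 1 2 by auto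
  show "(LINT u:{0<..}|lborel. f u) = sqrt pi / (2 * a) * exp (- 2 * a * b)"
    using conjunct2[OF 1] a by (simp add: S_def field_simps)
  show "(LINT u:{0<..}|lborel. f u / u\<^sup>2) = sqrt pi / (2 * b) * exp (- 2 * a * b)"
    using conjunct2[OF 2] b by (simp add: S_def field_simps)
qed

lemma gaussian_fourier_shifted:
  fixes c b h :: real
  assumes c: "c > 0"
  shows "integrable lborel (\<lambda>t. of_real (exp (- c * (t + h)\<^sup>2)) * cis (- b * t))"
    and "(LINT t|lborel. of_real (exp (- c * (t + h)\<^sup>2)) * cis (- b * t)) = cis (b * h) * of_real (sqrt (pi / c) * exp (- b\<^sup>2 / (4 * c)))"
proof -
  let ?g = "\<lambda>t. of_real (exp (- c * t\<^sup>2)) * cis (- b * t)"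
  have e: "of_real (exp (- c * (t + h)\<^sup>2)) * cis (- b * t) = cis (b * h) * ?g (h + 1 * t)" for t
    by (simp add: cis_mult algebra_simps)
  have "integrable lborel (\<lambda>t. ?g (h + 1 * t))"
    using lborel_integrable_real_affine[OF gaussian_fourier(1)[OF c, of b], of 1 h] by simp
  then show "integrable lborel (\<lambda>t. of_real (exp (- c * (t + h)\<^sup>2)) * cis (- b * t))"
    unfolding e by (rule integrable_mult_right)
  have "(LINT t|lborel. ?g (h + 1 * t)) = (LINT t|lborel. ?g t)"
    using lborel_integral_real_affine[of 1 ?g h] by simp
  then show "(LINT t|lborel. of_real (exp (- c * (t + h)\<^sup>2)) * cis (- b * t)) = cis (b * h) * of_real (sqrt (pi / c) * exp (- b\<^sup>2 / (4 * c)))"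
    unfolding e integral_mult_right_zero using gaussian_fourier(2)[OF c, of b] by simp
qed

text \<open>Completing the square in the second variable reduces the integral to two one-dimensional ones.\<close>

lemma gaussian_fourier_2d:
  fixes A B C a b :: real
  assumes C: "C > 0" and D: "A * C - B\<^sup>2 > 0"
  defines "q \<equiv> \<lambda>(s, t). A * s\<^sup>2 + 2 * B * s * t + C * t\<^sup>2"
  shows "integrable lborel (\<lambda>x. of_real (exp (- q x)) * cis (- (a * fst x + b * snd x)))"
    and "(LINT x|lborel. of_real (exp (- q x)) * cis (- (a * fst x + b * snd x)))
       = of_real (pi / sqrt (A * C - B\<^sup>2) * exp (- (C * a\<^sup>2 - 2 * B * a * b + A * b\<^sup>2) / (4 * (A * C - B\<^sup>2))))"
proof -
  \<comment> \<open>The coefficient that is left for the first variable after completing the square in the second.\<close>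
  define E where "E = A - B\<^sup>2 / C"
  have E: "E > 0" using C D by (simp add: E_def field_simps)
  let ?f = "\<lambda>x. of_real (exp (- q x)) * cis (- (a * fst x + b * snd x))"
  have split: "?f (s, t) = (of_real (exp (- E * s\<^sup>2)) * cis (- a * s)) * (of_real (exp (- C * (t + B / C * s)\<^sup>2)) * cis (- b * t))" for s t
  proof -
    have "q (s, t) = E * s\<^sup>2 + C * (t + B / C * s)\<^sup>2"
      using C by (simp add: q_def E_def field_simps power2_eq_square)
    then have "exp (- q (s, t)) = exp (- E * s\<^sup>2) * exp (- C * (t + B / C * s)\<^sup>2)"
      by (simp flip: exp_add)
    moreover have "cis (- (a * s + b * t)) = cis (- a * s) * cis (- b * t)" by (simp add: cis_mult)
    ultimately show ?thesis by simp
  qed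
  have inner_i: "integrable lborel (\<lambda>t. ?f (s, t))" for s
    unfolding split by (intro integrable_mult_right gaussian_fourier_shifted C)
  have inner: "(LINT t|lborel. ?f (s, t)) = of_real (exp (- E * s\<^sup>2)) * cis (- (a - b * B / C) * s) * of_real (sqrt (pi / C) * exp (- b\<^sup>2 / (4 * C)))" for s
  proof -
    have "cis (- (a - b * B / C) * s) = cis (- a * s) * cis (b * (B / C * s))" by (simp add: cis_mult algebra_simps)
    then show ?thesis
      unfolding split integral_mult_right_zero gaussian_fourier_shifted(2)[OF C] by (simp only: mult_ac)
  qed
  have inner_n: "(LINT t|lborel. norm (?f (s, t))) = exp (- E * s\<^sup>2) * sqrt (pi / C)" for s
  proof -
    have "norm (?f (s, t)) = exp (- E * s\<^sup>2) * norm (complex_of_real (exp (- C * (t + B / C * s)\<^sup>2)) * cis (- 0 * t))" for t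
      unfolding split by (simp add: norm_mult)
    moreover have "(LINT t|lborel. norm (complex_of_real (exp (- C * (t + B / C * s)\<^sup>2)) * cis (- 0 * t))) = sqrt (pi / C)"
    proof -
      have "(LINT t|lborel. complex_of_real (exp (- C * (t + B / C * s)\<^sup>2)) * cis (- 0 * t)) = of_real (LINT t|lborel. exp (- C * (t + B / C * s)\<^sup>2))"
        by (simp add: integral_complex_of_real)
      then have "complex_of_real (LINT t|lborel. exp (- C * (t + B / C * s)\<^sup>2)) = of_real (sqrt (pi / C))"
        using gaussian_fourier_shifted(2)[OF C, of "B / C * s" 0] by simp
      then show ?thesis by (simp only: of_real_eq_iff) (simp add: norm_mult)
    qed
    ultimately show ?thesis by simp
  qed
  have i: "integrable (lborel \<Otimes>\<^sub>M lborel) ?f"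
  proof (rule lborel_pair.Fubini_integrable)
    show "?f \<in> borel_measurable (lborel \<Otimes>\<^sub>M lborel)" unfolding q_def case_prod_beta cis_conv_exp by measurable
    show "integrable lborel (\<lambda>s. LINT t|lborel. norm (?f (s, t)))"
    proof -
      have "integrable lborel (\<lambda>s. norm (complex_of_real (exp (- E * s\<^sup>2)) * cis (- 0 * s)))"
        by (rule integrable_norm[OF gaussian_fourier(1)[OF E]])
      then show ?thesis unfolding inner_n by (simp add: norm_mult)
    qed
  qed (use inner_i in simp)
  then show "integrable lborel ?f" by (simp add: lborel_prod)
  have "(LINT x|lborel. ?f x) = (LINT s|lborel. LINT t|lborel. ?f (s, t))"
    using lborel_pair.integral_fst'[OF i] by (simp add: lborel_prod)
  also have "\<dots> = of_real (sqrt (pi / E) * exp (- (a - b * B / C)\<^sup>2 / (4 * E))) * of_real (sqrt (pi / C) * exp (- b\<^sup>2 / (4 * C)))"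
    unfolding inner integral_mult_left_zero gaussian_fourier(2)[OF E] ..
  also have "\<dots> = of_real ((sqrt (pi / E) * sqrt (pi / C)) * (exp (- (a - b * B / C)\<^sup>2 / (4 * E)) * exp (- b\<^sup>2 / (4 * C))))"
    by (simp only: of_real_mult mult_ac)
  also have "sqrt (pi / E) * sqrt (pi / C) = pi / sqrt (A * C - B\<^sup>2)"
  proof -
    have "E * C = A * C - B\<^sup>2" using C by (simp add: E_def field_simps)
    then have "(pi / E) * (pi / C) = pi\<^sup>2 / (A * C - B\<^sup>2)" by (simp add: power2_eq_square)
    then have "sqrt (pi / E) * sqrt (pi / C) = sqrt (pi\<^sup>2 / (A * C - B\<^sup>2))"
      by (simp only: real_sqrt_mult[symmetric])
    then show ?thesis by (simp add: real_sqrt_divide)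
  qed
  also have "exp (- (a - b * B / C)\<^sup>2 / (4 * E)) * exp (- b\<^sup>2 / (4 * C)) = exp (- (C * a\<^sup>2 - 2 * B * a * b + A * b\<^sup>2) / (4 * (A * C - B\<^sup>2)))"
  proof -
    have EC: "E = (A * C - B\<^sup>2) / C" using C by (simp add: E_def field_simps)
    have "(a - b * B / C)\<^sup>2 / (4 * E) + b\<^sup>2 / (4 * C) = ((a * C - b * B)\<^sup>2 + b\<^sup>2 * (A * C - B\<^sup>2)) / (4 * C * (A * C - B\<^sup>2))"
    proof -
      have "a - b * B / C = (a * C - b * B) / C" using C by (simp add: field_simps)
      then have "(a - b * B / C)\<^sup>2 / (4 * E) = (a * C - b * B)\<^sup>2 / (4 * C * (A * C - B\<^sup>2))"
        using C D by (simp add: EC power_divide power2_eq_square[of C])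
      moreover have "b\<^sup>2 / (4 * C) = b\<^sup>2 * (A * C - B\<^sup>2) / (4 * C * (A * C - B\<^sup>2))" using D by simp
      ultimately show ?thesis by (simp add: add_divide_distrib)
    qed
    also have "(a * C - b * B)\<^sup>2 + b\<^sup>2 * (A * C - B\<^sup>2) = C * (C * a\<^sup>2 - 2 * B * a * b + A * b\<^sup>2)"
      by (simp add: power2_eq_square algebra_simps)
    finally have e: "(a - b * B / C)\<^sup>2 / (4 * E) + b\<^sup>2 / (4 * C) = (C * a\<^sup>2 - 2 * B * a * b + A * b\<^sup>2) / (4 * (A * C - B\<^sup>2))"
      using C by simp
    have "exp (- (a - b * B / C)\<^sup>2 / (4 * E)) * exp (- b\<^sup>2 / (4 * C)) = exp (- ((a - b * B / C)\<^sup>2 / (4 * E) + b\<^sup>2 / (4 * C)))"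
      by (simp add: exp_add[symmetric])
    then show ?thesis unfolding e minus_divide_left .
  qed
  finally show "(LINT x|lborel. ?f x) = of_real (pi / sqrt (A * C - B\<^sup>2) * exp (- (C * a\<^sup>2 - 2 * B * a * b + A * b\<^sup>2) / (4 * (A * C - B\<^sup>2))))" .
qed

section \<open>The Weyl identity\<close>

text \<open>A product of two such factors is an integrable majorant on the plane that decays like \<open>\<parallel>x\<parallel>\<close> to the
  power \<open>- 3\<close> along the diagonals. Being a product, it is integrated, summed and translated one
  coordinate at a time.\<close>

definition majorant :: "real \<Rightarrow> real" where "majorant s = (1 + \<bar>s\<bar>) powr (- (3/2))"

lemma majorant_pos: "majorant s > 0" by (simp add: majorant_def add_pos_nonneg)

lemma majorant_measurable[measurable]: "majorant \<in> borel_measurable borel"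
  unfolding majorant_def[abs_def] by measurable

lemma integrable_majorant: "integrable lborel majorant"
proof -
  let ?f = "\<lambda>s::real. (1 + s) powr (- (3/2))"
  have *: "(\<integral>\<^sup>+s\<in>{0..}. ennreal (?f s) \<partial>lborel) = ennreal (0 - (- 2 * (1 + 0) powr (- (1/2))))"
  proof (rule nn_integral_FTC_atLeast)
    show "((\<lambda>s::real. - 2 * (1 + s) powr (- (1/2))) \<longlongrightarrow> 0) at_top" by real_asymp
    show "((\<lambda>s. - 2 * (1 + s) powr (- (1/2))) has_real_derivative ?f s) (at s)" if "0 \<le> s" for s
      using that by (auto intro!: derivative_eq_intros simp: powr_diff)
  qed auto
  have nn: "(\<integral>\<^sup>+s. ennreal (indicator {0..} s * ?f s) \<partial>lborel) = ennreal 2"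
  proof -
    have "ennreal (indicator {0..} s * ?f s) = ennreal (?f s) * indicator {0..} s" for s
      by (simp add: indicator_def)
    then show ?thesis using * by simp
  qed
  have i1: "integrable lborel (\<lambda>s::real. indicator {0..} s * ?f s)"
    by (rule integrableI_nn_integral_finite[OF _ _ nn]) auto
  have i2: "integrable lborel (\<lambda>s::real. indicator {0..} (0 + - 1 * s) * ?f (0 + - 1 * s))"
    using lborel_integrable_real_affine[OF i1, of "- 1" 0] by simp
  show ?thesis
  proof (rule Bochner_Integration.integrable_bound[OF Bochner_Integration.integrable_add[OF i1 i2]])
    show "AE s in lborel. norm (majorant s) \<le> norm (indicator {0..} s * ?f s + indicator {0..} (0 + - 1 * s) * ?f (0 + - 1 * s))"
      by (rule AE_I2) (auto simp: majorant_def indicator_def)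
  qed auto
qed

lemma integrable_majorant2: "integrable lborel (\<lambda>x::real \<times> real. majorant (fst x) * majorant (snd x))"
proof -
  have "integrable (lborel \<Otimes>\<^sub>M lborel) (\<lambda>x::real \<times> real. majorant (fst x) * majorant (snd x))"
  proof (rule lborel_pair.Fubini_integrable)
    show "integrable lborel (\<lambda>s. LINT t|lborel. norm (majorant (fst (s, t)) * majorant (snd (s, t))))"
      using integrable_majorant majorant_pos by (simp add: abs_mult less_imp_le)
  qed (use integrable_majorant in \<open>auto intro!: integrable_mult_right\<close>)
  then show ?thesis by (simp add: lborel_prod)
qed

lemma integrable_of_majorant_bound:
  fixes f :: "real \<times> real \<Rightarrow> complex"
  assumes "f \<in> borel_measurable borel" "\<And>x. norm (f x) \<le> C * (majorant (fst x) * majorant (snd x))"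
  shows "integrable lborel f"
proof (rule Bochner_Integration.integrable_bound[OF integrable_mult_right[OF integrable_majorant2, of C]])
  show "AE x in lborel. norm (f x) \<le> norm (C * (majorant (fst x) * majorant (snd x)))"
    using assms(2) by (intro AE_I2) (auto intro: order_trans[OF _ abs_ge_self])
qed (use assms in auto)

text \<open>The exponential absorbs any power; the third is the one comparable with the product majorant.\<close>

lemma screened_decay:
  fixes \<rho> z \<mu> :: real
  assumes "\<rho> \<ge> 0" "z > 0" "\<mu> > 0"
  shows "exp (- \<mu> * sqrt (\<rho>\<^sup>2 + z\<^sup>2)) / sqrt (\<rho>\<^sup>2 + z\<^sup>2) \<le> (max 1 (3 / \<mu>) ^ 3 / z) * (1 / (1 + \<rho>) ^ 3)"
proof -
  let ?r = "sqrt (\<rho>\<^sup>2 + z\<^sup>2)"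
  have r: "?r \<ge> \<rho>" "?r \<ge> z" using assms by (auto intro!: real_le_rsqrt)
  have "1 + \<rho> \<le> max 1 (3 / \<mu>) * (1 + \<mu> * ?r / 3)"
  proof -
    have "\<rho> = 3 / \<mu> * (\<mu> * \<rho> / 3)" using assms by simp
    also have "\<dots> \<le> max 1 (3 / \<mu>) * (\<mu> * ?r / 3)" using assms r by (intro mult_mono) auto
    finally have "1 + \<rho> \<le> max 1 (3 / \<mu>) * 1 + max 1 (3 / \<mu>) * (\<mu> * ?r / 3)"
      using max.cobounded1[of 1 "3 / \<mu>"] by linarith
    then show ?thesis by (simp only: distrib_left)
  qed
  then have "(1 + \<rho>) ^ 3 \<le> (max 1 (3 / \<mu>) * (1 + \<mu> * ?r / 3)) ^ 3" using assms by (intro power_mono) auto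
  also have "\<dots> = max 1 (3 / \<mu>) ^ 3 * (1 + \<mu> * ?r / 3) ^ 3" by (rule power_mult_distrib)
  also have "\<dots> \<le> max 1 (3 / \<mu>) ^ 3 * exp (\<mu> * ?r)"
  proof -
    have "\<mu> * ?r \<ge> 0" using assms r by (intro mult_nonneg_nonneg) auto
    then show ?thesis using exp_ge_one_plus_x_over_n_power_n[of 3 "\<mu> * ?r"] by (intro mult_left_mono) auto
  qed
  finally have "(1 + \<rho>) ^ 3 \<le> max 1 (3 / \<mu>) ^ 3 * exp (\<mu> * ?r)" .
  then have "exp (- \<mu> * ?r) \<le> max 1 (3 / \<mu>) ^ 3 * (1 / (1 + \<rho>) ^ 3)"
    using assms by (simp add: exp_minus field_simps)
  then have "exp (- \<mu> * ?r) / ?r \<le> max 1 (3 / \<mu>) ^ 3 * (1 / (1 + \<rho>) ^ 3) / z"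
    using r assms by (intro frac_le) auto
  then show ?thesis by (simp add: mult.commute)
qed

context dual_lattice
begin

text \<open>Coordinates in which the lattice becomes \<open>\<int>\<^sup>2\<close>.\<close>

definition pt :: "real \<times> real \<Rightarrow> real^2" where "pt x = fst x *\<^sub>R v1 + snd x *\<^sub>R v2"

text \<open>The plane wave of the Fourier transform in lattice coordinates.\<close>

definition wave :: "real^2 \<Rightarrow> real \<times> real \<Rightarrow> complex" where "wave \<kappa> x = cis (- (\<kappa> \<bullet> pt x))"

lemma continuous_pt: "continuous_on S pt"
  unfolding pt_def[abs_def] by (intro continuous_intros)

lemma continuous_wave: "continuous_on S (wave \<kappa>)"
  unfolding wave_def[abs_def] cis_conv_exp by (intro continuous_intros continuous_pt)

lemma pt_measurable[measurable]: "pt \<in> borel_measurable borel"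
  by (intro borel_measurable_continuous_onI continuous_pt)

lemma wave_measurable[measurable]: "wave \<kappa> \<in> borel_measurable borel"
  by (intro borel_measurable_continuous_onI continuous_wave)

lemma norm_wave[simp]: "norm (wave \<kappa> x) = 1" by (simp add: wave_def)

lemma inner_pt: "w1 \<bullet> pt x = fst x" "w2 \<bullet> pt x = snd x"
  by (simp_all add: pt_def inner_simps w1v1 w1v2 w2v1 w2v2)

text \<open>The coordinates of a point are bounded by its norm, so half of the cube can be spent on each.\<close>

lemma pt_decay: "1 / (1 + norm (pt x)) ^ 3 \<le> (1 + W) ^ 3 * (majorant (fst x) * majorant (snd x))"
proof -
  let ?\<rho> = "norm (pt x)"
  have W1: "1 + W > 0" using W_pos by simp
  have *: "(1 + ?\<rho>) powr (- (3/2)) \<le> (1 + W) powr (3/2) * majorant u" if "\<bar>u\<bar> \<le> W * ?\<rho>" for u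
  proof -
    have "(1 + W) * (1 + ?\<rho>) = 1 + W * ?\<rho> + W + ?\<rho>" by (simp add: algebra_simps)
    then have "1 + \<bar>u\<bar> \<le> (1 + W) * (1 + ?\<rho>)" using that W_pos norm_ge_zero[of "pt x"] by linarith
    then have "((1 + W) * (1 + ?\<rho>)) powr (- (3/2)) \<le> majorant u" unfolding majorant_def
      by (intro powr_mono2') auto
    then have "(1 + W) powr (- (3/2)) * (1 + ?\<rho>) powr (- (3/2)) \<le> majorant u" using W1 by (simp add: powr_mult)
    then have "(1 + W) powr (3/2) * ((1 + W) powr (- (3/2)) * (1 + ?\<rho>) powr (- (3/2))) \<le> (1 + W) powr (3/2) * majorant u"
      by (intro mult_left_mono) auto
    also have "(1 + W) powr (3/2) * ((1 + W) powr (- (3/2)) * (1 + ?\<rho>) powr (- (3/2))) = (1 + ?\<rho>) powr (- (3/2))"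
      using W1 by (simp add: mult.assoc[symmetric] powr_add[symmetric])
    finally show ?thesis .
  qed
  have b: "\<bar>fst x\<bar> \<le> W * ?\<rho>" "\<bar>snd x\<bar> \<le> W * ?\<rho>"
    using Cauchy_Schwarz_ineq2[of w1 "pt x"] Cauchy_Schwarz_ineq2[of w2 "pt x"] mult_right_mono[of "norm w1" W ?\<rho>] mult_right_mono[of "norm w2" W ?\<rho>]
    by (auto simp: inner_pt W_def)
  have "1 / (1 + ?\<rho>) ^ 3 = (1 + ?\<rho>) powr (- (3/2)) * (1 + ?\<rho>) powr (- (3/2))"
    by (simp add: powr_add[symmetric] powr_minus_divide add_pos_nonneg)
  also have "\<dots> \<le> ((1 + W) powr (3/2) * majorant (fst x)) * ((1 + W) powr (3/2) * majorant (snd x))"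
    by (intro mult_mono * b) (auto simp: majorant_pos less_imp_le)
  also have "\<dots> = ((1 + W) powr (3/2) * (1 + W) powr (3/2)) * (majorant (fst x) * majorant (snd x))" by (simp only: mult_ac)
  also have "(1 + W) powr (3/2) * (1 + W) powr (3/2) = (1 + W) ^ 3"
    using W1 by (simp add: powr_add[symmetric])
  finally show ?thesis .
qed

text \<open>The Gram matrix of the lattice basis; its determinant is the square of the cell area \<open>D\<close>.\<close>

definition gA where "gA = v1 \<bullet> v1"
definition gB where "gB = v1 \<bullet> v2"
definition gC where "gC = v2 \<bullet> v2"
definition D where "D = \<bar>det2 v1 v2\<bar>"

lemma D_pos: "D > 0" using det2_nz by (simp add: D_def)

lemma gram: "gA * gC - gB\<^sup>2 = D\<^sup>2"
  using det2_power2[of v1 v2] by (simp add: gA_def gB_def gC_def D_def power2_norm_eq_inner)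

lemma gC_pos: "gC > 0" using w2v2 by (auto simp: gC_def)

lemma norm_pt: "(norm (pt x))\<^sup>2 = gA * (fst x)\<^sup>2 + 2 * gB * fst x * snd x + gC * (snd x)\<^sup>2"
  unfolding pt_def gA_def gB_def gC_def power2_norm_eq_inner
  by (simp add: inner_simps inner_commute power2_eq_square algebra_simps)

lemma gram_dual: "gC * (\<kappa> \<bullet> v1)\<^sup>2 - 2 * gB * (\<kappa> \<bullet> v1) * (\<kappa> \<bullet> v2) + gA * (\<kappa> \<bullet> v2)\<^sup>2 = (norm \<kappa>)\<^sup>2 * D\<^sup>2"
  unfolding gA_def gB_def gC_def D_def power2_norm_eq_inner power2_abs det2_def
  by (simp add: inner_vec_def UNIV_2 power2_eq_square algebra_simps)

text \<open>The transform is taken over the coordinates, so that the cell area \<open>D\<close> appears as a Jacobian.\<close>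

lemma gaussian_lattice_fourier:
  assumes u: "u > 0"
  shows "integrable lborel (\<lambda>x. of_real (exp (- u\<^sup>2 * (norm (pt x))\<^sup>2)) * wave \<kappa> x)"
    and "(LINT x|lborel. of_real (exp (- u\<^sup>2 * (norm (pt x))\<^sup>2)) * wave \<kappa> x) = of_real (pi / (u\<^sup>2 * D) * exp (- (norm \<kappa>)\<^sup>2 / (4 * u\<^sup>2)))"
proof -
  let ?A = "u\<^sup>2 * gA" and ?B = "u\<^sup>2 * gB" and ?C = "u\<^sup>2 * gC" and ?a = "\<kappa> \<bullet> v1" and ?b = "\<kappa> \<bullet> v2"
  have disc: "?A * ?C - ?B\<^sup>2 = (u\<^sup>2 * D)\<^sup>2"
  proof -
    have "?A * ?C - ?B\<^sup>2 = u\<^sup>2 * u\<^sup>2 * (gA * gC - gB\<^sup>2)" by (simp add: power2_eq_square algebra_simps)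
    then show ?thesis unfolding gram by (simp add: power2_eq_square)
  qed
  have C: "?C > 0" and dp: "?A * ?C - ?B\<^sup>2 > 0" unfolding disc using u gC_pos D_pos by auto
  have e: "of_real (exp (- u\<^sup>2 * (norm (pt x))\<^sup>2)) * wave \<kappa> x =
     of_real (exp (- (case x of (s, t) \<Rightarrow> ?A * s\<^sup>2 + 2 * ?B * s * t + ?C * t\<^sup>2))) * cis (- (?a * fst x + ?b * snd x))" for x
    unfolding norm_pt wave_def by (cases x) (simp add: pt_def inner_simps algebra_simps)
  show "integrable lborel (\<lambda>x. of_real (exp (- u\<^sup>2 * (norm (pt x))\<^sup>2)) * wave \<kappa> x)"
    unfolding e by (rule gaussian_fourier_2d(1)[OF C dp])
  have "sqrt (?A * ?C - ?B\<^sup>2) = u\<^sup>2 * D" unfolding disc using u D_pos by simp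
  moreover have "(?C * ?a\<^sup>2 - 2 * ?B * ?a * ?b + ?A * ?b\<^sup>2) / (4 * (?A * ?C - ?B\<^sup>2)) = (norm \<kappa>)\<^sup>2 / (4 * u\<^sup>2)"
  proof -
    have "?C * ?a\<^sup>2 - 2 * ?B * ?a * ?b + ?A * ?b\<^sup>2 = u\<^sup>2 * ((norm \<kappa>)\<^sup>2 * D\<^sup>2)"
      unfolding gram_dual[symmetric] by (simp add: algebra_simps)
    then show ?thesis unfolding disc using u D_pos by (simp add: power2_eq_square)
  qed
  ultimately show "(LINT x|lborel. of_real (exp (- u\<^sup>2 * (norm (pt x))\<^sup>2)) * wave \<kappa> x) = of_real (pi / (u\<^sup>2 * D) * exp (- (norm \<kappa>)\<^sup>2 / (4 * u\<^sup>2)))"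
    unfolding e using gaussian_fourier_2d(2)[OF C dp, of ?a ?b] by (simp only: minus_divide_left[symmetric])
qed

definition rad :: "real \<Rightarrow> real \<times> real \<Rightarrow> real" where "rad z x = sqrt ((norm (pt x))\<^sup>2 + z\<^sup>2)"

lemma rad_ge: "z > 0 \<Longrightarrow> rad z x \<ge> z" "rad z x \<ge> norm (pt x)"
  by (auto simp: rad_def intro!: real_le_rsqrt)

lemma rad_pos: "z > 0 \<Longrightarrow> rad z x > 0" using rad_ge(1)[of z x] by linarith

lemma rad_measurable[measurable]: "rad z \<in> borel_measurable borel"
  unfolding rad_def[abs_def] by measurable

lemma exp_rad_integrable:
  assumes "z > 0" "\<mu> > 0"
  shows "integrable lborel (\<lambda>x. exp (- \<mu> * rad z x) / rad z x)"
proof -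
  have "integrable lborel (\<lambda>x. complex_of_real (exp (- \<mu> * rad z x) / rad z x))"
  proof (rule integrable_of_majorant_bound)
    fix x
    have "norm (complex_of_real (exp (- \<mu> * rad z x) / rad z x)) = exp (- \<mu> * rad z x) / rad z x"
      using rad_pos[OF assms(1), of x] by (simp only: norm_of_real) simp
    also have "\<dots> \<le> (max 1 (3 / \<mu>) ^ 3 / z) * (1 / (1 + norm (pt x)) ^ 3)"
      unfolding rad_def using screened_decay[of "norm (pt x)" z \<mu>] assms by simp
    also have "\<dots> \<le> (max 1 (3 / \<mu>) ^ 3 / z) * ((1 + W) ^ 3 * (majorant (fst x) * majorant (snd x)))"
      using assms by (intro mult_left_mono pt_decay) auto
    finally show "norm (complex_of_real (exp (- \<mu> * rad z x) / rad z x)) \<le> ((max 1 (3 / \<mu>) ^ 3 / z) * (1 + W) ^ 3) * (majorant (fst x) * majorant (snd x))"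
      by (simp only: mult.assoc)
  qed measurable
  then show ?thesis by (simp only: complex_of_real_integrable_eq)
qed

text \<open>The Fourier transform of the spherical wave over the plane at height \<open>z\<close>, in lattice coordinates.\<close>

definition FT_sph :: "complex \<Rightarrow> real^2 \<Rightarrow> real \<Rightarrow> complex" where
  "FT_sph k \<kappa> z = (LINT x|lborel. sph k (rad z x) * wave \<kappa> x)"

text \<open>The screened potential is a superposition of Gaussians,
  \<open>exp (- \<mu> r) / r = 2 / sqrt \<pi> \<integral> exp (- r\<^sup>2 u\<^sup>2 - (\<mu>/2)\<^sup>2 / u\<^sup>2) du\<close> over \<open>u > 0\<close>. Transforming under the
  integral replaces \<open>\<mu>\<^sup>2\<close> by \<open>\<mu>\<^sup>2 + \<parallel>\<kappa>\<parallel>\<^sup>2\<close> and produces a factor \<open>1/u\<^sup>2\<close>, and the companion integral of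
  \<open>gaussian_reciprocal_integrals\<close> evaluates the result.\<close>

lemma weyl_imaginary:
  fixes z \<mu> :: real and \<kappa> :: "real^2"
  assumes z: "z > 0" and \<mu>: "\<mu> > 0"
  defines "\<sigma> \<equiv> sqrt ((norm \<kappa>)\<^sup>2 + \<mu>\<^sup>2)"
  shows "FT_sph (\<i> * of_real \<mu>) \<kappa> z = of_real (2 * pi / D * exp (- z * \<sigma>) / \<sigma>)"
proof -
  have \<sigma>: "\<sigma> > 0" "\<sigma>\<^sup>2 = (norm \<kappa>)\<^sup>2 + \<mu>\<^sup>2" using \<mu> by (auto simp: \<sigma>_def add_nonneg_pos)
  define g where "g r u = exp (- (r\<^sup>2 * u\<^sup>2) - (\<mu> / 2)\<^sup>2 / u\<^sup>2)" for r u :: real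
  define h where "h = (\<lambda>(x, u). (indicator {0<..} u * g (rad z x) u) *\<^sub>R wave \<kappa> x)"
  have m2: "\<mu> / 2 > 0" using \<mu> by simp
  have G: "integrable lborel (\<lambda>u. indicator {0<..} u * g r u)"
      "(LINT u|lborel. indicator {0<..} u * g r u) = sqrt pi / (2 * r) * exp (- r * \<mu>)" if "r > 0" for r
    using gaussian_reciprocal_integrals(1,2)[OF that m2, of "g r"] unfolding set_integrable_def set_lebesgue_integral_def g_def by (auto simp: mult.commute)
  have inner_u: "(LINT u|lborel. h (x, u)) = of_real (sqrt pi / 2) * (sph (\<i> * of_real \<mu>) (rad z x) * wave \<kappa> x)" for x
  proof -
    have "(LINT u|lborel. h (x, u)) = (LINT u|lborel. indicator {0<..} u * g (rad z x) u) *\<^sub>R wave \<kappa> x"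
      unfolding h_def by (simp add: integral_scaleR_left[OF G(1)[OF rad_pos[OF z]]])
    also have "\<dots> = of_real (sqrt pi / 2) * (sph (\<i> * of_real \<mu>) (rad z x) * wave \<kappa> x)"
      unfolding G(2)[OF rad_pos[OF z]] by (simp add: sph_def scaleR_conv_of_real exp_of_real[symmetric] mult_ac)
    finally show ?thesis .
  qed
  have ih: "integrable (lborel \<Otimes>\<^sub>M lborel) h"
  proof (rule lborel_pair.Fubini_integrable)
    show "h \<in> borel_measurable (lborel \<Otimes>\<^sub>M lborel)" unfolding h_def g_def case_prod_beta by measurable
    show "AE x in lborel. integrable lborel (\<lambda>u. h (x, u))"
      unfolding h_def using G(1)[OF rad_pos[OF z]] by (intro AE_I2) (auto intro!: integrable_scaleR_left)
    have *: "(LINT u|lborel. norm (h (x, u))) = sqrt pi / 2 * (exp (- \<mu> * rad z x) / rad z x)" for x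
    proof -
      have "norm (h (x, u)) = indicator {0<..} u * g (rad z x) u" for u
        unfolding h_def by (simp add: g_def abs_mult)
      then show ?thesis using G(2)[OF rad_pos[OF z], of x] by (simp add: mult.commute)
    qed
    show "integrable lborel (\<lambda>x. LINT u|lborel. norm (h (x, u)))"
      unfolding * by (rule integrable_mult_right[OF exp_rad_integrable[OF z \<mu>]])
  qed
  have inner_x: "(LINT x|lborel. h (x, u)) = of_real (pi / D * (indicator {0<..} u * (exp (- (z\<^sup>2 * u\<^sup>2) - (\<sigma> / 2)\<^sup>2 / u\<^sup>2) / u\<^sup>2)))" for u
  proof (cases "u > 0")
    case True
    have "h (x, u) = of_real (exp (- (z\<^sup>2 * u\<^sup>2) - (\<mu> / 2)\<^sup>2 / u\<^sup>2)) * (of_real (exp (- u\<^sup>2 * (norm (pt x))\<^sup>2)) * wave \<kappa> x)" for x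
    proof -
      have "g (rad z x) u = exp (- (z\<^sup>2 * u\<^sup>2) - (\<mu> / 2)\<^sup>2 / u\<^sup>2) * exp (- u\<^sup>2 * (norm (pt x))\<^sup>2)"
        unfolding g_def rad_def by (simp add: exp_add[symmetric] algebra_simps)
      then show ?thesis unfolding h_def using True by (simp add: scaleR_conv_of_real)
    qed
    then have "(LINT x|lborel. h (x, u)) = of_real (exp (- (z\<^sup>2 * u\<^sup>2) - (\<mu> / 2)\<^sup>2 / u\<^sup>2)) * of_real (pi / (u\<^sup>2 * D) * exp (- (norm \<kappa>)\<^sup>2 / (4 * u\<^sup>2)))"
      by (simp only: integral_mult_right_zero gaussian_lattice_fourier(2)[OF True])
    also have "\<dots> = of_real (pi / (u\<^sup>2 * D) * (exp (- (z\<^sup>2 * u\<^sup>2) - (\<mu> / 2)\<^sup>2 / u\<^sup>2) * exp (- (norm \<kappa>)\<^sup>2 / (4 * u\<^sup>2))))"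
      by (simp only: of_real_mult mult_ac)
    also have "exp (- (z\<^sup>2 * u\<^sup>2) - (\<mu> / 2)\<^sup>2 / u\<^sup>2) * exp (- (norm \<kappa>)\<^sup>2 / (4 * u\<^sup>2)) = exp (- (z\<^sup>2 * u\<^sup>2) - (\<sigma> / 2)\<^sup>2 / u\<^sup>2)"
      unfolding exp_add[symmetric] power_divide \<sigma>(2) by (simp add: add_divide_distrib)
    finally show ?thesis using True by simp
  qed (simp add: h_def)
  have I2: "(LINT u|lborel. indicator {0<..} u * (exp (- (z\<^sup>2 * u\<^sup>2) - (\<sigma> / 2)\<^sup>2 / u\<^sup>2) / u\<^sup>2)) = sqrt pi / \<sigma> * exp (- z * \<sigma>)"
    using gaussian_reciprocal_integrals(4)[OF z, of "\<sigma> / 2" "\<lambda>u. exp (- (z\<^sup>2 * u\<^sup>2) - (\<sigma> / 2)\<^sup>2 / u\<^sup>2)"] \<sigma>(1)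
    unfolding set_lebesgue_integral_def by simp
  have "of_real (sqrt pi / 2) * FT_sph (\<i> * of_real \<mu>) \<kappa> z = (LINT x|lborel. LINT u|lborel. h (x, u))"
    unfolding inner_u FT_sph_def by (simp only: integral_mult_right_zero)
  also have "\<dots> = (LINT u|lborel. LINT x|lborel. h (x, u))"
    using lborel_pair.Fubini_integral[of "\<lambda>x u. h (x, u)"] ih by simp
  also have "\<dots> = of_real (pi / D * (sqrt pi / \<sigma> * exp (- z * \<sigma>)))"
    unfolding inner_x integral_complex_of_real integral_mult_right_zero I2 ..
  finally have "of_real (sqrt pi / 2) * FT_sph (\<i> * of_real \<mu>) \<kappa> z = of_real (sqrt pi / 2) * of_real (2 * pi / D * exp (- z * \<sigma>) / \<sigma>)"
    by (simp add: field_simps)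
  then show ?thesis by (subst (asm) mult_cancel_left) simp
qed

lemma norm_sph: "r > 0 \<Longrightarrow> norm (sph k r) = exp (- Im k * r) / r"
  by (simp add: sph_def norm_divide norm_exp_eq_Re)

lemma sph_rad_measurable[measurable]: "(\<lambda>x. sph k (rad z x)) \<in> borel_measurable borel"
  unfolding sph_def by measurable

lemma FT_sph_integrable:
  assumes "z > 0" "Im k > 0"
  shows "integrable lborel (\<lambda>x. sph k (rad z x) * wave \<kappa> x)"
proof (rule Bochner_Integration.integrable_bound[OF exp_rad_integrable[OF assms]])
  show "AE x in lborel. norm (sph k (rad z x) * wave \<kappa> x) \<le> norm (exp (- Im k * rad z x) / rad z x)"
  proof (rule AE_I2)
    fix x show "norm (sph k (rad z x) * wave \<kappa> x) \<le> norm (exp (- Im k * rad z x) / rad z x)"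
      using rad_pos[OF assms(1), of x] by (simp add: norm_mult norm_sph)
  qed
qed measurable

text \<open>The exponential is expanded about \<open>i \<mu>\<close>. On the disc of radius \<open>\<mu>\<close> the resulting series is dominated
  by \<open>exp (- (\<mu> - \<delta>) r) / r\<close>, so it may be integrated term by term, and the transform is a power
  series in \<open>k\<close>.\<close>

lemma FT_sph_holomorphic:
  assumes z: "z > 0" and \<mu>: "\<mu> > 0"
  shows "(\<lambda>k. FT_sph k \<kappa> z) holomorphic_on ball (\<i> * of_real \<mu>) \<mu>"
proof -
  let ?c = "\<i> * complex_of_real \<mu>"
  let ?r = "rad z"
  define a where "a n = (LINT x|lborel. of_real (exp (- \<mu> * ?r x) / ?r x) * ((\<i> * of_real (?r x)) ^ n / fact n) * wave \<kappa> x)" for n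
  have "(\<lambda>n. a n * (k - ?c) ^ n) sums FT_sph k \<kappa> z" if k: "k \<in> ball ?c \<mu>" for k
  proof -
    define \<delta> where "\<delta> = norm (k - ?c)"
    have \<delta>: "\<delta> \<ge> 0" "\<delta> < \<mu>" using k by (auto simp: \<delta>_def dist_norm norm_minus_commute)
    define f where "f n x = (of_real (exp (- \<mu> * ?r x) / ?r x) * ((\<i> * of_real (?r x)) ^ n / fact n) * wave \<kappa> x) * (k - ?c) ^ n" for n x
    have rp: "?r x > 0" for x by (rule rad_pos[OF z])
    have nf: "norm (f n x) = exp (- \<mu> * ?r x) / ?r x * ((\<delta> * ?r x) ^ n / fact n)" for n x
      using rp[of x] by (simp add: f_def norm_mult norm_divide norm_power \<delta>_def power_mult_distrib mult_ac)
    have ps: "(\<lambda>n. (\<delta> * ?r x) ^ n / fact n) sums exp (\<delta> * ?r x)" for x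
      using exp_converges[of "\<delta> * ?r x"] by (simp add: scaleR_conv_of_real divide_inverse mult.commute)
    have bound: "(\<Sum>n<N. norm (f n x)) \<le> exp (- (\<mu> - \<delta>) * ?r x) / ?r x" for N x
    proof -
      have "(\<Sum>n<N. norm (f n x)) = exp (- \<mu> * ?r x) / ?r x * (\<Sum>n<N. (\<delta> * ?r x) ^ n / fact n)"
        unfolding nf by (simp add: sum_distrib_left)
      also have "(\<Sum>n<N. (\<delta> * ?r x) ^ n / fact n) \<le> exp (\<delta> * ?r x)"
        unfolding sums_unique[OF ps] using rp[of x] \<delta> by (intro sum_le_suminf sums_summable[OF ps]) auto
      then have "exp (- \<mu> * ?r x) / ?r x * (\<Sum>n<N. (\<delta> * ?r x) ^ n / fact n) \<le> exp (- \<mu> * ?r x) / ?r x * exp (\<delta> * ?r x)"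
        using rp[of x] by (intro mult_left_mono) auto
      also have "\<dots> = exp (- (\<mu> - \<delta>) * ?r x) / ?r x" by (simp add: exp_add[symmetric] algebra_simps)
      finally show ?thesis by simp
    qed
    have int_b: "integrable lborel (\<lambda>x. exp (- (\<mu> - \<delta>) * ?r x) / ?r x)"
      using exp_rad_integrable[OF z, of "\<mu> - \<delta>"] \<delta> by simp
    have fm: "f n \<in> borel_measurable lborel" for n unfolding f_def[abs_def] by measurable
    have fi: "integrable lborel (f n)" for n
    proof (rule Bochner_Integration.integrable_bound[OF int_b fm], rule AE_I2)
      fix x
      have "norm (f n x) \<le> (\<Sum>n<Suc n. norm (f n x))" by (simp add: sum_nonneg)
      also have "\<dots> \<le> norm (exp (- (\<mu> - \<delta>) * ?r x) / ?r x)" using bound[where N = "Suc n" and x = x] by (rule order_trans) (use rp[of x] in simp)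
      finally show "norm (f n x) \<le> norm (exp (- (\<mu> - \<delta>) * ?r x) / ?r x)" .
    qed
    have sm: "summable (\<lambda>n. LINT x|lborel. norm (f n x))"
    proof (rule summableI_nonneg_bounded)
      fix N
      have "(\<Sum>n<N. LINT x|lborel. norm (f n x)) = (LINT x|lborel. (\<Sum>n<N. norm (f n x)))"
        by (rule Bochner_Integration.integral_sum[symmetric]) (rule integrable_norm[OF fi])
      also have "\<dots> \<le> (LINT x|lborel. exp (- (\<mu> - \<delta>) * ?r x) / ?r x)"
        by (intro integral_mono Bochner_Integration.integrable_sum integrable_norm fi int_b bound)
      finally show "(\<Sum>n<N. LINT x|lborel. norm (f n x)) \<le> (LINT x|lborel. exp (- (\<mu> - \<delta>) * ?r x) / ?r x)" .
    qed simp
    have ae: "AE x in lborel. summable (\<lambda>n. norm (f n x))"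
      unfolding nf by (intro AE_I2 summable_mult sums_summable[OF ps])
    have fs: "(\<lambda>n. f n x) sums (sph k (?r x) * wave \<kappa> x)" for x
    proof -
      let ?y = "\<i> * of_real (?r x) * (k - ?c)"
      have "(\<lambda>n. ?y ^ n /\<^sub>R fact n) sums exp ?y" by (rule exp_converges)
      then have "(\<lambda>n. (of_real (exp (- \<mu> * ?r x) / ?r x) * wave \<kappa> x) * (?y ^ n /\<^sub>R fact n)) sums ((of_real (exp (- \<mu> * ?r x) / ?r x) * wave \<kappa> x) * exp ?y)"
        by (rule sums_mult)
      moreover have "(of_real (exp (- \<mu> * ?r x) / ?r x) * wave \<kappa> x) * (?y ^ n /\<^sub>R fact n) = f n x" for n
        unfolding f_def power_mult_distrib by (simp add: scaleR_conv_of_real divide_inverse mult_ac)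
      moreover have "(of_real (exp (- \<mu> * ?r x) / ?r x) * wave \<kappa> x) * exp ?y = sph k (?r x) * wave \<kappa> x"
      proof -
        have "\<i> * k * of_real (?r x) = of_real (- \<mu> * ?r x) + ?y" by (simp add: algebra_simps)
        then have "exp (\<i> * k * of_real (?r x)) = of_real (exp (- \<mu> * ?r x)) * exp ?y" by (simp only: exp_add exp_of_real)
        then show ?thesis by (simp add: sph_def)
      qed
      ultimately show ?thesis by simp
    qed
    have "(\<lambda>n. LINT x|lborel. f n x) sums (LINT x|lborel. (\<Sum>n. f n x))" by (rule sums_integral[OF fi ae sm])
    moreover have "(LINT x|lborel. f n x) = a n * (k - ?c) ^ n" for n
      unfolding f_def a_def by (rule integral_mult_left_zero)
    moreover have "(LINT x|lborel. (\<Sum>n. f n x)) = FT_sph k \<kappa> z"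
      unfolding FT_sph_def sums_unique[OF fs, symmetric] ..
    ultimately show ?thesis by simp
  qed
  then show ?thesis by (rule power_series_holomorphic)
qed

text \<open>Both sides are holomorphic in \<open>k\<close> on a disc tangent to the real axis that contains the given \<open>k\<close>, and
  they agree on the imaginary diameter.\<close>

lemma weyl_identity:
  fixes \<kappa> :: "real^2"
  assumes z: "z > 0" and k: "Im k > 0"
  defines "\<sigma> \<equiv> \<lambda>k. csqrt (of_real ((norm \<kappa>)\<^sup>2) - k\<^sup>2)"
  shows "FT_sph k \<kappa> z = of_real (2 * pi / D) * exp (- of_real z * \<sigma> k) / \<sigma> k"
proof -
  \<comment> \<open>The disc about \<open>i \<mu>\<close> of radius \<open>\<mu>\<close> contains \<open>k\<close> as soon as \<open>\<parallel>k\<parallel>\<^sup>2 < 2 \<mu> Im k\<close>.\<close>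
  define \<mu> where "\<mu> = (norm k)\<^sup>2 / Im k"
  have k0: "norm k > 0" using k by auto
  have \<mu>: "\<mu> > 0" using k k0 by (simp add: \<mu>_def)
  let ?S = "ball (\<i> * complex_of_real \<mu>) \<mu>"
  have kS: "k \<in> ?S"
  proof -
    have "(norm (\<i> * complex_of_real \<mu> - k))\<^sup>2 = (norm k)\<^sup>2 - 2 * \<mu> * Im k + \<mu>\<^sup>2"
      unfolding cmod_power2 by (simp add: power2_eq_square algebra_simps)
    also have "2 * \<mu> * Im k = 2 * (norm k)\<^sup>2" using k by (simp add: \<mu>_def)
    also have "(norm k)\<^sup>2 - 2 * (norm k)\<^sup>2 + \<mu>\<^sup>2 < \<mu>\<^sup>2" using k0 by simp
    finally have "norm (\<i> * complex_of_real \<mu> - k) < \<mu>" using \<mu> by (intro power_less_imp_less_base[of _ 2 \<mu>]) auto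
    then show ?thesis by (simp add: dist_norm)
  qed
  have im: "Im w > 0" if "w \<in> ?S" for w
  proof -
    have "\<bar>Im (\<i> * complex_of_real \<mu> - w)\<bar> < \<mu>" using that abs_Im_le_cmod[of "\<i> * complex_of_real \<mu> - w"] by (simp add: dist_norm)
    then show ?thesis by simp
  qed
  have np: "of_real ((norm \<kappa>)\<^sup>2) - w\<^sup>2 \<notin> \<real>\<^sub>\<le>\<^sub>0" if "w \<in> ?S" for w
  proof
    assume "of_real ((norm \<kappa>)\<^sup>2) - w\<^sup>2 \<in> \<real>\<^sub>\<le>\<^sub>0"
    then have re: "(norm \<kappa>)\<^sup>2 \<le> (Re w)\<^sup>2 - (Im w)\<^sup>2" and "Re w * Im w = 0"
      by (auto simp: complex_nonpos_Reals_iff power2_eq_square)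
    with im[OF that] have "Re w = 0" by auto
    with re have "(norm \<kappa>)\<^sup>2 + (Im w)\<^sup>2 \<le> 0" by simp
    then show False using im[OF that] by (smt (verit) zero_le_power2 zero_less_power2)
  qed
  have \<sigma>0: "\<sigma> w \<noteq> 0" if "w \<in> ?S" for w
    using np[OF that] unfolding \<sigma>_def by auto
  have hs: "\<sigma> holomorphic_on ?S" unfolding \<sigma>_def
    using np by (intro holomorphic_intros) auto
  define E where "E w = FT_sph w \<kappa> z - of_real (2 * pi / D) * exp (- of_real z * \<sigma> w) / \<sigma> w" for w
  have hE: "E holomorphic_on ?S"
    unfolding E_def[abs_def] using \<sigma>0 by (intro holomorphic_intros FT_sph_holomorphic[OF z \<mu>] hs) auto
  define U where "U = (\<lambda>t. \<i> * complex_of_real t) ` {0<..<2 * \<mu>}"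
  have "E k = 0"
  proof (rule analytic_continuation[OF hE _ _ _ _ _ _ kS])
    show "U \<subseteq> ?S"
    proof
      fix w assume "w \<in> U"
      then obtain t where t: "0 < t" "t < 2 * \<mu>" "w = \<i> * of_real t" by (auto simp: U_def)
      have "\<i> * complex_of_real \<mu> - w = \<i> * of_real (\<mu> - t)" by (simp add: t algebra_simps)
      then have "dist (\<i> * complex_of_real \<mu>) w = \<bar>\<mu> - t\<bar>" unfolding dist_norm by (simp add: norm_mult del: of_real_diff)
      then show "w \<in> ?S" using t by simp
    qed
    show "\<i> * of_real \<mu> \<in> ?S" using \<mu> by simp
    show "\<i> * of_real \<mu> islimpt U"
      unfolding islimpt_approachable
    proof (intro allI impI)
      fix e :: real assume e: "e > 0"
      define t where "t = \<mu> + min e \<mu> / 2"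
      have t: "0 < t" "t < 2 * \<mu>" "t \<noteq> \<mu>" "\<bar>t - \<mu>\<bar> < e" using e \<mu> by (auto simp: t_def min_def)
      have "\<i> * complex_of_real t - \<i> * of_real \<mu> = \<i> * of_real (t - \<mu>)" by (simp add: algebra_simps)
      then have "dist (\<i> * complex_of_real t) (\<i> * of_real \<mu>) = \<bar>t - \<mu>\<bar>" unfolding dist_norm by (simp add: norm_mult del: of_real_diff)
      then show "\<exists>x'\<in>U. x' \<noteq> \<i> * of_real \<mu> \<and> dist x' (\<i> * of_real \<mu>) < e"
        using t by (intro bexI[of _ "\<i> * complex_of_real t"]) (auto simp: U_def)
    qed
    fix w assume "w \<in> U"
    then obtain t where t: "0 < t" "w = \<i> * of_real t" by (auto simp: U_def)
    have "of_real ((norm \<kappa>)\<^sup>2) - w\<^sup>2 = complex_of_real ((norm \<kappa>)\<^sup>2 + t\<^sup>2)" by (simp add: t power_mult_distrib)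
    then have "\<sigma> w = csqrt (complex_of_real ((norm \<kappa>)\<^sup>2 + t\<^sup>2))" by (simp only: \<sigma>_def)
    also have "\<dots> = of_real (sqrt ((norm \<kappa>)\<^sup>2 + t\<^sup>2))"
      using csqrt_of_real_nonneg[of "complex_of_real ((norm \<kappa>)\<^sup>2 + t\<^sup>2)"] by simp
    finally have "\<sigma> w = of_real (sqrt ((norm \<kappa>)\<^sup>2 + t\<^sup>2))" .
    then show "E w = 0" unfolding E_def t(2) using weyl_imaginary[OF z t(1), of \<kappa>] by (simp flip: exp_of_real)
  qed auto
  then show ?thesis by (simp add: E_def)
qed

text \<open>The Fourier transform of one lattice term at height \<open>z\<close>; unlike that of a single spherical wave it
  converges absolutely also for real \<open>k\<close>.\<close>

definition FT_fds where "FT_fds p d k \<kappa> z = (LINT x|lborel. fds p d k (norm (pt x)) z * wave \<kappa> x)"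

lemma fds_rad: "fds p d k (norm (pt x)) z = (\<Sum>q=0..p. fd_coeff p q * sph k (rad (z + real q * d) x))"
  by (simp add: fds_def rad_def)

text \<open>All \<open>p + 1\<close> waves of the difference have the same dependence on \<open>z\<close>, because their centres lie below
  the evaluation point.\<close>

lemma FT_fds_complex:
  fixes \<kappa> :: "real^2" and k :: complex
  assumes z: "z > 0" and d: "d > 0" and k: "Im k > 0"
  defines "\<sigma> \<equiv> csqrt (of_real ((norm \<kappa>)\<^sup>2) - k\<^sup>2)"
  shows "FT_fds p d k \<kappa> z = (of_real (2 * pi / D) / \<sigma> * (\<Sum>q=0..p. fd_coeff p q * exp (- of_real (real q * d) * \<sigma>))) * exp (- of_real z * \<sigma>)"
proof -
  have zq: "z + real q * d > 0" for q using z d by (simp add: add_pos_nonneg)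
  have "FT_fds p d k \<kappa> z = (LINT x|lborel. (\<Sum>q=0..p. fd_coeff p q * (sph k (rad (z + real q * d) x) * wave \<kappa> x)))"
    unfolding FT_fds_def fds_rad by (simp add: sum_distrib_right mult.assoc)
  also have "\<dots> = (\<Sum>q=0..p. fd_coeff p q * FT_sph k \<kappa> (z + real q * d))"
    by (subst Bochner_Integration.integral_sum) (auto simp: FT_sph_def intro!: integrable_mult_right FT_sph_integrable zq k)
  also have "\<dots> = (\<Sum>q=0..p. fd_coeff p q * (of_real (2 * pi / D) / \<sigma> * (exp (- of_real (real q * d) * \<sigma>) * exp (- of_real z * \<sigma>))))"
    unfolding weyl_identity[OF zq k] \<sigma>_def[symmetric]
    by (intro sum.cong refl) (simp add: exp_add[symmetric] algebra_simps)
  finally show ?thesis by (simp add: sum_distrib_left sum_distrib_right mult_ac)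
qed

text \<open>Uniform in \<open>k\<close> on bounded subsets of the closed upper half-plane. For \<open>\<rho> \<ge> 1\<close> this is \<open>fds_bound\<close>, whose
  exponent is at least 3 for \<open>p \<ge> 3\<close>; near the axis the height \<open>z > 0\<close> keeps the waves bounded.\<close>

lemma fds_decay:
  assumes d: "d > 0" and p: "p \<ge> 3" and z: "z > 0"
  shows "\<exists>C\<ge>0. \<forall>k x. norm k \<le> K \<longrightarrow> Im k \<ge> 0 \<longrightarrow> norm (fds p d k (norm (pt x)) z) \<le> C * (majorant (fst x) * majorant (snd x))"
proof -
  have p1: "p \<ge> 1" using p by simp
  obtain C1 where C1: "C1 \<ge> 0" "\<And>k \<rho>. norm k \<le> K \<Longrightarrow> Im k \<ge> 0 \<Longrightarrow> \<rho> \<ge> 1 \<Longrightarrow> norm (fds p d k \<rho> z) \<le> C1 / \<rho> ^ ((p + 1) div 2 + 1)"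
    using fds_bound[OF d p1, of K z] z by auto
  define S where "S = (\<Sum>q=0..p. norm (fd_coeff p q) * (1 / z))"
  have S: "S \<ge> 0" unfolding S_def using z by (intro sum_nonneg) auto
  define C where "C = 8 * (C1 + S)"
  have main: "norm (fds p d k \<rho> z) \<le> C * (1 / (1 + \<rho>) ^ 3)" if k: "norm k \<le> K" "Im k \<ge> 0" and \<rho>0: "\<rho> \<ge> 0" for k \<rho>
  proof (cases "\<rho> \<ge> 1")
    case True
    have "norm (fds p d k \<rho> z) \<le> C1 / \<rho> ^ ((p + 1) div 2 + 1)" by (rule C1(2)[OF k True])
    also have "\<dots> \<le> C1 / \<rho> ^ 3"
      using C1(1) True p by (intro divide_left_mono power_increasing mult_pos_pos zero_less_power) auto
    also have "\<dots> \<le> C1 / ((1 + \<rho>) / 2) ^ 3"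
      using C1(1) True by (intro divide_left_mono power_mono mult_pos_pos zero_less_power) auto
    also have "\<dots> = 8 * C1 * (1 / (1 + \<rho>) ^ 3)" by (simp add: power_divide)
    also have "\<dots> \<le> C * (1 / (1 + \<rho>) ^ 3)" unfolding C_def using S True by (intro mult_right_mono) auto
    finally show ?thesis .
  next
    case False
    have "norm (fds p d k \<rho> z) \<le> S"
      unfolding fds_def S_def
    proof (intro sum_norm_le)
      fix q assume "q \<in> {0..p}"
      let ?r = "sqrt (\<rho>\<^sup>2 + (z + real q * d)\<^sup>2)"
      have r: "?r \<ge> z" using z d by (intro real_le_rsqrt) (auto intro!: order_trans[OF power_mono[of z "z + real q * d" 2]])
      have "norm (sph k ?r) \<le> 1 / z"
        unfolding sph_def norm_divide using r z k norm_exp_i_le_1[of k ?r] by (intro frac_le) auto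
      then show "norm (fd_coeff p q * sph k ?r) \<le> norm (fd_coeff p q) * (1 / z)"
        unfolding norm_mult by (intro mult_left_mono) auto
    qed
    also have "\<dots> \<le> S * (8 * (1 / (1 + \<rho>) ^ 3))"
    proof -
      have "(1 + \<rho>) ^ 3 \<le> 2 ^ 3" using False \<rho>0 by (intro power_mono) auto
      then have "1 \<le> 8 * (1 / (1 + \<rho>) ^ 3)" using \<rho>0 by (simp add: field_simps)
      then show ?thesis using S mult_left_mono[of 1 "8 * (1 / (1 + \<rho>) ^ 3)" S] by simp
    qed
    also have "\<dots> \<le> C * (1 / (1 + \<rho>) ^ 3)" unfolding C_def using C1(1) \<rho>0 by (simp add: divide_right_mono)
    finally show ?thesis .
  qed
  have C: "C \<ge> 0" using C1(1) S by (simp add: C_def)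
  show ?thesis
  proof (intro exI[of _ "C * (1 + W) ^ 3"] conjI allI impI)
    show "C * (1 + W) ^ 3 \<ge> 0" using C W_pos by simp
    fix k x assume k: "norm (k::complex) \<le> K" "Im k \<ge> 0"
    have "norm (fds p d k (norm (pt x)) z) \<le> C * (1 / (1 + norm (pt x)) ^ 3)" by (rule main[OF k]) simp
    also have "\<dots> \<le> C * ((1 + W) ^ 3 * (majorant (fst x) * majorant (snd x)))" using C by (intro mult_left_mono pt_decay)
    finally show "norm (fds p d k (norm (pt x)) z) \<le> C * (1 + W) ^ 3 * (majorant (fst x) * majorant (snd x))" by (simp only: mult.assoc)
  qed
qed

lemma fds_measurable[measurable]: "(\<lambda>x. fds p d k (norm (pt x)) z) \<in> borel_measurable borel"
  unfolding fds_rad by measurable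

text \<open>The limit from the upper half-plane of the square root. The argument approaches the real axis from
  the side opposite to the sign of \<open>k\<close>, which decides the side of the branch cut and thereby the
  direction in which the wave travels.\<close>

lemma csqrt_limit:
  fixes k c :: real
  assumes k: "k \<noteq> 0"
  shows "(\<lambda>n. csqrt (of_real c - (Complex k (inverse (real (Suc n))))\<^sup>2)) \<longlonglongrightarrow>
     Complex (sqrt ((\<bar>c - k\<^sup>2\<bar> + (c - k\<^sup>2)) / 2)) (- sgn k * sqrt ((\<bar>c - k\<^sup>2\<bar> - (c - k\<^sup>2)) / 2))"
proof -
  define w where "w n = of_real c - (Complex k (inverse (real (Suc n))))\<^sup>2" for n
  have im: "Im (w n) = - 2 * k * inverse (real (Suc n))" for n by (simp add: w_def power2_eq_square)
  have C: "(\<lambda>n. Complex k (inverse (real (Suc n)))) \<longlonglongrightarrow> Complex k 0"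
    by (intro tendsto_Complex tendsto_const LIMSEQ_inverse_real_of_nat)
  have "w \<longlonglongrightarrow> of_real c - (Complex k 0)\<^sup>2"
    unfolding w_def[abs_def] by (intro tendsto_diff tendsto_const tendsto_power C)
  moreover have "of_real c - (Complex k 0)\<^sup>2 = complex_of_real (c - k\<^sup>2)" by (simp add: complex_eq_iff power2_eq_square)
  ultimately have wl: "w \<longlonglongrightarrow> of_real (c - k\<^sup>2)" by (simp only:)
  have "sgn (Im (w n)) = - sgn k" for n unfolding im by (simp add: sgn_mult)
  moreover have "Im (w n) \<noteq> 0" for n unfolding im using k by simp
  ultimately have e: "csqrt (w n) = Complex (sqrt ((cmod (w n) + Re (w n)) / 2)) (- sgn k * sqrt ((cmod (w n) - Re (w n)) / 2))" for n
    by (simp add: complex_eq_iff)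
  have "(\<lambda>n. Complex (sqrt ((cmod (w n) + Re (w n)) / 2)) (- sgn k * sqrt ((cmod (w n) - Re (w n)) / 2))) \<longlonglongrightarrow>
    Complex (sqrt ((cmod (of_real (c - k\<^sup>2)) + Re (of_real (c - k\<^sup>2))) / 2)) (- sgn k * sqrt ((cmod (of_real (c - k\<^sup>2)) - Re (of_real (c - k\<^sup>2))) / 2))"
    by (intro tendsto_intros tendsto_Complex wl) auto
  then show ?thesis unfolding e[symmetric] w_def[symmetric] norm_of_real Re_complex_of_real .
qed

text \<open>The vertical decay rate: minus \<open>i\<close> times the outgoing \<open>\<gamma>\<close> (\<open>tau_eq_gam_out\<close>), written without a case
  distinction as the limit that \<open>csqrt_limit\<close> produces.\<close>

definition tau :: "real \<Rightarrow> real^2 \<Rightarrow> complex" where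
  "tau k \<kappa> = Complex (sqrt ((\<bar>(norm \<kappa>)\<^sup>2 - k\<^sup>2\<bar> + ((norm \<kappa>)\<^sup>2 - k\<^sup>2)) / 2)) (- sgn k * sqrt ((\<bar>(norm \<kappa>)\<^sup>2 - k\<^sup>2\<bar> - ((norm \<kappa>)\<^sup>2 - k\<^sup>2)) / 2))"

text \<open>For \<open>k + i/n\<close> the transform is a coefficient times an exponential in \<open>z\<close>, and the transform converges
  by dominated convergence. The coefficient has the possibly vanishing square root in its
  denominator; its convergence is therefore deduced from that of the transform at one height instead
  of from its formula. This covers the grazing modes with \<open>\<tau> = 0\<close>.\<close>

lemma FT_fds_mode:
  fixes k :: real and \<kappa> :: "real^2"
  assumes d: "d > 0" and p: "p \<ge> 3" and k: "k \<noteq> 0"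
  shows "\<exists>\<beta>. \<forall>z>0. FT_fds p d (of_real k) \<kappa> z = \<beta> * exp (- of_real z * tau k \<kappa>)"
proof -
  define \<tau> where "\<tau> = tau k \<kappa>"
  define kn where "kn n = Complex k (inverse (real (Suc n)))" for n
  define \<sigma> where "\<sigma> n = csqrt (of_real ((norm \<kappa>)\<^sup>2) - (kn n)\<^sup>2)" for n
  have \<sigma>: "\<sigma> \<longlonglongrightarrow> \<tau>" unfolding \<sigma>_def[abs_def] kn_def \<tau>_def tau_def by (rule csqrt_limit[OF k])
  have ik: "Im (kn n) > 0" for n by (simp add: kn_def)
  have nk: "norm (kn n) \<le> \<bar>k\<bar> + 1" for n
    by (rule order_trans[OF cmod_le]) (simp add: kn_def inverse_le_1_iff)
  have knl: "kn \<longlonglongrightarrow> of_real k"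
  proof -
    have "kn \<longlonglongrightarrow> Complex k 0" unfolding kn_def[abs_def] by (intro tendsto_Complex tendsto_const LIMSEQ_inverse_real_of_nat)
    then show ?thesis by (simp only: complex_of_real_def)
  qed
  define \<beta>n where "\<beta>n n = of_real (2 * pi / D) / \<sigma> n * (\<Sum>q=0..p. fd_coeff p q * exp (- of_real (real q * d) * \<sigma> n))" for n
  have form: "FT_fds p d (kn n) \<kappa> z = \<beta>n n * exp (- of_real z * \<sigma> n)" if "z > 0" for n z
    unfolding \<beta>n_def \<sigma>_def by (rule FT_fds_complex[OF that d ik])
  have lim: "(\<lambda>n. FT_fds p d (kn n) \<kappa> z) \<longlonglongrightarrow> FT_fds p d (of_real k) \<kappa> z" if z: "z > 0" for z
  proof -
    obtain C where C: "\<And>k' x. norm k' \<le> \<bar>k\<bar> + 1 \<Longrightarrow> Im k' \<ge> 0 \<Longrightarrow> norm (fds p d k' (norm (pt x)) z) \<le> C * (majorant (fst x) * majorant (snd x))"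
      using fds_decay[OF d p z, of "\<bar>k\<bar> + 1"] by blast
    show ?thesis unfolding FT_fds_def
    proof (rule integral_dominated_convergence[where w = "\<lambda>x. C * (majorant (fst x) * majorant (snd x))"])
      show "integrable lborel (\<lambda>x. C * (majorant (fst x) * majorant (snd x)))" by (rule integrable_mult_right[OF integrable_majorant2])
      have "(\<lambda>n. fds p d (kn n) (norm (pt x)) z * wave \<kappa> x) \<longlonglongrightarrow> fds p d (of_real k) (norm (pt x)) z * wave \<kappa> x" for x
        unfolding fds_rad sph_def using z d rad_pos[of "z + real _ * d" x]
        by (intro tendsto_intros knl) (auto simp: add_pos_nonneg less_imp_neq[symmetric])
      then show "AE x in lborel. (\<lambda>n. fds p d (kn n) (norm (pt x)) z * wave \<kappa> x) \<longlonglongrightarrow> fds p d (of_real k) (norm (pt x)) z * wave \<kappa> x" by simp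
      show "AE x in lborel. norm (fds p d (kn n) (norm (pt x)) z * wave \<kappa> x) \<le> C * (majorant (fst x) * majorant (snd x))" for n
        using C[OF nk less_imp_le[OF ik]] by (intro AE_I2) (simp add: norm_mult)
    qed measurable
  qed
  have el: "(\<lambda>n. exp (- of_real z * \<sigma> n)) \<longlonglongrightarrow> exp (- of_real z * \<tau>)" for z by (intro tendsto_intros \<sigma>)
  \<comment> \<open>The limit of the coefficients is identified at the height \<open>z = 1\<close>.\<close>
  define \<beta> where "\<beta> = FT_fds p d (of_real k) \<kappa> 1 / exp (- of_real 1 * \<tau>)"
  have "\<beta>n \<longlonglongrightarrow> \<beta>"
  proof -
    have "(\<lambda>n. FT_fds p d (kn n) \<kappa> 1 / exp (- of_real 1 * \<sigma> n)) \<longlonglongrightarrow> \<beta>"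
      unfolding \<beta>_def by (intro tendsto_divide lim el) auto
    moreover have "FT_fds p d (kn n) \<kappa> 1 / exp (- of_real 1 * \<sigma> n) = \<beta>n n" for n
      unfolding form[OF zero_less_one] by simp
    ultimately show ?thesis by simp
  qed
  then have "(\<lambda>n. FT_fds p d (kn n) \<kappa> z) \<longlonglongrightarrow> \<beta> * exp (- of_real z * \<tau>)" if "z > 0" for z
    unfolding form[OF that] by (intro tendsto_mult el)
  then have "FT_fds p d (of_real k) \<kappa> z = \<beta> * exp (- of_real z * \<tau>)" if "z > 0" for z
    using LIMSEQ_unique[OF lim[OF that]] that by blast
  then show ?thesis unfolding \<tau>_def by blast
qed

end

section \<open>Poisson summation\<close>

text \<open>Centred at the origin, because Poisson summation is proved by evaluating at an interior point of
  the cell.\<close>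

definition cell :: "(real \<times> real) set" where "cell = {-1/2..<1/2} \<times> {-1/2..<1/2}"

definition fourier_char :: "int \<times> int \<Rightarrow> real \<times> real \<Rightarrow> complex" where
  "fourier_char u x = cis (2 * pi * (of_int (fst u) * fst x + of_int (snd u) * snd x))"

definition int_pt :: "int \<times> int \<Rightarrow> real \<times> real" where "int_pt u = (of_int (fst u), of_int (snd u))"

lemma cell_measurable[measurable]: "cell \<in> sets borel"
  unfolding cell_def by (intro borel_Times) auto

lemma norm_fourier_char[simp]: "norm (fourier_char u x) = 1" by (simp add: fourier_char_def)

lemma fourier_char_mult: "fourier_char u x * fourier_char v x = fourier_char (u + v) x"
  by (simp add: fourier_char_def cis_mult algebra_simps)

lemma fourier_char_int_pt: "fourier_char u (int_pt v + x) = fourier_char u x"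
proof -
  have "fourier_char u (int_pt v + x) = cis (2 * pi * of_int (fst u * fst v + snd u * snd v)) * fourier_char u x"
    by (simp add: fourier_char_def int_pt_def cis_mult algebra_simps)
  also have "cis (2 * pi * of_int (fst u * fst v + snd u * snd v)) = 1"
    by (rule cis_multiple_2pi[OF Ints_of_int])
  finally show ?thesis by simp
qed

lemma continuous_fourier_char: "continuous_on A (fourier_char u)"
  unfolding fourier_char_def[abs_def] cis_conv_exp by (intro continuous_intros)

lemma fourier_char_measurable[measurable]: "fourier_char u \<in> borel_measurable borel"
  by (intro borel_measurable_continuous_onI continuous_fourier_char)

lemma cell_tile_iff: "y - int_pt u \<in> cell \<longleftrightarrow> u = (\<lfloor>fst y + 1/2\<rfloor>, \<lfloor>snd y + 1/2\<rfloor>)"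
proof -
  have 1: "(a - of_int i \<in> {-1/2..<1/2}) = (i = \<lfloor>a + 1/2\<rfloor>)" for a :: real and i :: int
    unfolding eq_commute[of i] floor_eq_iff atLeastLessThan_iff by (auto; linarith)
  show ?thesis
    using 1[of "fst y" "fst u"] 1[of "snd y" "snd u"] by (cases u) (auto simp: cell_def mem_Times_iff int_pt_def)
qed

lemma emeasure_cell: "emeasure lborel cell = 1"
proof -
  have "emeasure (lborel \<Otimes>\<^sub>M lborel) cell = emeasure lborel {-1/2..<1/2::real} * emeasure lborel {-1/2..<1/2::real}"
    unfolding cell_def by (rule lborel.emeasure_pair_measure_Times) auto
  then show ?thesis by (simp add: lborel_prod)
qed

text \<open>The translates of the cell tile the plane: at each point exactly one term is present.\<close>

lemma tile_has_sum:
  fixes c :: "'b::real_normed_vector"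
  shows "((\<lambda>u. indicator cell (y - int_pt u) *\<^sub>R c) has_sum c) UNIV"
  by (rule has_sum_finite_neutralI[of "{(\<lfloor>fst y + 1/2\<rfloor>, \<lfloor>snd y + 1/2\<rfloor>)}"])
     (use cell_tile_iff[of y] in \<open>auto simp: indicator_def\<close>)

lemma tile_shift:
  fixes F :: "real \<times> real \<Rightarrow> 'b::{banach, second_countable_topology}"
  assumes [measurable]: "F \<in> borel_measurable borel"
  shows "(LINT x|lborel. indicator cell x *\<^sub>R F (int_pt u + x)) = (LINT y|lborel. indicator cell (y - int_pt u) *\<^sub>R F y)"
proof -
  have "(LINT x|lborel. (\<lambda>y. indicator cell (y - int_pt u) *\<^sub>R F y) (int_pt u + x)) = (LINT y|lborel. indicator cell (y - int_pt u) *\<^sub>R F y)"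
    by (rule lborel_integral_shift) measurable
  then show ?thesis by simp
qed

lemma tile_summable:
  fixes F :: "real \<times> real \<Rightarrow> complex"
  assumes F: "integrable lborel F"
  shows "(\<lambda>u. LINT x|lborel. norm (indicator cell x *\<^sub>R F (int_pt u + x))) summable_on UNIV"
proof (rule nonneg_bdd_above_summable_on)
  have [measurable]: "F \<in> borel_measurable borel" using F by auto
  have i: "integrable lborel (\<lambda>y. indicator cell (y - int_pt u) *\<^sub>R norm (F y))" for u
    by (rule Bochner_Integration.integrable_bound[OF integrable_norm[OF F]]) (auto simp: indicator_def)
  show "bdd_above (sum (\<lambda>u. LINT x|lborel. norm (indicator cell x *\<^sub>R F (int_pt u + x))) ` {A. A \<subseteq> UNIV \<and> finite A})"
  proof (rule bdd_aboveI2)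
    fix A assume "A \<in> {A. A \<subseteq> (UNIV :: (int \<times> int) set) \<and> finite A}"
    then have fin: "finite A" by simp
    have e: "(LINT x|lborel. norm (indicator cell x *\<^sub>R F (int_pt u + x))) = (LINT y|lborel. indicator cell (y - int_pt u) *\<^sub>R norm (F y))" for u
      by (subst tile_shift[symmetric]) auto
    have "(\<Sum>u\<in>A. LINT x|lborel. norm (indicator cell x *\<^sub>R F (int_pt u + x))) = (LINT y|lborel. (\<Sum>u\<in>A. indicator cell (y - int_pt u) *\<^sub>R norm (F y)))"
      unfolding e by (rule Bochner_Integration.integral_sum[symmetric]) (rule i)
    also have "\<dots> \<le> (LINT y|lborel. norm (F y))"
    proof (rule integral_mono)
      fix y
      show "(\<Sum>u\<in>A. indicator cell (y - int_pt u) *\<^sub>R norm (F y)) \<le> norm (F y)"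
        by (rule finite_sum_le_has_sum[OF tile_has_sum]) (use fin in auto)
    qed (intro Bochner_Integration.integrable_sum i integrable_norm F)+
    finally show "(\<Sum>u\<in>A. LINT x|lborel. norm (indicator cell x *\<^sub>R F (int_pt u + x))) \<le> (LINT y|lborel. norm (F y))" .
  qed
qed simp

text \<open>From \<open>1 + \<bar>s\<bar> \<le> (1 + \<bar>a\<bar>) (1 + \<bar>a + s\<bar>)\<close>.\<close>

lemma majorant_translate: "majorant (a + s) \<le> (1 + \<bar>a\<bar>) powr (3/2) * majorant s"
proof -
  have p: "1 + \<bar>a\<bar> > 0" by simp
  have "(1 + \<bar>s\<bar>) \<le> (1 + \<bar>a\<bar>) * (1 + \<bar>a + s\<bar>)"
  proof -
    have "(1 + \<bar>a\<bar>) * (1 + \<bar>a + s\<bar>) = 1 + \<bar>a\<bar> + \<bar>a + s\<bar> + \<bar>a\<bar> * \<bar>a + s\<bar>" by (simp add: algebra_simps)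
    moreover have "\<bar>a\<bar> * \<bar>a + s\<bar> \<ge> 0" by simp
    ultimately show ?thesis by linarith
  qed
  then have "((1 + \<bar>a\<bar>) * (1 + \<bar>a + s\<bar>)) powr (- (3/2)) \<le> majorant s" unfolding majorant_def by (intro powr_mono2') auto
  then have "(1 + \<bar>a\<bar>) powr (- (3/2)) * majorant (a + s) \<le> majorant s" unfolding majorant_def by (subst (asm) powr_mult) auto
  then have "(1 + \<bar>a\<bar>) powr (3/2) * ((1 + \<bar>a\<bar>) powr (- (3/2)) * majorant (a + s)) \<le> (1 + \<bar>a\<bar>) powr (3/2) * majorant s"
    by (intro mult_left_mono) auto
  moreover have "(1 + \<bar>a\<bar>) powr (3/2) * ((1 + \<bar>a\<bar>) powr (- (3/2)) * majorant (a + s)) = majorant (a + s)"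
    using p by (simp add: mult.assoc[symmetric] powr_add[symmetric])
  ultimately show ?thesis by simp
qed

lemma majorant_shift: "\<bar>s\<bar> \<le> 1 \<Longrightarrow> majorant (a + s) \<le> 4 * majorant a" "\<bar>s\<bar> \<le> 1 \<Longrightarrow> majorant a \<le> 4 * majorant (a + s)"
proof -
  have main: "majorant (b + a) \<le> 4 * majorant a" if "\<bar>b\<bar> \<le> 1" for a b
  proof -
    have "(1 + \<bar>b\<bar>) powr (3/2) \<le> 2 powr 2"
      using that by (intro order_trans[OF powr_mono2[of "3/2" "1 + \<bar>b\<bar>" 2] powr_mono]) auto
    then have "(1 + \<bar>b\<bar>) powr (3/2) * majorant a \<le> 4 * majorant a"
      using majorant_pos[of a] by (intro mult_right_mono) auto
    then show ?thesis using majorant_translate[of b a] by linarith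
  qed
  show "\<bar>s\<bar> \<le> 1 \<Longrightarrow> majorant (a + s) \<le> 4 * majorant a" using main[of s a] by (simp add: add.commute)
  show "\<bar>s\<bar> \<le> 1 \<Longrightarrow> majorant a \<le> 4 * majorant (a + s)" using main[of "- s" "a + s"] by simp
qed

lemma majorant2_shift:
  assumes "\<bar>fst x\<bar> \<le> 1" "\<bar>snd x\<bar> \<le> 1"
  shows "majorant (fst (int_pt u + x)) * majorant (snd (int_pt u + x)) \<le> 16 * (majorant (of_int (fst u)) * majorant (of_int (snd u)))"
    "majorant (of_int (fst u)) * majorant (of_int (snd u)) \<le> 16 * (majorant (fst (int_pt u + x)) * majorant (snd (int_pt u + x)))"
proof -
  have "majorant (of_int (fst u) + fst x) * majorant (of_int (snd u) + snd x) \<le> (4 * majorant (of_int (fst u))) * (4 * majorant (of_int (snd u)))"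
    using assms by (intro mult_mono majorant_shift) (auto intro: less_imp_le majorant_pos)
  then show "majorant (fst (int_pt u + x)) * majorant (snd (int_pt u + x)) \<le> 16 * (majorant (of_int (fst u)) * majorant (of_int (snd u)))" by (simp add: int_pt_def)
  have "majorant (of_int (fst u)) * majorant (of_int (snd u)) \<le> (4 * majorant (of_int (fst u) + fst x)) * (4 * majorant (of_int (snd u) + snd x))"
    using assms by (intro mult_mono majorant_shift) (auto intro: less_imp_le majorant_pos)
  then show "majorant (of_int (fst u)) * majorant (of_int (snd u)) \<le> 16 * (majorant (fst (int_pt u + x)) * majorant (snd (int_pt u + x)))" by (simp add: int_pt_def)
qed

lemma cell_bounds: "x \<in> cell \<Longrightarrow> \<bar>fst x\<bar> \<le> 1 \<and> \<bar>snd x\<bar> \<le> 1"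
  by (auto simp: cell_def)

text \<open>The lattice sum is compared with the integral, cell by cell.\<close>

lemma majorant_lattice_summable: "(\<lambda>u::int \<times> int. majorant (of_int (fst u)) * majorant (of_int (snd u))) summable_on UNIV"
proof -
  let ?F = "\<lambda>x. complex_of_real (majorant (fst x) * majorant (snd x))"
  have iF: "integrable lborel ?F" using integrable_majorant2 by (simp only: complex_of_real_integrable_eq)
  note [measurable] = borel_measurable_integrable[OF iF]
  show ?thesis
  proof (rule summable_on_comparison_test[OF summable_on_cmult_right[OF tile_summable[OF iF], of 16]])
    fix u :: "int \<times> int"
    have sh: "integrable lborel (\<lambda>x. ?F (int_pt u + x))" by (rule lborel_integrable_shift[OF iF])
    have i1: "integrable lborel (\<lambda>x. norm (indicator cell x *\<^sub>R ?F (int_pt u + x)))"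
      by (intro integrable_norm integrable_mult_indicator sh) auto
    have "majorant (of_int (fst u)) * majorant (of_int (snd u)) = (LINT x|lborel. (majorant (of_int (fst u)) * majorant (of_int (snd u))) * indicator cell x)"
      using emeasure_cell by (simp add: measure_def)
    also have "\<dots> \<le> (LINT x|lborel. 16 * norm (indicator cell x *\<^sub>R ?F (int_pt u + x)))"
    proof (rule integral_mono)
      show "integrable lborel (\<lambda>x. (majorant (of_int (fst u)) * majorant (of_int (snd u))) * indicator cell x)"
        using emeasure_cell by (intro integrable_mult_right integrable_real_indicator) auto
      show "integrable lborel (\<lambda>x. 16 * norm (indicator cell x *\<^sub>R ?F (int_pt u + x)))" by (intro integrable_mult_right i1)
      fix x :: "real \<times> real"
      have "norm (?F y) = majorant (fst y) * majorant (snd y)" for y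
        using majorant_pos[of "fst y"] majorant_pos[of "snd y"] by (simp only: norm_of_real) simp
      then show "(majorant (of_int (fst u)) * majorant (of_int (snd u))) * indicator cell x \<le> 16 * norm (indicator cell x *\<^sub>R ?F (int_pt u + x))"
        using majorant2_shift(2)[of x u] cell_bounds[of x] by (cases "x \<in> cell") (simp_all del: of_real_mult)
    qed
    finally show "majorant (of_int (fst u)) * majorant (of_int (snd u)) \<le> 16 * (LINT x|lborel. norm (indicator cell x *\<^sub>R ?F (int_pt u + x)))"
      by (simp only: integral_mult_right_zero)
  qed (auto intro: mult_nonneg_nonneg less_imp_le majorant_pos)
qed

text \<open>Unfolding: integrating a periodisation over one cell is integrating over the plane.\<close>

lemma unfold_tiles:
  fixes F :: "real \<times> real \<Rightarrow> complex"
  assumes m[measurable]: "F \<in> borel_measurable borel" and bd: "\<And>x. norm (F x) \<le> C * (majorant (fst x) * majorant (snd x))" and C: "C \<ge> 0"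
  shows "integrable lborel (\<lambda>x. indicator cell x *\<^sub>R infsum (\<lambda>u. F (int_pt u + x)) UNIV)"
    and "(LINT x|lborel. indicator cell x *\<^sub>R infsum (\<lambda>u. F (int_pt u + x)) UNIV) = (LINT x|lborel. F x)"
proof -
  have iF: "integrable lborel F" by (rule integrable_of_majorant_bound[OF m bd])
  define f where "f u x = indicator cell x *\<^sub>R F (int_pt u + x)" for u x
  define g where "g u y = indicator cell (y - int_pt u) *\<^sub>R F y" for u y
  have fi: "integrable lborel (f u)" for u unfolding f_def[abs_def]
    by (rule Bochner_Integration.integrable_bound[OF lborel_integrable_shift[OF iF, of "int_pt u"]]) (auto simp: indicator_def)
  have gi: "integrable lborel (g u)" for u unfolding g_def[abs_def]
    by (rule Bochner_Integration.integrable_bound[OF iF]) (auto simp: indicator_def)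
  have fs: "(\<lambda>u. LINT x|lborel. norm (f u x)) summable_on UNIV" unfolding f_def by (rule tile_summable[OF iF])
  have fg: "(LINT x|lborel. f u x) = (LINT y|lborel. g u y)" for u unfolding f_def g_def by (rule tile_shift) measurable
  have fgn: "(LINT x|lborel. norm (f u x)) = (LINT y|lborel. norm (g u y))" for u
    using tile_shift[of "\<lambda>y. norm (F y)" u] by (simp add: f_def g_def)
  have fp: "(\<lambda>u. norm (f u x)) summable_on UNIV" for x
  proof (rule summable_on_comparison_test[OF summable_on_cmult_right[OF majorant_lattice_summable, of "C * 16"]])
    fix u
    show "norm (f u x) \<le> C * 16 * (majorant (of_int (fst u)) * majorant (of_int (snd u)))"
    proof (cases "x \<in> cell")
      case True
      have "norm (f u x) \<le> C * (majorant (fst (int_pt u + x)) * majorant (snd (int_pt u + x)))" using True bd[of "int_pt u + x"] by (simp add: f_def)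
      also have "\<dots> \<le> C * (16 * (majorant (of_int (fst u)) * majorant (of_int (snd u))))"
        using cell_bounds[OF True] C by (intro mult_left_mono majorant2_shift) auto
      finally show ?thesis by simp
    next
      case False
      then show ?thesis using C by (simp add: f_def majorant_pos less_imp_le)
    qed
  qed simp
  have gh: "((\<lambda>u. g u y) has_sum F y) UNIV" for y unfolding g_def by (rule tile_has_sum)
  have gp: "(\<lambda>u. norm (g u y)) summable_on UNIV" for y
    using tile_has_sum[of y "norm (F y)"] has_sum_imp_summable by (simp add: g_def) blast
  have e: "infsum (\<lambda>u. f u x) UNIV = indicator cell x *\<^sub>R infsum (\<lambda>u. F (int_pt u + x)) UNIV" for x
    unfolding f_def by (simp add: infsum_scaleR_right)
  show "integrable lborel (\<lambda>x. indicator cell x *\<^sub>R infsum (\<lambda>u. F (int_pt u + x)) UNIV)"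
    using infsum_integral_int2(1)[OF fi fs fp] unfolding e .
  have "((\<lambda>u. LINT x|lborel. f u x) has_sum (LINT x|lborel. infsum (\<lambda>u. f u x) UNIV)) UNIV"
    by (rule infsum_integral_int2(2)[OF fi fs fp])
  moreover have "((\<lambda>u. LINT y|lborel. g u y) has_sum (LINT y|lborel. infsum (\<lambda>u. g u y) UNIV)) UNIV"
    by (rule infsum_integral_int2(2)[OF gi fs[unfolded fgn] gp])
  ultimately have "(LINT x|lborel. infsum (\<lambda>u. f u x) UNIV) = (LINT y|lborel. infsum (\<lambda>u. g u y) UNIV)"
    unfolding fg using has_sum_unique by blast
  then show "(LINT x|lborel. indicator cell x *\<^sub>R infsum (\<lambda>u. F (int_pt u + x)) UNIV) = (LINT x|lborel. F x)"
    unfolding e infsumI[OF gh] .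
qed

lemma fourier_char_integral_1d:
  "integrable lborel (\<lambda>s::real. indicator {-1/2..<1/2} s *\<^sub>R cis (2 * pi * (of_int j * s)))"
  "(LINT s|lborel. indicator {-1/2..<1/2::real} s *\<^sub>R cis (2 * pi * (of_int j * s))) = (if j = 0 then 1 else 0)"
proof -
  let ?f = "\<lambda>s. cis (2 * pi * (of_int j * s))"
  have m: "?f \<in> borel_measurable borel" unfolding cis_conv_exp by measurable
  have i0: "integrable lborel (\<lambda>s::real. indicator {-1/2..<1/2} s :: real)" by (rule integrable_real_indicator) auto
  show "integrable lborel (\<lambda>s. indicator {-1/2..<1/2} s *\<^sub>R ?f s)"
    by (rule Bochner_Integration.integrable_bound[OF i0]) (use m in auto)
  show "(LINT s|lborel. indicator {-1/2..<1/2::real} s *\<^sub>R ?f s) = (if j = 0 then 1 else 0)"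
  proof (cases "j = 0")
    case True
    have "(LINT s|lborel. indicator {-1/2..<1/2::real} s *\<^sub>R (1::complex)) = 1"
      by (subst integral_scaleR_left[OF i0]) simp
    then show ?thesis using True by simp
  next
    case False
    let ?F = "\<lambda>s. ?f s / (2 * pi * \<i> * of_int j)"
    have "(LINT s|lborel. indicator {-1/2..<1/2::real} s *\<^sub>R ?f s) = (LINT s|lborel. indicator {-1/2..1/2::real} s *\<^sub>R ?f s)"
    proof (rule integral_cong_AE)
      show "AE s in lborel. indicator {-1/2..<1/2::real} s *\<^sub>R ?f s = indicator {-1/2..1/2::real} s *\<^sub>R ?f s"
        using AE_lborel_singleton[of "1/2::real"] by eventually_elim (auto simp: indicator_def)
    qed (use m in auto)
    also have "\<dots> = ?F (1/2) - ?F (-1/2)"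
    proof (rule integral_FTC_Icc)
      fix s :: real
      have "(?F has_vector_derivative ?f s) (at s)"
      proof -
        define c where "c = complex_of_real (2 * pi) * \<i> * of_int j"
        have c0: "c \<noteq> 0" using False by (simp add: c_def)
        have e: "?f t = exp (c * of_real t)" for t by (simp add: cis_conv_exp c_def mult_ac)
        have "((\<lambda>z. exp (c * z) / c) has_field_derivative exp (c * of_real s)) (at (of_real s))"
          using c0 by (auto intro!: derivative_eq_intros)
        from has_vector_derivative_real_field[OF this] show ?thesis unfolding e c_def[symmetric] .
      qed
      then show "(?F has_vector_derivative ?f s) (at s within {- 1 / 2..1 / 2})" by (rule has_vector_derivative_at_within)
    next
      show "continuous_on {- 1 / 2..1 / 2} ?f" unfolding cis_conv_exp by (intro continuous_intros)
    qed simp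
    also have "\<dots> = 0"
    proof -
      have "?f (1/2) = ?f (-1/2) * cis (2 * pi * of_int j)" by (simp add: cis_mult algebra_simps)
      also have "cis (2 * pi * of_int j) = 1" by (rule cis_multiple_2pi[OF Ints_of_int])
      finally show ?thesis by simp
    qed
    finally show ?thesis using False by simp
  qed
qed

lemma fourier_char_integral:
  "integrable lborel (\<lambda>x. indicator cell x *\<^sub>R fourier_char v x)"
  "(LINT x|lborel. indicator cell x *\<^sub>R fourier_char v x) = (if v = 0 then 1 else 0)"
proof -
  let ?I = "{-1/2..<1/2::real}"
  have ic: "integrable lborel (\<lambda>x. indicator cell x :: real)"
    using emeasure_cell by (intro integrable_real_indicator) auto
  show i: "integrable lborel (\<lambda>x. indicator cell x *\<^sub>R fourier_char v x)"
    by (rule Bochner_Integration.integrable_bound[OF ic]) auto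
  have sp: "indicator cell (s, t) *\<^sub>R fourier_char v (s, t) = (indicator ?I s *\<^sub>R cis (2 * pi * (of_int (fst v) * s))) * (indicator ?I t *\<^sub>R cis (2 * pi * (of_int (snd v) * t)))" for s t
    by (simp add: cell_def fourier_char_def indicator_def cis_mult algebra_simps)
  have "(LINT x|lborel. indicator cell x *\<^sub>R fourier_char v x) = (LINT s|lborel. LINT t|lborel. indicator cell (s, t) *\<^sub>R fourier_char v (s, t))"
    using lborel_pair.integral_fst'[of "\<lambda>x. indicator cell x *\<^sub>R fourier_char v x"] i by (simp add: lborel_prod)
  also have "\<dots> = (if v = 0 then 1 else 0)"
    unfolding sp integral_mult_right_zero integral_mult_left_zero fourier_char_integral_1d(2) by (cases v) (auto simp: zero_prod_def)
  finally show "(LINT x|lborel. indicator cell x *\<^sub>R fourier_char v x) = (if v = 0 then 1 else 0)" .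
qed

text \<open>A nonnegative trigonometric polynomial with its maximum over the cell at the origin only, so that its
  powers concentrate there.\<close>

definition peak :: "real \<times> real \<Rightarrow> real" where "peak x = (cos (pi * fst x))\<^sup>2 * (cos (pi * snd x))\<^sup>2"

definition peak_coeff :: "int \<times> int \<Rightarrow> complex" where
  "peak_coeff w = (if fst w = 0 then 1/2 else 1/4) * (if snd w = 0 then 1/2 else 1/4)"

lemma peak_eq: "of_real (peak x) = (\<Sum>w\<in>{-1,0,1} \<times> {-1,0,1}. peak_coeff w * fourier_char w x)"
proof -
  let ?c = "\<lambda>a::int. if a = 0 then 1/2 else 1/4 :: complex"
  have c1: "complex_of_real ((cos (pi * s))\<^sup>2) = (\<Sum>a\<in>{-1,0,1}. ?c a * cis (2 * pi * (of_int a * s)))" for s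
  proof -
    have "cos (2 * pi * s) = 2 * (cos (pi * s))\<^sup>2 - 1" using cos_double_cos[of "pi * s"] by (simp add: mult.assoc)
    then show ?thesis by (simp add: complex_eq_iff mult.assoc diff_divide_distrib)
  qed
  have "of_real (peak x) = (\<Sum>a\<in>{-1,0,1}. ?c a * cis (2 * pi * (of_int a * fst x))) * (\<Sum>b\<in>{-1,0,1}. ?c b * cis (2 * pi * (of_int b * snd x)))"
    unfolding peak_def of_real_mult c1 ..
  also have "\<dots> = (\<Sum>w\<in>{-1,0,1} \<times> {-1,0,1}. peak_coeff w * fourier_char w x)"
    unfolding sum_product sum.cartesian_product peak_coeff_def fourier_char_def
    by (intro sum.cong refl) (auto simp: cis_mult algebra_simps)
  finally show ?thesis .
qed

lemma peak_measurable[measurable]: "peak \<in> borel_measurable borel"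
  unfolding peak_def[abs_def] by (intro borel_measurable_continuous_onI continuous_intros)

lemma peak_le_1: "peak x \<le> 1" "peak x \<ge> 0"
  unfolding peak_def by (auto intro!: mult_le_one simp: abs_square_le_1)

text \<open>Powers of \<open>peak\<close> are trigonometric polynomials.\<close>

lemma trig_moments_zero:
  fixes H :: "real \<times> real \<Rightarrow> complex"
  assumes H: "integrable lborel H" and z: "\<And>v. (LINT x|lborel. H x * fourier_char v x) = 0"
  shows "(LINT x|lborel. H x * fourier_char v x * of_real (peak x ^ n)) = 0"
proof (induction n arbitrary: v)
  case 0
  then show ?case by (simp add: z)
next
  case (Suc n)
  have [measurable]: "H \<in> borel_measurable borel" using H by auto
  have i: "integrable lborel (\<lambda>x. H x * fourier_char v x * of_real (peak x ^ n))" for v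
    by (rule Bochner_Integration.integrable_bound[OF H])
       (use peak_le_1 in \<open>auto simp: norm_mult norm_power intro!: mult_right_le_one_le power_le_one\<close>)
  have "H x * fourier_char v x * of_real (peak x ^ Suc n) = (\<Sum>w\<in>{-1,0,1} \<times> {-1,0,1}. peak_coeff w * (H x * fourier_char (v + w) x * of_real (peak x ^ n)))" for x
    unfolding power_Suc of_real_mult peak_eq fourier_char_mult[symmetric] sum_distrib_left sum_distrib_right by (intro sum.cong refl) (simp add: mult_ac)
  then have "(LINT x|lborel. H x * fourier_char v x * of_real (peak x ^ Suc n)) = (\<Sum>w\<in>{-1,0,1} \<times> {-1,0,1}. LINT x|lborel. peak_coeff w * (H x * fourier_char (v + w) x * of_real (peak x ^ n)))"
    by (simp only: Bochner_Integration.integral_sum[OF integrable_mult_right[OF i]])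
  also have "\<dots> = 0" by (simp only: integral_mult_right_zero Suc.IH mult_zero_right sum.neutral_const)
  finally show ?case .
qed

text \<open>Uniqueness for Fourier coefficients at a point of continuity. If \<open>h 0 \<noteq> 0\<close>, then after division by
  \<open>h 0\<close> the real part is at least 1/2 near the origin, and integrating against a high power of \<open>peak\<close>
  makes the contribution of a neighbourhood of the origin exceed that of the remaining cell, while
  the total is zero.\<close>

lemma vanishing_moments:
  fixes h :: "real \<times> real \<Rightarrow> complex"
  assumes i: "integrable lborel (\<lambda>x. indicator cell x *\<^sub>R h x)" and z: "\<And>v. (LINT x|lborel. (indicator cell x *\<^sub>R h x) * fourier_char v x) = 0"
    and c: "isCont h 0" and bd: "\<And>x. x \<in> cell \<Longrightarrow> norm (h x) \<le> Mb"
  shows "h 0 = 0"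
proof (rule ccontr)
  assume h0: "h 0 \<noteq> 0"
  define H where "H x = (indicator cell x *\<^sub>R h x) / h 0" for x
  have iH: "integrable lborel H" unfolding H_def[abs_def] by (rule integrable_divide_zero) (use i in auto)
  have zH: "(LINT x|lborel. H x * fourier_char v x) = 0" for v
  proof -
    have "H x * fourier_char v x = (1 / h 0) * ((indicator cell x *\<^sub>R h x) * fourier_char v x)" for x by (simp add: H_def scaleR_conv_of_real)
    then show ?thesis by (simp only: integral_mult_right_zero z mult_zero_right)
  qed
  obtain d0 where d0: "d0 > 0" "\<And>x. dist x 0 < d0 \<Longrightarrow> dist (h x) (h 0) < norm (h 0) / 2"
    using c h0 unfolding continuous_at_eps_delta by (metis half_gt_zero zero_less_norm_iff)
  \<comment> \<open>The square of half-width \<open>\<delta>\<close> lies inside the cell and inside the disc on which \<open>h\<close> is close to \<open>h 0\<close>.\<close>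
  define \<delta> where "\<delta> = min (1/4) (d0 / 4)"
  have \<delta>: "\<delta> > 0" "\<delta> \<le> 1/4" "2 * \<delta> < d0" using d0(1) by (auto simp: \<delta>_def min_def)
  have near: "Re (H x) \<ge> 1/2" if "\<bar>fst x\<bar> \<le> \<delta>" "\<bar>snd x\<bar> \<le> \<delta>" for x
  proof -
    have "norm x \<le> \<bar>fst x\<bar> + \<bar>snd x\<bar>" using norm_Pair_le[of "fst x" "snd x"] by simp
    then have "dist x 0 < d0" using that \<delta> by simp
    from d0(2)[OF this] have "norm (h x - h 0) \<le> norm (h 0) / 2" by (simp add: dist_norm)
    then have "norm (h x / h 0 - 1) \<le> 1/2" using h0 by (simp add: divide_diff_eq_iff norm_divide field_simps)
    then have "\<bar>Re (h x / h 0 - 1)\<bar> \<le> 1/2" using abs_Re_le_cmod order_trans by blast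
    then have "Re (h x / h 0) \<ge> 1/2" unfolding minus_complex.sel one_complex.sel by linarith
    moreover have "x \<in> cell" using that \<delta> by (cases x) (auto simp: cell_def)
    ultimately show ?thesis by (simp add: H_def)
  qed
  define B where "B = max 0 (Mb / norm (h 0))"
  have HB: "Re (H x) \<ge> - B * indicator cell x" for x
  proof (cases "x \<in> cell")
    case True
    have "norm (H x) \<le> Mb / norm (h 0)" using True bd[OF True] by (simp add: H_def norm_divide divide_right_mono)
    then have "\<bar>Re (H x)\<bar> \<le> B" unfolding B_def using abs_Re_le_cmod[of "H x"] by linarith
    then show ?thesis using True by simp
  qed (simp add: H_def)
  define q where "q = cos (pi * \<delta>)"
  have q: "q > 0" "q < 1"
  proof -
    have "pi * \<delta> \<le> pi / 4" using mult_left_mono[OF \<delta>(2), of pi] by simp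
    then have "pi * \<delta> < pi / 2" "0 < pi * \<delta>" using \<delta> pi_gt_zero by (linarith, simp)
    then show "q > 0" "q < 1" unfolding q_def using cos_gt_zero[of "pi * \<delta>"] cos_monotone_0_pi[of 0 "pi * \<delta>"] by auto
  qed
  have cos_le: "(cos (pi * s))\<^sup>2 \<le> q\<^sup>2" if "\<delta> < \<bar>s\<bar>" "\<bar>s\<bar> \<le> 1/2" for s
  proof -
    have "pi * \<bar>s\<bar> \<le> pi / 2" using mult_left_mono[OF that(2), of pi] by simp
    then have "cos (pi * \<bar>s\<bar>) \<ge> 0" by (intro cos_ge_zero) (auto intro: order_trans[of _ 0])
    moreover have "cos (pi * \<bar>s\<bar>) \<le> q" unfolding q_def
      using that \<delta>(1) \<open>pi * \<bar>s\<bar> \<le> pi / 2\<close> by (intro cos_monotone_0_pi_le) (auto intro: order_trans)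
    ultimately have "(cos (pi * \<bar>s\<bar>))\<^sup>2 \<le> q\<^sup>2" by (intro power_mono) auto
    moreover have "cos (pi * \<bar>s\<bar>) = cos (pi * s)" by (simp add: abs_if)
    ultimately show ?thesis by simp
  qed
  \<comment> \<open>By the double angle formula \<open>cos\<^sup>2\<close> is at least \<open>(1 + q)/2 > q\<close> on the inner square of half-width \<open>\<delta>/2\<close>, whereas \<open>peak\<close> is at most \<open>q\<^sup>2\<close> outside the outer one; the gap makes the inner square win for high powers.\<close>
  define r where "r = (1 + q) / 2"
  have cos_ge: "r \<le> (cos (pi * s))\<^sup>2" if "\<bar>s\<bar> \<le> \<delta> / 2" for s
  proof -
    have "2 * (pi * \<bar>s\<bar>) \<le> pi * \<delta>" using mult_left_mono[OF that, of "2 * pi"] by simp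
    moreover have "pi * \<delta> \<le> pi" using mult_left_mono[OF \<delta>(2), of pi] pi_gt_zero by linarith
    ultimately have "q \<le> cos (2 * (pi * \<bar>s\<bar>))" unfolding q_def by (intro cos_monotone_0_pi_le) auto
    also have "\<dots> = 2 * (cos (pi * \<bar>s\<bar>))\<^sup>2 - 1" by (rule cos_double_cos)
    also have "cos (pi * \<bar>s\<bar>) = cos (pi * s)" by (simp add: abs_if)
    finally show ?thesis by (simp add: r_def)
  qed
  have far: "peak x \<le> q\<^sup>2" if x: "x \<in> cell" "\<not> (\<bar>fst x\<bar> \<le> \<delta> \<and> \<bar>snd x\<bar> \<le> \<delta>)" for x
  proof -
    have h: "\<bar>fst x\<bar> \<le> 1/2" "\<bar>snd x\<bar> \<le> 1/2" using x(1) by (auto simp: cell_def)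
    consider "\<delta> < \<bar>fst x\<bar>" | "\<delta> < \<bar>snd x\<bar>" using x(2) by linarith
    then show ?thesis
    proof cases
      case 1
      have "peak x \<le> q\<^sup>2 * 1" unfolding peak_def using cos_le[OF 1 h(1)] by (intro mult_mono) (auto simp: abs_square_le_1)
      then show ?thesis by simp
    next
      case 2
      have "peak x \<le> 1 * q\<^sup>2" unfolding peak_def using cos_le[OF 2 h(2)] by (intro mult_mono) (auto simp: abs_square_le_1)
      then show ?thesis by simp
    qed
  qed
  define Sm where "Sm = {- (\<delta>/2)..\<delta>/2} \<times> {- (\<delta>/2)..\<delta>/2}"
  have Smm[measurable]: "Sm \<in> sets borel" unfolding Sm_def by (intro borel_Times) auto
  have eSm: "emeasure lborel Sm = ennreal (\<delta> * \<delta>)"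
  proof -
    have "emeasure (lborel \<Otimes>\<^sub>M lborel) Sm = emeasure lborel {- (\<delta>/2)..\<delta>/2} * emeasure lborel {- (\<delta>/2)..\<delta>/2}"
      unfolding Sm_def by (rule lborel.emeasure_pair_measure_Times) auto
    then show ?thesis using \<delta> by (simp add: lborel_prod ennreal_mult'')
  qed
  have key: "1/2 * (r\<^sup>2) ^ n * indicator Sm x - B * (q\<^sup>2) ^ n * indicator cell x \<le> Re (H x) * peak x ^ n" for n x
  proof -
    consider (a) "x \<in> Sm" | (b) "x \<notin> Sm" "\<bar>fst x\<bar> \<le> \<delta>" "\<bar>snd x\<bar> \<le> \<delta>" | (c) "x \<notin> Sm" "\<not> (\<bar>fst x\<bar> \<le> \<delta> \<and> \<bar>snd x\<bar> \<le> \<delta>)" "x \<in> cell" | (d) "x \<notin> Sm" "x \<notin> cell"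
      by blast
    then show ?thesis
    proof cases
      case a
      then have x: "\<bar>fst x\<bar> \<le> \<delta>/2" "\<bar>snd x\<bar> \<le> \<delta>/2" by (auto simp: Sm_def mem_Times_iff)
      have "r * r \<le> peak x" unfolding peak_def using cos_ge[OF x(1)] cos_ge[OF x(2)] q by (intro mult_mono) (auto simp: r_def)
      then have "(r\<^sup>2) ^ n \<le> peak x ^ n" by (intro power_mono) (auto simp: power2_eq_square)
      then have "1/2 * (r\<^sup>2) ^ n \<le> Re (H x) * peak x ^ n" using near[of x] x \<delta> by (intro mult_mono) auto
      moreover have "0 \<le> B * (q\<^sup>2) ^ n * indicator cell x" by (simp add: B_def)
      ultimately show ?thesis using a by simp
    next
      case b
      have "0 \<le> Re (H x) * peak x ^ n" using near[OF b(2,3)] peak_le_1[of x] by (intro mult_nonneg_nonneg) auto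
      moreover have "0 \<le> B * (q\<^sup>2) ^ n * indicator cell x" by (simp add: B_def)
      ultimately show ?thesis using b by simp
    next
      case c
      have "peak x ^ n \<le> (q\<^sup>2) ^ n" using far[OF c(3,2)] peak_le_1[of x] by (intro power_mono) auto
      then have "B * peak x ^ n \<le> B * (q\<^sup>2) ^ n" by (intro mult_left_mono) (auto simp: B_def)
      moreover have "- B * peak x ^ n \<le> Re (H x) * peak x ^ n" using HB[of x] c peak_le_1[of x] by (intro mult_right_mono) auto
      ultimately show ?thesis using c by simp
    next
      case d
      then show ?thesis by (simp add: H_def)
    qed
  qed
  have ineq: "1/2 * (r\<^sup>2) ^ n * (\<delta> * \<delta>) - B * (q\<^sup>2) ^ n \<le> 0" for n
  proof -
    have [measurable]: "H \<in> borel_measurable borel" using iH by auto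
    have iHp: "integrable lborel (\<lambda>x. H x * fourier_char 0 x * of_real (peak x ^ n))"
      by (rule Bochner_Integration.integrable_bound[OF iH])
         (use peak_le_1 in \<open>auto simp: norm_mult norm_power intro!: mult_right_le_one_le power_le_one\<close>)
    have ek0: "fourier_char 0 x = 1" for x by (simp add: fourier_char_def)
    have iA: "integrable lborel (\<lambda>x. 1/2 * (r\<^sup>2) ^ n * indicator Sm x)" "integrable lborel (\<lambda>x. B * (q\<^sup>2) ^ n * indicator cell x)"
      using eSm emeasure_cell by (auto intro!: integrable_mult_right integrable_real_indicator simp del: integrable_mult_right_iff)
    have "1/2 * (r\<^sup>2) ^ n * (\<delta> * \<delta>) - B * (q\<^sup>2) ^ n = (LINT x|lborel. 1/2 * (r\<^sup>2) ^ n * indicator Sm x - B * (q\<^sup>2) ^ n * indicator cell x)"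
      unfolding Bochner_Integration.integral_diff[OF iA] using eSm emeasure_cell \<delta> by (simp add: measure_def)
    also have "\<dots> \<le> (LINT x|lborel. Re (H x * fourier_char 0 x * of_real (peak x ^ n)))"
      by (intro integral_mono Bochner_Integration.integrable_diff iA integrable_Re iHp) (use key in \<open>simp add: ek0 flip: of_real_power\<close>)
    also have "\<dots> = Re (LINT x|lborel. H x * fourier_char 0 x * of_real (peak x ^ n))" by (rule integral_Re[OF iHp])
    also have "\<dots> = 0" by (simp only: trig_moments_zero[OF iH zH]) simp
    finally show ?thesis .
  qed
  have rq: "r / q > 1" using q by (simp add: r_def field_simps)
  then have "(r / q)\<^sup>2 > 1" by (rule one_less_power) simp
  then obtain n where n: "2 * B / (\<delta> * \<delta>) < ((r / q)\<^sup>2) ^ n" using real_arch_pow by blast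
  have "2 * B < ((r / q)\<^sup>2) ^ n * (\<delta> * \<delta>)" using n \<delta> by (simp add: pos_divide_less_eq)
  then have "2 * B * (q\<^sup>2) ^ n < ((r / q)\<^sup>2) ^ n * (\<delta> * \<delta>) * (q\<^sup>2) ^ n" using q by (intro mult_strict_right_mono) auto
  also have "\<dots> = (r\<^sup>2) ^ n * (\<delta> * \<delta>)" using q by (simp add: power_divide)
  finally show False using ineq[of n] by simp
qed

lemma series_continuous:
  fixes f :: "int \<times> int \<Rightarrow> real \<times> real \<Rightarrow> complex"
  assumes c: "\<And>u. continuous_on Y (f u)" and b: "\<And>u x. x \<in> Y \<Longrightarrow> norm (f u x) \<le> M u" and M: "M summable_on UNIV"
  shows "continuous_on Y (\<lambda>x. infsum (\<lambda>u. f u x) UNIV)"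
proof (rule uniform_limit_theorem)
  show "uniform_limit Y (\<lambda>X y. \<Sum>x\<in>X. f x y) (\<lambda>x. infsum (\<lambda>u. f u x) UNIV) (finite_subsets_at_top UNIV)"
    by (rule Weierstrass_m_test_general[OF b M])
  show "\<forall>\<^sub>F X in finite_subsets_at_top UNIV. continuous_on Y (\<lambda>y. \<Sum>x\<in>X. f x y)"
    by (intro always_eventually allI continuous_on_sum c)
qed simp

text \<open>The periodisation \<open>P\<close> of \<open>\<Phi>\<close> and the Fourier series \<open>T\<close> of its transform are continuous near the cell and
  have equal Fourier coefficients, hence agree at the origin. Summability of the transform
  takes the place of smoothness of \<open>\<Phi>\<close>.\<close>

theorem poisson_summation:
  fixes \<Phi> :: "real \<times> real \<Rightarrow> complex"
  assumes cont: "continuous_on UNIV \<Phi>" and bd: "\<And>x. norm (\<Phi> x) \<le> C * (majorant (fst x) * majorant (snd x))" and C: "C \<ge> 0"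
  defines "Fh \<equiv> \<lambda>v. LINT x|lborel. \<Phi> x * fourier_char (- v) x"
  assumes sm: "(\<lambda>v. norm (Fh v)) summable_on UNIV"
  shows "infsum (\<lambda>u. \<Phi> (int_pt u)) UNIV = infsum Fh UNIV"
proof -
  have m[measurable]: "\<Phi> \<in> borel_measurable borel" using cont by (rule borel_measurable_continuous_onI)
  define P where "P x = infsum (\<lambda>u. \<Phi> (int_pt u + x)) UNIV" for x
  define T where "T x = infsum (\<lambda>v. Fh v * fourier_char v x) UNIV" for x
  define h where "h x = P x - T x" for x
  let ?Y = "cball (0 :: real \<times> real) 1"
  have Y1: "\<bar>fst x\<bar> \<le> 1" "\<bar>snd x\<bar> \<le> 1" if "x \<in> ?Y" for x
    using that norm_fst_le[of "fst x" "snd x"] norm_snd_le[of "snd x" "fst x"] by auto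
  have contP: "continuous_on ?Y P" unfolding P_def
  proof (rule series_continuous)
    show "(\<lambda>u::int \<times> int. C * (16 * (majorant (of_int (fst u)) * majorant (of_int (snd u))))) summable_on UNIV"
      by (intro summable_on_cmult_right majorant_lattice_summable)
    show "continuous_on ?Y (\<lambda>x. \<Phi> (int_pt u + x))" for u
      by (intro continuous_on_compose2[OF cont] continuous_intros) auto
    fix u x assume x: "x \<in> ?Y"
    have "norm (\<Phi> (int_pt u + x)) \<le> C * (majorant (fst (int_pt u + x)) * majorant (snd (int_pt u + x)))" by (rule bd)
    also have "\<dots> \<le> C * (16 * (majorant (of_int (fst u)) * majorant (of_int (snd u))))"
      using Y1[OF x] C by (intro mult_left_mono majorant2_shift) auto
    finally show "norm (\<Phi> (int_pt u + x)) \<le> C * (16 * (majorant (of_int (fst u)) * majorant (of_int (snd u))))" .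
  qed
  have contT: "continuous_on ?Y T" unfolding T_def
    by (rule series_continuous[OF _ _ sm]) (auto intro!: continuous_intros continuous_fourier_char simp: norm_mult)
  have conth: "continuous_on ?Y h" unfolding h_def[abs_def] by (intro continuous_intros contP contT)
  have isc: "isCont h 0" by (rule continuous_on_interior[OF conth]) simp
  have cellY: "x \<in> ?Y" if "x \<in> cell" for x
  proof -
    have "\<bar>fst x\<bar> \<le> 1/2" "\<bar>snd x\<bar> \<le> 1/2" using that by (auto simp: cell_def)
    then show ?thesis using norm_Pair_le[of "fst x" "snd x"] by simp
  qed
  have "compact (h ` ?Y)" by (rule compact_continuous_image[OF conth]) simp
  then obtain Mb where Mb: "\<And>y. y \<in> h ` ?Y \<Longrightarrow> norm y \<le> Mb" using compact_imp_bounded[of "h ` ?Y"] unfolding bounded_iff by blast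
  have iP: "integrable lborel (\<lambda>x. indicator cell x *\<^sub>R P x)"
    unfolding P_def by (rule unfold_tiles(1)[OF m bd C])
  have ic: "integrable lborel (\<lambda>x. indicator cell x :: real)"
    using emeasure_cell by (intro integrable_real_indicator) auto
  have T_int: "integrable lborel (\<lambda>x. indicator cell x *\<^sub>R (T x * fourier_char v x))" and T_val: "(LINT x|lborel. indicator cell x *\<^sub>R (T x * fourier_char v x)) = Fh (- v)" for v
  proof -
    define f where "f w x = Fh w * (indicator cell x *\<^sub>R fourier_char (w + v) x)" for w x
    have fi: "integrable lborel (f w)" for w unfolding f_def[abs_def] by (intro integrable_mult_right fourier_char_integral)
    have fn: "norm (f w x) = norm (Fh w) * indicator cell x" for w x by (simp add: f_def norm_mult)
    have fs: "(\<lambda>w. LINT x|lborel. norm (f w x)) summable_on UNIV"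
      unfolding fn using sm emeasure_cell by (simp add: measure_def)
    have fp: "(\<lambda>w. norm (f w x)) summable_on UNIV" for x
      unfolding fn by (intro summable_on_cmult_left sm)
    have e: "infsum (\<lambda>w. f w x) UNIV = indicator cell x *\<^sub>R (T x * fourier_char v x)" for x
    proof -
      have "f w x = (Fh w * fourier_char w x) * (indicator cell x *\<^sub>R fourier_char v x)" for w
        unfolding f_def fourier_char_mult[symmetric] by (simp add: scaleR_conv_of_real)
      then show ?thesis unfolding T_def by (simp add: infsum_cmult_left' scaleR_conv_of_real)
    qed
    show "integrable lborel (\<lambda>x. indicator cell x *\<^sub>R (T x * fourier_char v x))"
      using infsum_integral_int2(1)[OF fi fs fp] unfolding e .
    have "((\<lambda>w. LINT x|lborel. f w x) has_sum (LINT x|lborel. indicator cell x *\<^sub>R (T x * fourier_char v x))) UNIV"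
      using infsum_integral_int2(2)[OF fi fs fp] unfolding e .
    moreover have "((\<lambda>w. LINT x|lborel. f w x) has_sum Fh (- v)) UNIV"
    proof (rule has_sum_finite_neutralI[of "{- v}"])
      have v: "(LINT x|lborel. f w x) = Fh w * (if w + v = 0 then 1 else 0)" for w
        unfolding f_def integral_mult_right_zero fourier_char_integral(2) ..
      show "(LINT x|lborel. f w x) = 0" if "w \<in> UNIV - {- v}" for w
        using that unfolding v by (simp add: eq_neg_iff_add_eq_0)
      show "Fh (- v) = (\<Sum>w\<in>{- v}. LINT x|lborel. f w x)" unfolding v by simp
    qed auto
    ultimately show "(LINT x|lborel. indicator cell x *\<^sub>R (T x * fourier_char v x)) = Fh (- v)" using has_sum_unique by blast
  qed
  have iT: "integrable lborel (\<lambda>x. indicator cell x *\<^sub>R T x)"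
    using T_int[of 0] by (simp add: fourier_char_def)
  have "h 0 = 0"
  proof (rule vanishing_moments[OF _ _ isc])
    show "integrable lborel (\<lambda>x. indicator cell x *\<^sub>R h x)"
      unfolding h_def scaleR_diff_right by (intro Bochner_Integration.integrable_diff iP iT)
    show "norm (h x) \<le> Mb" if "x \<in> cell" for x using Mb cellY[OF that] by blast
    fix v
    have mF: "(\<lambda>x. \<Phi> x * fourier_char v x) \<in> borel_measurable borel" by measurable
    have bF: "norm (\<Phi> x * fourier_char v x) \<le> C * (majorant (fst x) * majorant (snd x))" for x using bd by (simp add: norm_mult)
    have Pe: "infsum (\<lambda>u. \<Phi> (int_pt u + x) * fourier_char v (int_pt u + x)) UNIV = P x * fourier_char v x" for x
      unfolding P_def fourier_char_int_pt by (rule infsum_cmult_left')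
    have P_int: "integrable lborel (\<lambda>x. indicator cell x *\<^sub>R (P x * fourier_char v x))"
      and P_val: "(LINT x|lborel. indicator cell x *\<^sub>R (P x * fourier_char v x)) = Fh (- v)"
      using unfold_tiles[OF mF bF C] unfolding Pe Fh_def by simp_all
    have "(indicator cell x *\<^sub>R h x) * fourier_char v x = indicator cell x *\<^sub>R (P x * fourier_char v x) - indicator cell x *\<^sub>R (T x * fourier_char v x)" for x
      by (simp add: h_def scaleR_conv_of_real algebra_simps)
    then show "(LINT x|lborel. (indicator cell x *\<^sub>R h x) * fourier_char v x) = 0"
      by (simp only: Bochner_Integration.integral_diff[OF P_int T_int] P_val T_val) simp
  qed
  then show ?thesis by (simp add: h_def P_def T_def fourier_char_def)
qed

context dual_lattice
begin

lemma pt_surj: "pt (w1 \<bullet> x, w2 \<bullet> x) = x"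
proof -
  define y where "y = x - pt (w1 \<bullet> x, w2 \<bullet> x)"
  have o: "w1 \<bullet> y = 0" "w2 \<bullet> y = 0" by (simp_all add: y_def inner_diff_right inner_pt)
  have "det2 w1 w2 * y$1 = (w1 \<bullet> y) * w2$2 - (w2 \<bullet> y) * w1$2" "det2 w1 w2 * y$2 = (w2 \<bullet> y) * w1$1 - (w1 \<bullet> y) * w2$1"
    by (simp_all add: det2_def inner_vec_def UNIV_2 algebra_simps)
  then have "y$1 = 0" "y$2 = 0" using o det2_dual by auto
  then have "y = 0" by (simp add: vec_eq_iff forall_2)
  then show ?thesis by (simp add: y_def)
qed

text \<open>The points \<open>vstar\<close> differ by dual lattice vectors, so up to the Bloch phase their plane waves are the
  Fourier modes of the torus.\<close>

lemma vstar_inner_pt: "vstar w1 w2 \<alpha> j l \<bullet> pt x = 2 * pi * (of_int j * fst x + of_int l * snd x) + \<alpha> \<bullet> pt x"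
  by (simp add: vstar_def inner_add_left inner_pt algebra_simps)

lemma maxn_le_vstar: "maxn (j, l) \<le> V / (2 * pi) * (norm (vstar w1 w2 \<alpha> j l) + norm \<alpha>)"
proof -
  have *: "\<bar>real_of_int i\<bar> \<le> V / (2 * pi) * (norm (vstar w1 w2 \<alpha> j l) + norm \<alpha>)"
    if "(vstar w1 w2 \<alpha> j l - \<alpha>) \<bullet> v = 2 * pi * of_int i" "norm v \<le> V" for i v
  proof -
    have "2 * pi * \<bar>real_of_int i\<bar> = \<bar>(vstar w1 w2 \<alpha> j l - \<alpha>) \<bullet> v\<bar>" by (simp add: that abs_mult)
    also have "\<dots> \<le> norm (vstar w1 w2 \<alpha> j l - \<alpha>) * norm v" by (rule Cauchy_Schwarz_ineq2)
    also have "\<dots> \<le> (norm (vstar w1 w2 \<alpha> j l) + norm \<alpha>) * V"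
      using that(2) by (intro mult_mono norm_triangle_ineq4) auto
    finally show ?thesis by (simp add: field_simps)
  qed
  have "\<bar>real_of_int j\<bar> \<le> V / (2 * pi) * (norm (vstar w1 w2 \<alpha> j l) + norm \<alpha>)"
    by (rule *[of v1]) (auto simp: vstar_def inner_simps w1v1 w2v1 V_def)
  moreover have "\<bar>real_of_int l\<bar> \<le> V / (2 * pi) * (norm (vstar w1 w2 \<alpha> j l) + norm \<alpha>)"
    by (rule *[of v2]) (auto simp: vstar_def inner_simps w1v2 w2v2 V_def)
  ultimately show ?thesis by (simp add: maxn_def)
qed

text \<open>Evanescent modes decay at a rate that grows linearly with the mode number; for propagating modes the
  bound is trivial.\<close>

lemma Re_tau_ge: "Re (tau k \<kappa>) \<ge> norm \<kappa> - \<bar>k\<bar>"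
proof (cases "norm \<kappa> \<le> \<bar>k\<bar>")
  case False
  then have c: "k\<^sup>2 \<le> (norm \<kappa>)\<^sup>2" by (metis abs_le_square_iff abs_norm_cancel linear)
  have "(norm \<kappa> - \<bar>k\<bar>)\<^sup>2 \<le> (norm \<kappa>)\<^sup>2 - k\<^sup>2"
  proof -
    have "(norm \<kappa>)\<^sup>2 - k\<^sup>2 - (norm \<kappa> - \<bar>k\<bar>)\<^sup>2 = 2 * \<bar>k\<bar> * (norm \<kappa> - \<bar>k\<bar>)"
      by (simp add: power2_eq_square algebra_simps flip: power2_abs[of k])
    also have "\<dots> \<ge> 0" using False by simp
    finally show ?thesis by simp
  qed
  then show ?thesis using c by (simp add: tau_def real_le_rsqrt)
next
  case True
  then have "norm \<kappa> - \<bar>k\<bar> \<le> 0" by simp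
  also have "0 \<le> Re (tau k \<kappa>)" by (simp add: tau_def)
  finally show ?thesis .
qed

lemma tau_eq_gam_out:
  assumes k: "k \<noteq> 0"
  shows "- tau k (vstar w1 w2 \<alpha> j l) = \<i> * gam_out w1 w2 k \<alpha> j l"
proof -
  define c where "c = k\<^sup>2 - (norm (vstar w1 w2 \<alpha> j l))\<^sup>2"
  have g: "gam w1 w2 k \<alpha> j l = (if c \<ge> 0 then of_real (sqrt c) else \<i> * of_real (sqrt (- c)))"
    unfolding gam_def c_def[symmetric] by (rule sqrt_cut_of_real)
  have t: "tau k (vstar w1 w2 \<alpha> j l) = Complex (sqrt ((\<bar>c\<bar> - c) / 2)) (- sgn k * sqrt ((\<bar>c\<bar> + c) / 2))"
    unfolding tau_def c_def by (simp add: abs_minus_commute algebra_simps)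
  show ?thesis
  proof (cases "c \<ge> 0")
    case True
    then have "tau k (vstar w1 w2 \<alpha> j l) = Complex 0 (- sgn k * sqrt c)" unfolding t by simp
    moreover have "gam_out w1 w2 k \<alpha> j l = of_real (sgn k * sqrt c)"
      using True k by (auto simp: gam_out_def g sgn_if)
    ultimately show ?thesis by (simp add: complex_eq_iff)
  next
    case False
    then have "tau k (vstar w1 w2 \<alpha> j l) = Complex (sqrt (- c)) 0" unfolding t by simp
    moreover have "gam_out w1 w2 k \<alpha> j l = \<i> * of_real (sqrt (- c))"
      using False by (auto simp: gam_out_def g complex_is_Real_iff)
    ultimately show ?thesis by (simp add: complex_eq_iff)
  qed
qed

end

section \<open>The mode expansion\<close>

text \<open>The finite difference coefficients are symmetric up to the sign \<open>(- 1)^p\<close>, and the heights \<open>z + q d\<close> are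
  exchanged up to sign by \<open>z \<mapsto> - z - p d\<close>.\<close>

lemma fds_reflect: "fds p d k \<rho> (- z - real p * d) = (- 1) ^ p * fds p d k \<rho> z"
proof -
  have c: "fd_coeff p (p - q) = (- 1) ^ p * fd_coeff p q" if "q \<le> p" for q
  proof -
    have "p = (p - q) + q" using that by simp
    then have "(- 1 :: complex) ^ p = (- 1) ^ (p - q) * (- 1) ^ q" by (metis power_add)
    then have "(- 1 :: complex) ^ p * (- 1) ^ q = (- 1) ^ (p - q)" by (simp add: mult.assoc flip: power_mult_distrib)
    then show ?thesis using that by (simp add: fd_coeff_def binomial_symmetric[symmetric] mult.assoc[symmetric])
  qed
  have "fds p d k \<rho> (- z - real p * d) = (\<Sum>q=0..p. fd_coeff p (p - q) * sph k (sqrt (\<rho>\<^sup>2 + (- z - real p * d + real (p - q) * d)\<^sup>2)))"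
    unfolding fds_def by (rule sum.reindex_bij_witness[of _ "\<lambda>q. p - q" "\<lambda>q. p - q"]) auto
  also have "\<dots> = (\<Sum>q=0..p. (- 1) ^ p * (fd_coeff p q * sph k (sqrt (\<rho>\<^sup>2 + (z + real q * d)\<^sup>2))))"
  proof (rule sum.cong[OF refl])
    fix q assume q: "q \<in> {0..p}"
    have "- z - real p * d + real (p - q) * d = - (z + real q * d)" using q by (simp add: of_nat_diff algebra_simps)
    then show "fd_coeff p (p - q) * sph k (sqrt (\<rho>\<^sup>2 + (- z - real p * d + real (p - q) * d)\<^sup>2)) = (- 1) ^ p * (fd_coeff p q * sph k (sqrt (\<rho>\<^sup>2 + (z + real q * d)\<^sup>2)))"
      using c[of q] q by (simp only: power2_minus) simp
  qed
  finally show ?thesis by (simp add: fds_def sum_distrib_left)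
qed

context dual_lattice
begin

lemma Gfun_reflect: "Gfun d p k \<alpha> (x, - z - real p * d) = (- 1) ^ p * Gfun d p k \<alpha> (x, z)"
proof -
  have "lattice_term v1 v2 d p k \<alpha> m n (x, - z - real p * d) = (- 1) ^ p * lattice_term v1 v2 d p k \<alpha> m n (x, z)" for m n
    unfolding lattice_term_eq fst_conv snd_conv fds_reflect by (simp only: mult_ac)
  then have "(\<lambda>(m, n). lattice_term v1 v2 d p k \<alpha> m n (x, - z - real p * d)) = (\<lambda>u. (- 1) ^ p * (case u of (m, n) \<Rightarrow> lattice_term v1 v2 d p k \<alpha> m n (x, z)))"
    by (simp only: fun_eq_iff case_prod_beta) simp
  then show ?thesis unfolding Gfun_def by (simp only: infsum_cmult_right' mult_ac)
qed

lemma FT_fds_norm_le: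
  assumes d: "d > 0" and p: "p \<ge> 3" and z: "z > 0"
  shows "\<exists>M\<ge>0. \<forall>\<kappa>. norm (FT_fds p d (of_real k) \<kappa> z) \<le> M"
proof -
  obtain C where C: "C \<ge> 0" "\<And>x. norm (fds p d (of_real k) (norm (pt x)) z) \<le> C * (majorant (fst x) * majorant (snd x))"
    using fds_decay[OF d p z, of "\<bar>k\<bar>"] by auto
  have i: "integrable lborel (\<lambda>x. C * (majorant (fst x) * majorant (snd x)))" by (rule integrable_mult_right[OF integrable_majorant2])
  have "norm (FT_fds p d (of_real k) \<kappa> z) \<le> (LINT x|lborel. C * (majorant (fst x) * majorant (snd x)))" for \<kappa>
  proof -
    have b: "norm (fds p d (of_real k) (norm (pt x)) z * wave \<kappa> x) \<le> C * (majorant (fst x) * majorant (snd x))" for x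
      using C(2)[of x] by (simp add: norm_mult wave_def)
    show ?thesis unfolding FT_fds_def
    proof (rule Bochner_Integration.integral_norm_bound_integral[OF _ i])
      show "integrable lborel (\<lambda>x. fds p d (of_real k) (norm (pt x)) z * wave \<kappa> x)"
        by (rule integrable_of_majorant_bound[OF _ b]) measurable
    qed (rule b)
  qed
  moreover have "0 \<le> (LINT x|lborel. C * (majorant (fst x) * majorant (snd x)))"
    using C(1) by (intro Bochner_Integration.integral_nonneg mult_nonneg_nonneg less_imp_le[OF majorant_pos])
  ultimately show ?thesis by blast
qed

text \<open>The transform at height \<open>z\<close> is that at height \<open>z/2\<close>, which is bounded, times an exponential that decays
  linearly in the mode number.\<close>

lemma FT_fds_summable:
  assumes d: "d > 0" and p: "p \<ge> 3" and k: "k \<noteq> 0" and z: "z > 0"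
  shows "(\<lambda>u. norm (FT_fds p d (of_real k) (vstar w1 w2 \<alpha> (fst u) (snd u)) z)) summable_on UNIV"
proof -
  obtain M where M: "M \<ge> 0" "\<And>\<kappa>. norm (FT_fds p d (of_real k) \<kappa> (z / 2)) \<le> M" using FT_fds_norm_le[OF d p, of "z / 2" k] z by auto
  have 1: "norm (FT_fds p d (of_real k) \<kappa> z) \<le> M * exp (- (z / 2) * (norm \<kappa> - \<bar>k\<bar>))" for \<kappa>
  proof -
    obtain \<beta> where \<beta>: "\<And>z. z > 0 \<Longrightarrow> FT_fds p d (of_real k) \<kappa> z = \<beta> * exp (- of_real z * tau k \<kappa>)"
      using FT_fds_mode[OF d p k, of \<kappa>] by blast
    have "FT_fds p d (of_real k) \<kappa> z = FT_fds p d (of_real k) \<kappa> (z / 2) * exp (- of_real (z / 2) * tau k \<kappa>)"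
      using \<beta>[OF z] \<beta>[of "z / 2"] z by (simp add: exp_add[symmetric])
    then have "norm (FT_fds p d (of_real k) \<kappa> z) = norm (FT_fds p d (of_real k) \<kappa> (z / 2)) * exp (- (z / 2) * Re (tau k \<kappa>))"
      by (simp add: norm_mult norm_exp_eq_Re)
    also have "\<dots> \<le> M * exp (- (z / 2) * (norm \<kappa> - \<bar>k\<bar>))"
      using M z Re_tau_ge[of \<kappa> k] by (intro mult_mono) auto
    finally show ?thesis .
  qed
  \<comment> \<open>The mode number grows at least like \<open>2 \<pi> / V\<close> times the maximum of the indices, up to \<open>\<parallel>\<alpha>\<parallel>\<close>.\<close>
  define c where "c = (z / 2) * (2 * pi / V)"
  have c: "c > 0" using z V_pos by (simp add: c_def)
  define K where "K = M * exp ((z / 2) * (norm \<alpha> + \<bar>k\<bar>)) * (27 / c ^ 3)"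
  have K: "K \<ge> 0" using M c by (simp add: K_def)
  let ?t = "\<lambda>u. FT_fds p d (of_real k) (vstar w1 w2 \<alpha> (fst u) (snd u)) z"
  have "norm (?t u) \<le> K * maxn u powr (- (2 + 1))" if u: "1 \<le> maxn u" for u
  proof -
    let ?\<kappa> = "vstar w1 w2 \<alpha> (fst u) (snd u)"
    have "maxn u \<le> V / (2 * pi) * (norm ?\<kappa> + norm \<alpha>)" using maxn_le_vstar[of "fst u" "snd u" \<alpha>] by simp
    then have "(2 * pi / V) * maxn u \<le> (2 * pi / V) * (V / (2 * pi) * (norm ?\<kappa> + norm \<alpha>))"
      using V_pos by (intro mult_left_mono) auto
    then have "(2 * pi / V) * maxn u \<le> norm ?\<kappa> + norm \<alpha>" using V_pos by simp
    then have "(z / 2) * ((2 * pi / V) * maxn u) \<le> (z / 2) * (norm ?\<kappa> + norm \<alpha>)" using z by (intro mult_left_mono) auto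
    then have e: "- (z / 2) * (norm ?\<kappa> - \<bar>k\<bar>) \<le> (z / 2) * (norm \<alpha> + \<bar>k\<bar>) - c * maxn u"
      by (simp only: c_def mult.assoc) (simp only: algebra_simps)
    have ex: "exp (- (c * maxn u)) \<le> 27 / c ^ 3 * maxn u powr (- 3)"
    proof -
      have cm: "c * maxn u > 0" using c u by simp
      have "(c * maxn u / 3) ^ 3 \<le> (1 + c * maxn u / 3) ^ 3" using cm by (intro power_mono) auto
      also have "\<dots> \<le> exp (c * maxn u)" using exp_ge_one_plus_x_over_n_power_n[of 3 "c * maxn u"] cm by simp
      finally have "1 / exp (c * maxn u) \<le> 1 / (c * maxn u / 3) ^ 3"
        using cm by (intro divide_left_mono mult_pos_pos) auto
      also have "\<dots> = 27 / c ^ 3 * maxn u powr (- 3)"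
        using u by (simp add: powr_minus_divide power_divide power_mult_distrib)
      finally show ?thesis by (simp add: exp_minus divide_inverse)
    qed
    have "norm (?t u) \<le> M * exp (- (z / 2) * (norm ?\<kappa> - \<bar>k\<bar>))" by (rule 1)
    also have "\<dots> \<le> M * (exp ((z / 2) * (norm \<alpha> + \<bar>k\<bar>)) * exp (- (c * maxn u)))"
      unfolding exp_add[symmetric] using e M(1) by (intro mult_left_mono) auto
    also have "\<dots> \<le> M * (exp ((z / 2) * (norm \<alpha> + \<bar>k\<bar>)) * (27 / c ^ 3 * maxn u powr (- 3)))"
      using M(1) ex by (intro mult_left_mono) auto
    finally show ?thesis by (simp add: K_def mult.assoc)
  qed
  then have "(\<lambda>u. norm (?t u)) summable_on {u. 1 \<le> maxn u}"
    by (intro lattice_abs_bound(1)[of 1 2 K]) (use K in auto)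
  then show ?thesis by (rule abs_summable_from_tail)
qed

lemma pt_int_pt: "pt (int_pt (m, n)) = lat v1 v2 m n"
  by (simp add: pt_def int_pt_def lat_def)

lemma pt_add: "pt (a + b) = pt a + pt b"
  by (simp add: pt_def algebra_simps)

lemma continuous_fds:
  assumes "z > 0" "d > 0"
  shows "continuous_on UNIV (\<lambda>x. fds p d k (norm (pt x)) z)"
proof -
  have nz: "complex_of_real (rad (z + real q * d) x) \<noteq> 0" for q x
    using rad_pos[of "z + real q * d" x] assms by (simp add: add_pos_nonneg)
  show ?thesis unfolding fds_rad sph_def
    using nz unfolding rad_def by (intro continuous_intros continuous_pt) auto
qed

text \<open>Poisson summation for one lattice term translated by the evaluation point. The Bloch phase shifts the
  frequencies to \<open>vstar\<close>, and the translation produces the plane wave in \<open>x\<close>.\<close>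

lemma Gfun_mode_expansion:
  assumes d: "d > 0" and p: "p \<ge> 3" and k: "k \<noteq> 0" and z: "z > 0"
  shows "((\<lambda>u. 1 / (4 * of_real pi) * (cis (vstar w1 w2 \<alpha> (fst u) (snd u) \<bullet> x) * FT_fds p d (of_real k) (vstar w1 w2 \<alpha> (fst u) (snd u)) z)) has_sum Gfun d p k \<alpha> (x, z)) UNIV"
proof -
  define a where "a = (w1 \<bullet> x, w2 \<bullet> x)"
  have a: "pt a = x" unfolding a_def by (rule pt_surj)
  define \<Phi> where "\<Phi> u = cis (- (\<alpha> \<bullet> pt u)) * fds p d (of_real k) (norm (pt (a + u))) z" for u
  obtain C where C: "C \<ge> 0" "\<And>x. norm (fds p d (of_real k) (norm (pt x)) z) \<le> C * (majorant (fst x) * majorant (snd x))"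
    using fds_decay[OF d p z, of "\<bar>k\<bar>"] by auto
  define C' where "C' = C * ((1 + \<bar>fst a\<bar>) powr (3/2) * (1 + \<bar>snd a\<bar>) powr (3/2))"
  have C': "C' \<ge> 0" using C by (simp add: C'_def)
  have cont: "continuous_on UNIV \<Phi>"
    unfolding \<Phi>_def[abs_def] cis_conv_exp
    by (intro continuous_intros continuous_pt continuous_on_compose2[OF continuous_fds[OF z d]]) auto
  have bd: "norm (\<Phi> u) \<le> C' * (majorant (fst u) * majorant (snd u))" for u
  proof -
    have "norm (\<Phi> u) \<le> C * (majorant (fst a + fst u) * majorant (snd a + snd u))"
      using C(2)[of "a + u"] by (simp add: \<Phi>_def norm_mult)
    also have "\<dots> \<le> C * (((1 + \<bar>fst a\<bar>) powr (3/2) * majorant (fst u)) * ((1 + \<bar>snd a\<bar>) powr (3/2) * majorant (snd u)))"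
      using C(1) by (intro mult_left_mono mult_mono majorant_translate) (auto intro: less_imp_le majorant_pos intro!: mult_nonneg_nonneg)
    finally show ?thesis by (simp add: C'_def mult_ac)
  qed
  have Fh: "(LINT u|lborel. \<Phi> u * fourier_char (- v) u) = cis (vstar w1 w2 \<alpha> (fst v) (snd v) \<bullet> x) * FT_fds p d (of_real k) (vstar w1 w2 \<alpha> (fst v) (snd v)) z" for v
  proof -
    let ?\<kappa> = "vstar w1 w2 \<alpha> (fst v) (snd v)"
    let ?g = "\<lambda>y. cis (?\<kappa> \<bullet> x) * (fds p d (of_real k) (norm (pt y)) z * wave ?\<kappa> y)"
    have "\<Phi> u * fourier_char (- v) u = ?g (a + u)" for u
    proof -
      have "cis (- (\<alpha> \<bullet> pt u)) * fourier_char (- v) u = cis (- (?\<kappa> \<bullet> pt u))"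
        unfolding vstar_inner_pt fourier_char_def by (simp add: cis_mult algebra_simps)
      also have "\<dots> = cis (?\<kappa> \<bullet> x) * wave ?\<kappa> (a + u)"
        unfolding wave_def pt_add a inner_add_right by (simp add: cis_mult)
      finally show ?thesis by (simp add: \<Phi>_def mult_ac)
    qed
    then have "(LINT u|lborel. \<Phi> u * fourier_char (- v) u) = (LINT y|lborel. ?g y)"
      using lborel_integral_shift[of ?g a] by simp
    then show ?thesis by (simp only: integral_mult_right_zero FT_fds_def)
  qed
  have sm: "(\<lambda>v. norm (LINT u|lborel. \<Phi> u * fourier_char (- v) u)) summable_on UNIV"
    unfolding Fh norm_mult norm_cis mult_1_left by (rule FT_fds_summable[OF d p k z])
  have "infsum (\<lambda>u. \<Phi> (int_pt u)) UNIV = infsum (\<lambda>v. LINT u|lborel. \<Phi> u * fourier_char (- v) u) UNIV"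
    by (rule poisson_summation[OF cont bd C' sm])
  moreover have "infsum (\<lambda>u. \<Phi> (int_pt u)) UNIV = (\<Sum>\<^sub>\<infinity>(m, n)\<in>UNIV. lattice_term v1 v2 d p k \<alpha> m n (x, z))"
    by (rule infsum_cong) (auto simp: \<Phi>_def lattice_term_eq pt_add a pt_int_pt)
  ultimately have "((\<lambda>v. LINT u|lborel. \<Phi> u * fourier_char (- v) u) has_sum (\<Sum>\<^sub>\<infinity>(m, n)\<in>UNIV. lattice_term v1 v2 d p k \<alpha> m n (x, z))) UNIV"
    using has_sum_infsum[OF abs_summable_summable[OF sm]] by simp
  from has_sum_cmult_right[OF this, of "1 / (4 * of_real pi)"] show ?thesis unfolding Fh Gfun_def .
qed

text \<open>Above the sources this is the mode expansion with the explicit dependence on \<open>z\<close>; below them the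
  reflected expansion is used.\<close>

theorem Gfun_radiating:
  assumes d: "d > 0" and p: "p \<ge> 3" and k: "k \<noteq> 0"
  shows "radiating w1 w2 (real p * d) k \<alpha> (Gfun d p k \<alpha>)"
proof -
  have "\<exists>\<beta>. \<forall>z>0. FT_fds p d (of_real k) (vstar w1 w2 \<alpha> j l) z = \<beta> * exp (\<i> * gam_out w1 w2 k \<alpha> j l * of_real z)" for j l
    using FT_fds_mode[OF d p k, of "vstar w1 w2 \<alpha> j l"]
    unfolding tau_eq_gam_out[OF k, symmetric] by (simp add: mult.commute)
  then obtain \<beta> where \<beta>: "\<And>j l z. z > 0 \<Longrightarrow> FT_fds p d (of_real k) (vstar w1 w2 \<alpha> j l) z = \<beta> j l * exp (\<i> * gam_out w1 w2 k \<alpha> j l * of_real z)"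
    by metis
  have up: "((\<lambda>(j, l). (\<beta> j l / (4 * of_real pi)) * cis (vstar w1 w2 \<alpha> j l \<bullet> x) * exp (\<i> * gam_out w1 w2 k \<alpha> j l * of_real z)) has_sum Gfun d p k \<alpha> (x, z)) UNIV"
    if "z > 0" for x z
  proof -
    have "(\<lambda>u. 1 / (4 * of_real pi) * (cis (vstar w1 w2 \<alpha> (fst u) (snd u) \<bullet> x) * FT_fds p d (of_real k) (vstar w1 w2 \<alpha> (fst u) (snd u)) z))
      = (\<lambda>(j, l). (\<beta> j l / (4 * of_real pi)) * cis (vstar w1 w2 \<alpha> j l \<bullet> x) * exp (\<i> * gam_out w1 w2 k \<alpha> j l * of_real z))"
      by (auto simp: fun_eq_iff \<beta>[OF that])
    then show ?thesis using Gfun_mode_expansion[OF d p k that, of \<alpha> x] by simp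
  qed
  \<comment> \<open>The reflection maps \<open>z\<close> to \<open>- z - p d\<close>; the shift by \<open>p d\<close> contributes a constant factor to each mode.\<close>
  define B where "B j l = (- 1) ^ p * (\<beta> j l / (4 * of_real pi)) * exp (- \<i> * gam_out w1 w2 k \<alpha> j l * of_real (real p * d))" for j l
  have down: "((\<lambda>(j, l). B j l * cis (vstar w1 w2 \<alpha> j l \<bullet> x) * exp (- \<i> * gam_out w1 w2 k \<alpha> j l * of_real z)) has_sum Gfun d p k \<alpha> (x, z)) UNIV"
    if z: "z < - (real p * d)" for x z
  proof -
    define z' where "z' = - z - real p * d"
    have z': "z' > 0" "z = - z' - real p * d" using z by (auto simp: z'_def)
    have "((\<lambda>u. (- 1) ^ p * (case u of (j, l) \<Rightarrow> (\<beta> j l / (4 * of_real pi)) * cis (vstar w1 w2 \<alpha> j l \<bullet> x) * exp (\<i> * gam_out w1 w2 k \<alpha> j l * of_real z'))) has_sum (- 1) ^ p * Gfun d p k \<alpha> (x, z')) UNIV"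
      by (rule has_sum_cmult_right[OF up[OF z'(1)]])
    moreover have "(- 1) ^ p * Gfun d p k \<alpha> (x, z') = Gfun d p k \<alpha> (x, z)" unfolding z'(2) Gfun_reflect ..
    moreover have "(- 1) ^ p * (case u of (j, l) \<Rightarrow> (\<beta> j l / (4 * of_real pi)) * cis (vstar w1 w2 \<alpha> j l \<bullet> x) * exp (\<i> * gam_out w1 w2 k \<alpha> j l * of_real z'))
       = (case u of (j, l) \<Rightarrow> B j l * cis (vstar w1 w2 \<alpha> j l \<bullet> x) * exp (- \<i> * gam_out w1 w2 k \<alpha> j l * of_real z))" for u
    proof -
      obtain j l where u: "u = (j, l)" by (cases u)
      have "exp (\<i> * gam_out w1 w2 k \<alpha> j l * of_real z') = exp (- \<i> * gam_out w1 w2 k \<alpha> j l * of_real (real p * d)) * exp (- \<i> * gam_out w1 w2 k \<alpha> j l * of_real z)"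
        unfolding exp_add[symmetric] z'_def by (rule arg_cong[of _ _ exp]) (simp add: algebra_simps)
      then show ?thesis unfolding u B_def by (simp add: mult_ac)
    qed
    ultimately show ?thesis by (simp only:)
  qed
  show ?thesis unfolding radiating_def
  proof (intro conjI)
    show "\<exists>B. \<forall>x z. z > 0 \<longrightarrow> ((\<lambda>(j, l). B j l * cis (vstar w1 w2 \<alpha> j l \<bullet> x) * exp (\<i> * gam_out w1 w2 k \<alpha> j l * of_real z)) has_sum Gfun d p k \<alpha> (x, z)) UNIV"
      by (intro exI[of _ "\<lambda>j l. \<beta> j l / (4 * of_real pi)"] allI impI up)
    show "\<exists>B. \<forall>x z. z < - (real p * d) \<longrightarrow> ((\<lambda>(j, l). B j l * cis (vstar w1 w2 \<alpha> j l \<bullet> x) * exp (- \<i> * gam_out w1 w2 k \<alpha> j l * of_real z)) has_sum Gfun d p k \<alpha> (x, z)) UNIV"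
      by (intro exI[of _ B] allI impI down)
  qed
qed

end

section \<open>Convergence of the truncated sums\<close>

lemma ceiling_half: "\<lceil>real p / 2\<rceil> = int ((p + 1) div 2)"
proof -
  have "real ((p + 1) div 2) - 1 < real p / 2" "real p / 2 \<le> real ((p + 1) div 2)" by linarith+
  then show ?thesis by (intro ceiling_unique) simp_all
qed

lemma tendsto_of_powr_bound:
  fixes f :: "real \<Rightarrow> complex"
  assumes "\<forall>\<^sub>F A in at_top. norm (f A - L) \<le> C * A powr (- e)" "e > 0"
  shows "(f \<longlongrightarrow> L) at_top"
proof -
  have "((\<lambda>A. C * A powr (- e)) \<longlongrightarrow> C * 0) at_top"
    using assms(2) by (intro tendsto_mult tendsto_const tendsto_neg_powr filterlim_ident) auto
  then have "((\<lambda>A. f A - L) \<longlongrightarrow> 0) at_top" by (intro Lim_null_comparison[OF assms(1)]) simp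
  then show ?thesis by (simp add: LIM_zero_iff)
qed

theorem theorem3p2:
  fixes v1 v2 w1 w2 :: "real^2" and d r1 r2 :: real and chi :: "real \<Rightarrow> real" and p :: nat
  assumes "v1 \<noteq> v2" and "independent {v1, v2}"
    and "w1 \<bullet> v1 = 1" and "w1 \<bullet> v2 = 0" and "w2 \<bullet> v1 = 0" and "w2 \<bullet> v2 = 1"
    and "d > 0"
    and "0 < r1" and "r1 < r2"
    and "smooth chi" and "\<And>r. r < r1 \<Longrightarrow> chi r = 1" and "\<And>r. r > r2 \<Longrightarrow> chi r = 0"
    and "p \<ge> 3"
  shows "\<forall>(k::real) (\<alpha>::real^2). k \<noteq> 0 \<longrightarrow>
    (\<exists>G :: (real^2) \<times> real \<Rightarrow> complex.
       (\<forall>x. x \<notin> sources v1 v2 d p \<longrightarrow>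
          ((\<lambda>A. G_trunc v1 v2 d p k \<alpha> A x) \<longlongrightarrow> G x) at_top \<and>
          ((\<lambda>A. G_smooth_trunc chi v1 v2 d p k \<alpha> A x) \<longlongrightarrow> G x) at_top) \<and>
       radiating w1 w2 (real p * d) k \<alpha> G \<and>
       helmholtz_distr k G (\<lambda>\<phi>. - source_distr v1 v2 d p \<alpha> \<phi>) \<and>
       (\<forall>x m n. x \<notin> sources v1 v2 d p \<longrightarrow>
          G (x + (lat v1 v2 m n, 0)) = G x * cis (\<alpha> \<bullet> lat v1 v2 m n)) \<and>
       (\<forall>x. x \<notin> sources v1 v2 d p \<longrightarrow>
          (\<exists>C::real. \<forall>\<^sub>F A in at_top.
             norm (G_trunc v1 v2 d p k \<alpha> A x - G x)
               < C / A powr (of_int \<lceil>real p / 2\<rceil> - 1) \<and>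
             norm (G_smooth_trunc chi v1 v2 d p k \<alpha> A x - G x)
               < C / A powr (of_int \<lceil>real p / 2\<rceil> - 1 / 2))))"
proof (intro allI impI)
  fix k :: real and \<alpha> :: "real^2" assume k: "k \<noteq> 0"
  interpret dual_lattice v1 v2 w1 w2 using assms by unfold_locales auto
  define s where "s = real ((p + 1) div 2)"
  have s2: "s \<ge> 2" using \<open>p \<ge> 3\<close> by (auto simp: s_def)
  have ceil: "of_int \<lceil>real p / 2\<rceil> = s" by (simp add: ceiling_half s_def)
  let ?G = "Gfun d p k \<alpha>"
  have rate1: "\<exists>C. \<forall>\<^sub>F A in at_top. norm (G_trunc v1 v2 d p k \<alpha> A x - ?G x) \<le> C * A powr (- (s - 1))" for x
    using G_trunc_rate[OF \<open>d > 0\<close> \<open>p \<ge> 3\<close>, of k \<alpha> x] by (simp add: s_def)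
  have rate2: "\<exists>C. \<forall>\<^sub>F A in at_top. norm (G_smooth_trunc chi v1 v2 d p k \<alpha> A x - ?G x) \<le> C * A powr (- (s - 1/2))" for x
    using G_smooth_trunc_rate[OF \<open>d > 0\<close> \<open>p \<ge> 3\<close> \<open>0 < r1\<close> \<open>r1 < r2\<close> \<open>smooth chi\<close> assms(11,12) k, of \<alpha> x] by (simp add: s_def)
  show "\<exists>G. (\<forall>x. x \<notin> sources v1 v2 d p \<longrightarrow>
          ((\<lambda>A. G_trunc v1 v2 d p k \<alpha> A x) \<longlongrightarrow> G x) at_top \<and>
          ((\<lambda>A. G_smooth_trunc chi v1 v2 d p k \<alpha> A x) \<longlongrightarrow> G x) at_top) \<and>
       radiating w1 w2 (real p * d) k \<alpha> G \<and>
       helmholtz_distr k G (\<lambda>\<phi>. - source_distr v1 v2 d p \<alpha> \<phi>) \<and>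
       (\<forall>x m n. x \<notin> sources v1 v2 d p \<longrightarrow>
          G (x + (lat v1 v2 m n, 0)) = G x * cis (\<alpha> \<bullet> lat v1 v2 m n)) \<and>
       (\<forall>x. x \<notin> sources v1 v2 d p \<longrightarrow>
          (\<exists>C::real. \<forall>\<^sub>F A in at_top.
             norm (G_trunc v1 v2 d p k \<alpha> A x - G x)
               < C / A powr (of_int \<lceil>real p / 2\<rceil> - 1) \<and>
             norm (G_smooth_trunc chi v1 v2 d p k \<alpha> A x - G x)
               < C / A powr (of_int \<lceil>real p / 2\<rceil> - 1 / 2)))"
  proof (intro exI[of _ ?G] conjI allI impI)
    fix x
    show "((\<lambda>A. G_trunc v1 v2 d p k \<alpha> A x) \<longlongrightarrow> ?G x) at_top"
    proof -
      obtain C where "\<forall>\<^sub>F A in at_top. norm (G_trunc v1 v2 d p k \<alpha> A x - ?G x) \<le> C * A powr (- (s - 1))" using rate1 by blast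
      then show ?thesis by (rule tendsto_of_powr_bound) (use s2 in simp)
    qed
    show "((\<lambda>A. G_smooth_trunc chi v1 v2 d p k \<alpha> A x) \<longlongrightarrow> ?G x) at_top"
    proof -
      obtain C where "\<forall>\<^sub>F A in at_top. norm (G_smooth_trunc chi v1 v2 d p k \<alpha> A x - ?G x) \<le> C * A powr (- (s - 1/2))" using rate2 by blast
      then show ?thesis by (rule tendsto_of_powr_bound) (use s2 in simp)
    qed
    obtain C1 where C1: "\<forall>\<^sub>F A in at_top. norm (G_trunc v1 v2 d p k \<alpha> A x - ?G x) \<le> C1 * A powr (- (s - 1))"
      using rate1 by blast
    obtain C2 where C2: "\<forall>\<^sub>F A in at_top. norm (G_smooth_trunc chi v1 v2 d p k \<alpha> A x - ?G x) \<le> C2 * A powr (- (s - 1/2))"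
      using rate2 by blast
    show "\<exists>C::real. \<forall>\<^sub>F A in at_top.
             norm (G_trunc v1 v2 d p k \<alpha> A x - ?G x) < C / A powr (of_int \<lceil>real p / 2\<rceil> - 1) \<and>
             norm (G_smooth_trunc chi v1 v2 d p k \<alpha> A x - ?G x) < C / A powr (of_int \<lceil>real p / 2\<rceil> - 1 / 2)"
    proof (rule exI[of _ "max C1 C2 + 1"])
      show "\<forall>\<^sub>F A in at_top.
             norm (G_trunc v1 v2 d p k \<alpha> A x - ?G x) < (max C1 C2 + 1) / A powr (of_int \<lceil>real p / 2\<rceil> - 1) \<and>
             norm (G_smooth_trunc chi v1 v2 d p k \<alpha> A x - ?G x) < (max C1 C2 + 1) / A powr (of_int \<lceil>real p / 2\<rceil> - 1 / 2)"
        using C1 C2 eventually_gt_at_top[of 0]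
      proof eventually_elim
        case (elim A)
        have "C * A powr (- e) < (max C1 C2 + 1) / A powr e" if "C \<le> max C1 C2" for C e
        proof -
          have "C * A powr (- e) < (max C1 C2 + 1) * A powr (- e)" using that elim(3) by (intro mult_strict_right_mono) auto
          then show ?thesis by (simp add: powr_minus divide_inverse)
        qed
        from order_le_less_trans[OF elim(1) this] order_le_less_trans[OF elim(2) this]
        show ?case unfolding ceil by simp
      qed
    qed
  next
    show "radiating w1 w2 (real p * d) k \<alpha> ?G" by (rule Gfun_radiating[OF \<open>d > 0\<close> \<open>p \<ge> 3\<close> k])
    show "helmholtz_distr k ?G (\<lambda>\<phi>. - source_distr v1 v2 d p \<alpha> \<phi>)" by (rule Gfun_helmholtz[OF \<open>d > 0\<close> \<open>p \<ge> 3\<close>])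
    show "?G (x + (lat v1 v2 m n, 0)) = ?G x * cis (\<alpha> \<bullet> lat v1 v2 m n)" for x m n by (rule Gfun_quasi_periodic)
  qed
qed

end
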